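(* (Weyl character formulas) Let $\lambda\in\mathbb Z^n$ with $\lambda_1\ge\lambda_2\ge\cdots\ge\lambda_n>0$. Then \begin{align*} P_\lambda(q,t^+)&=\frac{P_{\lambda+0}(q,t^+)}{P_0(q,t^+)}, & P_\lambda(q,t^\pm)&=\frac{A^\pm_{\lambda+\omega}(q,t^+)}{A^\pm_\omega(q,t^+)},\\ P_\lambda(q,t^-)&=\frac{A_{\lambda+\rho}(q,t^+)}{A_\rho(q,t^+)}, & P_\lambda(q,t^\mp)&=\frac{A^\mp_{\lambda+\pi}(q,t^+)}{A^\mp_\pi(q,t^+)}. \end{align*}
   Context: Let $n\ge1$, $\mathbb K=\mathbb C(q^{1/2},t^{1/2},t_0^{1/2},u_0^{1/2},t_n^{1/2},u_n^{1/2})$ (independent parameters), $\mathbb K[x]=\mathbb K[x_1^{\pm1},\dots,x_n^{\pm1}]$, $x^\mu=x_1^{\mu_1}\cdots x_n^{\mu_n}$; $0=(0,\dots,0)$, $\rho=(n,n-1,\dots,1)$, $\omega=(1,\dots,1)$, $\pi=(n-1,\dots,1,0)$. **Parameter shifts.** $(q,t^+)$ denotes the original parameters. $(q,t^\pm)$ denotes the substitution $t_n^{1/2}\mapsto qt_n^{1/2}$; $(q,t^\mp)$ the substitution $t\mapsto qt$; $(q,t^-)$ both substitutions; the other parameters are unchanged. $W_{\mathrm{fin}}$ is the group of signed permutations acting on $\mathbb Z^n$, generated by $s_i$ ($i<n$, swapping entries $i,i+1$) and $s_n$ (negating the last entry); it acts on $\mathbb K[x]$ by $wx^\mu=x^{w\mu}$.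 For $w\in W_{\mathrm{fin}}$, $w(j)\in\{\pm1,\dots,\pm n\}$ is defined by $w\varepsilon_j=\varepsilon_{w(j)}$, where $\varepsilon_j$ is the $j$th unit vector and $\varepsilon_{-k}=-\varepsilon_k$. $w_0$ is the longest element, and $\ell_s(w)$, $\ell_d(w)$ are the numbers of factors $s_i$ ($i<n$), resp. $s_n$, in a reduced word of $w$. **Operators on $\mathbb K[x]$.** $(\xi_{s_0}f)(x)=f(qx_1^{-1},x_2,\dots,x_n)$, $\xi_{s_i}=s_i$ for $1\le i\le n$. Define $T_0,\dots,T_n$ by $$t_0^{1/2}T_0=t_0-\frac{(x_1+q^{1/2}t_0^{1/2}u_0^{-1/2})(x_1-q^{1/2}t_0^{1/2}u_0^{1/2})}{x_1^2-q}(1-\xi_{s_0}),$$ $$t_n^{1/2}T_n=t_n-\frac{(1+t_n^{1/2}u_n^{-1/2}x_n)(1-t_n^{1/2}u_n^{1/2}x_n)}{1-x_n^2}(1-\xi_{s_n}),\qquad t^{1/2}T_i=t-\frac{x_{i+1}-tx_i}{x_{i+1}-x_i}(1-\xi_{s_i})\ (1\le i<n),$$ and $Y_j=T_{j-1}^{-1}\cdots T_1^{-1}T_0T_1\cdots T_{n-1}T_nT_{n-1}\cdots T_j$ for $1\le j\le n$. $T_w=T_{i_1}\cdots T_{i_k}$ for a reduced word $w=s_{i_1}\cdots s_{i_k}$ in $W_{\mathrm{fin}}$. **Polynomials.** For $\mu\in\mathbb Z^n$ let $v_\mu\in W_{\mathrm{fin}}$ be the minimal length element such that $v_\mu\mu$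 is weakly increasing with all entries $\le0$. $E_\mu\in\mathbb K[x]$ is the unique Laurent polynomial with coefficient of $x^\mu$ equal to $1$ and $Y_jE_\mu=q^{-\mu_j}t^{-v_\mu(j)}(t_0^{1/2}t_n^{1/2}t^n)^{\mathrm{sgn}(v_\mu(j))}E_\mu$ for $1\le j\le n$. Multiplicative characters: for $i<n$, $\chi^+(T_i)=\chi^\pm(T_i)=t^{1/2}$, $\chi^\mp(T_i)=\chi^-(T_i)=-t^{-1/2}$; $\chi^+(T_n)=\chi^\mp(T_n)=t_n^{1/2}$, $\chi^\pm(T_n)=\chi^-(T_n)=-t_n^{-1/2}$; $\varepsilon_\Xi=\frac1{\chi^\Xi(T_{w_0})}\sum_{w\in W_{\mathrm{fin}}}\chi^\Xi(T_w)T_w$ for $\Xi\in\{+,\pm,\mp,-\}$. For $\nu\in\mathbb Z^n$ with $\nu_1\ge\cdots\ge\nu_n\ge0$ let $W_\nu$ be its stabilizer in $W_{\mathrm{fin}}$ and $W_\nu(t,t_n)=\sum_{w\in W_\nu}t^{\ell_s(w)}t_n^{\ell_d(w)}$. Then for $\lambda$ with $\lambda_1\ge\cdots\ge\lambda_n\ge0$ $$P_\lambda=\tfrac{\chi^+(T_{w_0})}{W_\lambda(t,t_n)}\varepsilon_+E_\lambda,\quad A_{\lambda+\rho}=\tfrac{\chi^+(T_{w_0})}{W_{\lambda+\rho}(t,t_n)}\varepsilon_-E_{\lambda+\rho},\quad A^\pm_{\lambda+\omega}=\tfrac{\chi^+(T_{w_0})}{W_{\lambda+\omega}(t,t_n)}\varepsilon_\pm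 E_{\lambda+\omega},\quad A^\mp_{\lambda+\pi}=\tfrac{\chi^+(T_{w_0})}{W_{\lambda+\pi}(t,t_n)}\varepsilon_\mp E_{\lambda+\pi}.$$ The case $\lambda=0$ gives $P_0=1$ and the Weyl denominators $A^\pm_\omega=x^{-\omega}\prod_{i=1}^n(1-t_n^{1/2}u_n^{1/2}x_i)(1+t_n^{1/2}u_n^{-1/2}x_i)$, $A^\mp_\pi=x^{-\pi}\prod_{1\le i<j\le n}(1-tx_ix_j)(1-tx_ix_j^{-1})$, $A_\rho=A^\mp_\pi A^\pm_\omega$. *)

theory Defs
  imports
    Complex_Main
    "HOL-Library.Poly_Mapping"
    "HOL-Combinatorics.Transposition"
    "HOL-Computational_Algebra.Computational_Algebra"
begin

section \<open>The coefficient field\<close>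

text \<open>The half-power \<open>Tn_half\<close> stands for $t_n^{1/2}$, and so on.\<close>

datatype param = Q_half | T_half | T0_half | U0_half | Tn_half | Un_half

text \<open>
  The order on the indeterminates carries no meaning. It is only needed because the library
  proves that \<open>'a \<Rightarrow>\<^sub>0 'b\<close> is an integral domain for ordered exponent monoids.
\<close>

primrec param_rank :: "param \<Rightarrow> nat" where
  "param_rank Q_half = 0"
| "param_rank T_half = 1"
| "param_rank T0_half = 2"
| "param_rank U0_half = 3"
| "param_rank Tn_half = 4"
| "param_rank Un_half = 5"

lemma param_rank_inject: "param_rank a = param_rank b \<longleftrightarrow> a = b"
  by (cases a; cases b) simp_all

instantiation param :: linorder
begin

definition less_eq_param :: "param \<Rightarrow> param \<Rightarrow> bool" where
  "less_eq_param a b \<longleftrightarrow> param_rank a \<le> param_rank b"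

definition less_param :: "param \<Rightarrow> param \<Rightarrow> bool" where
  "less_param a b \<longleftrightarrow> param_rank a < param_rank b"

instance
  by standard (auto simp: less_eq_param_def less_param_def param_rank_inject)

end

text \<open>The polynomial ring over the complex numbers in the six parameters, and its fraction field.\<close>

type_synonym param_poly = "(param \<Rightarrow>\<^sub>0 nat) \<Rightarrow>\<^sub>0 complex"
type_synonym coeff = "param_poly fract"

definition par :: "param \<Rightarrow> coeff" where
  "par v = to_fract (Poly_Mapping.single (Poly_Mapping.single v 1) 1)"

abbreviation q_h :: coeff where "q_h \<equiv> par Q_half"
abbreviation t_h :: coeff where "t_h \<equiv> par T_half"
abbreviation t0_h :: coeff where "t0_h \<equiv> par T0_half"
abbreviation u0_h :: coeff where "u0_h \<equiv> par U0_half"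
abbreviation tn_h :: coeff where "tn_h \<equiv> par Tn_half"
abbreviation un_h :: coeff where "un_h \<equiv> par Un_half"

abbreviation q_par :: coeff where "q_par \<equiv> q_h ^ 2"
abbreviation t_par :: coeff where "t_par \<equiv> t_h ^ 2"
abbreviation t0_par :: coeff where "t0_par \<equiv> t0_h ^ 2"
abbreviation tn_par :: coeff where "tn_par \<equiv> tn_h ^ 2"


section \<open>Laurent polynomials\<close>

text \<open>
  Exponent vectors are finitely supported functions on the natural numbers;
  \<open>lattice n\<close> is $\mathbb Z^n$, with coordinates indexed by $1,\dots,n$.
\<close>

type_synonym expo = "nat \<Rightarrow>\<^sub>0 int"
type_synonym laurent = "expo \<Rightarrow>\<^sub>0 coeff"

definition lattice :: "nat \<Rightarrow> expo set" where
  "lattice n = {\<mu>. Poly_Mapping.keys \<mu> \<subseteq> {1..n}}"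

definition laurent_ring :: "nat \<Rightarrow> laurent set" where
  "laurent_ring n = {f. Poly_Mapping.keys f \<subseteq> lattice n}"

definition scal :: "coeff \<Rightarrow> laurent" where
  "scal c = Poly_Mapping.single 0 c"

definition var :: "nat \<Rightarrow> laurent" where
  "var i = Poly_Mapping.single (Poly_Mapping.single i 1) 1"

definition div_exact :: "laurent \<Rightarrow> laurent \<Rightarrow> laurent" where
  "div_exact a b = (THE h. h * b = a)"


section \<open>Parameter shifts\<close>

definition eval_param :: "(param \<Rightarrow> coeff) \<Rightarrow> param_poly \<Rightarrow> coeff" where
  "eval_param \<sigma> p = (\<Sum>m \<in> Poly_Mapping.keys p.
     to_fract (Poly_Mapping.single 0 (Poly_Mapping.lookup p m)) *
     (\<Prod>v \<in> Poly_Mapping.keys m. \<sigma> v ^ Poly_Mapping.lookup m v))"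

text \<open>
  Substitution of the parameters in a rational function. It does not depend on the chosen fraction
  when the elements \<open>\<sigma> v\<close> are algebraically independent, as for the shifts below.
\<close>

definition subst_coeff :: "(param \<Rightarrow> coeff) \<Rightarrow> coeff \<Rightarrow> coeff" where
  "subst_coeff \<sigma> z =
     (case (SOME (a, b). b \<noteq> 0 \<and> z = Fraction_Field.Fract a b) of
        (a, b) \<Rightarrow> eval_param \<sigma> a / eval_param \<sigma> b)"

definition subst_laurent :: "(param \<Rightarrow> coeff) \<Rightarrow> laurent \<Rightarrow> laurent" where
  "subst_laurent \<sigma> f = Poly_Mapping.map (subst_coeff \<sigma>) f"

text \<open>
  The suffixes \<open>pm\<close> and \<open>mp\<close> stand for the superscripts $\pm$ and $\mp$.
  The substitution of $qt$ for $t$ replaces $t^{1/2}$ by $q^{1/2}t^{1/2}$.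
\<close>

definition shift_pm :: "param \<Rightarrow> coeff" where
  "shift_pm = par(Tn_half := q_par * tn_h)"

definition shift_mp :: "param \<Rightarrow> coeff" where
  "shift_mp = par(T_half := q_h * t_h)"

definition shift_minus :: "param \<Rightarrow> coeff" where
  "shift_minus = par(T_half := q_h * t_h, Tn_half := q_par * tn_h)"


section \<open>The finite Weyl group\<close>

text \<open>Elements of the group are represented by their action on exponent vectors.\<close>

definition negate_entry :: "nat \<Rightarrow> expo \<Rightarrow> expo" where
  "negate_entry i \<mu> = Poly_Mapping.update i (- Poly_Mapping.lookup \<mu> i) \<mu>"

definition refl :: "nat \<Rightarrow> nat \<Rightarrow> expo \<Rightarrow> expo" where
  "refl n i = (if i < n then Poly_Mapping.map_key (Transposition.transpose i (Suc i))
               else negate_entry n)"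

definition word_elem :: "nat \<Rightarrow> nat list \<Rightarrow> expo \<Rightarrow> expo" where
  "word_elem n is = foldr (\<lambda>i w. refl n i \<circ> w) is id"

definition W_fin :: "nat \<Rightarrow> (expo \<Rightarrow> expo) set" where
  "W_fin n = {word_elem n is |is. set is \<subseteq> {1..n}}"

definition len :: "nat \<Rightarrow> (expo \<Rightarrow> expo) \<Rightarrow> nat" where
  "len n w = (LEAST k. \<exists>is. set is \<subseteq> {1..n} \<and> word_elem n is = w \<and> length is = k)"

definition reduced_word :: "nat \<Rightarrow> (expo \<Rightarrow> expo) \<Rightarrow> nat list \<Rightarrow> bool" where
  "reduced_word n w is \<longleftrightarrow> set is \<subseteq> {1..n} \<and> word_elem n is = w \<and> length is = len n w"

definition some_reduced_word :: "nat \<Rightarrow> (expo \<Rightarrow> expo) \<Rightarrow> nat list" where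
  "some_reduced_word n w = (SOME is. reduced_word n w is)"

definition len_s :: "nat \<Rightarrow> (expo \<Rightarrow> expo) \<Rightarrow> nat" where
  "len_s n w = length (filter (\<lambda>i. i < n) (some_reduced_word n w))"

definition len_d :: "nat \<Rightarrow> (expo \<Rightarrow> expo) \<Rightarrow> nat" where
  "len_d n w = length (filter (\<lambda>i. i = n) (some_reduced_word n w))"

definition longest :: "nat \<Rightarrow> expo \<Rightarrow> expo" where
  "longest n = (ARG_MAX (len n) w. w \<in> W_fin n)"

definition unit_vec :: "int \<Rightarrow> expo" where
  "unit_vec k = Poly_Mapping.single (nat \<bar>k\<bar>) (sgn k)"

text \<open>The signed index $w(j)$.\<close>

definition signed_index :: "nat \<Rightarrow> (expo \<Rightarrow> expo) \<Rightarrow> nat \<Rightarrow> int" where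
  "signed_index n w j =
     (THE k. 1 \<le> \<bar>k\<bar> \<and> \<bar>k\<bar> \<le> int n \<and> w (unit_vec (int j)) = unit_vec k)"

definition antidominant :: "nat \<Rightarrow> expo \<Rightarrow> bool" where
  "antidominant n \<mu> \<longleftrightarrow>
     (\<forall>i. 1 \<le> i \<and> i < n \<longrightarrow> Poly_Mapping.lookup \<mu> i \<le> Poly_Mapping.lookup \<mu> (Suc i)) \<and>
     (\<forall>i. 1 \<le> i \<and> i \<le> n \<longrightarrow> Poly_Mapping.lookup \<mu> i \<le> 0)"

definition v_min :: "nat \<Rightarrow> expo \<Rightarrow> expo \<Rightarrow> expo" where
  "v_min n \<mu> = (ARG_MIN (len n) v. v \<in> W_fin n \<and> antidominant n (v \<mu>))"


section \<open>Operators\<close>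

definition act :: "(expo \<Rightarrow> expo) \<Rightarrow> laurent \<Rightarrow> laurent" where
  "act w f = (\<Sum>\<mu> \<in> Poly_Mapping.keys f. Poly_Mapping.single (w \<mu>) (Poly_Mapping.lookup f \<mu>))"

text \<open>The substitution of $q x_1^{-1}$ for $x_1$.\<close>

definition xi0 :: "laurent \<Rightarrow> laurent" where
  "xi0 f = (\<Sum>\<mu> \<in> Poly_Mapping.keys f.
     Poly_Mapping.single (negate_entry 1 \<mu>)
       (q_par powi Poly_Mapping.lookup \<mu> 1 * Poly_Mapping.lookup f \<mu>))"

definition hecke :: "nat \<Rightarrow> nat \<Rightarrow> laurent \<Rightarrow> laurent" where
  "hecke n i f =
    (if i = 0 then
       scal (1 / t0_h) * (scal t0_par * f -
         div_exact
           ((var 1 + scal (q_h * t0_h / u0_h)) * (var 1 - scal (q_h * t0_h * u0_h)) * (f - xi0 f))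
           (var 1 ^ 2 - scal q_par))
     else if i < n then
       scal (1 / t_h) * (scal t_par * f -
         div_exact
           ((var (Suc i) - scal t_par * var i) * (f - act (refl n i) f))
           (var (Suc i) - var i))
     else
       scal (1 / tn_h) * (scal tn_par * f -
         div_exact
           ((1 + scal (tn_h / un_h) * var n) * (1 - scal (tn_h * un_h) * var n) *
              (f - act (refl n n) f))
           (1 - var n ^ 2)))"

definition hecke_word :: "nat \<Rightarrow> nat list \<Rightarrow> laurent \<Rightarrow> laurent" where
  "hecke_word n is = foldr (\<lambda>i F. hecke n i \<circ> F) is id"

definition hecke_inv_word :: "nat \<Rightarrow> nat list \<Rightarrow> laurent \<Rightarrow> laurent" where
  "hecke_inv_word n is = foldr (\<lambda>i F. inv_into (laurent_ring n) (hecke n i) \<circ> F) is id"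

definition Y_op :: "nat \<Rightarrow> nat \<Rightarrow> laurent \<Rightarrow> laurent" where
  "Y_op n j = hecke_inv_word n (rev [1..<j]) \<circ> hecke_word n ([0..<n] @ [n] @ rev [j..<n])"

definition hecke_elem :: "nat \<Rightarrow> (expo \<Rightarrow> expo) \<Rightarrow> laurent \<Rightarrow> laurent" where
  "hecke_elem n w = hecke_word n (some_reduced_word n w)"


section \<open>Polynomials\<close>

definition Y_eigenvalue :: "nat \<Rightarrow> expo \<Rightarrow> nat \<Rightarrow> coeff" where
  "Y_eigenvalue n \<mu> j =
     q_par powi (- Poly_Mapping.lookup \<mu> j) *
     t_par powi (- signed_index n (v_min n \<mu>) j) *
     (t0_h * tn_h * t_par ^ n) powi (sgn (signed_index n (v_min n \<mu>) j))"

definition E_poly :: "nat \<Rightarrow> expo \<Rightarrow> laurent" where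
  "E_poly n \<mu> = (THE f. f \<in> laurent_ring n \<and> Poly_Mapping.lookup f \<mu> = 1 \<and>
     (\<forall>j \<in> {1..n}. Y_op n j f = scal (Y_eigenvalue n \<mu> j) * f))"

text \<open>The four multiplicative characters, named after the superscripts $+$, $\pm$, $\mp$, $-$.\<close>

datatype char_sign = Plus | PlusMinus | MinusPlus | Minus

definition chi :: "char_sign \<Rightarrow> nat \<Rightarrow> nat \<Rightarrow> coeff" where
  "chi \<Xi> n i =
    (if i < n then (if \<Xi> = Plus \<or> \<Xi> = PlusMinus then t_h else - (1 / t_h))
     else (if \<Xi> = Plus \<or> \<Xi> = MinusPlus then tn_h else - (1 / tn_h)))"

definition chi_elem :: "char_sign \<Rightarrow> nat \<Rightarrow> (expo \<Rightarrow> expo) \<Rightarrow> coeff" where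
  "chi_elem \<Xi> n w = prod_list (map (chi \<Xi> n) (some_reduced_word n w))"

definition symmetrizer :: "char_sign \<Rightarrow> nat \<Rightarrow> laurent \<Rightarrow> laurent" where
  "symmetrizer \<Xi> n f = scal (1 / chi_elem \<Xi> n (longest n)) *
     (\<Sum>w \<in> W_fin n. scal (chi_elem \<Xi> n w) * hecke_elem n w f)"

definition stab_poincare :: "nat \<Rightarrow> expo \<Rightarrow> coeff" where
  "stab_poincare n \<nu> =
     (\<Sum>w | w \<in> W_fin n \<and> w \<nu> = \<nu>. t_par ^ len_s n w * tn_par ^ len_d n w)"

definition sym_poly :: "char_sign \<Rightarrow> nat \<Rightarrow> expo \<Rightarrow> laurent" where
  "sym_poly \<Xi> n \<nu> =
     scal (chi_elem Plus n (longest n) / stab_poincare n \<nu>) * symmetrizer \<Xi> n (E_poly n \<nu>)"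

text \<open>
  The argument is the full subscript of the polynomial, for instance $\lambda+\rho$ in
  $A_{\lambda+\rho}$.
\<close>

definition P_poly :: "nat \<Rightarrow> expo \<Rightarrow> laurent" where
  "P_poly n \<nu> = sym_poly Plus n \<nu>"

definition A_minus :: "nat \<Rightarrow> expo \<Rightarrow> laurent" where
  "A_minus n \<nu> = sym_poly Minus n \<nu>"

definition A_pm :: "nat \<Rightarrow> expo \<Rightarrow> laurent" where
  "A_pm n \<nu> = sym_poly PlusMinus n \<nu>"

definition A_mp :: "nat \<Rightarrow> expo \<Rightarrow> laurent" where
  "A_mp n \<nu> = sym_poly MinusPlus n \<nu>"

definition rho :: "nat \<Rightarrow> expo" where
  "rho n = (\<Sum>i = 1..n. Poly_Mapping.single i (int n + 1 - int i))"

definition omega :: "nat \<Rightarrow> expo" where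
  "omega n = (\<Sum>i = 1..n. Poly_Mapping.single i 1)"

definition pi_vec :: "nat \<Rightarrow> expo" where
  "pi_vec n = (\<Sum>i = 1..n. Poly_Mapping.single i (int n - int i))"

end

theory Submission
  imports Defs "HOL-Combinatorics.Permutations" "HOL-Library.Function_Algebras"
begin

text \<open>
  The operators $T_0,\dots,T_n$ generate an affine Hecke algebra, in which
  $Z=\sum_j(Y_j+Y_j^{-1})$ commutes with $T_1,\dots,T_n$. Symmetrizing $E_\kappa$ for dominant $\kappa$
  therefore gives an eigenvector of $Z$ on which $T_1,\dots,T_n$ act through the character $\chi$.
  Such a vector is determined by its coefficient at $x^\kappa$: among its exponents of maximal norm
  there is a dominant one, and the eigenvalue of $Z$ identifies it as $\kappa$.

  Let $A$ be the Weyl denominator attached to $\chi$ and $\delta$ its leading exponent. On functions of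
  generic points the $T_i$ are weighted sums of the identity and a reflection, and there
  $A^{-1}ZA=Z'$ on invariant functions, where $Z'$ is formed with the shifted parameters. Indeed both
  sides are determined by their values on the constant function and on indicators of orbits, and for
  an indicator a single path contributes at a suitable point. Hence $A_\delta$ times the shifted
  $P_\lambda$ is an eigenvector of type $\chi$ with the eigenvalue and the leading coefficient of
  $A_{\lambda+\delta}$, and so equals it.
\<close>

section \<open>The affine Hecke algebra\<close>

text \<open>The polynomials are definite descriptions, so existence and uniqueness of
  \<open>E_poly\<close> must be proved. Exponents are filtered by Euclidean norm: apart from
  \<open>\<mu>\<close> and its reflection, \<open>T_i\<close> sends \<open>x^\<mu>\<close> to terms
  strictly inside the segment between these two, which have smaller norm. Existence for dominant
  weights rests on \<open>Z\<close>, whose leading eigenvalues separate dominant weights. Uniqueness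
  rests on each single \<open>Y_j\<close>: refining the norm by the number of inversions makes it
  triangular, and the degree in \<open>q\<close> of a diagonal entry reveals the exponent. Norm does
  not control products of polynomials, so leading coefficients of products are taken inside the
  convex sets \<open>dom \<kappa>\<close>. Operator identities, the braid relations included, are
  checked on values at points whose coordinates satisfy no algebraic relation. The same points serve
  both parameter sets: only the map on coefficients changes, so the two forms of \<open>Z\<close>
  can be compared value by value. The amount of the shift is fixed in \<open>Mc_shift\<close>,
  because \<open>s_0\<close> replaces \<open>1/y_1\<close> by \<open>q/y_1\<close>.\<close>

locale affine_hecke =
  fixes n :: nat and T h :: "nat \<Rightarrow> 'a::{ring,monoid_mult}"
  assumes n_pos: "1 \<le> n"
    and h_central: "\<And>i j. i \<le> n \<Longrightarrow> j \<le> n \<Longrightarrow> h i * T j = T j * h i"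
    and h_comm: "\<And>i j. i \<le> n \<Longrightarrow> j \<le> n \<Longrightarrow> h i * h j = h j * h i"
    and h_eq: "\<And>i j. 1 \<le> i \<Longrightarrow> i < n \<Longrightarrow> 1 \<le> j \<Longrightarrow> j < n \<Longrightarrow> h i = h j"
    and quad: "\<And>i. i \<le> n \<Longrightarrow> T i * T i = h i * T i + 1"
    and far: "\<And>i j. i + 2 \<le> j \<Longrightarrow> j \<le> n \<Longrightarrow> T i * T j = T j * T i"
    and braid3: "\<And>i. 1 \<le> i \<Longrightarrow> i + 1 < n \<Longrightarrow> T i * T (i+1) * T i = T (i+1) * T i * T (i+1)"
    and braid4: "\<And>i. i = 0 \<or> i + 1 = n \<Longrightarrow> i + 1 \<le> n \<Longrightarrow> 2 \<le> n \<Longrightarrow>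
        T i * T (i+1) * T i * T (i+1) = T (i+1) * T i * T (i+1) * T i"
begin

text \<open>By the quadratic relation this is the inverse of \<open>T i\<close>. The
  \<open>h i\<close> are ring elements and not scalars of a base field, so that one locale covers
  operators on Laurent polynomials and operators on functions of points.\<close>

definition Ti :: "nat \<Rightarrow> 'a" where "Ti i = T i - h i"

lemma T_Ti: "i \<le> n \<Longrightarrow> T i * Ti i = 1"
  by (simp add: Ti_def algebra_simps quad h_central)

lemma Ti_T: "i \<le> n \<Longrightarrow> Ti i * T i = 1"
  by (simp add: Ti_def algebra_simps quad)

lemma T_Ti_l: "i \<le> n \<Longrightarrow> T i * (Ti i * x) = x"
  by (metis T_Ti mult.assoc mult_1_left)

lemma Ti_T_l: "i \<le> n \<Longrightarrow> Ti i * (T i * x) = x"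
  by (metis Ti_T mult.assoc mult_1_left)

lemma cancel_TL: "i \<le> n \<Longrightarrow> T i * x = T i * y \<longleftrightarrow> x = y"
  by (metis Ti_T_l)

lemma cancel_TR: "i \<le> n \<Longrightarrow> x * T i = y * T i \<longleftrightarrow> x = y"
  by (metis T_Ti mult.assoc mult.right_neutral)

definition commutes :: "'a \<Rightarrow> 'a \<Rightarrow> bool" where "commutes x y \<longleftrightarrow> x * y = y * x"

lemma commutesD: "commutes x y \<Longrightarrow> x * y = y * x" by (simp add: commutes_def)

lemma commutes_sym: "commutes x y \<Longrightarrow> commutes y x" by (simp add: commutes_def)

lemma commutes_mult: "commutes x y \<Longrightarrow> commutes x z \<Longrightarrow> commutes x (y * z)"
  unfolding commutes_def by (metis mult.assoc)

lemma commutes_add: "commutes x y \<Longrightarrow> commutes x z \<Longrightarrow> commutes x (y + z)"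
  unfolding commutes_def by (simp add: algebra_simps)

lemma commutes_sum: "(\<And>j. j \<in> A \<Longrightarrow> commutes x (f j)) \<Longrightarrow> commutes x (sum f A)"
  unfolding commutes_def by (simp add: sum_distrib_left sum_distrib_right)

lemma commutes_inv:
  assumes "commutes x y" "y * y' = 1" "y' * y = 1"
  shows "commutes x y'"
proof -
  have "x * y' = y' * y * x * y'" by (simp add: assms)
  also have "\<dots> = y' * (x * y) * y'" using assms(1) by (simp add: commutes_def mult.assoc)
  also have "\<dots> = y' * x" by (simp add: assms mult.assoc)
  finally show ?thesis by (simp add: commutes_def)
qed

lemma commutes_far: "i + 2 \<le> j \<or> j + 2 \<le> i \<Longrightarrow> i \<le> n \<Longrightarrow> j \<le> n \<Longrightarrow> commutes (T i) (T j)"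
  unfolding commutes_def by (metis far)

lemma commutes_h: "i \<le> n \<Longrightarrow> j \<le> n \<Longrightarrow> commutes (T i) (h j)"
  unfolding commutes_def by (metis h_central)

lemma commutes_Ti: "commutes x (T i) \<Longrightarrow> i \<le> n \<Longrightarrow> commutes x (Ti i)"
  by (rule commutes_inv[of x "T i"]) (auto simp: T_Ti Ti_T)

text \<open>\<open>R k\<close> is $T_j\cdots T_n\cdots T_j$ for $j = n - k$.\<close>

primrec R :: "nat \<Rightarrow> 'a" where
  "R 0 = T n"
| "R (Suc k) = T (n - Suc k) * R k * T (n - Suc k)"

lemma R_step: "1 \<le> j \<Longrightarrow> j < n \<Longrightarrow> R (n - j) = T j * R (n - Suc j) * T j"
proof -
  assume a: "1 \<le> j" "j < n"
  then have "n - j = Suc (n - Suc j)" by simp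
  then show ?thesis using a by (simp add: )
qed

lemma R_commutes_low: "j + 1 < n - k \<Longrightarrow> k < n \<Longrightarrow> commutes (T j) (R k)"
proof (induction k)
  case 0 then show ?case by (auto intro!: commutes_far)
next
  case (Suc k)
  then have "commutes (T j) (R k)" by auto
  moreover have "commutes (T j) (T (n - Suc k))" using Suc.prems by (auto intro!: commutes_far)
  ultimately show ?case by (auto intro: commutes_mult)
qed

text \<open>The only critical case is \<open>i = j + 1\<close> with \<open>j = n - Suc k\<close>.
  For \<open>i = n\<close> it is the relation of order four. Otherwise \<open>T i\<close> enters at
  the left by \<open>braid3\<close>, becomes \<open>T j\<close>, passes the inner part of the word,
  and is turned back at the right by \<open>braid3\<close>.\<close>

lemma R_commutes_high: "n - k < i \<Longrightarrow> i \<le> n \<Longrightarrow> k < n \<Longrightarrow> commutes (T i) (R k)"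
proof (induction k)
  case 0 then show ?case by simp
next
  case (Suc k)
  define j where "j = n - Suc k"
  have j: "1 \<le> j" "j < n" "n - k = Suc j" using Suc.prems unfolding j_def by auto
  show ?case
  proof (cases "i = Suc j")
    case False
    then have "commutes (T i) (R k)" using Suc j by auto
    moreover have "commutes (T i) (T j)" using False Suc.prems j by (intro commutes_far) (auto simp: j_def)
    ultimately show ?thesis unfolding R.simps j_def[symmetric] by (auto intro: commutes_mult)
  next
    case i: True
    show ?thesis
    proof (cases k)
      case 0
      then have "i = n" "j + 1 = n" using i j by auto
      then have "T j * T n * T j * T n = T n * T j * T n * T j" using braid4[of j] j by auto
      then show ?thesis unfolding R.simps j_def[symmetric, unfolded 0] commutes_def 0 \<open>i = n\<close>
        by (simp only: mult.assoc)
    next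
      case (Suc l)
      have il: "i = n - k" "i < n" using i j Suc Suc.prems by auto
      have Rk: "R k = T i * R l * T i" unfolding Suc using il Suc by simp
      have b: "T j * T i * T j = T i * T j * T i" using braid3[of j] i j il by simp
      have c: "T j * R l = R l * T j" by (rule commutesD[OF R_commutes_low]) (use i j il Suc Suc.prems in auto)
      have "T i * (T j * (T i * R l * T i) * T j) = (T i * T j * T i) * R l * T i * T j" by (simp only: mult.assoc)
      also have "\<dots> = T j * T i * (T j * R l) * T i * T j" unfolding b[symmetric] by (simp only: mult.assoc)
      also have "\<dots> = T j * T i * R l * (T j * T i * T j)" by (simp only: c mult.assoc)
      also have "\<dots> = T j * (T i * R l * T i) * T j * T i" unfolding b by (simp only: mult.assoc)
      finally show ?thesis unfolding R.simps j_def[symmetric] Rk commutes_def .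
    qed
  qed
qed

section \<open>The commuting elements \<open>Y j\<close> and their inverses\<close>

fun Y :: "nat \<Rightarrow> 'a" where
  "Y 0 = 1"
| "Y (Suc 0) = T 0 * R (n - 1)"
| "Y (Suc (Suc j)) = Ti (Suc j) * Y (Suc j) * Ti (Suc j)"

lemma Y_Suc: "1 \<le> j \<Longrightarrow> Y (Suc j) = Ti j * Y j * Ti j"
  by (cases j) auto

primrec Ri :: "nat \<Rightarrow> 'a" where
  "Ri 0 = Ti n"
| "Ri (Suc k) = Ti (n - Suc k) * Ri k * Ti (n - Suc k)"

fun Yi :: "nat \<Rightarrow> 'a" where
  "Yi 0 = 1"
| "Yi (Suc 0) = Ri (n - 1) * Ti 0"
| "Yi (Suc (Suc j)) = T (Suc j) * Yi (Suc j) * T (Suc j)"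

lemma Yi_Suc: "1 \<le> j \<Longrightarrow> Yi (Suc j) = T j * Yi j * T j"
  by (cases j) auto

lemma R_Ri: "k < n \<Longrightarrow> R k * Ri k = 1 \<and> Ri k * R k = 1"
proof (induction k)
  case 0 then show ?case by (simp add: T_Ti Ti_T)
next
  case (Suc k)
  let ?j = "n - Suc k"
  have "T ?j * R k * T ?j * (Ti ?j * Ri k * Ti ?j) = T ?j * (R k * Ri k) * Ti ?j"
    by (simp add: mult.assoc T_Ti_l)
  moreover have "Ti ?j * Ri k * Ti ?j * (T ?j * R k * T ?j) = Ti ?j * (Ri k * R k) * T ?j"
    by (simp add: mult.assoc Ti_T_l)
  ultimately show ?case using Suc by (simp add: T_Ti Ti_T)
qed

lemma Y_Yi: "j \<le> n \<Longrightarrow> Y j * Yi j = 1 \<and> Yi j * Y j = 1"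
proof (induction j rule: Y.induct)
  case 2
  have r: "R (n - 1) * Ri (n - 1) = 1" "Ri (n - 1) * R (n - 1) = 1" using R_Ri[of "n - 1"] n_pos by auto
  have "T 0 * R (n - 1) * (Ri (n - 1) * Ti 0) = T 0 * (R (n - 1) * Ri (n - 1)) * Ti 0"
    by (simp only: mult.assoc)
  moreover have "Ri (n - 1) * Ti 0 * (T 0 * R (n - 1)) = Ri (n - 1) * R (n - 1)"
    by (simp add: mult.assoc Ti_T_l)
  ultimately show ?case using r by (simp add: T_Ti)
next
  case (3 j)
  have y: "Y (Suc j) * Yi (Suc j) = 1" "Yi (Suc j) * Y (Suc j) = 1" using 3 by auto
  have "Ti (Suc j) * Y (Suc j) * Ti (Suc j) * (T (Suc j) * Yi (Suc j) * T (Suc j)) =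
     Ti (Suc j) * (Y (Suc j) * Yi (Suc j)) * T (Suc j)" using "3.prems" by (simp add: mult.assoc Ti_T_l)
  moreover have "T (Suc j) * Yi (Suc j) * T (Suc j) * (Ti (Suc j) * Y (Suc j) * Ti (Suc j)) =
     T (Suc j) * (Yi (Suc j) * Y (Suc j)) * Ti (Suc j)" using "3.prems" by (simp add: mult.assoc T_Ti_l)
  ultimately show ?case using "3.prems" y by (simp add: T_Ti Ti_T)
qed simp

lemma Y1_commutes: "2 \<le> i \<Longrightarrow> i \<le> n \<Longrightarrow> commutes (T i) (Y 1)"
  by (auto simp: intro!: commutes_mult commutes_far R_commutes_high)

lemma Y_commutes_high: "1 \<le> j \<Longrightarrow> j < i \<Longrightarrow> i \<le> n \<Longrightarrow> commutes (T i) (Y j)"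
proof (induction j rule: Y.induct)
  case 2 then show ?case using Y1_commutes by simp
next
  case (3 j)
  then show ?case by (auto intro!: commutes_mult commutes_Ti commutes_far)
qed simp

lemma Ti_T_T: "1 \<le> i \<Longrightarrow> i + 1 < n \<Longrightarrow> T i * (Ti (i+1) * Ti i) = Ti (i+1) * Ti i * T (i+1)"
proof -
  assume a: "1 \<le> i" "i + 1 < n"
  have "T i * T (i+1) * (T i * (Ti (i+1) * Ti i)) = (T i * T (i+1) * T i) * Ti (i+1) * Ti i" by (simp only: mult.assoc)
  also have "\<dots> = T (i+1)" unfolding braid3[OF a] using a by (simp add: mult.assoc T_Ti_l T_Ti)
  also have "\<dots> = T i * T (i+1) * (Ti (i+1) * Ti i * T (i+1))" using a by (simp add: mult.assoc T_Ti_l)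
  finally show ?thesis using a by (simp add: mult.assoc cancel_TL)
qed

lemma Ti_T_T': "1 \<le> i \<Longrightarrow> i + 1 < n \<Longrightarrow> Ti i * Ti (i+1) * T i = T (i+1) * (Ti i * Ti (i+1))"
proof -
  assume a: "1 \<le> i" "i + 1 < n"
  have "(Ti i * Ti (i+1) * T i) * (T (i+1) * T i) = Ti i * Ti (i+1) * (T i * T (i+1) * T i)" by (simp only: mult.assoc)
  also have "\<dots> = T (i+1)" unfolding braid3[OF a] using a by (simp add: mult.assoc Ti_T_l)
  also have "\<dots> = T (i+1) * (Ti i * Ti (i+1)) * (T (i+1) * T i)" using a by (simp add: mult.assoc Ti_T_l Ti_T)
  finally have "(Ti i * Ti (i+1) * T i) * T (i+1) * T i = T (i+1) * (Ti i * Ti (i+1)) * T (i+1) * T i"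
    by (simp only: mult.assoc)
  then show ?thesis using a by (simp add: cancel_TR)
qed

text \<open>The critical case is \<open>T j\<close> against
  \<open>Ti (j+1) * Ti j * Y j * Ti j * Ti (j+1)\<close>: the braid relation turns
  \<open>T j\<close> into \<open>T (j+1)\<close> at the left, this commutes with \<open>Y j\<close>,
  and it is turned back at the right.\<close>

lemma Y_commutes_low: "1 \<le> i \<Longrightarrow> i + 1 < j \<Longrightarrow> j \<le> n \<Longrightarrow> commutes (T i) (Y j)"
proof (induction j rule: Y.induct)
  case (3 j)
  show ?case
  proof (cases "i = j")
    case False
    then show ?thesis using 3 by (auto intro!: commutes_mult commutes_Ti commutes_far)
  next
    case True
    have j: "1 \<le> j" "j + 1 < n" using 3 True by auto
    have c: "T (j+1) * Y j = Y j * T (j+1)" using Y_commutes_high[of j "j+1"] j by (simp add: commutes_def)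
    have "T j * (Ti (j+1) * Ti j * Y j * Ti j * Ti (j+1)) = (T j * (Ti (j+1) * Ti j)) * Y j * Ti j * Ti (j+1)"
      by (simp add: mult.assoc)
    also have "\<dots> = Ti (j+1) * Ti j * (T (j+1) * Y j) * Ti j * Ti (j+1)" using Ti_T_T[OF j] by (simp add: mult.assoc)
    also have "\<dots> = Ti (j+1) * Ti j * Y j * (T (j+1) * (Ti j * Ti (j+1)))" by (simp only: c mult.assoc)
    also have "\<dots> = Ti (j+1) * Ti j * Y j * Ti j * Ti (j+1) * T j" by (simp only: Ti_T_T'[OF j, symmetric] mult.assoc)
    finally show ?thesis using j True by (simp add: commutes_def Y_Suc mult.assoc)
  qed
qed auto

text \<open>With \<open>V\<close> the word from 2 to \<open>n\<close> and back, both products are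
  brought to \<open>T 0 * T 1 * T 0 * V * T 1 * V\<close>; the second one by the order-four
  relations between \<open>T 0\<close> and \<open>T 1\<close> and between \<open>V\<close> and
  \<open>T 1\<close>.\<close>

lemma Y1_Y2: "2 \<le> n \<Longrightarrow> commutes (Y 1) (Y 2)"
proof -
  assume n: "2 \<le> n"
  define V where "V = R (n - 2)"
  have R: "R (n - 1) = T 1 * V * T 1" using R_step[of 1] n by (simp add: V_def numeral_2_eq_2)
  have Y1: "Y 1 = T 0 * (T 1 * V * T 1)" using R by simp
  have "Y 2 = Ti 1 * Y 1 * Ti 1" by (simp add: numeral_2_eq_2)
  then have Y2: "Y 2 = Ti 1 * T 0 * T 1 * V"
    unfolding Y1 using n by (simp add: mult.assoc T_Ti)
  have V0: "T 0 * V = V * T 0" unfolding V_def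
    by (rule commutesD[OF R_commutes_low]) (use n in auto)
  \<comment> \<open>Towards \<open>T 1\<close> the word \<open>V\<close> behaves like a generator
    joined to it by a double bond. For \<open>n = 2\<close> it is one; otherwise
    \<open>T 1 * V * T 1\<close> is the word \<open>R (n - 1)\<close>, which commutes with all
    letters of \<open>V\<close>.\<close>
  have VU: "V * (T 1 * (V * T 1)) = T 1 * (V * (T 1 * V))"
  proof (cases "n = 2")
    case True
    then have "n - 2 = 0" by simp
    then have "V = T n" unfolding V_def by (simp only: R.simps)
    then show ?thesis using braid4[of 1] True by (simp add: mult.assoc numeral_2_eq_2)
  next
    case False
    have *: "commutes (R (n - 1)) (R k)" if "k \<le> n - 2" for k using that
    proof (induction k)
      case 0
      have "commutes (T n) (R (n - 1))" using n by (intro R_commutes_high) auto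
      then show ?case by (simp add: commutes_sym)
    next
      case (Suc k)
      have "commutes (T (n - Suc k)) (R (n - 1))" using n Suc.prems by (intro R_commutes_high) auto
      then show ?case using Suc unfolding R.simps by (intro commutes_mult) (auto intro: commutes_sym)
    qed
    have "commutes (T 1 * V * T 1) V" using *[of "n - 2"] unfolding R V_def by simp
    then show ?thesis by (simp only: commutes_def mult.assoc)
  qed
  have b4: "T 0 * (T 1 * (T 0 * (T 1 * x))) = T 1 * (T 0 * (T 1 * (T 0 * x)))" for x
  proof -
    have "T 0 * T 1 * T 0 * T 1 * x = T 1 * T 0 * T 1 * T 0 * x" using braid4[of 0] n by simp
    then show ?thesis by (simp only: mult.assoc)
  qed
  have "Y 1 * Y 2 = T 0 * T 1 * V * T 0 * T 1 * V"
    unfolding Y1 Y2 using n by (simp add: mult.assoc T_Ti_l)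
  also have "\<dots> = T 0 * T 1 * (T 0 * V) * T 1 * V" by (simp only: V0 mult.assoc)
  finally have 1: "Y 1 * Y 2 = T 0 * T 1 * T 0 * V * T 1 * V" by (simp only: mult.assoc)
  have "Y 2 * Y 1 = Ti 1 * T 0 * T 1 * (V * T 0) * T 1 * V * T 1"
    unfolding Y1 Y2 by (simp only: mult.assoc)
  also have "\<dots> = Ti 1 * T 0 * T 1 * T 0 * (V * (T 1 * (V * T 1)))" by (simp only: V0[symmetric] mult.assoc)
  also have "\<dots> = Ti 1 * (T 0 * (T 1 * (T 0 * (T 1 * (V * (T 1 * V))))))" by (simp only: VU mult.assoc)
  also have "\<dots> = T 0 * T 1 * T 0 * V * T 1 * V" unfolding b4 using n by (simp add: Ti_T_l mult.assoc)
  finally show ?thesis using 1 by (simp add: commutes_def)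
qed

lemma Y1_commutes_Y: "1 \<le> j \<Longrightarrow> j \<le> n \<Longrightarrow> commutes (Y 1) (Y j)"
proof (induction j rule: Y.induct)
  case 2 then show ?case by (simp add: commutes_def)
next
  case (3 j)
  show ?case
  proof (cases "j = 0")
    case True then show ?thesis using Y1_Y2 3 by (simp add: numeral_2_eq_2)
  next
    case False
    have "commutes (Y 1) (T (Suc j))" using Y1_commutes[of "Suc j"] False 3 by (simp add: commutes_sym)
    then show ?thesis using 3 False by (auto intro!: commutes_mult commutes_Ti)
  qed
qed simp

text \<open>\<open>Y j\<close> commutes with \<open>Y 1\<close> and with \<open>T 1\<close>, ...,
  \<open>T (j-2)\<close>, and the smaller-indexed \<open>Y i\<close> is built from these
  alone.\<close>

theorem Y_commutes_less: "1 \<le> i \<Longrightarrow> i < j \<Longrightarrow> j \<le> n \<Longrightarrow> commutes (Y j) (Y i)"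
proof (induction i rule: Y.induct)
  case 2 then show ?case using Y1_commutes_Y[of j] by (simp add: commutes_sym)
next
  case (3 i)
  have "commutes (Y j) (T (Suc i))" using Y_commutes_low[of "Suc i" j] 3 by (simp add: commutes_sym)
  then show ?case using 3 by (auto intro!: commutes_mult commutes_Ti)
qed simp

theorem Y_commutes: "1 \<le> i \<Longrightarrow> i \<le> n \<Longrightarrow> 1 \<le> j \<Longrightarrow> j \<le> n \<Longrightarrow> commutes (Y i) (Y j)"
  using Y_commutes_less[of i j] Y_commutes_less[of j i] commutes_sym
  by (cases i j rule: linorder_cases) (auto simp: commutes_def)

section \<open>Cross relations and the central element\<close>

lemma h_T: "i \<le> n \<Longrightarrow> j \<le> n \<Longrightarrow> commutes (h i) (T j)"
  using commutes_sym[OF commutes_h] by blast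

lemma h_Ti: "i \<le> n \<Longrightarrow> j \<le> n \<Longrightarrow> commutes (h i) (Ti j)"
  using commutes_Ti[OF h_T] by blast

lemma h_R: "i \<le> n \<Longrightarrow> k < n \<Longrightarrow> commutes (h i) (R k)"
  by (induction k) (auto intro!: commutes_mult h_T)

lemma h_Y: "i \<le> n \<Longrightarrow> j \<le> n \<Longrightarrow> commutes (h i) (Y j)"
proof (induction j rule: Y.induct)
  case 2 then show ?case using n_pos by (auto intro!: commutes_mult h_T h_R)
qed (auto intro!: commutes_mult h_Ti simp: commutes_def[of _ 1])

text \<open>Bernstein's relations. They come from moving one outer factor of
  \<open>Y (Suc i) = Ti i * Y i * Ti i\<close> to the other side and writing
  \<open>Ti i = T i - h i\<close>.\<close>

lemma T_Y: assumes "1 \<le> i" "i < n"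
  shows "Y i * T i = T i * Y (Suc i) + h i * Y i"
    and "Y (Suc i) * T i = T i * Y i - h i * Y i"
    and "Yi i * T i = T i * Yi (Suc i) - h i * Yi (Suc i)"
    and "Yi (Suc i) * T i = T i * Yi i + h i * Yi (Suc i)"
proof -
  have Yh: "Y j * h i = h i * Y j" if "j \<le> n" for j
    using h_Y[of i j] that assms by (simp add: commutes_def)
  have Yih: "Yi j * h i = h i * Yi j" if "j \<le> n" for j
    using commutes_inv[of "h i" "Y j" "Yi j"] Y_Yi[OF that] Yh[OF that] by (simp add: commutes_def)
  have e: "Y (Suc i) = Ti i * Y i * Ti i" using Y_Suc assms by simp
  have 1: "T i * Y (Suc i) = Y i * Ti i" using assms by (simp add: e mult.assoc T_Ti_l)
  then show "Y i * T i = T i * Y (Suc i) + h i * Y i" using assms Yh[of i] by (simp add: Ti_def algebra_simps)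
  have 2: "Y (Suc i) * T i = Ti i * Y i" using assms by (simp add: e mult.assoc Ti_T)
  then show "Y (Suc i) * T i = T i * Y i - h i * Y i" by (simp add: Ti_def algebra_simps)
  have f: "Yi (Suc i) = T i * Yi i * T i" using Yi_Suc assms by simp
  then have "Ti i * Yi (Suc i) = Yi i * T i" using assms by (simp add: mult.assoc Ti_T_l)
  then show "Yi i * T i = T i * Yi (Suc i) - h i * Yi (Suc i)" by (simp add: Ti_def algebra_simps)
  have "Yi (Suc i) * Ti i = T i * Yi i" using assms by (simp add: f mult.assoc T_Ti)
  then show "Yi (Suc i) * T i = T i * Yi i + h i * Yi (Suc i)" using assms Yih[of "Suc i"]
    by (simp add: Ti_def algebra_simps)
qed

text \<open>$Y_nT_n^{-1}$ is conjugate to $T_0$, hence satisfies the same quadratic relation.\<close>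

lemma T_Yn:
  shows "Y n * T n = T n * Yi n + h n * Y n + h 0"
    and "Yi n * T n = T n * Y n - h n * Y n - h 0"
proof -
  define X where "X j = Y j * Ri (n - j)" for j
  define X' where "X' j = R (n - j) * Yi j" for j
  have XX': "X j - X' j = h 0" if "1 \<le> j" "j \<le> n" for j using that
  proof (induction j)
    case (Suc j)
    show ?case
    proof (cases "j = 0")
      case True
      have r: "R (n - 1) * Ri (n - 1) = 1" using R_Ri[of "n - 1"] n_pos by auto
      then have "X (Suc j) = T 0" by (simp add: X_def True mult.assoc)
      moreover have "R (n - 1) * (Ri (n - 1) * Ti 0) = (R (n - 1) * Ri (n - 1)) * Ti 0" by (simp only: mult.assoc)
      then have "X' (Suc j) = Ti 0" using r by (simp add: X'_def True)
      ultimately show ?thesis by (simp add: Ti_def)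
    next
      case False
      have j: "1 \<le> j" "j < n" "n - j = Suc (n - Suc j)" "n - (n - j) = j" using False Suc by auto
      have "Ri (n - j) = Ti j * Ri (n - Suc j) * Ti j" "R (n - j) = T j * R (n - Suc j) * T j"
        unfolding j(3) Ri.simps R.simps using j by simp_all
      then have "X j = Y j * Ti j * Ri (n - Suc j) * Ti j" "X' j = T j * R (n - Suc j) * T j * Yi j"
        by (simp_all add: X_def X'_def mult.assoc)
      then have "Ti j * X j * T j = X (Suc j)" "Ti j * X' j * T j = X' (Suc j)"
        using j by (simp_all add: X_def X'_def Y_Suc Yi_Suc mult.assoc Ti_T Ti_T_l)
      then have "X (Suc j) - X' (Suc j) = Ti j * (X j - X' j) * T j" by (simp add: algebra_simps)
      also have "\<dots> = h 0" using Suc j commutesD[OF h_T, of 0 j] by (simp add: mult.assoc Ti_T_l)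
      finally show ?thesis .
    qed
  qed simp
  have nn: "Y n * Ti n - T n * Yi n = h 0" using XX'[of n] n_pos by (simp add: X_def X'_def)
  have Yh: "Y n * h n = h n * Y n" using h_Y[of n n] by (simp add: commutes_def)
  show 1: "Y n * T n = T n * Yi n + h n * Y n + h 0"
    using nn Yh by (simp add: Ti_def algebra_simps)
  have Yi: "Yi n * Y n = 1" "Y n * Yi n = 1" using Y_Yi by auto
  have "Ti n * (Y n * Ti n) * T n = Ti n * (h 0 + T n * Yi n) * T n" using nn by (simp add: algebra_simps)
  then have "Ti n * Y n = h 0 + Yi n * T n"
    using commutesD[OF h_T, of 0 n]
    by (simp add: mult.assoc Ti_T Ti_T_l distrib_left distrib_right)
  then show "Yi n * T n = T n * Y n - h n * Y n - h 0" by (simp add: Ti_def algebra_simps)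
qed

definition Z :: 'a where "Z = (\<Sum>j=1..n. Y j + Yi j)"

lemma commutes_Yi: "commutes x (Y j) \<Longrightarrow> j \<le> n \<Longrightarrow> commutes x (Yi j)"
  using commutes_inv Y_Yi by blast

text \<open>The terms with \<open>h i\<close> that arise when \<open>T i\<close> passes
  \<open>Y i\<close> and \<open>Y (Suc i)\<close> are opposite, and so are those for the inverses.
  For \<open>i = n\<close> the terms with \<open>h n\<close> and \<open>h 0\<close> cancel between
  \<open>Y n\<close> and \<open>Yi n\<close>. All remaining summands commute with
  \<open>T i\<close>.\<close>

theorem Z_central: assumes "1 \<le> i" "i \<le> n" shows "commutes (T i) Z"
proof (cases "i = n")
  case True
  have "Z = (\<Sum>j=1..<n. Y j + Yi j) + (Y n + Yi n)"
  proof -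
    have "{1..n} = insert n {1..<n}" using n_pos by auto
    then show ?thesis unfolding Z_def by simp
  qed
  moreover have "commutes (T i) (\<Sum>j=1..<n. Y j + Yi j)"
    using True by (auto intro!: commutes_sum commutes_add commutes_Yi Y_commutes_high)
  moreover have "commutes (T i) (Y n + Yi n)"
    unfolding commutes_def True distrib_left distrib_right T_Yn by simp
  ultimately show ?thesis by (simp only: commutes_add)
next
  case False
  have s: "{1..n} = ({1..n} - {i, Suc i}) \<union> {i, Suc i}" using assms False by auto
  have "Z = (\<Sum>j\<in>{1..n} - {i, Suc i}. Y j + Yi j) + (\<Sum>j\<in>{i, Suc i}. Y j + Yi j)"
    unfolding Z_def by (subst s, subst sum.union_disjoint) auto
  moreover have "commutes (T i) (\<Sum>j\<in>{1..n} - {i, Suc i}. Y j + Yi j)"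
  proof (rule commutes_sum)
    fix j assume j: "j \<in> {1..n} - {i, Suc i}"
    then have "commutes (T i) (Y j)"
      using Y_commutes_high[of j i] Y_commutes_low[of i j] assms False by (cases "j < i") auto
    then show "commutes (T i) (Y j + Yi j)" using j by (auto intro!: commutes_add commutes_Yi)
  qed
  moreover have "commutes (T i) (\<Sum>j\<in>{i, Suc i}. Y j + Yi j)"
    using T_Y[of i] assms False by (simp add: commutes_def distrib_left distrib_right)
  ultimately show ?thesis by (simp only: commutes_add)
qed

theorem Z_commutes_Y: "1 \<le> i \<Longrightarrow> i \<le> n \<Longrightarrow> commutes (Y i) Z"
  unfolding Z_def by (intro commutes_sum commutes_add commutes_Yi Y_commutes) auto

end

section \<open>Signed permutations and their lengths\<close>

abbreviation lk :: "('a \<Rightarrow>\<^sub>0 'b::zero) \<Rightarrow> 'a \<Rightarrow> 'b" where "lk \<equiv> Poly_Mapping.lookup"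

lemma transpose_eq: "Transposition.transpose a b k = (if k = a then b else if k = b then a else k)"
  by (simp add: Transposition.transpose_def)

lemma lk_negate [simp]: "lk (negate_entry i \<mu>) k = (if k = i then - lk \<mu> i else lk \<mu> k)"
  by (simp add: negate_entry_def lookup_update)

lemma lk_refl_less: "i < n \<Longrightarrow> lk (refl n i \<mu>) k = lk \<mu> (Transposition.transpose i (Suc i) k)"
  by (simp add: refl_def map_key.rep_eq)

lemma lk_refl_ge [simp]: "\<not> i < n \<Longrightarrow> lk (refl n i \<mu>) k = (if k = n then - lk \<mu> n else lk \<mu> k)"
  by (simp add: refl_def)

lemma lk_refl: "lk (refl n i \<mu>) k =
  (if i < n then lk \<mu> (if k = i then Suc i else if k = Suc i then i else k)
   else if k = n then - lk \<mu> n else lk \<mu> k)"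
  by (simp add: lk_refl_less transpose_eq)

lemma refl_refl [simp]: "refl n i (refl n i \<mu>) = \<mu>"
  by (rule poly_mapping_eqI) (simp add: lk_refl)

lemma negate_negate [simp]: "negate_entry i (negate_entry i \<mu>) = \<mu>"
  by (rule poly_mapping_eqI) simp

lemma in_lattice: "\<mu> \<in> lattice n \<longleftrightarrow> (\<forall>k. k \<notin> {1..n} \<longrightarrow> lk \<mu> k = 0)"
  by (auto simp: lattice_def in_keys_iff)

lemma refl_lattice [simp]: "1 \<le> n \<Longrightarrow> 1 \<le> i \<Longrightarrow> refl n i \<mu> \<in> lattice n \<longleftrightarrow> \<mu> \<in> lattice n"
proof -
  assume a: "1 \<le> n" "1 \<le> i"
  have "refl n i \<nu> \<in> lattice n" if "\<nu> \<in> lattice n" for \<nu>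
    using that a by (auto simp: in_lattice lk_refl)
  then show ?thesis using refl_refl by metis
qed

lemma word_elem_Nil [simp]: "word_elem n [] = id"
  by (simp add: word_elem_def)

lemma word_elem_Cons [simp]: "word_elem n (i # is) = refl n i \<circ> word_elem n is"
  by (simp add: word_elem_def)

lemma word_elem_append: "word_elem n (is @ js) = word_elem n is \<circ> word_elem n js"
  by (induction "is") auto

lemma word_elem_rev: "word_elem n (rev is) (word_elem n is \<mu>) = \<mu>"
  by (induction "is" arbitrary: \<mu>) (auto simp: word_elem_append)

lemma W_fin_induct [consumes 1, case_names id refl]:
  assumes "w \<in> W_fin n" "P id" "\<And>i w. w \<in> W_fin n \<Longrightarrow> P w \<Longrightarrow> 1 \<le> i \<Longrightarrow> i \<le> n \<Longrightarrow> P (refl n i \<circ> w)"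
  shows "P w"
proof -
  obtain "is" where "set is \<subseteq> {1..n}" "w = word_elem n is" using assms(1) by (auto simp: W_fin_def)
  then show ?thesis
  proof (induction "is" arbitrary: w)
    case (Cons i "is")
    then have "P (refl n i \<circ> word_elem n is)"
      by (intro assms(3)) (auto simp: W_fin_def)
    then show ?case using Cons.prems by (simp only: word_elem_Cons)
  qed (use assms in auto)
qed

lemma word_in_W: "set is \<subseteq> {1..n} \<Longrightarrow> word_elem n is \<in> W_fin n"
  by (auto simp: W_fin_def)

lemma W_fin_id [simp]: "id \<in> W_fin n"
  using word_in_W[of "[]" n] by simp

lemma W_fin_refl: "w \<in> W_fin n \<Longrightarrow> 1 \<le> i \<Longrightarrow> i \<le> n \<Longrightarrow> refl n i \<circ> w \<in> W_fin n"
  using word_in_W[of "i # _" n] by (force simp: W_fin_def)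

text \<open>The group is given only through its action on exponents; this recovers signed
  permutations. Note that \<open>\<sigma>\<close> is a pull-back, hence the inverse of the
  permutation that \<open>w\<close> induces on the indices of unit vectors.\<close>

lemma W_fin_form:
  assumes "w \<in> W_fin n"
  obtains \<sigma> e where "\<sigma> permutes {1..n}" "\<And>k. e k = 1 \<or> e k = (-1::int)" "\<And>k. k \<notin> {1..n} \<Longrightarrow> e k = 1"
    "\<And>\<mu> k. lk (w \<mu>) k = e k * lk \<mu> (\<sigma> k)"
proof -
  have "\<exists>\<sigma> e. \<sigma> permutes {1..n} \<and> (\<forall>k. e k = 1 \<or> e k = (-1::int)) \<and> (\<forall>k. k \<notin> {1..n} \<longrightarrow> e k = 1) \<and>
    (\<forall>\<mu> k. lk (w \<mu>) k = e k * lk \<mu> (\<sigma> k))"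
    using assms
  proof (induction rule: W_fin_induct)
    case id
    show ?case by (rule exI[of _ id], rule exI[of _ "\<lambda>_. 1"]) (auto simp: permutes_def)
  next
    case (refl i w)
    then obtain \<sigma> e where *: "\<sigma> permutes {1..n}" "\<forall>k. e k = 1 \<or> e k = (-1::int)" "\<forall>k. k \<notin> {1..n} \<longrightarrow> e k = 1"
      "\<forall>\<mu> k. lk (w \<mu>) k = e k * lk \<mu> (\<sigma> k)" by blast
    show ?case
    proof (cases "i < n")
      case True
      let ?t = "Transposition.transpose i (Suc i)"
      have "?t permutes {1..n}" using refl True by (auto intro!: permutes_swap_id)
      then have "\<sigma> \<circ> ?t permutes {1..n}" using * by (auto intro: permutes_compose)
      moreover have "\<forall>\<mu> k. lk ((refl n i \<circ> w) \<mu>) k = (e \<circ> ?t) k * lk \<mu> ((\<sigma> \<circ> ?t) k)"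
        using * True by (simp add: lk_refl_less)
      moreover have "\<forall>k. k \<notin> {1..n} \<longrightarrow> (e \<circ> ?t) k = 1" using * refl True by (auto simp: transpose_eq)
      moreover have "\<forall>k. (e \<circ> ?t) k = 1 \<or> (e \<circ> ?t) k = -1" using * by simp
      ultimately show ?thesis by blast
    next
      case False
      then have "\<forall>\<mu> k. lk ((refl n i \<circ> w) \<mu>) k = (e(n := - e n)) k * lk \<mu> (\<sigma> k)"
        using * by simp
      moreover have "\<forall>k. (e(n := - e n)) k = 1 \<or> (e(n := - e n)) k = -1"
        "\<forall>k. k \<notin> {1..n} \<longrightarrow> (e(n := - e n)) k = 1" using * refl by (auto simp: minus_equation_iff)
      ultimately show ?thesis using * by blast
    qed
  qed
  then show ?thesis using that by blast
qed

section \<open>Positive roots, inversions and length\<close>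

definition mm :: "nat \<Rightarrow> nat \<Rightarrow> expo \<Rightarrow> int" where
  "mm n i \<mu> = (if i < n then lk \<mu> i - lk \<mu> (Suc i) else lk \<mu> n)"

lemma mm_refl [simp]: "mm n i (refl n i \<mu>) = - mm n i \<mu>"
  by (simp add: mm_def lk_refl)

lemma mm_0_refl: "mm n i \<mu> = 0 \<Longrightarrow> i \<le> n \<Longrightarrow> refl n i \<mu> = \<mu>"
  by (rule poly_mapping_eqI) (auto simp: mm_def lk_refl split: if_splits)

text \<open>
  Positive roots: \<open>(a, b, True)\<close> is $\varepsilon_a-\varepsilon_b$ and \<open>(a, b, False)\<close> is
  $\varepsilon_a+\varepsilon_b$, the case $a=b$ being the long root.
\<close>

definition roots :: "nat \<Rightarrow> (nat \<times> nat \<times> bool) set" where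
  "roots n = {(a, b, s). 1 \<le> a \<and> b \<le> n \<and> (if s then a < b else a \<le> b)}"

definition root_val :: "expo \<Rightarrow> nat \<times> nat \<times> bool \<Rightarrow> int" where
  "root_val \<mu> = (\<lambda>(a, b, s). if s then lk \<mu> a - lk \<mu> b else lk \<mu> a + lk \<mu> b)"

definition simple_root :: "nat \<Rightarrow> nat \<Rightarrow> nat \<times> nat \<times> bool" where
  "simple_root n i = (if i < n then (i, Suc i, True) else (n, n, False))"

text \<open>The index pair \<open>(i, Suc i)\<close> is kept in order: the sum of the two unit
  vectors is fixed by the swap, and transposing its indices would leave the set of pairs with
  \<open>a \<le> b\<close>. For \<open>i = n\<close> only the roots with \<open>a < n\<close> and
  \<open>b = n\<close> change, from sum to difference and back.\<close>

definition refl_root :: "nat \<Rightarrow> nat \<Rightarrow> nat \<times> nat \<times> bool \<Rightarrow> nat \<times> nat \<times> bool" where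
  "refl_root n i = (\<lambda>(a, b, s).
     if i < n then if (a, b) = (i, Suc i) then (a, b, s)
       else (Transposition.transpose i (Suc i) a, Transposition.transpose i (Suc i) b, s)
     else if a < n \<and> b = n then (a, b, \<not> s) else (a, b, s))"

definition inv_count :: "nat \<Rightarrow> expo \<Rightarrow> nat" where
  "inv_count n \<mu> = card {r \<in> roots n. root_val \<mu> r < 0}"

lemma finite_roots [simp]: "finite (roots n)"
  by (rule finite_subset[of _ "{1..n} \<times> {1..n} \<times> UNIV"]) (auto simp: roots_def split: if_splits)

lemma simple_root_in: "1 \<le> i \<Longrightarrow> i \<le> n \<Longrightarrow> simple_root n i \<in> roots n"
  by (auto simp: simple_root_def roots_def)

lemma root_val_simple: "i \<le> n \<Longrightarrow> (root_val \<mu> (simple_root n i) < 0) = (mm n i \<mu> < 0)"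
  by (auto simp: simple_root_def root_val_def mm_def)

lemma refl_root:
  assumes "1 \<le> i" "i \<le> n" "r \<in> roots n - {simple_root n i}"
  shows "refl_root n i r \<in> roots n - {simple_root n i}" "refl_root n i (refl_root n i r) = r"
    "root_val (refl n i \<mu>) r = root_val \<mu> (refl_root n i r)"
  using assms
  by (cases r; auto simp: roots_def refl_root_def simple_root_def root_val_def lk_refl transpose_eq split: if_splits)+

text \<open>A simple reflection permutes the positive roots other than its own simple root, and on
  that one it changes the sign of the value.\<close>

lemma inv_count_refl_pos:
  assumes "1 \<le> i" "i \<le> n" "mm n i \<mu> > 0"
  shows "inv_count n (refl n i \<mu>) = Suc (inv_count n \<mu>)"
proof -
  let ?r = "simple_root n i"
  define N where "N \<mu> = {r \<in> roots n - {?r}. root_val \<mu> r < 0}" for \<mu>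
  have "bij_betw (refl_root n i) (N (refl n i \<mu>)) (N \<mu>)"
    by (rule bij_betwI[where g = "refl_root n i"])
       (use refl_root[OF assms(1,2)] in \<open>auto simp: N_def\<close>)
  then have c: "card (N (refl n i \<mu>)) = card (N \<mu>)" by (rule bij_betw_same_card)
  have "{r \<in> roots n. root_val \<mu> r < 0} = N \<mu>"
    using assms root_val_simple[of i n \<mu>] by (auto simp: N_def)
  moreover have "{r \<in> roots n. root_val (refl n i \<mu>) r < 0} = insert ?r (N (refl n i \<mu>))"
    using assms root_val_simple[of i n "refl n i \<mu>"] simple_root_in[of i n] by (auto simp: N_def)
  moreover have "?r \<notin> N (refl n i \<mu>)" "finite (N (refl n i \<mu>))" by (auto simp: N_def)
  ultimately show ?thesis by (simp add: inv_count_def c)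
qed

lemma inv_count_refl_neg:
  assumes "1 \<le> i" "i \<le> n" "mm n i \<mu> < 0"
  shows "inv_count n \<mu> = Suc (inv_count n (refl n i \<mu>))"
  using inv_count_refl_pos[of i n "refl n i \<mu>"] assms by simp

definition dominant :: "nat \<Rightarrow> expo \<Rightarrow> bool" where
  "dominant n \<mu> \<longleftrightarrow> (\<forall>i. 1 \<le> i \<and> i \<le> n \<longrightarrow> 0 \<le> mm n i \<mu>)"

lemma dominant_mono:
  assumes "dominant n \<mu>" "1 \<le> i" "i \<le> j" "j \<le> n"
  shows "lk \<mu> j \<le> lk \<mu> i"
  using assms(3,4)
proof (induction j rule: dec_induct)
  case (step k)
  then have "0 \<le> mm n k \<mu>" using assms by (auto simp: dominant_def)
  then show ?case using step by (simp add: mm_def)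
qed simp

lemma dominant_nonneg: "dominant n \<mu> \<Longrightarrow> 1 \<le> i \<Longrightarrow> i \<le> n \<Longrightarrow> 0 \<le> lk \<mu> i"
proof -
  assume a: "dominant n \<mu>" "1 \<le> i" "i \<le> n"
  then have "0 \<le> mm n n \<mu>" by (auto simp: dominant_def)
  then show ?thesis using dominant_mono[of n \<mu> i n] a by (simp add: mm_def)
qed

lemma inv_count_0_iff: "inv_count n \<mu> = 0 \<longleftrightarrow> dominant n \<mu>"
proof
  assume "dominant n \<mu>"
  then have "root_val \<mu> r \<ge> 0" if "r \<in> roots n" for r
    using that dominant_mono[of n \<mu>] dominant_nonneg[of n \<mu>]
    by (cases r) (auto simp: roots_def root_val_def split: if_splits intro!: add_nonneg_nonneg)
  then show "inv_count n \<mu> = 0" by (auto simp: inv_count_def) (meson leD)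
next
  assume "inv_count n \<mu> = 0"
  then have "{r \<in> roots n. root_val \<mu> r < 0} = {}" by (simp add: inv_count_def)
  then have "\<not> mm n i \<mu> < 0" if "1 \<le> i" "i \<le> n" for i
    using simple_root_in[OF that] root_val_simple[OF that(2), of \<mu>] by blast
  then show "dominant n \<mu>" by (auto simp: dominant_def not_less)
qed

lemma lk_rho: "lk (rho n) k = (if k \<in> {1..n} then int n + 1 - int k else 0)"
  by (auto simp: rho_def lookup_sum lookup_single when_def)

text \<open>Up to scaling, \<open>mm n i (w \<mu>)\<close> is the pairing of \<open>\<mu>\<close>
  with a root that depends on \<open>w\<close> and \<open>i\<close> only. Strict dominance of
  \<open>rho n\<close> shows whether that root is positive or negative.\<close>

lemma W_fin_mm_rho:
  assumes "w \<in> W_fin n" "1 \<le> i" "i \<le> n"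
  shows "mm n i (w (rho n)) \<noteq> 0"
    and "dominant n \<mu> \<Longrightarrow> mm n i (w (rho n)) > 0 \<Longrightarrow> mm n i (w \<mu>) \<ge> 0"
    and "dominant n \<mu> \<Longrightarrow> mm n i (w (rho n)) < 0 \<Longrightarrow> mm n i (w \<mu>) \<le> 0"
proof -
  obtain \<sigma> e where s: "\<sigma> permutes {1..n}" and e: "\<And>k. e k = 1 \<or> e k = (-1::int)"
    and w: "\<And>\<mu> k. lk (w \<mu>) k = e k * lk \<mu> (\<sigma> k)" using W_fin_form[OF assms(1)] by metis
  have sk: "\<sigma> k \<in> {1..n} \<longleftrightarrow> k \<in> {1..n}" for k using permutes_in_image[OF s] .
  have i: "\<sigma> i \<in> {1..n}" "i < n \<Longrightarrow> \<sigma> (Suc i) \<in> {1..n}" "i < n \<Longrightarrow> \<sigma> i \<noteq> \<sigma> (Suc i)"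
    using sk[of i] sk[of "Suc i"] assms inj_eq[OF permutes_inj[OF s], of i "Suc i"] by auto
  show "mm n i (w (rho n)) \<noteq> 0"
    using e[of i] e[of "Suc i"] i assms by (auto simp: mm_def w lk_rho)
  assume d: "dominant n \<mu>"
  have nn: "0 \<le> lk \<mu> (\<sigma> i)" "i < n \<Longrightarrow> 0 \<le> lk \<mu> (\<sigma> (Suc i))"
    using dominant_nonneg[OF d] i by auto
  show "mm n i (w \<mu>) \<ge> 0" if "mm n i (w (rho n)) > 0"
    using that e[of i] e[of "Suc i"] i nn assms
      dominant_mono[OF d, of "\<sigma> i" "\<sigma> (Suc i)"] dominant_mono[OF d, of "\<sigma> (Suc i)" "\<sigma> i"]
    by (auto simp: mm_def w lk_rho split: if_splits)
  show "mm n i (w \<mu>) \<le> 0" if "mm n i (w (rho n)) < 0"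
    using that e[of i] e[of "Suc i"] i nn assms
      dominant_mono[OF d, of "\<sigma> i" "\<sigma> (Suc i)"] dominant_mono[OF d, of "\<sigma> (Suc i)" "\<sigma> i"]
    by (auto simp: mm_def w lk_rho split: if_splits)
qed

lemma dominant_rho: "dominant n (rho n)"
  by (auto simp: dominant_def mm_def lk_rho)

text \<open>Nonnegative entries force all signs to be 1; decreasing entries then force
  \<open>\<sigma>\<close> to be strictly increasing on \<open>{1..n}\<close>, so it is the
  identity.\<close>

lemma W_fin_rho_dominant:
  assumes "w \<in> W_fin n" "dominant n (w (rho n))"
  shows "w = id"
proof -
  obtain \<sigma> e where s: "\<sigma> permutes {1..n}" and e: "\<And>k. e k = 1 \<or> e k = (-1::int)"
    and e1: "\<And>k. k \<notin> {1..n} \<Longrightarrow> e k = 1"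
    and w: "\<And>\<mu> k. lk (w \<mu>) k = e k * lk \<mu> (\<sigma> k)" using W_fin_form[OF assms(1)] by metis
  have sk: "\<sigma> k \<in> {1..n} \<longleftrightarrow> k \<in> {1..n}" for k using permutes_in_image[OF s] .
  have ek: "e k = 1" for k
  proof (cases "k \<in> {1..n}")
    case True
    then have "0 \<le> e k * lk (rho n) (\<sigma> k)" using dominant_nonneg[OF assms(2)] by (simp add: w)
    then show ?thesis using e[of k] sk[of k] True by (auto simp: lk_rho)
  qed (use e1 in auto)
  have le: "\<sigma> j \<ge> \<sigma> i" if "1 \<le> i" "i \<le> j" "j \<le> n" for i j
    using dominant_mono[OF assms(2) that] sk[of i] sk[of j] that by (simp add: w ek lk_rho)
  have lt: "\<sigma> j > \<sigma> i" if "1 \<le> i" "i < j" "j \<le> n" for i j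
    using le[of i j] permutes_inj[OF s] that by (metis injD less_imp_le_nat nat_less_le)
  have ge: "j \<le> \<sigma> j" if "1 \<le> j" "j \<le> n" for j using that
  proof (induction j)
    case (Suc j)
    show ?case
    proof (cases "j = 0")
      case True then show ?thesis using sk[of 1] Suc.prems by auto
    next
      case False then show ?thesis using Suc lt[of j "Suc j"] by auto
    qed
  qed simp
  have le: "\<sigma> (n - k) \<le> n - k" if "k < n" for k using that
  proof (induction k)
    case 0 then show ?case using sk[of n] by auto
  next
    case (Suc k)
    then have "\<sigma> (n - Suc k) < \<sigma> (n - k)" by (intro lt) auto
    then show ?case using Suc by linarith
  qed
  have "\<sigma> k = k" for k
  proof (cases "k \<in> {1..n}")
    case True then show ?thesis using ge[of k] le[of "n - k"] by auto
  next
    case False then show ?thesis using s by (simp add: permutes_def)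
  qed
  then show ?thesis by (auto simp: fun_eq_iff w ek intro!: poly_mapping_eqI)
qed

lemma inv_count_refl_le:
  assumes "1 \<le> i" "i \<le> n"
  shows "inv_count n (refl n i \<mu>) \<le> Suc (inv_count n \<mu>)"
proof -
  consider "mm n i \<mu> < 0" | "mm n i \<mu> = 0" | "mm n i \<mu> > 0" by linarith
  then show ?thesis
  proof cases
    case 1 then show ?thesis using inv_count_refl_neg[OF assms, of \<mu>] by linarith
  next
    case 2 then show ?thesis using mm_0_refl[of n i \<mu>] assms by simp
  next
    case 3 then show ?thesis using inv_count_refl_pos[OF assms, of \<mu>] by linarith
  qed
qed

lemma inv_count_word_le: "set is \<subseteq> {1..n} \<Longrightarrow> inv_count n (word_elem n is (rho n)) \<le> length is"
proof (induction "is")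
  case Nil then show ?case using dominant_rho by (simp add: inv_count_0_iff)
next
  case (Cons i "is")
  let ?\<mu> = "word_elem n is (rho n)"
  have i: "1 \<le> i" "i \<le> n" using Cons by auto
  show ?case
    using Cons inv_count_refl_le[OF i, of ?\<mu>] by simp
qed

lemma word_of_inv_count:
  assumes "w \<in> W_fin n"
  shows "\<exists>is. set is \<subseteq> {1..n} \<and> word_elem n is = w \<and> length is = inv_count n (w (rho n))"
  using assms
proof (induction "inv_count n (w (rho n))" arbitrary: w)
  case 0
  then have "w = id" using W_fin_rho_dominant by (simp add: inv_count_0_iff)
  then show ?case using 0 by (intro exI[of _ "[]"]) auto
next
  case (Suc k)
  have "\<not> dominant n (w (rho n))" using Suc.hyps(2) inv_count_0_iff by (metis nat.distinct(1))
  then obtain i where i: "1 \<le> i" "i \<le> n" "mm n i (w (rho n)) < 0" by (auto simp: dominant_def not_le)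
  have "inv_count n ((refl n i \<circ> w) (rho n)) = k"
    using inv_count_refl_neg[OF i] Suc.hyps(2) by simp
  moreover have "refl n i \<circ> w \<in> W_fin n" using W_fin_refl Suc.prems i by auto
  ultimately obtain "is" where "is": "set is \<subseteq> {1..n}" "word_elem n is = refl n i \<circ> w" "length is = k"
    using Suc.hyps(1)[of "refl n i \<circ> w"] by auto
  then have "word_elem n (i # is) = w" by (auto simp: fun_eq_iff)
  then show ?case using "is" i Suc.hyps(2) by (intro exI[of _ "i # is"]) auto
qed

text \<open>Each letter of a word changes the inversion number of the image of \<open>rho n\<close>
  by at most one, which bounds the length from below. Reflecting in negative simple pairings lowers
  it by exactly one until the image is dominant and the element is the identity.\<close>

lemma len_eq: assumes "w \<in> W_fin n" shows "len n w = inv_count n (w (rho n))"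
  unfolding len_def
proof (rule Least_equality)
  show "\<exists>is. set is \<subseteq> {1..n} \<and> word_elem n is = w \<and> length is = inv_count n (w (rho n))"
    by (rule word_of_inv_count[OF assms])
  show "inv_count n (w (rho n)) \<le> k"
    if "\<exists>is. set is \<subseteq> {1..n} \<and> word_elem n is = w \<and> length is = k" for k
    using that inv_count_word_le[of _ n] by blast
qed

lemma reduced_word_iff: "reduced_word n w is \<longleftrightarrow>
    set is \<subseteq> {1..n} \<and> word_elem n is = w \<and> length is = inv_count n (w (rho n))"
  using len_eq word_in_W by (auto simp: reduced_word_def)

lemma some_reduced_word: "w \<in> W_fin n \<Longrightarrow> reduced_word n w (some_reduced_word n w)"
  unfolding some_reduced_word_def
  by (rule someI_ex) (use word_of_inv_count in \<open>auto simp: reduced_word_iff\<close>)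

lemma reduced_word_Cons:
  assumes "reduced_word n w (i # is)"
  shows "1 \<le> i" "i \<le> n" "reduced_word n (word_elem n is) is" "w = refl n i \<circ> word_elem n is"
    "mm n i (word_elem n is (rho n)) > 0" "word_elem n is \<in> W_fin n"
proof -
  have a: "set is \<subseteq> {1..n}" "1 \<le> i" "i \<le> n" "w = refl n i \<circ> word_elem n is"
    "Suc (length is) = inv_count n (w (rho n))"
    using assms by (auto simp: reduced_word_iff)
  show "1 \<le> i" "i \<le> n" "w = refl n i \<circ> word_elem n is" "word_elem n is \<in> W_fin n" using a word_in_W by auto
  let ?\<mu> = "word_elem n is (rho n)"
  have le: "inv_count n ?\<mu> \<le> length is" using inv_count_word_le a by auto
  show p: "mm n i ?\<mu> > 0"
  proof (rule ccontr)
    assume "\<not> ?thesis"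
    then have "inv_count n (refl n i ?\<mu>) \<le> inv_count n ?\<mu>"
      using inv_count_refl_neg[OF a(2,3), of ?\<mu>] mm_0_refl[of n i ?\<mu>] a(3)
      by (cases "mm n i ?\<mu> = 0") auto
    then show False using a le by simp
  qed
  show "reduced_word n (word_elem n is) is"
    using inv_count_refl_pos[OF a(2,3) p] a by (auto simp: reduced_word_iff)
qed

lemma reduced_word_ConsI:
  assumes "reduced_word n w is" "1 \<le> i" "i \<le> n" "mm n i (w (rho n)) > 0"
  shows "reduced_word n (refl n i \<circ> w) (i # is)"
  using assms inv_count_refl_pos[of i n "w (rho n)"] by (auto simp: reduced_word_iff)

text \<open>An element is determined by the image of \<open>rho n\<close>, whose entries are bounded
  by \<open>n\<close> in absolute value.\<close>

lemma finite_W_fin: "finite (W_fin n)"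
proof -
  have "inj_on (\<lambda>w. w (rho n)) (W_fin n)"
  proof (rule inj_onI)
    fix w w' assume w: "w \<in> W_fin n" "w' \<in> W_fin n" "w (rho n) = w' (rho n)"
    then obtain "is" where "is": "set is \<subseteq> {1..n}" "w = word_elem n is" by (auto simp: W_fin_def)
    define u where "u = word_elem n (rev is) \<circ> w'"
    have "u \<in> W_fin n"
    proof -
      obtain js where js: "set js \<subseteq> {1..n}" "w' = word_elem n js" using w(2) by (auto simp: W_fin_def)
      have "u = word_elem n (rev is @ js)" by (simp only: u_def js word_elem_append)
      moreover have "word_elem n (rev is @ js) \<in> W_fin n" using "is" js by (intro word_in_W) auto
      ultimately show ?thesis by simp
    qed
    moreover have "u (rho n) = rho n" by (simp add: u_def w(3)[symmetric] "is" word_elem_rev)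
    ultimately have "u = id" using W_fin_rho_dominant dominant_rho by metis
    then have "word_elem n (rev is) (w' \<mu>) = \<mu>" for \<mu> by (auto simp: u_def fun_eq_iff)
    then have "word_elem n is (word_elem n (rev is) (w' \<mu>)) = w \<mu>" for \<mu> by (simp add: "is")
    then show "w = w'" using word_elem_rev[of n "rev is"] by (simp add: fun_eq_iff)
  qed
  moreover have "finite ((\<lambda>w. w (rho n)) ` W_fin n)"
  proof (rule finite_subset)
    let ?F = "{f. \<forall>k. (k \<in> {1..n} \<longrightarrow> f k \<in> {- int n..int n}) \<and> (k \<notin> {1..n} \<longrightarrow> f k = 0)}"
    show "finite (Poly_Mapping.lookup -` ?F)"
    proof (rule finite_vimageI)
      show "finite ?F" by (rule finite_set_of_finite_funs) simp_all
      show "inj Poly_Mapping.lookup" by (rule injI) (simp only: poly_mapping_eq_iff)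
    qed
    show "(\<lambda>w. w (rho n)) ` W_fin n \<subseteq> lk -` ?F"
    proof (rule image_subsetI)
      fix w assume w: "w \<in> W_fin n"
      obtain \<sigma> e where s: "\<sigma> permutes {1..n}" and e: "\<And>k. e k = 1 \<or> e k = (-1::int)"
        and wf: "\<And>\<mu> k. lk (w \<mu>) k = e k * lk \<mu> (\<sigma> k)" using W_fin_form[OF w] by metis
      have "(k \<in> {1..n} \<longrightarrow> lk (w (rho n)) k \<in> {- int n..int n}) \<and> (k \<notin> {1..n} \<longrightarrow> lk (w (rho n)) k = 0)" for k
        using permutes_in_image[OF s, of k] e[of k] by (auto simp: wf lk_rho)
      then show "w (rho n) \<in> lk -` ?F" by simp
    qed
  qed
  ultimately show ?thesis by (rule finite_imageD[rotated])
qed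

section \<open>Matsumoto's theorem: words in braid operators depend only on the group
  element\<close>

locale braid_ops =
  fixes n :: nat and T :: "nat \<Rightarrow> 'v \<Rightarrow> 'v"
  assumes far: "\<And>i j f. 1 \<le> i \<Longrightarrow> i + 2 \<le> j \<Longrightarrow> j \<le> n \<Longrightarrow> T i (T j f) = T j (T i f)"
    and braid3: "\<And>i f. 1 \<le> i \<Longrightarrow> i + 1 < n \<Longrightarrow> T i (T (i+1) (T i f)) = T (i+1) (T i (T (i+1) f))"
    and braid4: "\<And>i f. 1 \<le> i \<Longrightarrow> i + 1 = n \<Longrightarrow>
        T i (T (i+1) (T i (T (i+1) f))) = T (i+1) (T i (T (i+1) (T i f)))"
begin

definition op_word :: "nat list \<Rightarrow> 'v \<Rightarrow> 'v" where
  "op_word is = foldr (\<lambda>i F. T i \<circ> F) is id"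

lemma op_word_simps [simp]: "op_word [] = id" "op_word (i # is) = T i \<circ> op_word is"
  by (simp_all add: op_word_def)

text \<open>
  If $s_i$ and $s_j$ are both left descents of $w$, then so is every root of the dihedral system
  they generate, and a reduced word can be started with either alternating word.
\<close>

lemma reduced_prefix:
  assumes "w \<in> W_fin n" "set ks \<subseteq> {1..n}"
    "\<And>k l. k < length ks \<Longrightarrow> mm n (ks ! k) (word_elem n (rev (take k ks)) (w (rho n))) < 0"
  shows "\<exists>us. reduced_word n w (ks @ us) \<and> reduced_word n (word_elem n (rev ks) \<circ> w) us"
  using assms
proof (induction ks arbitrary: w)
  case Nil
  then show ?case using some_reduced_word by (intro exI[of _ "some_reduced_word n w"]) auto
next
  case (Cons i ks)
  define v where "v = refl n i \<circ> w"
  have i: "1 \<le> i" "i \<le> n" using Cons.prems by auto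
  have v: "v \<in> W_fin n" using W_fin_refl Cons.prems i unfolding v_def by auto
  have 0: "mm n i (w (rho n)) < 0" using Cons.prems(3)[of 0] by simp
  have "mm n (ks ! k) (word_elem n (rev (take k ks)) (v (rho n))) < 0" if "k < length ks" for k
    using Cons.prems(3)[of "Suc k"] that by (simp add: word_elem_append v_def)
  then obtain us where us: "reduced_word n v (ks @ us)" "reduced_word n (word_elem n (rev ks) \<circ> v) us"
    using Cons.IH[OF v] Cons.prems(2) by (metis set_subset_Cons subset_trans)
  have "reduced_word n (refl n i \<circ> v) (i # ks @ us)"
    using 0 by (intro reduced_word_ConsI us i) (simp add: v_def)
  moreover have "refl n i \<circ> v = w" by (auto simp: v_def fun_eq_iff)
  moreover have "word_elem n (rev (i # ks)) \<circ> w = word_elem n (rev ks) \<circ> v"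
    by (auto simp: v_def fun_eq_iff word_elem_append)
  ultimately show ?case using us by (metis append_Cons)
qed

text \<open>Induction on the length. For different first letters \<open>i\<close> and
  \<open>j\<close>, each word is compared with a reduced word that starts with one side of the braid
  relation for \<open>i\<close> and \<open>j\<close>; the two new words continue with reduced words
  of one and the same shorter element.\<close>

theorem matsumoto:
  assumes "reduced_word n w is" "reduced_word n w js"
  shows "op_word is = op_word js"
  using assms
proof (induction "length is" arbitrary: w "is" js rule: less_induct)
  case less
  have len: "length is = length js" using less.prems by (simp add: reduced_word_iff)
  show ?case
  proof (cases "is")
    case Nil then show ?thesis using len by simp
  next
    case (Cons i is')
    then obtain j js' where js: "js = j # js'" using len by (cases js) auto
    note I = reduced_word_Cons[OF less.prems(1)[unfolded Cons]]
    note J = reduced_word_Cons[OF less.prems(2)[unfolded js]]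
    have W: "w \<in> W_fin n" using less.prems word_in_W by (auto simp: reduced_word_iff)
    have wi: "word_elem n is' = refl n i \<circ> w" "word_elem n js' = refl n j \<circ> w"
      by (subst I(4), simp add: fun_eq_iff, subst J(4), simp add: fun_eq_iff)
    have di: "mm n i (w (rho n)) < 0" using I by (subst I(4)) simp
    have dj: "mm n j (w (rho n)) < 0" using J by (subst J(4)) simp
    \<comment> \<open>The tail behind the first letter is shorter, so the induction hypothesis
      allows it to be exchanged for any other reduced tail.\<close>
    have key: "op_word (i # is') = op_word (i # ks @ us)"
      if "reduced_word n w (i # ks @ us)" for ks us
    proof -
      have "reduced_word n (word_elem n (ks @ us)) (ks @ us)" "w = refl n i \<circ> word_elem n (ks @ us)"
        using reduced_word_Cons[OF that] by auto
      moreover from this have "word_elem n is' = word_elem n (ks @ us)" using wi by (auto simp: fun_eq_iff)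
      ultimately have "reduced_word n (word_elem n is') (ks @ us)" by (simp only:)
      then show ?thesis using less.hyps[OF _ I(3)] Cons by auto
    qed
    have key': "op_word (j # js') = op_word (j # ks @ us)"
      if "reduced_word n w (j # ks @ us)" for ks us
    proof -
      have "reduced_word n (word_elem n (ks @ us)) (ks @ us)" "w = refl n j \<circ> word_elem n (ks @ us)"
        using reduced_word_Cons[OF that] by auto
      moreover from this have "word_elem n js' = word_elem n (ks @ us)" using wi by (auto simp: fun_eq_iff)
      ultimately have "reduced_word n (word_elem n js') (ks @ us)" by (simp only:)
      then show ?thesis using less.hyps[OF _ J(3)] len js Cons by auto
    qed
    \<comment> \<open>\<open>i # ks\<close> and \<open>j # ls\<close> are the two sides of the braid
      relation. The conditions \<open>d1\<close> and \<open>d2\<close> say that every letter is a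
      descent when reached, which is what \<open>reduced_prefix\<close> asks for.\<close>
    have dihedral: ?thesis
      if ks: "set (i # ks) \<subseteq> {1..n}" "set (j # ls) \<subseteq> {1..n}"
        and d1: "\<forall>k<length (i # ks). mm n ((i # ks) ! k) (word_elem n (rev (take k (i # ks))) (w (rho n))) < 0"
        and d2: "\<forall>k<length (j # ls). mm n ((j # ls) ! k) (word_elem n (rev (take k (j # ls))) (w (rho n))) < 0"
        and e: "op_word (i # ks) = op_word (j # ls)" "word_elem n (rev (i # ks)) \<circ> w = word_elem n (rev (j # ls)) \<circ> w"
      for ks ls
    proof -
      obtain us where us: "reduced_word n w (i # ks @ us)" "reduced_word n (word_elem n (rev (i # ks)) \<circ> w) us"
        using reduced_prefix[OF W ks(1)] d1 by auto
      obtain vs where vs: "reduced_word n w (j # ls @ vs)" "reduced_word n (word_elem n (rev (j # ls)) \<circ> w) vs"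
        using reduced_prefix[OF W ks(2)] d2 by auto
      have "length us < length is" using us(1) less.prems(1) by (auto simp: reduced_word_iff)
      then have "op_word us = op_word vs" using less.hyps[OF _ us(2)] vs(2) e(2) by simp
      moreover have "op_word (xs @ ys) = op_word xs \<circ> op_word ys" for xs ys
        by (induction xs) auto
      ultimately show ?thesis using key[OF us(1)] key'[OF vs(1)] e(1) Cons js
        by (metis append_Cons)
    qed
    consider "i = j" | "i + 2 \<le> j \<or> j + 2 \<le> i" | "j = i + 1" "j < n" | "i = j + 1" "i < n" | "j = i + 1" "j = n" | "i = j + 1" "i = n"
      using I(2) J(2) by linarith
    then show ?thesis
    proof cases
      case 1
      then show ?thesis using less.hyps[OF _ I(3), of js'] J(3) wi Cons js by auto
    next
      case 2
      show ?thesis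
        by (rule dihedral[of "[j]" "[i]"])
           (use 2 I(1,2) J(1,2) di dj far[of i j] far[of j i] in
             \<open>auto simp: less_Suc_eq fun_eq_iff mm_def lk_refl intro!: poly_mapping_eqI\<close>)
    next
      case 3
      show ?thesis
        by (rule dihedral[of "[j,i]" "[i,j]"])
           (use 3 I(1,2) J(1,2) di dj braid3[of i] in
             \<open>auto simp: less_Suc_eq fun_eq_iff mm_def lk_refl intro!: poly_mapping_eqI\<close>)
    next
      case 4
      show ?thesis
        by (rule dihedral[of "[j,i]" "[i,j]"])
           (use 4 I(1,2) J(1,2) di dj braid3[of j] in
             \<open>auto simp: less_Suc_eq fun_eq_iff mm_def lk_refl intro!: poly_mapping_eqI\<close>)
    next
      case 5
      show ?thesis
        by (rule dihedral[of "[j,i,j]" "[i,j,i]"])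
           (use 5 I(1,2) J(1,2) di dj braid4[of i] in
             \<open>auto simp: less_Suc_eq fun_eq_iff mm_def lk_refl intro!: poly_mapping_eqI\<close>)
    next
      case 6
      show ?thesis
        by (rule dihedral[of "[j,i,j]" "[i,j,i]"])
           (use 6 I(1,2) J(1,2) di dj braid4[of j] in
             \<open>auto simp: less_Suc_eq fun_eq_iff mm_def lk_refl intro!: poly_mapping_eqI\<close>)
    qed
  qed
qed

end

section \<open>Laurent polynomials and additive maps on them\<close>

definition pm_lift :: "('k \<Rightarrow> 'a \<Rightarrow> 'b::comm_monoid_add) \<Rightarrow> ('k \<Rightarrow>\<^sub>0 'a::zero) \<Rightarrow> 'b" where
  "pm_lift \<phi> f = (\<Sum>k \<in> Poly_Mapping.keys f. \<phi> k (lk f k))"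

lemma pm_sum_single: "f = (\<Sum>k \<in> Poly_Mapping.keys f. Poly_Mapping.single k (lk f k))"
  for f :: "'k \<Rightarrow>\<^sub>0 'a::comm_monoid_add"
  by (rule poly_mapping_eqI) (simp add: lookup_sum lookup_single when_def in_keys_iff)

locale pm_additive =
  fixes \<phi> :: "'k \<Rightarrow> 'a::comm_monoid_add \<Rightarrow> 'b::comm_monoid_add"
  assumes zero: "\<phi> k 0 = 0" and add: "\<phi> k (a + b) = \<phi> k a + \<phi> k b"
begin

lemma lift_0 [simp]: "pm_lift \<phi> 0 = 0"
  by (simp add: pm_lift_def)

lemma lift_add: "pm_lift \<phi> (f + g) = pm_lift \<phi> f + pm_lift \<phi> g"
  unfolding pm_lift_def by (rule setsum_keys_plus_distrib) (simp_all add: zero add)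

lemma lift_single: "pm_lift \<phi> (Poly_Mapping.single k a) = \<phi> k a"
  by (simp add: pm_lift_def zero)

end

text \<open>Each element is a finite sum of single terms. Cancellation in the target is what gives
  \<open>F 0 = 0\<close> from additivity.\<close>

lemma additive_eqI:
  fixes F G :: "('k \<Rightarrow>\<^sub>0 'a::comm_monoid_add) \<Rightarrow> 'b::cancel_comm_monoid_add"
  assumes "\<And>f g. F (f + g) = F f + F g" "\<And>f g. G (f + g) = G f + G g"
    "\<And>k a. F (Poly_Mapping.single k a) = G (Poly_Mapping.single k a)"
  shows "F f = G f"
proof -
  have 0: "F 0 = 0" "G 0 = 0" using assms(1)[of 0 0] assms(2)[of 0 0] by simp_all
  have "F (sum h A) = (\<Sum>x\<in>A. F (h x))" "G (sum h A) = (\<Sum>x\<in>A. G (h x))" for h :: "'k \<Rightarrow> 'k \<Rightarrow>\<^sub>0 'a" and A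
    by (induction A rule: infinite_finite_induct) (simp_all add: 0 assms)
  then show ?thesis by (subst (1 2) pm_sum_single) (simp add: assms)
qed

locale pm_hom = pm_additive \<phi> for \<phi> :: "'k::comm_monoid_add \<Rightarrow> 'a::comm_semiring_1 \<Rightarrow> 'b::comm_semiring_1_cancel" +
  assumes mult: "\<phi> (k + l) (a * b) = \<phi> k a * \<phi> l b" and one: "\<phi> 0 1 = 1"
begin

lemma lift_mult: "pm_lift \<phi> (f * g) = pm_lift \<phi> f * pm_lift \<phi> g"
proof -
  have s: "pm_lift \<phi> (Poly_Mapping.single k a * g) = pm_lift \<phi> (Poly_Mapping.single k a) * pm_lift \<phi> g" for k a g
    by (rule additive_eqI[of "\<lambda>g. pm_lift \<phi> (Poly_Mapping.single k a * g)"])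
       (simp_all add: distrib_left lift_add lift_single mult_single mult)
  show ?thesis
    by (rule additive_eqI[of "\<lambda>f. pm_lift \<phi> (f * g)" "\<lambda>f. pm_lift \<phi> f * pm_lift \<phi> g"])
       (simp_all add: distrib_right lift_add s)
qed

end

lemma single_eq_0_iff [simp]: "Poly_Mapping.single k a = 0 \<longleftrightarrow> a = 0"
  by (metis lookup_single_eq lookup_zero single_zero)

abbreviation mono :: "expo \<Rightarrow> laurent" where "mono \<mu> \<equiv> Poly_Mapping.single \<mu> 1"

lemma scal_mult [simp]: "scal (a * b) = scal a * scal b"
  by (simp add: scal_def mult_single)

lemma scal_simps [simp]: "scal 0 = 0" "scal 1 = 1" "scal (a + b) = scal a + scal b"
  "scal (a - b) = scal a - scal b" "scal (- a) = - scal a"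
  by (simp_all add: scal_def single_add single_diff single_uminus)

lemma scal_single: "scal c * Poly_Mapping.single \<mu> a = Poly_Mapping.single \<mu> (c * a)"
  by (simp add: scal_def mult_single)

lemma scal_sum: "scal (sum f A) = (\<Sum>x\<in>A. scal (f x))"
  by (induction A rule: infinite_finite_induct) simp_all

lemma lk_scal [simp]: "lk (scal c * f) \<mu> = c * lk f \<mu>"
  by (rule additive_eqI[of "\<lambda>f. lk (scal c * f) \<mu>" "\<lambda>f. c * lk f \<mu>"])
     (simp_all add: distrib_left lookup_add scal_single lookup_single when_def)

lemma scal_eq_0_iff [simp]: "scal c = 0 \<longleftrightarrow> c = 0"
  by (simp add: scal_def)

lemma keys_scal: "Poly_Mapping.keys (scal c * f) \<subseteq> Poly_Mapping.keys f"
  by (auto simp: in_keys_iff)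

lemma par_nonzero [simp]: "par v \<noteq> 0"
  by (simp add: par_def)

interpretation act: pm_additive "\<lambda>\<mu> c. Poly_Mapping.single (w \<mu>) (c::coeff)" for w :: "expo \<Rightarrow> expo"
  by standard (simp_all add: single_add)

lemma act_lift: "act w f = pm_lift (\<lambda>\<mu> c. Poly_Mapping.single (w \<mu>) c) f"
  by (simp add: act_def pm_lift_def)

lemma act_single [simp]: "act w (Poly_Mapping.single \<mu> c) = Poly_Mapping.single (w \<mu>) c"
  by (simp add: act_lift act.lift_single)

lemma act_add: "act w (f + g) = act w f + act w g"
  by (simp add: act_lift act.lift_add)

interpretation xi0: pm_additive "\<lambda>\<mu> c. Poly_Mapping.single (negate_entry 1 \<mu>) (q_par powi lk \<mu> 1 * c)"
  by standard (simp_all add: single_add distrib_left)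

lemma xi0_lift: "xi0 f = pm_lift (\<lambda>\<mu> c. Poly_Mapping.single (negate_entry 1 \<mu>) (q_par powi lk \<mu> 1 * c)) f"
  by (simp add: xi0_def pm_lift_def)

lemma xi0_single [simp]: "xi0 (Poly_Mapping.single \<mu> c) = Poly_Mapping.single (negate_entry 1 \<mu>) (q_par powi lk \<mu> 1 * c)"
  unfolding xi0_lift by (rule xi0.lift_single)

lemma xi0_add: "xi0 (f + g) = xi0 f + xi0 g"
  unfolding xi0_lift by (rule xi0.lift_add)

section \<open>Demazure-Lusztig operators on monomials\<close>

text \<open>
  All the operators \<open>hecke n i\<close>, including \<open>i = 0\<close>, have the form
  $\kappa + \kappa^{-1}\frac{1+\gamma z-\kappa^2z^d}{1-z^d}(\xi-1)$ for a Laurent monomial $z$.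
\<close>

definition kap :: "nat \<Rightarrow> nat \<Rightarrow> coeff" where
  "kap n i = (if i = 0 then t0_h else if i < n then t_h else tn_h)"

definition gam :: "nat \<Rightarrow> nat \<Rightarrow> coeff" where
  "gam n i = (if i = 0 then t0_h / u0_h - t0_h * u0_h else if i < n then 0 else tn_h / un_h - tn_h * un_h)"

definition zc :: "nat \<Rightarrow> coeff" where "zc i = (if i = 0 then q_h else 1)"

definition ze :: "nat \<Rightarrow> nat \<Rightarrow> expo" where
  "ze n i = (if i = 0 then - Poly_Mapping.single 1 1
     else if i < n then Poly_Mapping.single i 1 - Poly_Mapping.single (Suc i) 1
     else Poly_Mapping.single n 1)"

definition zd :: "nat \<Rightarrow> nat \<Rightarrow> int" where
  "zd n i = (if i = 0 \<or> \<not> i < n then 2 else 1)"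

definition zp :: "nat \<Rightarrow> nat \<Rightarrow> int \<Rightarrow> laurent" where
  "zp n i k = Poly_Mapping.single (frag_cmul k (ze n i)) (zc i powi k)"

definition sref :: "nat \<Rightarrow> nat \<Rightarrow> expo \<Rightarrow> expo" where
  "sref n i = (if i = 0 then negate_entry 1 else refl n i)"

definition m0 :: "nat \<Rightarrow> nat \<Rightarrow> expo \<Rightarrow> int" where
  "m0 n i \<mu> = (if i = 0 then - lk \<mu> 1 else mm n i \<mu>)"

text \<open>The number of copies of \<open>ze\<close> that the reflection adds to the exponent;
  equivalently, the operator \<open>rf\<close> multiplies \<open>x^\<mu>\<close> by this power of
  \<open>z\<close>. It has the sign opposite to the pairing \<open>m0\<close>.\<close>

definition zb :: "nat \<Rightarrow> nat \<Rightarrow> expo \<Rightarrow> int" where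
  "zb n i \<mu> = - zd n i * m0 n i \<mu>"

definition rf :: "nat \<Rightarrow> nat \<Rightarrow> laurent \<Rightarrow> laurent" where
  "rf n i f = (if i = 0 then xi0 f else act (refl n i) f)"

lemma zc_nonzero [simp]: "zc i \<noteq> 0" by (simp add: zc_def)

lemma kap_nonzero [simp]: "kap n i \<noteq> 0" by (simp add: kap_def)

lemma zd_pos: "zd n i > 0" by (simp add: zd_def)

lemma zp_0 [simp]: "zp n i 0 = 1" by (simp add: zp_def)

lemma zp_add: "zp n i (k + l) = zp n i k * zp n i l"
  by (simp add: zp_def mult_single frag_cmul_distrib power_int_add)

lemma frag_cmul_ze_eq_0: "1 \<le> n \<Longrightarrow> frag_cmul k (ze n i) = 0 \<longleftrightarrow> k = 0"
  by (auto simp: ze_def poly_mapping_eq_iff fun_eq_iff lookup_minus lookup_single when_def split: if_splits)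

lemma sref_eq: "sref n i \<mu> = \<mu> + frag_cmul (zb n i \<mu>) (ze n i)"
  by (rule poly_mapping_eqI)
     (auto simp: sref_def zb_def ze_def zd_def m0_def mm_def lookup_add lookup_minus lookup_single when_def lk_refl)

lemma rf_single': "rf n i (Poly_Mapping.single \<mu> c) = Poly_Mapping.single (sref n i \<mu>) (zc i powi zb n i \<mu> * c)"
proof -
  have "q_par powi k = q_h powi (2 * k)" for k by (simp add: power_int_power)
  then show ?thesis by (simp add: rf_def sref_def zc_def zd_def m0_def zb_def)
qed

lemma rf_single: "rf n i (Poly_Mapping.single \<mu> c) = Poly_Mapping.single \<mu> c * zp n i (zb n i \<mu>)"
  unfolding rf_single' by (simp add: zp_def mult_single sref_eq mult.commute)

lemma rf_add: "rf n i (f + g) = rf n i f + rf n i g"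
  by (simp add: rf_def act_add xi0_add)

definition zden :: "nat \<Rightarrow> nat \<Rightarrow> laurent" where "zden n i = 1 - zp n i (zd n i)"

definition znum :: "nat \<Rightarrow> nat \<Rightarrow> laurent" where
  "znum n i = 1 + scal (gam n i) * zp n i 1 - scal (kap n i ^ 2) * zp n i (zd n i)"

lemma zden_nonzero: assumes "1 \<le> n" shows "zden n i \<noteq> 0"
proof
  assume "zden n i = 0"
  then have "lk (zp n i (zd n i)) 0 = lk (1::laurent) 0" by (simp add: zden_def)
  then show False using frag_cmul_ze_eq_0[OF assms, of "zd n i" i] zd_pos[of n i]
    by (simp add: zp_def lookup_single when_def)
qed

definition string_int :: "nat \<Rightarrow> nat \<Rightarrow> expo \<Rightarrow> expo set" where
  "string_int n i \<mu> = {\<mu> + frag_cmul k (ze n i) | k.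
      min 0 (zb n i \<mu>) < k \<and> k < max 0 (zb n i \<mu>)}"

lemma keys_add_subset: "Poly_Mapping.keys f \<subseteq> A \<Longrightarrow> Poly_Mapping.keys g \<subseteq> A \<Longrightarrow> Poly_Mapping.keys (f + g) \<subseteq> A"
  using keys_add[of f g] by blast

lemma keys_diff_subset: "Poly_Mapping.keys f \<subseteq> A \<Longrightarrow> Poly_Mapping.keys g \<subseteq> A \<Longrightarrow> Poly_Mapping.keys (f - g) \<subseteq> A"
  for f g :: "'k \<Rightarrow>\<^sub>0 'a::ab_group_add"
  by (auto simp: in_keys_iff lookup_minus subset_iff) (metis diff_0_right)

lemma keys_scal_subset: "Poly_Mapping.keys f \<subseteq> A \<Longrightarrow> Poly_Mapping.keys (scal c * f) \<subseteq> A"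
  using keys_scal by blast

text \<open>\<open>h\<close> is the geometric sum of the \<open>S k\<close> with step
  \<open>zd n i\<close>, so the denominator telescopes to the two ends. In the numerator everything
  else is interior: the term with \<open>gam\<close> shifts by one, which is interior for step 2,
  and for step 1 its coefficient vanishes.\<close>

lemma string_sum:
  fixes \<mu> :: expo and b :: int and n i :: nat
  defines "S \<equiv> \<lambda>k. mono \<mu> * zp n i k"
  shows "\<exists>h r. zden n i * h = S b - S (b + zd n i * int (Suc m)) \<and>
      znum n i * h = S b - scal (kap n i ^ 2) * S (b + zd n i * int (Suc m)) + r \<and>
      Poly_Mapping.keys r \<subseteq> {\<mu> + frag_cmul k (ze n i) | k. b < k \<and> k < b + zd n i * int (Suc m)}"
proof -
  let ?d = "zd n i" and ?t = "scal (kap n i ^ 2)"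
  let ?K = "\<lambda>l. {\<mu> + frag_cmul k (ze n i) | k. b < k \<and> k < l}"
  have Sz: "S k * zp n i l = S (k + l)" for k l by (simp add: S_def zp_add mult.assoc)
  have keysS: "Poly_Mapping.keys (S k) \<subseteq> {\<mu> + frag_cmul k (ze n i)}" for k
    by (simp add: S_def zp_def mult_single)
  have g: "Poly_Mapping.keys (scal (gam n i) * S (k + 1)) \<subseteq> ?K (k + ?d)" if "b \<le> k" for k
  proof (cases "?d = 1")
    case True
    then have "gam n i = 0" by (auto simp: zd_def gam_def split: if_splits)
    then show ?thesis by simp
  next
    case False
    then have "?d = 2" by (auto simp: zd_def split: if_splits)
    then show ?thesis using that keysS[of "k + 1"] by (intro keys_scal_subset) fastforce
  qed
  have den: "zden n i * S k = S k - S (k + ?d)" for k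
    using Sz[of k ?d] by (simp add: zden_def algebra_simps)
  have num: "znum n i * S k = S k - ?t * S (k + ?d) + scal (gam n i) * S (k + 1)" for k
  proof -
    have "znum n i * S k = S k - ?t * (S k * zp n i ?d) + scal (gam n i) * (S k * zp n i 1)"
      by (simp add: znum_def algebra_simps)
    then show ?thesis by (simp only: Sz)
  qed
  show ?thesis
  proof (induction m)
    case 0
    show ?case
      by (intro exI[of _ "S b"] exI[of _ "scal (gam n i) * S (b + 1)"])
         (use den[of b] num[of b] g[of b] in simp)
  next
    case (Suc m)
    then obtain h r where h: "zden n i * h = S b - S (b + ?d * int (Suc m))"
      "znum n i * h = S b - ?t * S (b + ?d * int (Suc m)) + r"
      "Poly_Mapping.keys r \<subseteq> ?K (b + ?d * int (Suc m))" by blast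
    define k where "k = b + ?d * int (Suc m)"
    have k: "b < k" "b + ?d * int (Suc (Suc m)) = k + ?d" using zd_pos[of n i]
      by (simp_all add: k_def algebra_simps add_pos_nonneg)
    define r' where "r' = r + (S k - ?t * S k) + scal (gam n i) * S (k + 1)"
    have A: "Poly_Mapping.keys r \<subseteq> ?K (k + ?d)" using h(3)[folded k_def] zd_pos[of n i] by fastforce
    have B: "Poly_Mapping.keys (S k) \<subseteq> ?K (k + ?d)" using keysS[of k] k zd_pos[of n i] by fastforce
    have C: "Poly_Mapping.keys (scal (gam n i) * S (k + 1)) \<subseteq> ?K (k + ?d)" using g[of k] k by simp
    have "Poly_Mapping.keys r' \<subseteq> ?K (k + ?d)" unfolding r'_def
      by (rule keys_add_subset[OF keys_add_subset[OF A keys_diff_subset[OF B keys_scal_subset[OF B]]] C])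
    moreover have "zden n i * (h + S k) = S b - S (k + ?d)"
      using h(1)[folded k_def] den[of k] by (simp add: distrib_left)
    moreover have "znum n i * (h + S k) = S b - ?t * S (k + ?d) + r'"
      using h(2)[folded k_def] num[of k] by (simp add: distrib_left r'_def)
    ultimately show ?case unfolding k(2) by blast
  qed
qed

lemma zp_sref: "mono \<mu> * zp n i (zb n i \<mu>) = scal (zc i powi zb n i \<mu>) * mono (sref n i \<mu>)"
  using rf_single[of n i \<mu> 1] rf_single'[of n i \<mu> 1] by (simp add: scal_single)

text \<open>The action on a monomial up to exponents strictly inside the string. A diagonal term
  besides the reflected one appears only for a negative pairing; all triangularity statements below
  exploit this asymmetry.\<close>

definition hecke_mono_spec :: "nat \<Rightarrow> nat \<Rightarrow> expo \<Rightarrow> laurent \<Rightarrow> bool" where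
  "hecke_mono_spec n i \<mu> g \<longleftrightarrow> (\<exists>r. Poly_Mapping.keys r \<subseteq> string_int n i \<mu> \<and>
     g = (if m0 n i \<mu> = 0 then scal (kap n i) * mono \<mu>
          else (if m0 n i \<mu> < 0 then scal (kap n i - 1 / kap n i) * mono \<mu> else 0) +
            scal ((if m0 n i \<mu> < 0 then kap n i else 1 / kap n i) * zc i powi zb n i \<mu>) * mono (sref n i \<mu>) + r))"

lemma divided_difference_mono:
  "\<exists>h. zden n i * h = mono \<mu> - rf n i (mono \<mu>) \<and>
     hecke_mono_spec n i \<mu> (scal (1 / kap n i) * (scal (kap n i ^ 2) * mono \<mu> - znum n i * h))"
proof -
  let ?m = "m0 n i \<mu>" and ?d = "zd n i" and ?k = "kap n i"
  define b where "b = zb n i \<mu>"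
  have b: "b = - ?d * ?m" by (simp add: b_def zb_def)
  have kk: "1 / ?k * ?k^2 = ?k" by (simp add: power2_eq_square)
  define S where "S = (\<lambda>k. mono \<mu> * zp n i k)"
  have S0: "S 0 = mono \<mu>" by (simp add: S_def)
  have R: "rf n i (mono \<mu>) = S b" unfolding S_def b_def by (rule rf_single)
  have R': "S b = scal (zc i powi (b)) * mono (sref n i \<mu>)" unfolding S_def b_def by (rule zp_sref)
  consider "?m = 0" | "?m > 0" | "?m < 0" by linarith
  then show ?thesis
  proof cases
    case 1
    have "scal (1 / ?k) * scal (?k^2) = scal ?k" by (simp only: scal_mult[symmetric] kk)
    then show ?thesis using 1 R S0
      by (intro exI[of _ 0]) (auto simp: hecke_mono_spec_def S_def b mult.assoc[symmetric] intro!: exI[of _ 0])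
  next
    case 2
    then have B: "b < 0" using zd_pos[of n i] by (simp add: b mult_pos_pos)
    have "?m = int (Suc (nat ?m - 1))" using 2 by simp
    then obtain m where m: "?m = int (Suc m)" by blast
    \<comment> \<open>Here \<open>b < 0\<close>, so the geometric sum starts at the reflected
      exponent and ends at \<open>\<mu>\<close>; the quotient sought is therefore
      \<open>- h\<close>.\<close>
    obtain h r where h: "zden n i * h = S b - S 0"
      "znum n i * h = S b - scal (?k^2) * S 0 + r"
      and r: "Poly_Mapping.keys r \<subseteq> {\<mu> + frag_cmul k (ze n i) | k. b < k \<and> k < 0}"
      using string_sum[of n i \<mu> b m] by (auto simp: S_def b m)
    have "scal (1 / ?k) * (scal (?k^2) * mono \<mu> - znum n i * (- h)) = scal (1 / ?k) * (scal (?k^2) * S 0 + znum n i * h)"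
      by (simp add: S0)
    also have "\<dots> = scal (1 / ?k) * S b + scal (1 / ?k) * r"
      unfolding h(2) by (simp add: distrib_left)
    finally have "scal (1 / ?k) * (scal (?k^2) * mono \<mu> - znum n i * (- h)) = scal (1 / ?k) * S b + scal (1 / ?k) * r" .
    moreover have "Poly_Mapping.keys (scal (1 / ?k) * r) \<subseteq> string_int n i \<mu>"
      using r B by (intro keys_scal_subset) (fastforce simp: string_int_def b_def[symmetric] min_def max_def)
    moreover have "zden n i * (- h) = mono \<mu> - rf n i (mono \<mu>)" by (simp add: h R S0)
    moreover have "scal (1 / ?k) * S b = scal (1 / ?k * zc i powi b) * mono (sref n i \<mu>)"
      by (simp only: R' scal_mult mult.assoc)
    moreover have f: "(?m = 0) = False" "(?m < 0) = False" using 2 by auto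
    ultimately show ?thesis
      by (intro exI[of _ "- h"]) (auto simp only: hecke_mono_spec_def b_def[symmetric] f if_False if_True add_0 simp_thms intro!: exI[of _ "scal (1 / ?k) * r"])
  next
    case 3
    then have B: "b > 0" using zd_pos[of n i] by (simp add: b mult_pos_neg)
    have "- ?m = int (Suc (nat (- ?m) - 1))" using 3 by simp
    then obtain m where m: "- ?m = int (Suc m)" by blast
    then have bm: "b = ?d * int (Suc m)" unfolding b by (metis minus_mult_commute)
    obtain h r where h: "zden n i * h = S 0 - S b"
      "znum n i * h = S 0 - scal (?k^2) * S b + r"
      and r: "Poly_Mapping.keys r \<subseteq> {\<mu> + frag_cmul k (ze n i) | k. 0 < k \<and> k < b}"
      using string_sum[of n i \<mu> 0 m] unfolding bm[symmetric] add_0 by (auto simp: S_def)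
    have s: "scal (1 / ?k) * scal (?k^2) = scal ?k" by (simp only: scal_mult[symmetric] kk)
    have "scal (1 / ?k) * (scal (?k^2) * mono \<mu> - znum n i * h) =
      (scal (1 / ?k) * scal (?k^2)) * S 0 - scal (1 / ?k) * S 0 + (scal (1 / ?k) * scal (?k^2)) * S b - scal (1 / ?k) * r"
      unfolding h(2) S0[symmetric] by (simp add: algebra_simps)
    then have "scal (1 / ?k) * (scal (?k^2) * mono \<mu> - znum n i * h) =
      scal (?k - 1 / ?k) * mono \<mu> + scal ?k * S b + scal (- 1 / ?k) * r"
      by (simp only: s S0) (simp add: algebra_simps)
    moreover have "Poly_Mapping.keys (scal (- 1 / ?k) * r) \<subseteq> string_int n i \<mu>"
      using r B by (intro keys_scal_subset) (fastforce simp: string_int_def b_def[symmetric] min_def max_def)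
    moreover have "zden n i * h = mono \<mu> - rf n i (mono \<mu>)" by (simp add: h R S0)
    moreover have "scal ?k * S b = scal (?k * zc i powi b) * mono (sref n i \<mu>)"
      by (simp only: R' scal_mult mult.assoc)
    moreover have f: "(?m = 0) = False" "(?m < 0) = True" using 3 by auto
    ultimately show ?thesis
      by (intro exI[of _ h]) (auto simp only: hecke_mono_spec_def b_def[symmetric] f if_False if_True simp_thms intro!: exI[of _ "scal (- 1 / ?k) * r"])
  qed
qed

lemma rf_scal: "rf n i (scal c * f) = scal c * rf n i f"
  by (rule additive_eqI[of "\<lambda>f. rf n i (scal c * f)" "\<lambda>f. scal c * rf n i f"])
     (simp_all add: distrib_left rf_add scal_single rf_single' mult.left_commute)

lemma divided_difference: "\<exists>h. zden n i * h = f - rf n i f"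
proof -
  have s: "\<exists>h. zden n i * h = Poly_Mapping.single \<mu> c - rf n i (Poly_Mapping.single \<mu> c)" for \<mu> c
  proof -
    obtain h where "zden n i * h = mono \<mu> - rf n i (mono \<mu>)" using divided_difference_mono by blast
    then have "zden n i * (scal c * h) = scal c * (mono \<mu> - rf n i (mono \<mu>))" by (simp add: mult.left_commute)
    also have "\<dots> = scal c * mono \<mu> - rf n i (scal c * mono \<mu>)" by (simp add: right_diff_distrib rf_scal)
    finally show ?thesis by (auto simp: scal_single)
  qed
  have "\<exists>h. zden n i * h = sum g A - rf n i (sum g A)" if "\<And>a. a \<in> A \<Longrightarrow> \<exists>h. zden n i * h = g a - rf n i (g a)" "finite A"
    for g :: "expo \<Rightarrow> laurent" and A
    using that(2,1)
  proof (induction A)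
    case empty
    have "rf n i 0 = 0" using rf_add[of n i 0 0] by (metis add_0 add_cancel_right_right)
    then show ?case by (auto intro: exI[of _ 0])
  next
    case (insert a A)
    then obtain h h' where "zden n i * h = sum g A - rf n i (sum g A)" "zden n i * h' = g a - rf n i (g a)" by blast
    then have "zden n i * (h' + h) = sum g (insert a A) - rf n i (sum g (insert a A))"
      using insert by (simp add: rf_add distrib_left)
    then show ?case by blast
  qed
  then show ?thesis using s by (subst (1 2) pm_sum_single) (auto simp del: )
qed

lemma div_exactI: "b \<noteq> 0 \<Longrightarrow> h * b = a \<Longrightarrow> div_exact a b = h"
  unfolding div_exact_def by (rule the_equality) auto

lemma div_exact_mult:
  assumes "D * h = g" "U \<noteq> 0" "D \<noteq> 0"
  shows "div_exact (U * N * g) (U * D) = N * h"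
proof (rule div_exactI)
  show "N * h * (U * D) = U * N * g" unfolding assms(1)[symmetric] by (simp only: mult_ac)
qed (use assms in simp)

text \<open>The exact quotient is a definite description, so it is evaluated by exhibiting a
  quotient. In each case a monomial \<open>?U\<close> is split off from numerator and denominator to
  bring the fraction into the common form in \<open>z\<close>.\<close>

lemma hecke_eq:
  assumes n: "1 \<le> n" and h: "zden n i * h = f - rf n i f" and i: "i \<le> n"
  shows "hecke n i f = scal (1 / kap n i) * (scal (kap n i ^ 2) * f - znum n i * h)"
proof -
  have v: "var j * var j = Poly_Mapping.single (Poly_Mapping.single j 2) 1" for j
    by (simp add: var_def mult_single single_add[symmetric])
  have vz: "var 1 * zp n 0 1 = scal q_h"
    by (simp add: var_def zp_def mult_single ze_def zc_def scal_def)
  have vz2: "var 1 * var 1 * zp n 0 2 = scal (q_h^2)"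
  proof -
    have "var 1 * var 1 * zp n 0 2 = (var 1 * zp n 0 1) * (var 1 * zp n 0 1)"
      using zp_add[of n 0 1 1] by (simp add: mult_ac)
    then show ?thesis unfolding vz by (simp add: power2_eq_square)
  qed
  have nz: "var j \<noteq> 0" for j by (simp add: var_def)
  consider "i = 0" | "0 < i" "i < n" | "i = n" "0 < i" using i by linarith
  then show ?thesis
  proof cases
    case 1
    let ?U = "var 1 * var 1"
    have gs: "gam n 0 = t0_h / u0_h - t0_h * u0_h" by (simp add: gam_def)
    have a: "(var 1 + scal (q_h * t0_h / u0_h)) * (var 1 - scal (q_h * t0_h * u0_h)) = ?U * znum n 0"
    proof -
      define A B where "A = t0_h / u0_h" and "B = t0_h * u0_h"
      have AB: "scal A * scal B = scal (t0_h^2)"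
        by (simp add: A_def B_def power2_eq_square flip: scal_mult)
      have "?U * znum n 0 = ?U + scal (gam n 0) * var 1 * (var 1 * zp n 0 1) - scal (t0_h^2) * (?U * zp n 0 2)"
        by (simp add: znum_def zd_def kap_def algebra_simps)
      also have "\<dots> = ?U + (scal A - scal B) * var 1 * scal q_h - scal A * scal B * (scal q_h * scal q_h)"
        unfolding vz vz2 gs AB by (simp add: A_def B_def power2_eq_square)
      also have "\<dots> = (var 1 + scal q_h * scal A) * (var 1 - scal q_h * scal B)"
        by (simp add: algebra_simps)
      also have "\<dots> = (var 1 + scal (q_h * t0_h / u0_h)) * (var 1 - scal (q_h * t0_h * u0_h))"
        by (simp add: A_def B_def mult.assoc flip: scal_mult)
      finally show ?thesis ..
    qed
    have b: "var 1 ^ 2 - scal q_par = ?U * zden n 0"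
    proof -
      have "?U * zden n 0 = ?U - ?U * zp n 0 2" by (simp add: zden_def zd_def right_diff_distrib)
      then show ?thesis unfolding vz2 by (simp add: power2_eq_square)
    qed
    have "div_exact ((var 1 + scal (q_h * t0_h / u0_h)) * (var 1 - scal (q_h * t0_h * u0_h)) * (f - xi0 f)) (var 1 ^ 2 - scal q_par) = znum n 0 * h"
      unfolding a b using nz zden_nonzero[OF n, of 0] h 1 by (intro div_exact_mult) (simp_all add: rf_def)
    then show ?thesis using 1 by (simp add: hecke_def kap_def)
  next
    case 2
    let ?U = "var (Suc i)"
    have z: "?U * zp n i 1 = var i" using 2 by (simp add: var_def zp_def mult_single ze_def zc_def)
    have a: "var (Suc i) - scal t_par * var i = ?U * znum n i"
      using 2 by (simp add: znum_def zd_def kap_def gam_def algebra_simps z[symmetric])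
    have b: "var (Suc i) - var i = ?U * zden n i"
      using 2 by (simp add: zden_def zd_def algebra_simps z)
    have "div_exact ((var (Suc i) - scal t_par * var i) * (f - act (refl n i) f)) (var (Suc i) - var i) = znum n i * h"
      unfolding a b using nz zden_nonzero[OF n, of i] h 2 by (intro div_exact_mult) (simp_all add: rf_def)
    then show ?thesis using 2 by (simp add: hecke_def kap_def)
  next
    case 3
    have c: "frag_cmul k (Poly_Mapping.single n 1) = Poly_Mapping.single n k" for k
      by (rule poly_mapping_eqI) (simp add: lookup_single when_def)
    have z: "zp n n 1 = var n" "zp n n 2 = var n * var n" using 3 unfolding v by (simp_all add: var_def zp_def ze_def zc_def c)
    have a: "(1 + scal (tn_h / un_h) * var n) * (1 - scal (tn_h * un_h) * var n) = znum n n"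
    proof -
      have AB: "scal (tn_h / un_h) * scal (tn_h * un_h) = scal (kap n n ^ 2)"
        using 3 by (simp add: kap_def power2_eq_square flip: scal_mult)
      have "(1 + scal (tn_h / un_h) * var n) * (1 - scal (tn_h * un_h) * var n) =
        1 + (scal (tn_h / un_h) - scal (tn_h * un_h)) * var n - (scal (tn_h / un_h) * scal (tn_h * un_h)) * (var n * var n)"
        by (simp add: algebra_simps del: scal_mult)
      also note AB
      finally show ?thesis using 3 by (simp add: znum_def zd_def gam_def z)
    qed
    have b: "1 - var n ^ 2 = zden n n" by (simp add: zden_def zd_def z power2_eq_square)
    have "div_exact ((1 + scal (tn_h / un_h) * var n) * (1 - scal (tn_h * un_h) * var n) * (f - act (refl n n) f)) (1 - var n ^ 2) = znum n n * h"
      unfolding a b using zden_nonzero[OF n, of n] h 3 div_exact_mult[of "zden n n" h _ 1 "znum n n"] by (simp add: rf_def)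
    then show ?thesis using 3 by (simp add: hecke_def kap_def)
  qed
qed

lemma hecke_mono: "1 \<le> n \<Longrightarrow> i \<le> n \<Longrightarrow> hecke_mono_spec n i \<mu> (hecke n i (mono \<mu>))"
  using divided_difference_mono[of n i \<mu>] hecke_eq[of n i _ "mono \<mu>"] by auto

lemma hecke_add:
  assumes "1 \<le> n" "i \<le> n"
  shows "hecke n i (f + g) = hecke n i f + hecke n i g"
proof -
  obtain h h' where h: "zden n i * h = f - rf n i f" "zden n i * h' = g - rf n i g" using divided_difference by metis
  have "zden n i * (h + h') = f + g - rf n i (f + g)" by (simp add: rf_add distrib_left h)
  note e = hecke_eq[OF assms(1) this assms(2)]
  show ?thesis unfolding e hecke_eq[OF assms(1) h(1) assms(2)] hecke_eq[OF assms(1) h(2) assms(2)]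
    by (simp add: algebra_simps)
qed

lemma hecke_scal:
  assumes "1 \<le> n" "i \<le> n"
  shows "hecke n i (scal c * f) = scal c * hecke n i f"
proof -
  obtain h where h: "zden n i * h = f - rf n i f" using divided_difference by metis
  have "zden n i * (scal c * h) = scal c * f - rf n i (scal c * f)" by (simp add: rf_scal mult.left_commute h right_diff_distrib)
  note e = hecke_eq[OF assms(1) this assms(2)]
  show ?thesis unfolding e hecke_eq[OF assms(1) h assms(2)] by (simp add: algebra_simps)
qed

section \<open>Braid relations for rank-two Demazure-Lusztig operators\<close>

text \<open>The \<open>F\<close>s are the values of a function at the six points of a dihedral
  orbit, and \<open>x\<close>, \<open>y\<close>, \<open>u\<close> the diagonal coefficients of the
  operators at \<open>z\<close>, \<open>w\<close> and \<open>z * w\<close>. Apart from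
  \<open>R\<close> only the quadratic relation \<open>k\<close> enters.\<close>

lemma braid3_identity:
  fixes x y u h k :: "'k::field"
  assumes R: "u * (h - x) + x * y - y * u = 0" and k: "k * (k - h) = 1"
  shows "x * (y * (x * F0 + (k - x) * F1) + (k - y) * (u * F2 + (k - u) * F12)) +
     (k - x) * (u * ((h - x) * F1 + (k - (h - x)) * F0) + (k - u) * (y * F21 + (k - y) * F121)) =
   y * (x * (y * F0 + (k - y) * F2) + (k - x) * (u * F1 + (k - u) * F21)) +
     (k - y) * (u * ((h - y) * F2 + (k - (h - y)) * F0) + (k - u) * (x * F12 + (k - x) * F121))"
  using R k by algebra

text \<open>The analogue for the eight points of the dihedral orbit of order eight:
  \<open>a1\<close>, \<open>a2\<close> are the diagonal coefficients of the end node at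
  \<open>z\<close> and \<open>z * w\<close>, and \<open>e1\<close>, \<open>e2\<close> those of its
  neighbour at \<open>w\<close> and \<open>w * z ^ 2\<close>. At inverted arguments a coefficient
  \<open>a\<close> becomes \<open>h' - a\<close>, respectively \<open>e\<close> becomes
  \<open>h - e\<close>.\<close>

lemma braid4_identity:
  fixes a1 a2 e1 e2 h h' k k' :: "'k::field"
  assumes R: "a1 * e1 - a1 * e2 - a2 * e1 - a2 * e2 + h' * e2 + h * a2 = 0"
    and k: "k * (k - h) = 1" and k': "k' * (k' - h') = 1"
  defines "A1 \<equiv> k' - a1" and "A2 \<equiv> k' - a2" and "A1' \<equiv> k' - (h' - a1)" and "A2' \<equiv> k' - (h' - a2)"
    and "E1 \<equiv> k - e1" and "E2 \<equiv> k - e2" and "E1' \<equiv> k - (h - e1)" and "E2' \<equiv> k - (h - e2)"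
  shows
   "a1 * (e1 * (a1 * (e1 * F0 + E1 * FB) + A1 * (e2 * FA + E2 * FBA)) +
       E1 * (a2 * ((h - e1) * FB + E1' * F0) + A2 * (e2 * FAB + E2 * FBAB))) +
    A1 * (e2 * ((h' - a1) * (e2 * FA + E2 * FBA) + A1' * (e1 * F0 + E1 * FB)) +
       E2 * (a2 * ((h - e2) * FBA + E2' * FA) + A2 * (e1 * FABA + E1 * FW))) =
    e1 * (a1 * (e1 * (a1 * F0 + A1 * FA) + E1 * (a2 * FB + A2 * FAB)) +
       A1 * (e2 * ((h' - a1) * FA + A1' * F0) + E2 * (a2 * FBA + A2 * FABA))) +
    E1 * (a2 * ((h - e1) * (a2 * FB + A2 * FAB) + E1' * (a1 * F0 + A1 * FA)) +
       A2 * (e2 * ((h' - a2) * FAB + A2' * FB) + E2 * (a1 * FBAB + A1 * FW)))"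
proof -
  have 0: "e1 * E1 * F0 = e1 * E1 * F0" ..
  show ?thesis unfolding A1_def A2_def A1'_def A2'_def E1_def E2_def E1'_def E2'_def
    using R k k' by algebra
qed

section \<open>Evaluation at points and the function-space representation\<close>

locale coeff_hom =
  fixes \<iota> :: "coeff \<Rightarrow> 'k::field"
  assumes hom_add: "\<iota> (a + b) = \<iota> a + \<iota> b" and hom_mult: "\<iota> (a * b) = \<iota> a * \<iota> b" and hom_1: "\<iota> 1 = 1"
begin

lemma hom_0 [simp]: "\<iota> 0 = 0"
  using hom_add[of 0 0] by (metis add_0 add_cancel_right_right)

lemma hom_minus: "\<iota> (- a) = - \<iota> a"
  using hom_add[of a "- a"] by (simp add: eq_neg_iff_add_eq_0 add.commute)

lemma hom_diff: "\<iota> (a - b) = \<iota> a - \<iota> b"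
  using hom_add[of a "- b"] by (simp add: hom_minus)

lemma hom_eq_0 [simp]: "\<iota> a = 0 \<longleftrightarrow> a = 0"
  using hom_mult[of a "1 / a"] hom_1 by (cases "a = 0") auto

lemma hom_inverse: "\<iota> (inverse a) = inverse (\<iota> a)"
  using hom_mult[of a "inverse a"] hom_1 by (cases "a = 0") (auto intro: inverse_unique[symmetric])

lemma hom_divide: "\<iota> (a / b) = \<iota> a / \<iota> b"
  by (simp add: divide_inverse hom_mult hom_inverse)

lemma hom_power: "\<iota> (a ^ k) = \<iota> a ^ k"
  by (induction k) (simp_all add: hom_1 hom_mult)

lemma hom_powi: "\<iota> (a powi k) = \<iota> a powi k"
  by (cases k rule: int_cases2) (simp_all add: hom_power power_int_minus hom_inverse)

lemma hom_sum: "\<iota> (sum f A) = (\<Sum>x\<in>A. \<iota> (f x))"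
  by (induction A rule: infinite_finite_induct) (simp_all add: hom_add)

lemmas hom_simps = hom_add hom_mult hom_1 hom_minus hom_diff hom_divide hom_power hom_powi hom_sum

definition mon :: "(nat \<Rightarrow> 'k) \<Rightarrow> expo \<Rightarrow> 'k" where
  "mon p \<mu> = (\<Prod>i \<in> Poly_Mapping.keys \<mu>. p i powi lk \<mu> i)"

definition ev :: "(nat \<Rightarrow> 'k) \<Rightarrow> laurent \<Rightarrow> 'k" where
  "ev p = pm_lift (\<lambda>\<mu> c. \<iota> c * mon p \<mu>)"

sublocale ev: pm_additive "\<lambda>\<mu> c. \<iota> c * mon p \<mu>" for p
  by standard (simp_all add: hom_simps distrib_right)

lemma ev_add: "ev p (f + g) = ev p f + ev p g"
  by (simp add: ev_def ev.lift_add)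

lemma ev_single: "ev p (Poly_Mapping.single \<mu> c) = \<iota> c * mon p \<mu>"
  by (simp add: ev_def ev.lift_single)

lemma ev_0 [simp]: "ev p 0 = 0" by (simp add: ev_def)

lemma ev_minus: "ev p (- f) = - ev p f"
  using ev_add[of p f "- f"] by (simp add: eq_neg_iff_add_eq_0 add.commute)

lemma ev_diff: "ev p (f - g) = ev p f - ev p g"
  using ev_add[of p f "- g"] by (simp add: ev_minus)

lemma mon_superset: "finite A \<Longrightarrow> Poly_Mapping.keys \<mu> \<subseteq> A \<Longrightarrow> mon p \<mu> = (\<Prod>i\<in>A. p i powi lk \<mu> i)"
  unfolding mon_def by (rule prod.mono_neutral_left) (auto simp: in_keys_iff)

lemma mon_0 [simp]: "mon p 0 = 1" by (simp add: mon_def)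

lemma mon_single [simp]: "mon p (Poly_Mapping.single i k) = p i powi k"
  by (cases "k = 0") (simp_all add: mon_def)

lemma mon_add: assumes "\<And>i. p i \<noteq> 0" shows "mon p (\<mu> + \<nu>) = mon p \<mu> * mon p \<nu>"
proof -
  let ?A = "Poly_Mapping.keys \<mu> \<union> Poly_Mapping.keys \<nu>"
  have "mon p (\<mu> + \<nu>) = (\<Prod>i\<in>?A. p i powi lk (\<mu> + \<nu>) i)" using keys_add[of \<mu> \<nu>] by (intro mon_superset) auto
  also have "\<dots> = (\<Prod>i\<in>?A. p i powi lk \<mu> i) * (\<Prod>i\<in>?A. p i powi lk \<nu> i)"
    by (simp add: lookup_add power_int_add assms prod.distrib)
  also have "\<dots> = mon p \<mu> * mon p \<nu>"
    using mon_superset[of ?A \<mu> p] mon_superset[of ?A \<nu> p] by simp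
  finally show ?thesis .
qed

lemma mon_uminus: assumes "\<And>i. p i \<noteq> 0" shows "mon p (- \<mu>) = inverse (mon p \<mu>)"
  by (simp add: mon_def power_int_minus keys_minus prod_inversef[unfolded o_def])

lemma power_int_prod: "(\<Prod>i\<in>A. f i) powi k = (\<Prod>i\<in>A. f i powi k)" for f :: "'b \<Rightarrow> 'k"
  by (induction A rule: infinite_finite_induct) (simp_all add: power_int_mult_distrib)

lemma mon_frag: "mon p (frag_cmul k \<mu>) = mon p \<mu> powi k"
proof -
  have "mon p (frag_cmul k \<mu>) = (\<Prod>i\<in>Poly_Mapping.keys \<mu>. p i powi lk (frag_cmul k \<mu>) i)"
    by (intro mon_superset keys_cmul finite_keys)
  also have "\<dots> = (\<Prod>i\<in>Poly_Mapping.keys \<mu>. (p i powi lk \<mu> i) powi k)"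
    by (simp add: power_int_mult[symmetric] mult.commute)
  finally show ?thesis by (simp add: mon_def power_int_prod)
qed

lemma ev_hom: assumes "\<And>i. p i \<noteq> 0" shows "pm_hom (\<lambda>\<mu> c. \<iota> c * mon p \<mu>)"
  by unfold_locales (simp_all add: hom_simps mon_add assms algebra_simps)

lemma ev_mult: assumes "\<And>i. p i \<noteq> 0" shows "ev p (f * g) = ev p f * ev p g"
  unfolding ev_def by (rule pm_hom.lift_mult[OF ev_hom[OF assms]])

lemma ev_1 [simp]: "ev p 1 = 1"
  using ev_single[of p 0 1] by (simp add: hom_1)

lemma ev_scal [simp]: "ev p (scal c) = \<iota> c"
  by (simp add: scal_def ev_single)

lemma ev_prod: assumes "\<And>i. p i \<noteq> 0" shows "ev p (prod F A) = (\<Prod>x\<in>A. ev p (F x))"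
  by (induction A rule: infinite_finite_induct) (simp_all add: ev_mult assms)

lemma ev_var [simp]: "ev p (var i) = p i"
  by (simp add: var_def ev_single hom_1)

definition spt :: "nat \<Rightarrow> nat \<Rightarrow> (nat \<Rightarrow> 'k) \<Rightarrow> nat \<Rightarrow> 'k" where
  "spt n i p = (if i = 0 then p(1 := \<iota> q_par / p 1)
     else if i < n then p(i := p (Suc i), Suc i := p i) else p(n := 1 / p n))"

lemma spt_nonzero: "(\<And>i. p i \<noteq> 0) \<Longrightarrow> spt n i p j \<noteq> 0"
  by (auto simp: spt_def)

lemma ev_rf: assumes p: "\<And>i. p i \<noteq> 0"
  shows "ev p (rf n i f) = ev (spt n i p) f"
proof (rule additive_eqI[of "\<lambda>f. ev p (rf n i f)"])
  fix \<mu> c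
  let ?A = "Poly_Mapping.keys \<mu> \<union> Poly_Mapping.keys (sref n i \<mu>) \<union> {1, i, Suc i, n}"
  have m: "mon p (sref n i \<mu>) = (\<Prod>j\<in>?A. p j powi lk (sref n i \<mu>) j)" by (rule mon_superset) auto
  have m': "mon (spt n i p) \<mu> = (\<Prod>j\<in>?A. spt n i p j powi lk \<mu> j)" by (rule mon_superset) auto
  have q: "q_par powi k = q_h powi (2 * k)" for k by (simp add: power_int_power)
  have "\<iota> (zc i powi zb n i \<mu>) * mon p (sref n i \<mu>) = mon (spt n i p) \<mu>"
  proof -
    consider "i = 0" | "0 < i" "i < n" | "0 < i" "\<not> i < n" by linarith
    then show ?thesis
    proof cases
      case 1
      have A: "zc i powi zb n i \<mu> = q_par powi lk \<mu> 1" using 1 by (simp add: zc_def zb_def zd_def m0_def q)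
      have B: "mon (spt n i p) \<mu> = (\<iota> q_par / p 1) powi lk \<mu> 1 * (\<Prod>j\<in>?A - {1}. p j powi lk \<mu> j)"
        unfolding m' using 1 by (subst prod.remove[of _ 1]) (auto simp: spt_def intro!: arg_cong2[of _ _ _ _ "(*)"] prod.cong)
      have C: "mon p (sref n i \<mu>) = p 1 powi (- lk \<mu> 1) * (\<Prod>j\<in>?A - {1}. p j powi lk \<mu> j)"
        unfolding m using 1 by (subst prod.remove[of _ 1]) (auto simp: sref_def intro!: arg_cong2[of _ _ _ _ "(*)"] prod.cong)
      show ?thesis unfolding A B C by (simp add: hom_simps power_int_divide_distrib power_int_minus divide_simps p)
    next
      case 2
      let ?t = "Transposition.transpose i (Suc i)"
      define B where "B = Poly_Mapping.keys \<mu> \<union> ?t ` Poly_Mapping.keys \<mu>"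
      have im: "?t ` ?t ` K = K" for K by (simp add: image_image)
      have tB: "?t ` B = B" unfolding B_def image_Un im by blast
      have "finite B" by (simp add: B_def)
      have s: "Poly_Mapping.keys (sref n i \<mu>) \<subseteq> B"
      proof
        fix k assume "k \<in> Poly_Mapping.keys (sref n i \<mu>)"
        then have "?t k \<in> Poly_Mapping.keys \<mu>" using 2 by (auto simp: in_keys_iff sref_def lk_refl_less)
        then show "k \<in> B" unfolding B_def by (metis UnI2 image_eqI transpose_involutory)
      qed
      have "mon p (sref n i \<mu>) = (\<Prod>j\<in>B. p j powi lk \<mu> (?t j))"
        using mon_superset[OF \<open>finite B\<close> s, of p] 2 by (simp add: sref_def lk_refl_less)
      also have "\<dots> = (\<Prod>j\<in>?t ` B. p j powi lk \<mu> (?t j))" by (simp add: tB)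
      also have "\<dots> = (\<Prod>j\<in>B. p (?t j) powi lk \<mu> j)"
        by (subst prod.reindex) (auto intro!: inj_onI)
      also have "\<dots> = mon (spt n i p) \<mu>"
      proof -
        have "p (?t j) = spt n i p j" for j using 2 by (auto simp: spt_def transpose_eq)
        then show ?thesis using mon_superset[OF \<open>finite B\<close>, of \<mu> "spt n i p"] by (simp add: B_def)
      qed
      finally show ?thesis using 2 by (simp add: zc_def hom_1)
    next
      case 3
      have A: "mon (spt n i p) \<mu> = (1 / p n) powi lk \<mu> n * (\<Prod>j\<in>?A - {n}. p j powi lk \<mu> j)"
        unfolding m' using 3 by (subst prod.remove[of _ n]) (auto simp: spt_def intro!: arg_cong2[of _ _ _ _ "(*)"] prod.cong)
      have B: "mon p (sref n i \<mu>) = p n powi (- lk \<mu> n) * (\<Prod>j\<in>?A - {n}. p j powi lk \<mu> j)"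
        unfolding m using 3 by (subst prod.remove[of _ n]) (auto simp: sref_def intro!: arg_cong2[of _ _ _ _ "(*)"] prod.cong)
      show ?thesis unfolding A B using 3 by (simp add: zc_def hom_simps power_int_divide_distrib power_int_minus divide_simps)
    qed
  qed
  then show "ev p (rf n i (Poly_Mapping.single \<mu> c)) = ev (spt n i p) (Poly_Mapping.single \<mu> c)"
    by (simp add: rf_single' ev_single hom_mult mult_ac)
qed (simp_all add: rf_add ev_add)

text \<open>Injectivity of evaluation says that the coordinates are algebraically independent over
  the image of the coefficient field. Identities between values at such a point are identities of
  Laurent polynomials.\<close>

definition gen :: "(nat \<Rightarrow> 'k) \<Rightarrow> bool" where
  "gen p \<longleftrightarrow> (\<forall>i. p i \<noteq> 0) \<and> (\<forall>f. ev p f = 0 \<longrightarrow> f = 0)"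

lemma gen_nonzero: "gen p \<Longrightarrow> p i \<noteq> 0" by (simp add: gen_def)

lemma gen_eq_iff: "gen p \<Longrightarrow> ev p f = ev p g \<longleftrightarrow> f = g"
  using ev_diff[of p f g] by (auto simp: gen_def)

lemma m0_sref: "1 \<le> n \<Longrightarrow> zb n i (sref n i \<mu>) = - zb n i \<mu>"
  by (simp add: zb_def m0_def sref_def)

lemma sref_sref: "sref n i (sref n i \<mu>) = \<mu>"
  by (simp add: sref_def)

lemma rf_rf: assumes "1 \<le> n" shows "rf n i (rf n i f) = f"
proof (rule additive_eqI[of "\<lambda>f. rf n i (rf n i f)" "\<lambda>f. f"])
  fix \<mu> c
  show "rf n i (rf n i (Poly_Mapping.single \<mu> c)) = Poly_Mapping.single \<mu> c"
    by (simp add: rf_single' m0_sref[OF assms] sref_sref power_int_minus mult.assoc[symmetric])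
qed (simp_all add: rf_add)

lemma gen_spt: assumes "1 \<le> n" "gen p" shows "gen (spt n i p)"
  unfolding gen_def
proof (intro conjI allI impI)
  show "spt n i p j \<noteq> 0" for j using assms by (intro spt_nonzero) (simp add: gen_def)
  fix f assume "ev (spt n i p) f = 0"
  then have "ev p (rf n i f) = 0" using assms by (simp add: ev_rf gen_def)
  then have "rf n i f = 0" using assms by (simp add: gen_def)
  then have "rf n i (rf n i f) = rf n i 0" by simp
  moreover have "rf n i 0 = 0" using rf_add[of n i 0 0] by (metis add_0 add_cancel_right_right)
  ultimately show "f = 0" by (simp add: rf_rf[OF assms(1)])
qed

definition zv :: "nat \<Rightarrow> nat \<Rightarrow> (nat \<Rightarrow> 'k) \<Rightarrow> 'k" where
  "zv n i p = (if i = 0 then \<iota> q_h / p 1 else if i < n then p i / p (Suc i) else p n)"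

definition hh :: "nat \<Rightarrow> nat \<Rightarrow> coeff" where "hh n i = kap n i - 1 / kap n i"

text \<open>The coefficient of the unreflected value in the operator \<open>i\<close>: it is
  \<open>\<kappa>\<close> minus
  \<open>\<kappa>^-1 (1 + \<gamma> z - \<kappa>^2 z^d) / (1 - z^d)\<close>, simplified. The
  reflected value gets the complement to \<open>\<kappa>\<close>.\<close>

definition bb :: "nat \<Rightarrow> nat \<Rightarrow> (nat \<Rightarrow> 'k) \<Rightarrow> 'k" where
  "bb n i p = (\<iota> (hh n i) - \<iota> (gam n i / kap n i) * zv n i p) / (1 - zv n i p powi zd n i)"

lemma ev_zp: assumes "gen p" shows "ev p (zp n i k) = zv n i p powi k"
proof -
  have nz: "\<And>i. p i \<noteq> 0" using assms by (simp add: gen_def)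
  have "mon p (x - y) = mon p x / mon p y" for x y
    using mon_add[where p = p, OF nz, of x "- y"] mon_uminus[where p = p, OF nz, of y] by (simp add: divide_inverse)
  then have "zv n i p = \<iota> (zc i) * mon p (ze n i)"
    by (auto simp: zv_def ze_def zc_def mon_uminus[OF nz] hom_1 divide_inverse)
  then show ?thesis by (simp add: zp_def ev_single mon_frag hom_powi power_int_mult_distrib)
qed

lemma zv_den: assumes "1 \<le> n" "gen p" shows "1 - zv n i p powi zd n i \<noteq> 0"
proof -
  have "ev p (zden n i) = 1 - zv n i p powi zd n i" by (simp add: zden_def ev_diff ev_zp assms)
  moreover have "ev p (zden n i) \<noteq> 0" using zden_nonzero[OF assms(1)] assms(2) by (auto simp: gen_def)
  ultimately show ?thesis by simp
qed

lemma zv_nonzero: "gen p \<Longrightarrow> zv n i p \<noteq> 0"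
  by (simp add: zv_def gen_def)

lemma ev_hecke: assumes "1 \<le> n" "i \<le> n" "gen p"
  shows "ev p (hecke n i f) = bb n i p * ev p f + (\<iota> (kap n i) - bb n i p) * ev (spt n i p) f"
proof -
  have nz: "\<And>i. p i \<noteq> 0" using assms by (simp add: gen_def)
  obtain h where h: "zden n i * h = f - rf n i f" using divided_difference by metis
  let ?z = "zv n i p" and ?k = "\<iota> (kap n i)"
  have D: "1 - ?z powi zd n i \<noteq> 0" by (rule zv_den[OF assms(1,3)])
  have "ev p (zden n i) * ev p h = ev p f - ev (spt n i p) f"
    using arg_cong[OF h, of "ev p"] by (simp add: ev_mult[OF nz] ev_diff ev_rf[OF nz])
  then have eh: "ev p h = (ev p f - ev (spt n i p) f) / (1 - ?z powi zd n i)"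
    using D by (simp add: zden_def ev_diff ev_zp assms field_simps)
  have num: "ev p (znum n i) = 1 + \<iota> (gam n i) * ?z - ?k ^ 2 * ?z powi zd n i"
    by (simp add: znum_def ev_add ev_diff ev_mult[OF nz] ev_zp assms hom_simps)
  have "ev p (hecke n i f) = 1 / ?k * (?k ^ 2 * ev p f - ev p (znum n i) * ev p h)"
    unfolding hecke_eq[OF assms(1) h assms(2)] ev_mult[OF nz] ev_diff ev_scal by (simp add: hom_simps)
  also have "\<dots> = bb n i p * ev p f + (?k - bb n i p) * ev (spt n i p) f"
    unfolding eh num bb_def hh_def hom_simps using D by (simp add: divide_simps) (simp add: algebra_simps power2_eq_square)
  finally show ?thesis .
qed

end

section \<open>The endomorphism ring of an abelian group\<close>

typedef (overloaded) 'v endo = "{f :: 'v::ab_group_add \<Rightarrow> 'v. \<forall>x y. f (x + y) = f x + f y}"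
  morphisms app Endo
  by (rule exI[of _ "\<lambda>x. x"]) simp

setup_lifting type_definition_endo

text \<open>The sorts \<open>ring\<close> and \<open>monoid_mult\<close> are taken instead of
  \<open>ring_1\<close>, since over the trivial group zero and one coincide.\<close>

instantiation endo :: (ab_group_add) "{ring, monoid_mult}"
begin

lift_definition zero_endo :: "'a endo" is "\<lambda>_. 0" by simp
lift_definition one_endo :: "'a endo" is "\<lambda>x. x" by simp
lift_definition plus_endo :: "'a endo \<Rightarrow> 'a endo \<Rightarrow> 'a endo" is "\<lambda>f g x. f x + g x" by (simp add: ac_simps)
lift_definition minus_endo :: "'a endo \<Rightarrow> 'a endo \<Rightarrow> 'a endo" is "\<lambda>f g x. f x - g x" by simp
lift_definition uminus_endo :: "'a endo \<Rightarrow> 'a endo" is "\<lambda>f x. - f x" by simp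
lift_definition times_endo :: "'a endo \<Rightarrow> 'a endo \<Rightarrow> 'a endo" is "\<lambda>f g x. f (g x)" by simp

instance
  by standard (transfer; force simp: algebra_simps)+

end

lemma app_Endo: "(\<And>x y. f (x + y) = f x + f y) \<Longrightarrow> app (Endo f) x = f x"
  by (simp add: Endo_inverse)

lemma app_simps [simp]: "app 0 x = 0" "app 1 x = x" "app (f + g) x = app f x + app g x"
  "app (f - g) x = app f x - app g x" "app (- f) x = - app f x" "app (f * g) x = app f (app g x)"
  by (transfer; simp)+

lemma app_add: "app f (x + y) = app f x + app f y"
  by transfer simp

lemma app_zero [simp]: "app f 0 = 0"
  using app_add[of f 0 0] by (metis add_0 add_cancel_right_right)

lemma app_diff: "app f (x - y) = app f x - app f y"
  using app_add[of f "x - y" y] by simp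

lemma app_sum: "app f (sum g A) = (\<Sum>x\<in>A. app f (g x))"
  by (induction A rule: infinite_finite_induct) (simp_all add: app_add)

lemma app_sum_left: "app (sum F A) x = (\<Sum>a\<in>A. app (F a) x)"
  by (induction A rule: infinite_finite_induct) simp_all

lemma endo_eqI: "(\<And>x. app f x = app g x) \<Longrightarrow> f = g"
  by (simp add: app_inject[symmetric] fun_eq_iff)

section \<open>The Hecke algebra acting on functions of points\<close>

locale eval_rep = coeff_hom +
  fixes n :: nat
  assumes n_pos: "1 \<le> n"
begin

abbreviation sp where "sp \<equiv> spt n"

text \<open>At points that are not generic the operator is multiplication by
  \<open>\<kappa>\<close>. This scalar satisfies the same quadratic and braid relations, so the
  relations hold on all functions without restricting their domain.\<close>

definition FT :: "nat \<Rightarrow> ((nat \<Rightarrow> 'a) \<Rightarrow> 'a) \<Rightarrow> (nat \<Rightarrow> 'a) \<Rightarrow> 'a" where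
  "FT i F p = (if gen p then bb n i p * F p + (\<iota> (kap n i) - bb n i p) * F (sp i p) else \<iota> (kap n i) * F p)"

lemma FT_gen: "gen p \<Longrightarrow> FT i F p = bb n i p * F p + (\<iota> (kap n i) - bb n i p) * F (sp i p)"
  by (simp add: FT_def)

lemma gen_sp [simp]: "gen p \<Longrightarrow> gen (sp i p)"
  by (rule gen_spt[OF n_pos])

lemma sp_sp: "gen p \<Longrightarrow> i \<le> n \<Longrightarrow> sp i (sp i p) = p"
  using gen_nonzero[of p 1] by (auto simp: spt_def fun_eq_iff)

lemma zv_sp_same: "gen p \<Longrightarrow> i \<le> n \<Longrightarrow> zv n i (sp i p) = 1 / zv n i p"
  using gen_nonzero[of p] by (auto simp: spt_def zv_def hom_simps power2_eq_square field_simps)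

definition el :: "'a \<Rightarrow> 'a \<Rightarrow> 'a" where "el h z = h / (1 - z)"
definition es :: "'a \<Rightarrow> 'a \<Rightarrow> 'a \<Rightarrow> 'a" where "es h g z = (h - g * z) / (1 - z ^ 2)"

lemma bb_el: "0 < i \<Longrightarrow> i < n \<Longrightarrow> bb n i p = el (\<iota> (hh n i)) (zv n i p)"
  by (simp add: bb_def el_def gam_def zd_def)

lemma bb_es: "i = 0 \<or> i = n \<Longrightarrow> bb n i p = es (\<iota> (hh n i)) (\<iota> (gam n i / kap n i)) (zv n i p)"
  by (auto simp: bb_def es_def zd_def)

lemma el_inv: "z \<noteq> 0 \<Longrightarrow> z \<noteq> 1 \<Longrightarrow> el h (1 / z) = h - el h z"
  by (simp add: el_def divide_simps) (simp add: algebra_simps)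

lemma es_inv: "z \<noteq> 0 \<Longrightarrow> z ^ 2 \<noteq> 1 \<Longrightarrow> es h g (1 / z) = h - es h g z"
  by (simp add: es_def divide_simps) (simp add: algebra_simps power2_eq_square)

lemma zv_ne: assumes "gen p" shows "0 < i \<Longrightarrow> i < n \<Longrightarrow> zv n i p \<noteq> 1" "i = 0 \<or> i = n \<Longrightarrow> zv n i p ^ 2 \<noteq> 1"
  using zv_den[OF n_pos assms, of i] by (auto simp: zd_def)

text \<open>Reflecting the point inverts \<open>z\<close>. That the two coefficients add up to
  \<open>hh\<close> is, together with \<open>kap_hh\<close>, the content of the quadratic
  relation.\<close>

lemma bb_sp: assumes "gen p" "i \<le> n" shows "bb n i (sp i p) = \<iota> (hh n i) - bb n i p"
proof (cases "0 < i \<and> i < n")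
  case True
  then show ?thesis using zv_ne[OF assms(1), of i] zv_nonzero[OF assms(1), of n i] zv_sp_same[OF assms]
    by (simp add: bb_el el_inv)
next
  case False
  then have "i = 0 \<or> i = n" using assms(2) by linarith
  then show ?thesis using zv_ne[OF assms(1), of i] zv_nonzero[OF assms(1), of n i] zv_sp_same[OF assms]
    by (simp add: bb_es es_inv)
qed

lemma kap_hh: "\<iota> (kap n i) * (\<iota> (kap n i) - \<iota> (hh n i)) = 1"
  by (simp add: hh_def hom_simps)

lemma FT_quad: assumes "i \<le> n"
  shows "FT i (FT i F) p = \<iota> (hh n i) * FT i F p + F p"
proof (cases "gen p")
  case True
  let ?b = "bb n i p" and ?k = "\<iota> (kap n i)" and ?h = "\<iota> (hh n i)"
  have "?b * (?b * F p + (?k - ?b) * F (sp i p)) + (?k - ?b) * ((?h - ?b) * F (sp i p) + (?k - (?h - ?b)) * F p)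
     = ?h * (?b * F p + (?k - ?b) * F (sp i p)) + F p"
    using kap_hh[of i] by algebra
  then show ?thesis using True assms by (simp add: FT_gen bb_sp sp_sp)
next
  case False
  have "\<iota> (kap n i) * (\<iota> (kap n i) * F p) = \<iota> (hh n i) * (\<iota> (kap n i) * F p) + F p"
    using kap_hh[of i] by algebra
  then show ?thesis using False by (simp add: FT_def)
qed

lemma sp_far: "gen p \<Longrightarrow> i + 2 \<le> j \<Longrightarrow> j \<le> n \<Longrightarrow> sp i (sp j p) = sp j (sp i p)"
  by (auto simp: spt_def fun_eq_iff)

lemma zv_far: "i + 2 \<le> j \<Longrightarrow> j \<le> n \<Longrightarrow> zv n i (sp j p) = zv n i p" "i + 2 \<le> j \<Longrightarrow> j \<le> n \<Longrightarrow> zv n j (sp i p) = zv n j p"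
  by (auto simp: spt_def zv_def)

lemma bb_cong: "zv n i p = zv n i q \<Longrightarrow> bb n i p = bb n i q"
  by (simp add: bb_def)

lemma FT_far: assumes "i + 2 \<le> j" "j \<le> n" shows "FT i (FT j F) = FT j (FT i F)"
proof
  fix p
  show "FT i (FT j F) p = FT j (FT i F) p"
  proof (cases "gen p")
    case True
    have "bb n i (sp j p) = bb n i p" "bb n j (sp i p) = bb n j p"
      using zv_far[OF assms] by (auto intro: bb_cong)
    then show ?thesis using True sp_far[OF True assms] by (simp add: FT_gen algebra_simps)
  qed (simp add: FT_def)
qed

text \<open>This is the hypothesis \<open>R\<close> of \<open>braid3_identity\<close>: an addition
  rule for the rational function \<open>h / (1 - z)\<close>.\<close>

lemma el_rel:
  assumes "1 - z \<noteq> 0" "1 - w \<noteq> 0" "1 - z * w \<noteq> 0"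
  shows "el h (z * w) * (h - el h z) + el h z * el h w - el h w * el h (z * w) = 0"
  using assms by (simp add: el_def divide_simps) (simp add: algebra_simps)

text \<open>This is the hypothesis \<open>R\<close> of \<open>braid4_identity\<close>. After
  clearing the four denominators it is a polynomial identity.\<close>

lemma es_rel:
  assumes "1 - z ^ 2 \<noteq> 0" "1 - (z * w) ^ 2 \<noteq> 0" "1 - w \<noteq> 0" "1 - w * z ^ 2 \<noteq> 0"
  shows "es h' g z * el h w - es h' g z * el h (w * z ^ 2) - es h' g (z * w) * el h w
    - es h' g (z * w) * el h (w * z ^ 2) + h' * el h (w * z ^ 2) + h * es h' g (z * w) = 0"
proof -
  define A B C D where "A = 1 - z ^ 2" and "B = 1 - (z * w) ^ 2" and "C = 1 - w" and "D = 1 - w * z ^ 2"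
  have nz: "A \<noteq> 0" "B \<noteq> 0" "C \<noteq> 0" "D \<noteq> 0" using assms by (auto simp: A_def B_def C_def D_def)
  have "(h' - g * z) * h * B * D - (h' - g * z) * h * B * C - (h' - g * (z * w)) * h * A * D
    - (h' - g * (z * w)) * h * A * C + h' * h * A * B * C + h * (h' - g * (z * w)) * A * C * D = 0"
    unfolding A_def B_def C_def D_def by algebra
  then show ?thesis unfolding es_def el_def A_def[symmetric] B_def[symmetric] C_def[symmetric] D_def[symmetric]
    using nz by (simp add: divide_simps) (simp add: algebra_simps)
qed

lemma FT_braid3:
  assumes i: "1 \<le> i" "i + 1 < n"
  shows "FT i (FT (i+1) (FT i F)) = FT (i+1) (FT i (FT (i+1) F))"
proof
  fix p
  let ?j = "i + 1"
  show "FT i (FT ?j (FT i F)) p = FT ?j (FT i (FT ?j F)) p"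
  proof (cases "gen p")
    case True
    have nz: "\<And>k. p k \<noteq> 0" using True by (simp add: gen_nonzero)
    define h where "h = \<iota> (hh n i)"
    have hj: "\<iota> (hh n ?j) = h" "\<iota> (kap n ?j) = \<iota> (kap n i)" using i by (simp_all add: h_def hh_def kap_def)
    define z w where "z = zv n i p" and "w = zv n ?j p"
    have zz: "zv n i (sp ?j p) = z * w" "zv n ?j (sp i p) = z * w" "zv n i (sp ?j (sp i p)) = w" "zv n ?j (sp i (sp ?j p)) = z"
      using i nz by (auto simp: z_def w_def zv_def spt_def)
    have e: "bb n i q = el h (zv n i q)" "bb n ?j q = el h (zv n ?j q)" for q
      using i hj bb_el[of i] bb_el[of ?j] by (simp_all add: h_def)
    have b: "bb n i p = el h z" "bb n ?j p = el h w"
      "bb n i (sp ?j p) = el h (z * w)" "bb n ?j (sp i p) = el h (z * w)"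
      "bb n i (sp ?j (sp i p)) = el h w" "bb n ?j (sp i (sp ?j p)) = el h z"
      unfolding e zz by (simp_all add: z_def w_def)
    have b': "bb n i (sp i p) = h - el h z" "bb n ?j (sp ?j p) = h - el h w"
      using bb_sp[of p i] bb_sp[of p ?j] b(1,2) i True hj by (simp_all add: h_def)
    have ss: "sp i (sp i p) = p" "sp ?j (sp ?j p) = p" "sp i (sp ?j (sp i p)) = sp ?j (sp i (sp ?j p))"
      using i True by (auto simp: sp_sp spt_def fun_eq_iff)
    have den: "1 - z \<noteq> 0" "1 - w \<noteq> 0" "1 - z * w \<noteq> 0"
      using zv_ne(1)[of p i] zv_ne(1)[of p ?j] zv_ne(1)[of "sp ?j p" i] i True zz by (auto simp: z_def w_def)
    have k: "\<iota> (kap n i) * (\<iota> (kap n i) - h) = 1" using kap_hh[of i] by (simp add: h_def)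
    show ?thesis
      using braid3_identity[OF el_rel[OF den, of h] k, of "F p" "F (sp i p)" "F (sp ?j p)" "F (sp i (sp ?j p))"
          "F (sp ?j (sp i p))" "F (sp ?j (sp i (sp ?j p)))"] True
      by (simp only: FT_gen gen_sp b b' ss hj)
  next
    case False
    then show ?thesis using i by (simp add: FT_def kap_def)
  qed
qed

lemma sp_braid4:
  assumes n: "2 \<le> n" and ab: "a = 0 \<and> b = 1 \<or> a = n \<and> b + 1 = n"
  shows "sp b (sp a (sp b (sp a p))) = sp a (sp b (sp a (sp b p)))"
  using ab
proof
  assume *: "a = 0 \<and> b = 1"
  have "sp 0 p = p(1 := \<iota> q_par / p 1)" "sp 1 p = p(1 := p 2, 2 := p 1)" for p
    using n by (auto simp: spt_def numeral_2_eq_2)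
  then show ?thesis using * by (simp only: fun_eq_iff) simp
next
  assume *: "a = n \<and> b + 1 = n"
  then have "sp n p = p(n := 1 / p n)" "sp b p = p(b := p n, n := p b)" for p
    using n by (auto simp: spt_def)
  then show ?thesis using * by (simp only: fun_eq_iff) auto
qed

text \<open>\<open>a\<close> is an end of the affine Dynkin diagram and \<open>b\<close> its neighbour.\<close>

lemma FT_braid4:
  assumes n: "2 \<le> n" and ab: "a = 0 \<and> b = 1 \<or> a = n \<and> b + 1 = n"
  shows "FT a (FT b (FT a (FT b F))) = FT b (FT a (FT b (FT a F)))"
proof
  fix p
  show "FT a (FT b (FT a (FT b F))) p = FT b (FT a (FT b (FT a F))) p"
  proof (cases "gen p")
    case True
    have nz: "\<And>k. p k \<noteq> 0" using True by (simp add: gen_nonzero)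
    have ab': "a \<le> n" "b \<le> n" "0 < b" "b < n" "a = 0 \<or> a = n" using ab n by auto
    define h h' g where "h = \<iota> (hh n b)" and "h' = \<iota> (hh n a)" and "g = \<iota> (gam n a / kap n a)"
    define z w where "z = zv n a p" and "w = zv n b p"
    have sa: "zv n b (sp a q) = zv n b q * zv n a q ^ 2" "zv n a (sp b q) = zv n a q * zv n b q" if "gen q" for q
      using ab n gen_nonzero[OF that] by (auto simp: zv_def spt_def hom_simps power2_eq_square field_simps)
    have znz: "z \<noteq> 0" "w \<noteq> 0" using True by (auto simp: z_def w_def zv_nonzero)
    have zz: "zv n b (sp a p) = w * z ^ 2" "zv n a (sp b p) = z * w"
      "zv n a (sp a p) = 1 / z" "zv n b (sp b p) = 1 / w"
      using True ab' by (simp_all add: sa zv_sp_same z_def w_def)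
    then have zz2: "zv n a (sp b (sp a p)) = z * w" "zv n b (sp b (sp a p)) = 1 / (w * z ^ 2)"
      "zv n a (sp a (sp b p)) = 1 / (z * w)" "zv n b (sp a (sp b p)) = w * z ^ 2"
      using True ab' znz by (simp_all add: sa zv_sp_same power2_eq_square z_def[symmetric] w_def[symmetric])
    then have zz3: "zv n a (sp a (sp b (sp a p))) = 1 / (z * w)" "zv n b (sp a (sp b (sp a p))) = w"
      "zv n a (sp b (sp a (sp b p))) = z"
      using True ab' znz by (simp_all add: sa zv_sp_same power2_eq_square z_def[symmetric] w_def[symmetric])
    have bB: "bb n b q = el h (zv n b q)" and bA: "bb n a q = es h' g (zv n a q)" for q
      using bb_el[of b q] bb_es[of a q] ab' by (simp_all add: h_def h'_def g_def)
    have den: "1 - z ^ 2 \<noteq> 0" "1 - (z * w) ^ 2 \<noteq> 0" "1 - w \<noteq> 0" "1 - w * z ^ 2 \<noteq> 0"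
      using zv_ne[of p a] zv_ne[of p b] zv_ne[of "sp a p" b] zv_ne[of "sp b p" a] ab' True zz by (auto simp: z_def w_def)
    then have inv: "es h' g (1 / z) = h' - es h' g z" "es h' g (1 / (z * w)) = h' - es h' g (z * w)"
      "el h (1 / w) = h - el h w" "el h (1 / (w * z ^ 2)) = h - el h (w * z ^ 2)"
      using znz by (auto simp del: divide_divide_eq_left intro!: es_inv el_inv)
    have ss: "sp a (sp a q) = q" "sp b (sp b q) = q" if "gen q" for q using that ab' by (auto simp: sp_sp)
    have W: "sp b (sp a (sp b (sp a p))) = sp a (sp b (sp a (sp b p)))"
      using sp_braid4[OF n ab, of p] .
    have k: "\<iota> (kap n b) * (\<iota> (kap n b) - h) = 1" "\<iota> (kap n a) * (\<iota> (kap n a) - h') = 1"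
      using kap_hh by (simp_all add: h_def h'_def)
    show ?thesis
      using braid4_identity[OF es_rel[OF den, of h' g h] k, of "F p" "F (sp b p)" "F (sp a p)" "F (sp b (sp a p))"
          "F (sp a (sp b p))" "F (sp b (sp a (sp b p)))" "F (sp a (sp b (sp a p)))" "F (sp a (sp b (sp a (sp b p))))"] True
      by (simp only: FT_gen gen_sp bA bB zz zz2 zz3 inv ss W z_def[symmetric] w_def[symmetric])
  next
    case False
    then show ?thesis by (simp add: FT_def)
  qed
qed

end

context eval_rep
begin

definition FTe :: "nat \<Rightarrow> ((nat \<Rightarrow> 'a) \<Rightarrow> 'a) endo" where "FTe i = Endo (FT i)"
definition Fhe :: "nat \<Rightarrow> ((nat \<Rightarrow> 'a) \<Rightarrow> 'a) endo" where "Fhe i = Endo (\<lambda>F p. \<iota> (hh n i) * F p)"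

lemma app_FTe [simp]: "app (FTe i) F = FT i F"
  unfolding FTe_def by (rule app_Endo) (auto simp: FT_def fun_eq_iff algebra_simps)

lemma app_Fhe [simp]: "app (Fhe i) F = (\<lambda>p. \<iota> (hh n i) * F p)"
  unfolding Fhe_def by (rule app_Endo) (auto simp: fun_eq_iff algebra_simps)

lemma FT_scale: "FT i (\<lambda>p. c * F p) = (\<lambda>p. c * FT i F p)"
  by (auto simp: FT_def fun_eq_iff algebra_simps)

sublocale FH: affine_hecke n FTe Fhe
proof
  fix i j assume "i \<le> n" "j \<le> n"
  show "Fhe i * FTe j = FTe j * Fhe i" by (rule endo_eqI) (simp add: FT_scale)
  show "Fhe i * Fhe j = Fhe j * Fhe i" by (rule endo_eqI) (simp add: fun_eq_iff)
next
  fix i j assume "1 \<le> i" "i < n" "1 \<le> j" "j < n"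
  then show "Fhe i = Fhe j" by (intro endo_eqI) (simp add: hh_def kap_def)
next
  fix i assume "i \<le> n"
  then show "FTe i * FTe i = Fhe i * FTe i + 1" by (intro endo_eqI) (simp add: fun_eq_iff FT_quad)
next
  fix i j assume "i + 2 \<le> j" "j \<le> n"
  then show "FTe i * FTe j = FTe j * FTe i" using FT_far[of i j] by (intro endo_eqI) simp
next
  fix i assume "1 \<le> i" "i + 1 < n"
  then show "FTe i * FTe (i + 1) * FTe i = FTe (i + 1) * FTe i * FTe (i + 1)"
    using FT_braid3[of i] by (intro endo_eqI) simp
next
  fix i assume i: "i = 0 \<or> i + 1 = n" "i + 1 \<le> n" "2 \<le> n"
  then consider "i = 0" | "i + 1 = n" by blast
  then show "FTe i * FTe (i + 1) * FTe i * FTe (i + 1) = FTe (i + 1) * FTe i * FTe (i + 1) * FTe i"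
  proof cases
    case 1
    then show ?thesis using FT_braid4[of 0 1] i by (intro endo_eqI) simp
  next
    case 2
    then have "FT (i+1) (FT i (FT (i+1) (FT i F))) = FT i (FT (i+1) (FT i (FT (i+1) F)))" for F
      by (intro FT_braid4) (use i in auto)
    then show ?thesis by (intro endo_eqI) (simp only: app_simps app_FTe)
  qed
qed (rule n_pos)

text \<open>The value 0 at points that are not generic is compatible with the default of
  \<open>FT\<close>, so that \<open>evf_hecke\<close> is an equality of functions.\<close>

definition evf :: "laurent \<Rightarrow> (nat \<Rightarrow> 'a) \<Rightarrow> 'a" where
  "evf f p = (if gen p then ev p f else 0)"

lemma evf_add: "evf (f + g) = evf f + evf g"
  by (auto simp: evf_def ev_add fun_eq_iff)

lemma evf_diff: "evf (f - g) = evf f - evf g"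
  by (auto simp: evf_def ev_diff fun_eq_iff)

lemma evf_scal: "evf (scal c * f) = (\<lambda>p. \<iota> c * evf f p)"
  using gen_nonzero by (auto simp: evf_def ev_mult fun_eq_iff)

lemma evf_hecke: "i \<le> n \<Longrightarrow> evf (hecke n i f) = FT i (evf f)"
  using n_pos by (auto simp: evf_def fun_eq_iff FT_def ev_hecke)

lemma evf_inj: "gen p \<Longrightarrow> evf f = evf g \<Longrightarrow> f = g"
  by (metis evf_def gen_eq_iff)

end

section \<open>The tautological point, and the relations for the operators on Laurent
  polynomials\<close>

definition base_hom :: "coeff \<Rightarrow> laurent fract" where "base_hom c = to_fract (scal c)"

definition base_pt :: "nat \<Rightarrow> laurent fract" where "base_pt i = to_fract (var i)"

interpretation base: coeff_hom base_hom
  by standard (simp_all add: base_hom_def)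

lemma to_fract_mono_add: "to_fract (mono (\<mu> + \<nu>)) = to_fract (mono \<mu>) * to_fract (mono \<nu>)"
  by (simp add: mult_single flip: to_fract_mult)

lemma to_fract_mono_single: "to_fract (mono (Poly_Mapping.single i k)) = base_pt i powi k"
proof -
  have nat: "to_fract (mono (Poly_Mapping.single i (int m))) = base_pt i ^ m" for m
  proof (induction m)
    case (Suc m)
    have "Poly_Mapping.single i (int (Suc m)) = Poly_Mapping.single i 1 + Poly_Mapping.single i (int m)"
      by (simp flip: single_add)
    then show ?case using Suc by (simp only: to_fract_mono_add) (simp add: base_pt_def var_def)
  qed simp
  show ?thesis
  proof (cases k rule: int_cases2)
    case (nonneg m) then show ?thesis using nat by simp
  next
    case (nonpos m)
    have "to_fract (mono (Poly_Mapping.single i k)) * base_pt i ^ m = 1"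
      unfolding nat[symmetric] to_fract_mono_add[symmetric] nonpos by (simp flip: single_add)
    moreover have "base_pt i \<noteq> 0" by (simp add: base_pt_def var_def)
    ultimately show ?thesis using nonpos by (simp add: power_int_minus field_simps)
  qed
qed

lemma base_mon: "base.mon base_pt \<mu> = to_fract (mono \<mu>)"
proof -
  have nz: "base_pt i \<noteq> 0" for i by (simp add: base_pt_def var_def)
  have "base.mon base_pt (\<Sum>i\<in>A. Poly_Mapping.single i (c i)) = to_fract (mono (\<Sum>i\<in>A. Poly_Mapping.single i (c i)))"
    if "finite A" for A and c :: "nat \<Rightarrow> int"
    using that by (induction A) (simp_all add: base.mon_add[OF nz] to_fract_mono_add to_fract_mono_single)
  from this[of "Poly_Mapping.keys \<mu>" "lk \<mu>"] show ?thesis by (simp flip: pm_sum_single)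
qed

text \<open>The point with coordinates \<open>x_i\<close> in the fraction field evaluates every
  Laurent polynomial to itself, so it is generic.\<close>

lemma base_ev: "base.ev base_pt f = to_fract f"
proof (rule additive_eqI[of "base.ev base_pt"])
  fix \<mu> c
  show "base.ev base_pt (Poly_Mapping.single \<mu> c) = to_fract (Poly_Mapping.single \<mu> c)"
    by (simp add: base.ev_single base_mon base_hom_def scal_single flip: to_fract_mult)
qed (simp_all add: base.ev_add)

lemma base_gen: "base.gen base_pt"
  by (simp add: base.gen_def base_ev base_pt_def var_def)

locale rank = fixes n :: nat assumes n_pos: "1 \<le> n"
begin

sublocale base: eval_rep base_hom n
  by standard (rule n_pos)

definition LT :: "nat \<Rightarrow> laurent endo" where "LT i = Endo (hecke n i)"
definition Lh :: "nat \<Rightarrow> laurent endo" where "Lh i = Endo (\<lambda>f. scal (base.hh n i) * f)"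

lemma app_LT: "i \<le> n \<Longrightarrow> app (LT i) f = hecke n i f"
  unfolding LT_def by (rule app_Endo) (rule hecke_add[OF n_pos])

lemma app_Lh: "app (Lh i) f = scal (base.hh n i) * f"
  unfolding Lh_def by (rule app_Endo) (simp add: distrib_left)

lemmas base_evf_inj = base.evf_inj[OF base_gen]

text \<open>The relations are pulled back from functions: \<open>evf\<close> intertwines the
  operators, and it is injective because a generic point exists.\<close>

lemma hecke_rel:
  shows "i \<le> n \<Longrightarrow> hecke n i (hecke n i f) = scal (base.hh n i) * hecke n i f + f"
    and "i + 2 \<le> j \<Longrightarrow> j \<le> n \<Longrightarrow> hecke n i (hecke n j f) = hecke n j (hecke n i f)"
    and "1 \<le> i \<Longrightarrow> i + 1 < n \<Longrightarrow> hecke n i (hecke n (i+1) (hecke n i f)) = hecke n (i+1) (hecke n i (hecke n (i+1) f))"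
    and "i = 0 \<or> i + 1 = n \<Longrightarrow> i + 1 \<le> n \<Longrightarrow> 2 \<le> n \<Longrightarrow>
      hecke n i (hecke n (i+1) (hecke n i (hecke n (i+1) f))) = hecke n (i+1) (hecke n i (hecke n (i+1) (hecke n i f)))"
proof -
  show "i \<le> n \<Longrightarrow> hecke n i (hecke n i f) = scal (base.hh n i) * hecke n i f + f"
    by (rule base_evf_inj) (simp add: base.evf_hecke base.evf_add base.evf_scal fun_eq_iff base.FT_quad)
  show "i + 2 \<le> j \<Longrightarrow> j \<le> n \<Longrightarrow> hecke n i (hecke n j f) = hecke n j (hecke n i f)"
    by (rule base_evf_inj) (use base.FT_far[of i j] in \<open>simp add: base.evf_hecke\<close>)
  show "1 \<le> i \<Longrightarrow> i + 1 < n \<Longrightarrow> hecke n i (hecke n (i+1) (hecke n i f)) = hecke n (i+1) (hecke n i (hecke n (i+1) f))"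
    by (rule base_evf_inj) (use base.FT_braid3[of i] in \<open>simp add: base.evf_hecke\<close>)
  show "i = 0 \<or> i + 1 = n \<Longrightarrow> i + 1 \<le> n \<Longrightarrow> 2 \<le> n \<Longrightarrow>
      hecke n i (hecke n (i+1) (hecke n i (hecke n (i+1) f))) = hecke n (i+1) (hecke n i (hecke n (i+1) (hecke n i f)))"
    using arg_cong[OF base.FH.braid4[of i], of "\<lambda>x. app x (base.evf f)"]
    by (intro base_evf_inj) (simp add: base.evf_hecke)
qed

sublocale LH: affine_hecke n LT Lh
proof
  fix i j assume a: "i \<le> n" "j \<le> n"
  show "Lh i * LT j = LT j * Lh i" by (rule endo_eqI) (simp add: app_LT app_Lh a hecke_scal[OF n_pos a(2)] del: scal_simps)
  show "Lh i * Lh j = Lh j * Lh i" by (rule endo_eqI) (simp add: app_Lh mult.left_commute)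
next
  fix i j assume "1 \<le> i" "i < n" "1 \<le> j" "j < n"
  then show "Lh i = Lh j" by (intro endo_eqI) (simp add: app_Lh base.hh_def kap_def)
next
  fix i assume "i \<le> n"
  then show "LT i * LT i = Lh i * LT i + 1" by (intro endo_eqI) (simp add: app_LT app_Lh hecke_rel)
next
  fix i j assume "i + 2 \<le> j" "j \<le> n"
  then show "LT i * LT j = LT j * LT i" using hecke_rel(2)[of i j] by (intro endo_eqI) (simp add: app_LT)
next
  fix i assume "1 \<le> i" "i + 1 < n"
  then show "LT i * LT (i + 1) * LT i = LT (i + 1) * LT i * LT (i + 1)"
    using hecke_rel(3)[of i] by (intro endo_eqI) (simp add: app_LT)
next
  fix i assume "i = 0 \<or> i + 1 = n" "i + 1 \<le> n" "2 \<le> n"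
  then show "LT i * LT (i + 1) * LT i * LT (i + 1) = LT (i + 1) * LT i * LT (i + 1) * LT i"
    using hecke_rel(4)[of i] by (intro endo_eqI) (simp add: app_LT)
qed (rule n_pos)

end

section \<open>Evaluation carries \<open>Z\<close> on Laurent polynomials to \<open>Z\<close> on
  functions\<close>

context eval_rep
begin

interpretation rank n by standard (rule n_pos)

definition intw :: "laurent endo \<Rightarrow> ((nat \<Rightarrow> 'a) \<Rightarrow> 'a) endo \<Rightarrow> bool" where
  "intw x y \<longleftrightarrow> (\<forall>f. evf (app x f) = app y (evf f))"

lemma intw_intros:
  "intw 1 1" "intw x y \<Longrightarrow> intw x' y' \<Longrightarrow> intw (x + x') (y + y')"
  "intw x y \<Longrightarrow> intw x' y' \<Longrightarrow> intw (x - x') (y - y')"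
  "intw x y \<Longrightarrow> intw x' y' \<Longrightarrow> intw (x * x') (y * y')"
  by (simp_all add: intw_def evf_add evf_diff)

lemma intw_sum: "(\<And>a. a \<in> A \<Longrightarrow> intw (f a) (g a)) \<Longrightarrow> intw (sum f A) (sum g A)"
proof (induction A rule: infinite_finite_induct)
  have "intw 0 0" using intw_intros(3)[OF intw_intros(1) intw_intros(1)] by simp
  then show "intw (sum f {}) (sum g {})" by simp
  show "intw (sum f A) (sum g A)" if "infinite A" for A using \<open>intw 0 0\<close> that by simp
qed (simp add: intw_intros)

lemma intw_T: "i \<le> n \<Longrightarrow> intw (LT i) (FTe i)"
  by (simp add: intw_def app_LT evf_hecke)

lemma intw_Ti: "i \<le> n \<Longrightarrow> intw (LH.Ti i) (FH.Ti i)"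
  unfolding LH.Ti_def FH.Ti_def
  by (intro intw_intros intw_T) (simp_all add: intw_def app_Lh evf_scal)

lemma intw_R: "k < n \<Longrightarrow> intw (LH.R k) (FH.R k) \<and> intw (LH.Ri k) (FH.Ri k)"
  by (induction k) (auto intro!: intw_intros intw_T intw_Ti)

lemma intw_Y: "j \<le> n \<Longrightarrow> intw (LH.Y j) (FH.Y j) \<and> intw (LH.Yi j) (FH.Yi j)"
proof (induction j rule: LH.Y.induct)
  case 2
  then show ?case using intw_R[of "n - 1"] n_pos by (auto intro!: intw_intros intw_T intw_Ti)
qed (auto intro!: intw_intros intw_T intw_Ti)

lemma evf_Z: "evf (app (LH.Z) f) = app FH.Z (evf f)"
proof -
  have "intw LH.Z FH.Z" unfolding LH.Z_def FH.Z_def by (intro intw_sum intw_intros) (auto dest: intw_Y)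
  then show ?thesis by (simp add: intw_def)
qed

end

section \<open>Leading terms\<close>

definition nm :: "nat \<Rightarrow> expo \<Rightarrow> int" where "nm n \<mu> = (\<Sum>i=1..n. lk \<mu> i ^ 2)"

lemma nm_nonneg: "0 \<le> nm n \<mu>" by (simp add: nm_def sum_nonneg)

lemma nm_sref: assumes "1 \<le> n" "i \<le> n" shows "nm n (sref n i \<mu>) = nm n \<mu>"
proof (cases "0 < i \<and> i < n")
  case True
  have "nm n (sref n i \<mu>) = (\<Sum>k=1..n. lk \<mu> (Transposition.transpose i (Suc i) k) ^ 2)"
    using True by (simp add: nm_def sref_def lk_refl_less)
  also have "\<dots> = nm n \<mu>" unfolding nm_def
    by (rule sum.reindex_bij_witness[of _ "Transposition.transpose i (Suc i)" "Transposition.transpose i (Suc i)"])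
       (use True in \<open>auto simp: transpose_eq\<close>)
  finally show ?thesis .
next
  case False
  then show ?thesis using assms by (auto simp: nm_def sref_def intro!: sum.cong)
qed

lemma ze_lattice: "1 \<le> n \<Longrightarrow> i \<le> n \<Longrightarrow> ze n i \<in> lattice n"
  by (auto simp: in_lattice ze_def lookup_minus lookup_single when_def)

lemma sref_lattice: "1 \<le> n \<Longrightarrow> i \<le> n \<Longrightarrow> \<mu> \<in> lattice n \<Longrightarrow> sref n i \<mu> \<in> lattice n"
  by (auto simp: in_lattice sref_def lk_refl)

text \<open>Along the line \<open>\<mu> + k ze\<close> the squared norm is a quadratic polynomial in
  \<open>k\<close> with positive leading coefficient. It has equal values at 0 and at
  \<open>zb\<close>, because a reflection preserves the norm; strictly between them it is
  smaller.\<close>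

lemma nm_string:
  assumes n: "1 \<le> n" "i \<le> n" and \<mu>: "\<mu> \<in> lattice n" and \<nu>: "\<nu> \<in> string_int n i \<mu>"
  shows "\<nu> \<in> lattice n" "nm n \<nu> < nm n \<mu>"
proof -
  obtain k where k: "\<nu> = \<mu> + frag_cmul k (ze n i)" "min 0 (zb n i \<mu>) < k" "k < max 0 (zb n i \<mu>)"
    using \<nu> by (auto simp: string_int_def)
  show "\<nu> \<in> lattice n" using \<mu> ze_lattice[OF n] by (auto simp: k in_lattice lookup_add)
  define a where "a = (\<Sum>j=1..n. lk \<mu> j * lk (ze n i) j)"
  have e: "nm n (\<mu> + frag_cmul l (ze n i)) = nm n \<mu> + 2 * l * a + l^2 * nm n (ze n i)" for l
    by (simp add: nm_def a_def lookup_add power2_eq_square sum_distrib_left sum.distrib[symmetric] algebra_simps)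
  have "ze n i \<noteq> 0" using frag_cmul_ze_eq_0[OF n(1), of 1 i] by (metis frag_cmul_one zero_neq_one)
  then obtain j where j: "lk (ze n i) j \<noteq> 0" by (metis lookup_zero poly_mapping_eqI)
  then have "j \<in> {1..n}" using ze_lattice[OF n] by (auto simp: in_lattice)
  then have "0 < (\<Sum>i'\<in>{1..n}. lk (ze n i) i' ^ 2)" using j by (intro sum_pos2[of _ j]) auto
  then have p: "0 < nm n (ze n i)" by (simp add: nm_def)
  let ?b = "zb n i \<mu>"
  have "?b * (2 * a + ?b * nm n (ze n i)) = 0"
    using e[of ?b] nm_sref[OF n, of \<mu>] by (simp add: sref_eq power2_eq_square algebra_simps)
  then have a: "2 * a = - ?b * nm n (ze n i)" using k by auto
  have "nm n \<nu> = nm n \<mu> + k * (2 * a) + k^2 * nm n (ze n i)" unfolding k(1) e by simp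
  also have "\<dots> = nm n \<mu> + (k * (k - ?b)) * nm n (ze n i)" unfolding a by (simp add: algebra_simps power2_eq_square)
  finally have "nm n \<nu> = nm n \<mu> + (k * (k - ?b)) * nm n (ze n i)" .
  moreover have "k * (k - ?b) < 0" using k by (auto simp: min_def max_def mult_less_0_iff split: if_splits)
  ultimately show "nm n \<nu> < nm n \<mu>" using mult_neg_pos[OF _ p] by simp
qed

definition supp_in :: "expo set \<Rightarrow> laurent set" where "supp_in C = {f. Poly_Mapping.keys f \<subseteq> C}"

lemma supp_in_0 [simp]: "0 \<in> supp_in C" by (simp add: supp_in_def)
lemma supp_in_add: "f \<in> supp_in C \<Longrightarrow> g \<in> supp_in C \<Longrightarrow> f + g \<in> supp_in C"
  by (simp add: supp_in_def keys_add_subset)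
lemma supp_in_diff: "f \<in> supp_in C \<Longrightarrow> g \<in> supp_in C \<Longrightarrow> f - g \<in> supp_in C"
  by (simp add: supp_in_def keys_diff_subset)
lemma supp_in_scal: "f \<in> supp_in C \<Longrightarrow> scal c * f \<in> supp_in C"
  by (simp add: supp_in_def keys_scal_subset)
lemma supp_in_sum: "(\<And>a. a \<in> A \<Longrightarrow> F a \<in> supp_in C) \<Longrightarrow> sum F A \<in> supp_in C"
  by (induction A rule: infinite_finite_induct) (simp_all add: supp_in_add)
lemma supp_in_mono: "C \<subseteq> D \<Longrightarrow> f \<in> supp_in C \<Longrightarrow> f \<in> supp_in D"
  by (auto simp: supp_in_def)
lemma supp_in_single [simp]: "\<mu> \<in> C \<Longrightarrow> Poly_Mapping.single \<mu> c \<in> supp_in C"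
  by (simp add: supp_in_def)
lemma supp_in_lk: "f \<in> supp_in C \<Longrightarrow> \<mu> \<notin> C \<Longrightarrow> lk f \<mu> = 0"
  by (auto simp: supp_in_def in_keys_iff)
lemma supp_in_Int: "f \<in> supp_in (C \<inter> D) \<longleftrightarrow> f \<in> supp_in C \<and> f \<in> supp_in D"
  by (auto simp: supp_in_def)
lemma laurent_ring_supp: "laurent_ring n = supp_in (lattice n)"
  by (simp add: laurent_ring_def supp_in_def)

lemma laurent_sum_mono: "f = (\<Sum>\<mu> \<in> Poly_Mapping.keys f. scal (lk f \<mu>) * mono \<mu>)"
  by (subst pm_sum_single) (simp add: scal_single)

section \<open>Supports that are stable under the Hecke algebra\<close>

context rank
begin

abbreviation "lat \<equiv> lattice n"

text \<open>Saturated sets of exponents: by the formula on monomials, closure under reflections and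
  strings makes the span of the monomials invariant under all generators, \<open>T_0\<close>
  included. The instances below are the lattice, norm balls, the sets \<open>dom\<close>, and
  intersections.\<close>

definition good :: "expo set \<Rightarrow> bool" where
  "good C \<longleftrightarrow> C \<subseteq> lat \<and> (\<forall>i \<le> n. \<forall>\<mu> \<in> C. sref n i \<mu> \<in> C \<and> string_int n i \<mu> \<subseteq> C)"

definition below :: "int \<Rightarrow> expo set" where "below N = {\<mu> \<in> lat. nm n \<mu> < N}"

lemma good_lattice: "good lat"
  unfolding good_def
proof (intro conjI allI impI ballI subset_refl)
  fix i \<mu> assume i: "i \<le> n" and \<mu>: "\<mu> \<in> lat"
  show "sref n i \<mu> \<in> lat" by (rule sref_lattice[OF n_pos i \<mu>])
  show "string_int n i \<mu> \<subseteq> lat" using nm_string(1)[OF n_pos i \<mu>] by (rule subsetI)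
qed

lemma good_below: "good (below N)"
  unfolding good_def
proof (intro conjI allI impI ballI)
  show "below N \<subseteq> lat" by (auto simp: below_def)
  fix i \<mu> assume i: "i \<le> n" and "\<mu> \<in> below N"
  then have \<mu>: "\<mu> \<in> lat" "nm n \<mu> < N" by (simp_all add: below_def)
  show "sref n i \<mu> \<in> below N" using sref_lattice[OF n_pos i \<mu>(1)] nm_sref[OF n_pos i] \<mu> by (simp add: below_def)
  show "string_int n i \<mu> \<subseteq> below N"
  proof
    fix \<nu> assume "\<nu> \<in> string_int n i \<mu>"
    from nm_string[OF n_pos i \<mu>(1) this] show "\<nu> \<in> below N" using \<mu>(2) by (simp add: below_def)
  qed
qed

lemma good_Int: "good C \<Longrightarrow> good D \<Longrightarrow> good (C \<inter> D)"
  by (auto simp: good_def)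

definition stable :: "expo set \<Rightarrow> laurent endo \<Rightarrow> bool" where
  "stable C x \<longleftrightarrow> (\<forall>f \<in> supp_in C. app x f \<in> supp_in C)"

lemma stableD: "stable C x \<Longrightarrow> f \<in> supp_in C \<Longrightarrow> app x f \<in> supp_in C"
  by (simp add: stable_def)

lemma hecke_mono_good:
  assumes "i \<le> n" "good C" "\<mu> \<in> C" shows "hecke n i (mono \<mu>) \<in> supp_in C"
proof -
  obtain r where r: "Poly_Mapping.keys r \<subseteq> string_int n i \<mu>"
    and h: "hecke n i (mono \<mu>) = (if m0 n i \<mu> = 0 then scal (kap n i) * mono \<mu>
          else (if m0 n i \<mu> < 0 then scal (kap n i - 1 / kap n i) * mono \<mu> else 0) +
            scal ((if m0 n i \<mu> < 0 then kap n i else 1 / kap n i) * zc i powi zb n i \<mu>) * mono (sref n i \<mu>) + r)"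
    using hecke_mono[OF n_pos assms(1), of \<mu>] unfolding hecke_mono_spec_def by blast
  have "string_int n i \<mu> \<subseteq> C" using assms by (auto simp: good_def)
  then have "r \<in> supp_in C" using r by (auto simp: supp_in_def)
  then show ?thesis unfolding h using assms
    by (auto simp: good_def simp del: scal_simps scal_mult intro!: supp_in_add supp_in_scal)
qed

lemma app_sum_mono: "app x f = (\<Sum>\<mu> \<in> Poly_Mapping.keys f. app x (scal (lk f \<mu>) * mono \<mu>))"
  by (subst laurent_sum_mono) (simp only: app_sum)

lemma stable_LT: assumes "good C" "i \<le> n" shows "stable C (LT i)"
  unfolding stable_def
proof
  fix f assume f: "f \<in> supp_in C"
  show "app (LT i) f \<in> supp_in C" unfolding app_sum_mono[of _ f]
  proof (rule supp_in_sum)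
    fix \<mu> assume "\<mu> \<in> Poly_Mapping.keys f"
    then have "\<mu> \<in> C" using f by (auto simp: supp_in_def)
    then show "app (LT i) (scal (lk f \<mu>) * mono \<mu>) \<in> supp_in C"
      unfolding app_LT[OF assms(2)] hecke_scal[OF n_pos assms(2)] by (intro supp_in_scal hecke_mono_good assms)
  qed
qed

lemma stable_Lh: "stable C (Lh i)"
  by (simp add: stable_def app_Lh supp_in_scal del: scal_simps)

lemma stable_intros:
  "stable C 1" "stable C x \<Longrightarrow> stable C y \<Longrightarrow> stable C (x + y)"
  "stable C x \<Longrightarrow> stable C y \<Longrightarrow> stable C (x - y)"
  "stable C x \<Longrightarrow> stable C y \<Longrightarrow> stable C (x * y)"
  by (simp_all add: stable_def supp_in_add supp_in_diff)

lemma stable_sum: "(\<And>a. a \<in> A \<Longrightarrow> stable C (F a)) \<Longrightarrow> stable C (sum F A)"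
  by (simp add: stable_def app_sum_left supp_in_sum)

lemma stable_Ti: "good C \<Longrightarrow> i \<le> n \<Longrightarrow> stable C (LH.Ti i)"
  unfolding LH.Ti_def by (intro stable_intros stable_LT stable_Lh)

lemma stable_R: "good C \<Longrightarrow> k < n \<Longrightarrow> stable C (LH.R k) \<and> stable C (LH.Ri k)"
  by (induction k) (auto intro!: stable_intros stable_LT stable_Ti)

lemma stable_Y: "good C \<Longrightarrow> j \<le> n \<Longrightarrow> stable C (LH.Y j) \<and> stable C (LH.Yi j)"
proof (induction j rule: LH.Y.induct)
  case 2
  then show ?case using stable_R[of C "n - 1"] n_pos by (auto intro!: stable_intros stable_LT stable_Ti)
qed (auto intro!: stable_intros stable_LT stable_Ti)

lemma stable_Z: "good C \<Longrightarrow> stable C LH.Z"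
  unfolding LH.Z_def by (intro stable_sum stable_intros) (auto dest: stable_Y)

definition lin :: "laurent endo \<Rightarrow> bool" where
  "lin x \<longleftrightarrow> (\<forall>c f. app x (scal c * f) = scal c * app x f)"

lemma linD: "lin x \<Longrightarrow> app x (scal c * f) = scal c * app x f" by (simp add: lin_def)

lemma lin_intros:
  "lin 1" "lin x \<Longrightarrow> lin y \<Longrightarrow> lin (x + y)" "lin x \<Longrightarrow> lin y \<Longrightarrow> lin (x - y)" "lin x \<Longrightarrow> lin y \<Longrightarrow> lin (x * y)"
  by (simp_all add: lin_def distrib_left right_diff_distrib)

lemma lin_LT: "i \<le> n \<Longrightarrow> lin (LT i)"
  by (simp add: lin_def app_LT hecke_scal[OF n_pos])

lemma lin_Lh: "lin (Lh i)"
  by (simp add: lin_def app_Lh mult.left_commute)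

lemma lin_sum: "(\<And>a. a \<in> A \<Longrightarrow> lin (F a)) \<Longrightarrow> lin (sum F A)"
  by (simp add: lin_def app_sum_left sum_distrib_left)

lemma lin_Ti: "i \<le> n \<Longrightarrow> lin (LH.Ti i)"
  unfolding LH.Ti_def by (intro lin_intros lin_LT lin_Lh)

lemma lin_R: "k < n \<Longrightarrow> lin (LH.R k) \<and> lin (LH.Ri k)"
  by (induction k) (auto intro!: lin_intros lin_LT lin_Ti)

lemma lin_Y: "j \<le> n \<Longrightarrow> lin (LH.Y j) \<and> lin (LH.Yi j)"
proof (induction j rule: LH.Y.induct)
  case 2
  then show ?case using lin_R[of "n - 1"] n_pos by (auto intro!: lin_intros lin_LT lin_Ti)
qed (auto intro!: lin_intros lin_LT lin_Ti)

lemma lin_Z: "lin LH.Z"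
  unfolding LH.Z_def by (intro lin_sum lin_intros) (auto dest: lin_Y)

lemma hecke_lead:
  assumes i: "i \<le> n" and \<mu>: "\<mu> \<in> lat"
  shows "m0 n i \<mu> = 0 \<Longrightarrow> hecke n i (mono \<mu>) = scal (kap n i) * mono \<mu>"
    and "m0 n i \<mu> > 0 \<Longrightarrow> hecke n i (mono \<mu>) - scal (zc i powi zb n i \<mu> / kap n i) * mono (sref n i \<mu>) \<in> supp_in (below (nm n \<mu>))"
    and "m0 n i \<mu> < 0 \<Longrightarrow> hecke n i (mono \<mu>) - (scal (base.hh n i) * mono \<mu> + scal (kap n i * zc i powi zb n i \<mu>) * mono (sref n i \<mu>))
        \<in> supp_in (below (nm n \<mu>))"
proof -
  obtain r where r: "Poly_Mapping.keys r \<subseteq> string_int n i \<mu>"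
    and h: "hecke n i (mono \<mu>) = (if m0 n i \<mu> = 0 then scal (kap n i) * mono \<mu>
          else (if m0 n i \<mu> < 0 then scal (kap n i - 1 / kap n i) * mono \<mu> else 0) +
            scal ((if m0 n i \<mu> < 0 then kap n i else 1 / kap n i) * zc i powi zb n i \<mu>) * mono (sref n i \<mu>) + r)"
    using hecke_mono[OF n_pos i, of \<mu>] unfolding hecke_mono_spec_def by blast
  have r': "r \<in> supp_in (below (nm n \<mu>))"
    using r nm_string[OF n_pos i \<mu>] by (auto simp: supp_in_def below_def)
  show "m0 n i \<mu> = 0 \<Longrightarrow> hecke n i (mono \<mu>) = scal (kap n i) * mono \<mu>" by (simp add: h)
  show "m0 n i \<mu> > 0 \<Longrightarrow> hecke n i (mono \<mu>) - scal (zc i powi zb n i \<mu> / kap n i) * mono (sref n i \<mu>) \<in> supp_in (below (nm n \<mu>))"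
    using r' by (simp add: h del: scal_simps scal_mult)
  show "m0 n i \<mu> < 0 \<Longrightarrow> hecke n i (mono \<mu>) - (scal (base.hh n i) * mono \<mu> + scal (kap n i * zc i powi zb n i \<mu>) * mono (sref n i \<mu>))
        \<in> supp_in (below (nm n \<mu>))"
    using r' by (simp add: h base.hh_def del: scal_simps scal_mult)
qed

text \<open>\<open>x\<close> sends \<open>x^\<mu>\<close> to \<open>c x^\<nu>\<close> up to smaller
  norm. Linearity, stability and equality of norms are part of the notion so that leading terms
  compose along a word.\<close>

definition tr :: "laurent endo \<Rightarrow> expo \<Rightarrow> coeff \<Rightarrow> expo \<Rightarrow> bool" where
  "tr x \<mu> c \<nu> \<longleftrightarrow> lin x \<and> (\<forall>C. good C \<longrightarrow> stable C x) \<and> \<mu> \<in> lat \<and> \<nu> \<in> lat \<and> nm n \<nu> = nm n \<mu> \<and>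
     app x (mono \<mu>) - scal c * mono \<nu> \<in> supp_in (below (nm n \<mu>))"

lemma tr_comp: assumes "tr x \<mu> c \<nu>" "tr y \<nu> d \<kappa>" shows "tr (y * x) \<mu> (c * d) \<kappa>"
proof -
  have "app y (app x (mono \<mu>) - scal c * mono \<nu>) \<in> supp_in (below (nm n \<mu>))"
    using assms good_below by (auto simp: tr_def intro: stableD)
  moreover have "scal c * (app y (mono \<nu>) - scal d * mono \<kappa>) \<in> supp_in (below (nm n \<mu>))"
    using assms by (auto simp: tr_def intro: supp_in_scal)
  ultimately have "app y (app x (mono \<mu>) - scal c * mono \<nu>) + scal c * (app y (mono \<nu>) - scal d * mono \<kappa>)
     \<in> supp_in (below (nm n \<mu>))" by (rule supp_in_add)
  moreover have "app y (app x (mono \<mu>) - scal c * mono \<nu>) + scal c * (app y (mono \<nu>) - scal d * mono \<kappa>) =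
     app (y * x) (mono \<mu>) - scal (c * d) * mono \<kappa>"
    using assms(2) by (simp add: tr_def app_diff linD right_diff_distrib mult.assoc)
  ultimately show ?thesis using assms by (auto simp: tr_def intro: lin_intros stable_intros)
qed

lemma tr_1: "\<mu> \<in> lat \<Longrightarrow> tr 1 \<mu> 1 \<mu>"
  by (simp add: tr_def lin_intros stable_intros)

lemma zb_0: "m0 n i \<mu> = 0 \<Longrightarrow> zb n i \<mu> = 0" by (simp add: zb_def)

lemma sref_0: "m0 n i \<mu> = 0 \<Longrightarrow> sref n i \<mu> = \<mu>"
  by (simp add: sref_eq zb_0 frag_cmul_zero)

text \<open>For a nonnegative pairing there is no diagonal term, hence a single leading term. For
  the inverse operator the right condition is a nonpositive pairing: there subtracting
  \<open>h\<close> removes the diagonal term.\<close>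

lemma tr_LT:
  assumes "i \<le> n" "\<mu> \<in> lat" "m0 n i \<mu> \<ge> 0"
  shows "tr (LT i) \<mu> (if m0 n i \<mu> = 0 then kap n i else zc i powi zb n i \<mu> / kap n i) (sref n i \<mu>)"
  using assms hecke_lead[OF assms(1,2)] sref_0[of i \<mu>] sref_lattice[OF n_pos assms(1,2)] nm_sref[OF n_pos assms(1)]
  by (auto simp: tr_def lin_LT stable_LT app_LT)

lemma tr_Ti:
  assumes "i \<le> n" "\<mu> \<in> lat" "m0 n i \<mu> \<le> 0"
  shows "tr (LH.Ti i) \<mu> (if m0 n i \<mu> = 0 then 1 / kap n i else kap n i * zc i powi zb n i \<mu>) (sref n i \<mu>)"
proof -
  have "app (LH.Ti i) (mono \<mu>) - scal (if m0 n i \<mu> = 0 then 1 / kap n i else kap n i * zc i powi zb n i \<mu>) * mono (sref n i \<mu>)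
     \<in> supp_in (below (nm n \<mu>))"
  proof (cases "m0 n i \<mu> = 0")
    case True
    have "app (LH.Ti i) (mono \<mu>) = scal (kap n i) * mono \<mu> - scal (base.hh n i) * mono \<mu>"
      using hecke_lead(1)[OF assms(1,2) True] assms(1) by (simp add: LH.Ti_def app_LT app_Lh)
    also have "\<dots> = scal (1 / kap n i) * mono \<mu>" by (simp add: base.hh_def left_diff_distrib)
    finally show ?thesis using True sref_0[OF True] by simp
  next
    case False
    then have "m0 n i \<mu> < 0" using assms by simp
    from hecke_lead(3)[OF assms(1,2) this] show ?thesis
      using False assms(1) by (simp add: LH.Ti_def app_LT app_Lh diff_diff_eq del: scal_mult)
  qed
  then show ?thesis
    using assms sref_lattice[OF n_pos assms(1,2)] nm_sref[OF n_pos assms(1)]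
    by (auto simp: tr_def lin_Ti stable_Ti)
qed

end

section \<open>Leading terms of \<open>Y j\<close> on dominant monomials\<close>

context affine_hecke
begin

primrec Tup :: "nat \<Rightarrow> 'a" where
  "Tup 0 = 1" | "Tup (Suc k) = Tup k * T (Suc k)"

primrec Tdown :: "nat \<Rightarrow> 'a" where
  "Tdown 0 = 1" | "Tdown (Suc k) = Ti (Suc k) * Tdown k"

text \<open>The inverse that the recursion appends on the right cancels the last letter of
  \<open>R\<close>, so inverses survive only on the left. This is the word used in
  \<open>Y_op\<close>.\<close>

lemma Y_word: "k < n \<Longrightarrow> Y (Suc k) = Tdown k * (T 0 * (Tup k * R (n - Suc k)))"
proof (induction k)
  case (Suc k)
  have "R (n - Suc k) = T (Suc k) * R (n - Suc (Suc k)) * T (Suc k)"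
    using R_step[of "Suc k"] Suc.prems by simp
  then have "R (n - Suc k) * Ti (Suc k) = T (Suc k) * R (n - Suc (Suc k))"
    using Suc.prems by (simp add: mult.assoc T_Ti)
  then show ?case using Suc by (simp add: mult.assoc)
qed simp

end

context rank
begin

lemma refl_negate: "0 < j \<Longrightarrow> j < n \<Longrightarrow> refl n j (negate_entry (Suc j) (refl n j \<mu>)) = negate_entry j \<mu>"
  by (rule poly_mapping_eqI) (simp add: lk_refl)

lemma negate_refl: "0 < j \<Longrightarrow> j < n \<Longrightarrow> refl n j (negate_entry (Suc j) \<mu>) = negate_entry j (refl n j \<mu>)"
  by (rule poly_mapping_eqI) (simp add: lk_refl)

lemma negate_lat: "1 \<le> j \<Longrightarrow> j \<le> n \<Longrightarrow> \<mu> \<in> lat \<Longrightarrow> negate_entry j \<mu> \<in> lat"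
  by (auto simp: in_lattice)

text \<open>The entry in position \<open>j\<close> travels to the end and its negative travels back.
  A smaller entry contributes \<open>1 / t_h\<close> on both ways. For an equal positive entry the
  two factors cancel, and among zeros every factor is \<open>t_h\<close>.\<close>

definition cR :: "nat \<Rightarrow> expo \<Rightarrow> coeff" where
  "cR j \<mu> = (if 0 < lk \<mu> j then 1 / tn_h * (1 / t_par) ^ card {k. j < k \<and> k \<le> n \<and> lk \<mu> k < lk \<mu> j} else tn_h * t_par ^ (n - j))"

lemma R_lead:
  assumes "1 \<le> j" "j \<le> n" "\<mu> \<in> lat" "0 \<le> lk \<mu> j" "\<And>k. j < k \<Longrightarrow> k \<le> n \<Longrightarrow> 0 \<le> lk \<mu> k \<and> lk \<mu> k \<le> lk \<mu> j"
  shows "tr (LH.R (n - j)) \<mu> (cR j \<mu>) (negate_entry j \<mu>)"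
  using assms
proof (induction "n - j" arbitrary: j \<mu>)
  case 0
  then have j: "j = n" by simp
  have s: "sref n n \<mu> = negate_entry n \<mu>" using n_pos by (simp add: sref_def refl_def)
  have e: "card {k. n < k \<and> k \<le> n \<and> lk \<mu> k < lk \<mu> n} = 0" by (auto simp: card_eq_0_iff)
  have "cR n \<mu> = (if lk \<mu> n = 0 then tn_h else 1 / tn_h)" unfolding cR_def e using 0 j by auto
  then show ?case using tr_LT[of n \<mu>] 0 n_pos
    by (auto simp: j s m0_def mm_def kap_def zc_def)
next
  case (Suc k)
  then have j: "j < n" "0 < j" by auto
  define \<nu> where "\<nu> = refl n j \<mu>"
  have lk\<nu>: "lk \<nu> (Suc j) = lk \<mu> j" "lk \<nu> j = lk \<mu> (Suc j)" "\<And>k. Suc j < k \<Longrightarrow> lk \<nu> k = lk \<mu> k"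
    using j by (auto simp: \<nu>_def lk_refl)
  have \<nu>: "\<nu> \<in> lat" using Suc.prems j n_pos by (simp add: \<nu>_def)
  have le: "0 \<le> lk \<mu> (Suc j)" "lk \<mu> (Suc j) \<le> lk \<mu> j" using Suc.prems j by auto
  have IH: "tr (LH.R (n - Suc j)) \<nu> (cR (Suc j) \<nu>) (negate_entry (Suc j) \<nu>)"
    using Suc.hyps(2) Suc.prems j \<nu> by (intro Suc.hyps(1)) (auto simp: lk\<nu>)
  have m1: "m0 n j \<mu> = lk \<mu> j - lk \<mu> (Suc j)" using j by (simp add: m0_def mm_def)
  have 1: "tr (LT j) \<mu> (if lk \<mu> j = lk \<mu> (Suc j) then t_h else 1 / t_h) \<nu>"
    using tr_LT[of j \<mu>] Suc.prems j le by (simp add: m1 sref_def \<nu>_def kap_def zc_def cong: if_cong)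
  have m2: "m0 n j (negate_entry (Suc j) \<nu>) = lk \<mu> (Suc j) + lk \<mu> j" using j by (simp add: m0_def mm_def lk\<nu>)
  have 2: "tr (LT j) (negate_entry (Suc j) \<nu>) (if lk \<mu> (Suc j) + lk \<mu> j = 0 then t_h else 1 / t_h) (negate_entry j \<mu>)"
    using tr_LT[of j "negate_entry (Suc j) \<nu>"] j le Suc.prems \<nu> refl_negate[of j \<mu>]
    by (simp add: m2 sref_def kap_def zc_def negate_lat \<nu>_def[symmetric] cong: if_cong)
  have R: "LH.R (n - j) = LT j * LH.R (n - Suc j) * LT j" using LH.R_step[of j] j by simp
  have "tr (LH.R (n - j)) \<mu> ((if lk \<mu> j = lk \<mu> (Suc j) then t_h else 1 / t_h) * (cR (Suc j) \<nu> *
      (if lk \<mu> (Suc j) + lk \<mu> j = 0 then t_h else 1 / t_h))) (negate_entry j \<mu>)"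
    unfolding R by (rule tr_comp[OF 1 tr_comp[OF IH 2]])
  moreover have "(if lk \<mu> j = lk \<mu> (Suc j) then t_h else 1 / t_h) * (cR (Suc j) \<nu> *
      (if lk \<mu> (Suc j) + lk \<mu> j = 0 then t_h else 1 / t_h)) = cR j \<mu>"
  proof (cases "0 < lk \<mu> j")
    case True
    let ?A = "\<lambda>j. {k. j < k \<and> k \<le> n \<and> lk \<mu> k < lk \<mu> j}" and ?B = "{k. Suc j < k \<and> k \<le> n \<and> lk \<mu> k < lk \<mu> j}"
    have B: "{k. Suc j < k \<and> k \<le> n \<and> lk \<nu> k < lk \<nu> (Suc j)} = ?B" using lk\<nu> by auto
    have cB: "cR (Suc j) \<nu> = 1 / tn_h * (1 / t_par) ^ card ?B"
      using True unfolding cR_def B by (simp add: lk\<nu>(1))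
    have fB: "finite ?B" by (rule finite_subset[of _ "{..n}"]) auto
    show ?thesis
    proof (cases "lk \<mu> j = lk \<mu> (Suc j)")
      case eq: True
      have "?A j = ?B" using eq by (auto simp: Suc_lessI) (metis Suc_lessI less_irrefl)
      then show ?thesis using True eq by (simp add: cR_def[of j] cB)
    next
      case ne: False
      then have "?A j = insert (Suc j) ?B" using le j by (auto simp: Suc_le_eq intro: Suc_lessI)
      then have "card (?A j) = Suc (card ?B)" using fB by simp
      then show ?thesis using True ne le by (simp add: cR_def[of j] cB power2_eq_square)
    qed
  next
    case False
    then have "lk \<mu> j = 0" "lk \<mu> (Suc j) = 0" using le by auto
    moreover have "n - j = Suc (n - Suc j)" using j by simp
    ultimately show ?thesis by (simp add: cR_def lk\<nu>(1) power2_eq_square)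
  qed
  ultimately show ?case by simp
qed

text \<open>The entry in position \<open>k + 1\<close> is carried to the front by adjacent swaps,
  the earlier ones moving one place to the right.\<close>

primrec mv :: "nat \<Rightarrow> expo \<Rightarrow> expo" where
  "mv 0 \<mu> = \<mu>" | "mv (Suc k) \<mu> = mv k (refl n (Suc k) \<mu>)"

lemma mv_first: "Suc k \<le> n \<Longrightarrow> lk (mv k \<mu>) 1 = lk \<mu> (Suc k)"
  by (induction k arbitrary: \<mu>) (simp_all add: lk_refl)

lemma mv_negate: "Suc k \<le> n \<Longrightarrow> negate_entry 1 (mv k (negate_entry (Suc k) \<mu>)) = mv k \<mu>"
  by (induction k arbitrary: \<mu>) (simp_all add: negate_refl)

lemma mv_lat: "k < n \<Longrightarrow> \<mu> \<in> lat \<Longrightarrow> mv k \<mu> \<in> lat"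
  by (induction k arbitrary: \<mu>) (use n_pos in simp_all)

lemma Tup_lead:
  assumes "Suc k \<le> n" "\<mu> \<in> lat" "\<And>m. 1 \<le> m \<Longrightarrow> m \<le> k \<Longrightarrow> lk \<mu> (Suc k) \<le> lk \<mu> m"
  shows "tr (LH.Tup k) \<mu> (\<Prod>m=1..k. if lk \<mu> m = lk \<mu> (Suc k) then t_h else 1 / t_h) (mv k \<mu>)"
  using assms
proof (induction k arbitrary: \<mu>)
  case 0 then show ?case using tr_1 by simp
next
  case (Suc k)
  define \<nu> where "\<nu> = refl n (Suc k) \<mu>"
  have j: "Suc k < n" using Suc.prems by simp
  have lk\<nu>: "lk \<nu> (Suc k) = lk \<mu> (Suc (Suc k))" "\<And>m. m \<le> k \<Longrightarrow> lk \<nu> m = lk \<mu> m"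
    using j by (auto simp: \<nu>_def lk_refl)
  have \<nu>: "\<nu> \<in> lat" using Suc.prems n_pos by (simp add: \<nu>_def)
  have m1: "m0 n (Suc k) \<mu> = lk \<mu> (Suc k) - lk \<mu> (Suc (Suc k))" using j by (simp add: m0_def mm_def)
  have 1: "tr (LT (Suc k)) \<mu> (if lk \<mu> (Suc k) = lk \<mu> (Suc (Suc k)) then t_h else 1 / t_h) \<nu>"
    using tr_LT[of "Suc k" \<mu>] Suc.prems(2) Suc.prems(3)[of "Suc k"] j by (simp add: m1 sref_def \<nu>_def kap_def zc_def cong: if_cong)
  have "tr (LH.Tup k) \<nu> (\<Prod>m=1..k. if lk \<nu> m = lk \<nu> (Suc k) then t_h else 1 / t_h) (mv k \<nu>)"
    using Suc.prems \<nu> by (intro Suc.IH) (auto simp: lk\<nu>)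
  then have "tr (LH.Tup k) \<nu> (\<Prod>m=1..k. if lk \<mu> m = lk \<mu> (Suc (Suc k)) then t_h else 1 / t_h) (mv k \<nu>)"
    by (simp add: lk\<nu>)
  from tr_comp[OF 1 this] show ?case by (simp add: \<nu>_def mult.commute)
qed

lemma Tdown_lead:
  assumes "Suc k \<le> n" "\<mu> \<in> lat" "\<And>m. 1 \<le> m \<Longrightarrow> m \<le> k \<Longrightarrow> lk \<mu> (Suc k) \<le> lk \<mu> m"
  shows "tr (LH.Tdown k) (mv k \<mu>) (\<Prod>m=1..k. if lk \<mu> m = lk \<mu> (Suc k) then 1 / t_h else t_h) \<mu>"
  using assms
proof (induction k arbitrary: \<mu>)
  case 0 then show ?case using tr_1 by simp
next
  case (Suc k)
  define \<nu> where "\<nu> = refl n (Suc k) \<mu>"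
  have j: "Suc k < n" using Suc.prems by simp
  have lk\<nu>: "lk \<nu> (Suc k) = lk \<mu> (Suc (Suc k))" "lk \<nu> (Suc (Suc k)) = lk \<mu> (Suc k)" "\<And>m. m \<le> k \<Longrightarrow> lk \<nu> m = lk \<mu> m"
    using j by (auto simp: \<nu>_def lk_refl)
  have \<nu>: "\<nu> \<in> lat" using Suc.prems n_pos by (simp add: \<nu>_def)
  have m1: "m0 n (Suc k) \<nu> = lk \<mu> (Suc (Suc k)) - lk \<mu> (Suc k)" using j by (simp add: m0_def mm_def lk\<nu>)
  have 1: "tr (LH.Ti (Suc k)) \<nu> (if lk \<mu> (Suc k) = lk \<mu> (Suc (Suc k)) then 1 / t_h else t_h) \<mu>"
    using tr_Ti[of "Suc k" \<nu>] \<nu> Suc.prems(3)[of "Suc k"] j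
      refl_refl[of n "Suc k" \<mu>, folded \<nu>_def]
    by (cases "lk \<mu> (Suc k) = lk \<mu> (Suc (Suc k))") (auto simp: m1 sref_def kap_def zc_def)
  have "tr (LH.Tdown k) (mv k \<nu>) (\<Prod>m=1..k. if lk \<nu> m = lk \<nu> (Suc k) then 1 / t_h else t_h) \<nu>"
    using Suc.prems \<nu> by (intro Suc.IH) (auto simp: lk\<nu>)
  then have "tr (LH.Tdown k) (mv k \<nu>) (\<Prod>m=1..k. if lk \<mu> m = lk \<mu> (Suc (Suc k)) then 1 / t_h else t_h) \<nu>"
    by (simp add: lk\<nu>)
  from tr_comp[OF this 1] show ?case by (simp add: \<nu>_def mult.commute)
qed

definition cY :: "nat \<Rightarrow> expo \<Rightarrow> coeff" where
  "cY j \<mu> = cR j \<mu> * (\<Prod>m\<in>{1..<j}. if lk \<mu> m = 0 \<and> lk \<mu> j = 0 then t_h else 1 / t_h) *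
     (if lk \<mu> j = 0 then t0_h else q_par powi (- lk \<mu> j) / t0_h) *
     (\<Prod>m\<in>{1..<j}. if lk \<mu> m = lk \<mu> j then 1 / t_h else t_h)"

text \<open>The word carries the entry \<open>j\<close> to the end, returns it with opposite sign,
  moves it to the front, restores the sign by \<open>T_0\<close> and brings it back to its place.
  Dominance of \<open>\<kappa>\<close> gives each letter a pairing of the sign for which it has one
  leading term. The power of \<open>q\<close> comes from \<open>T_0\<close> alone.\<close>

theorem Y_lead:
  assumes "dominant n \<kappa>" "\<kappa> \<in> lat" "1 \<le> j" "j \<le> n"
  shows "tr (LH.Y j) \<kappa> (cY j \<kappa>) \<kappa>"
proof -
  obtain k where k: "j = Suc k" "k < n" using assms by (cases j) auto
  let ?\<mu> = "negate_entry (Suc k) \<kappa>"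
  have nn: "0 \<le> lk \<kappa> m" if "1 \<le> m" "m \<le> n" for m using dominant_nonneg[OF assms(1) that] .
  have "tr (LH.R (n - j)) \<kappa> (cR j \<kappa>) ?\<mu>"
    unfolding k(1) using assms dominant_mono[OF assms(1)] nn by (intro R_lead) (auto simp: k)
  moreover have "tr (LH.Tup k) ?\<mu> (\<Prod>m\<in>{1..<j}. if lk \<kappa> m = 0 \<and> lk \<kappa> j = 0 then t_h else 1 / t_h) (mv k ?\<mu>)"
  proof -
    have "tr (LH.Tup k) ?\<mu> (\<Prod>m=1..k. if lk ?\<mu> m = lk ?\<mu> (Suc k) then t_h else 1 / t_h) (mv k ?\<mu>)"
      using assms k nn negate_lat[of j \<kappa>] by (intro Tup_lead) (auto intro: order_trans[of _ 0])
    moreover have "(\<Prod>m=1..k. if lk ?\<mu> m = lk ?\<mu> (Suc k) then t_h else 1 / t_h) =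
       (\<Prod>m\<in>{1..<j}. if lk \<kappa> m = 0 \<and> lk \<kappa> j = 0 then t_h else 1 / t_h)"
    proof (rule prod.cong)
      fix m assume "m \<in> {1..<j}"
      then show "(if lk ?\<mu> m = lk ?\<mu> (Suc k) then t_h else 1 / t_h) = (if lk \<kappa> m = 0 \<and> lk \<kappa> j = 0 then t_h else 1 / t_h)"
        using nn[of m] nn[of j] k by auto
    qed (use k in auto)
    ultimately show ?thesis by simp
  qed
  moreover have "tr (LT 0) (mv k ?\<mu>) (if lk \<kappa> j = 0 then t0_h else q_par powi (- lk \<kappa> j) / t0_h) (mv k \<kappa>)"
  proof -
    have f: "lk (mv k ?\<mu>) 1 = - lk \<kappa> j" using mv_first[of k ?\<mu>] k by simp
    then have m: "m0 n 0 (mv k ?\<mu>) = lk \<kappa> j" by (simp add: m0_def)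
    have "sref n 0 (mv k ?\<mu>) = mv k \<kappa>" using mv_negate[of k \<kappa>] k by (simp add: sref_def)
    moreover have "zc 0 powi zb n 0 (mv k ?\<mu>) = q_par powi (- lk \<kappa> j)"
      by (simp add: zc_def zb_def m zd_def power_int_power)
    ultimately show ?thesis
      using tr_LT[of 0 "mv k ?\<mu>"] nn[of j] assms k mv_lat[of k ?\<mu>] negate_lat[of j \<kappa>]
      by (simp add: m kap_def cong: if_cong)
  qed
  moreover have "tr (LH.Tdown k) (mv k \<kappa>) (\<Prod>m\<in>{1..<j}. if lk \<kappa> m = lk \<kappa> j then 1 / t_h else t_h) \<kappa>"
  proof -
    have "{1..k} = {1..<j}" using k by auto
    then show ?thesis using Tdown_lead[of k \<kappa>] dominant_mono[OF assms(1)] assms k by auto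
  qed
  ultimately have "tr (LH.Tdown k * (LT 0 * (LH.Tup k * LH.R (n - j)))) \<kappa> (cR j \<kappa> * (\<Prod>m\<in>{1..<j}. if lk \<kappa> m = 0 \<and> lk \<kappa> j = 0 then t_h else 1 / t_h)
     * (if lk \<kappa> j = 0 then t0_h else q_par powi (- lk \<kappa> j) / t0_h) * (\<Prod>m\<in>{1..<j}. if lk \<kappa> m = lk \<kappa> j then 1 / t_h else t_h)) \<kappa>"
    using tr_comp by blast
  then show ?thesis by (simp only: cY_def LH.Y_word[OF k(2)] k(1))
qed

end

section \<open>Independence of Laurent monomials in the parameters\<close>

lemma UNIV_param: "UNIV = {Q_half, T_half, T0_half, U0_half, Tn_half, Un_half}"
  using param.exhaust by blast

instance param :: finite
  by standard (simp add: UNIV_param)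

definition Mon :: "(param \<Rightarrow> int) \<Rightarrow> coeff" where "Mon e = (\<Prod>v\<in>UNIV. par v powi e v)"

lemma Mon_mult: "Mon e * Mon e' = Mon (\<lambda>v. e v + e' v)"
  by (simp add: Mon_def power_int_add prod.distrib[symmetric])

lemma Mon_0 [simp]: "Mon (\<lambda>_. 0) = 1"
  by (simp add: Mon_def)

lemma Mon_inverse: "1 / Mon e = Mon (\<lambda>v. - e v)"
  by (simp add: Mon_def power_int_minus prod_inversef[unfolded o_def] divide_inverse)

lemma Mon_nonzero [simp]: "Mon e \<noteq> 0"
  by (simp add: Mon_def)

definition expv :: "(param \<Rightarrow> int) \<Rightarrow> param \<Rightarrow>\<^sub>0 nat" where
  "expv e = (\<Sum>v\<in>UNIV. Poly_Mapping.single v (nat (e v)))"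

lemma lk_expv: "lk (expv e) v = nat (e v)"
  by (simp add: expv_def lookup_sum lookup_single when_def)

lemma par_power: "par v ^ k = to_fract (Poly_Mapping.single (Poly_Mapping.single v k) 1)"
proof (induction k)
  case (Suc k)
  have "Poly_Mapping.single v (Suc k) = Poly_Mapping.single v 1 + Poly_Mapping.single v k"
    by (simp flip: single_add)
  then show ?case using Suc by (simp add: par_def mult_single flip: to_fract_mult)
qed simp

lemma Mon_to_fract: "(\<And>v. 0 \<le> e v) \<Longrightarrow> Mon e = to_fract (Poly_Mapping.single (expv e) 1)"
proof -
  assume e: "\<And>v. 0 \<le> e v"
  have "(\<Prod>v\<in>A. par v powi e v) = to_fract (Poly_Mapping.single (\<Sum>v\<in>A. Poly_Mapping.single v (nat (e v))) 1)"
    if "finite A" for A using that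
  proof (induction A)
    case (insert v A)
    have "par v powi e v = par v ^ nat (e v)" using e[of v] by (simp add: power_int_def)
    then show ?case using insert by (simp add: par_power mult_single flip: to_fract_mult)
  qed simp
  then show ?thesis by (simp add: Mon_def expv_def)
qed

text \<open>Multiplication by one monomial of large degree makes all exponents nonnegative. The sums
  are then polynomials whose coefficients are multiplicities, and these can be read off in
  characteristic zero.\<close>

lemma Mon_independent:
  assumes "(\<Sum>e\<in>#A. Mon e) = (\<Sum>e\<in>#B. Mon e)"
  shows "A = B"
proof -
  define S where "S = (\<lambda>(e, v). - e v) ` ((set_mset A \<union> set_mset B) \<times> (UNIV :: param set))"
  have "finite S" by (simp add: S_def)
  then obtain K where K: "\<And>x. x \<in> S \<Longrightarrow> x \<le> K" using finite_nat_bounded[of "nat ` S"]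
    by (metis Max_ge finite_imageI)
  have K: "0 \<le> e v + K" if "e \<in># A \<or> e \<in># B" for e v
    using K[of "- e v"] that by (force simp: S_def)
  define g where "g e = expv (\<lambda>v. e v + K)" for e
  define h where "h m = (\<lambda>v. int (lk m v) - K)" for m :: "param \<Rightarrow>\<^sub>0 nat"
  have hg: "h (g e) = e" if "e \<in># A \<or> e \<in># B" for e
    using K[OF that] by (auto simp: h_def g_def lk_expv)
  define P :: "(param \<Rightarrow> int) multiset \<Rightarrow> param_poly" where "P A = (\<Sum>e\<in>#A. Poly_Mapping.single (g e) 1)" for A
  have M: "(\<Sum>e\<in>#C. Mon e) * Mon (\<lambda>_. K) = to_fract (P C)" if "\<And>e v. e \<in># C \<Longrightarrow> 0 \<le> e v + K" for C
    using that
  proof (induction C)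
    case (add x C)
    have "Mon x * Mon (\<lambda>_. K) = to_fract (Poly_Mapping.single (g x) 1)"
      unfolding Mon_mult g_def by (rule Mon_to_fract) (use add in auto)
    then show ?case using add by (simp add: distrib_right P_def)
  qed (simp add: P_def)
  have "to_fract (P A) = to_fract (P B)" using M[of A] M[of B] K assms by metis
  then have PAB: "P A = P B" by simp
  have "lk (P C) m = of_nat (count (image_mset g C) m)" for C m
    by (induction C) (auto simp: P_def lookup_add lookup_single when_def)
  then have "image_mset g A = image_mset g B"
    using PAB by (intro multiset_eqI) (metis of_nat_eq_iff)
  then have "image_mset h (image_mset g A) = image_mset h (image_mset g B)" by simp
  then show ?thesis using hg by (simp add: multiset.map_comp comp_def cong: image_mset_cong)
qed

lemma Mon_inject: "Mon e = Mon e' \<Longrightarrow> e = e'"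
  using Mon_independent[of "{#e#}" "{#e'#}"] by simp

text \<open>The exponent of \<open>q^(1/2)\<close> in a Laurent monomial in the parameters. Since it
  remembers the entries of a weight, it suffices for telling eigenvalues apart.\<close>

definition qdeg :: "coeff \<Rightarrow> int \<Rightarrow> bool" where
  "qdeg c k \<longleftrightarrow> (\<exists>e. c = Mon e \<and> e Q_half = k)"

lemma qdeg_mult: "qdeg c k \<Longrightarrow> qdeg d l \<Longrightarrow> qdeg (c * d) (k + l)"
  by (auto simp: qdeg_def Mon_mult)

lemma qdeg_1: "qdeg 1 0"
  unfolding qdeg_def by (rule exI[of _ "\<lambda>_. 0"]) simp

lemma qdeg_inverse: "qdeg c k \<Longrightarrow> qdeg (1 / c) (- k)"
  unfolding qdeg_def using Mon_inverse by metis

lemma qdeg_divide: "qdeg c k \<Longrightarrow> qdeg d l \<Longrightarrow> qdeg (c / d) (k - l)"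
  using qdeg_mult[of c k "1 / d" "- l"] qdeg_inverse by auto

lemma qdeg_unique: "qdeg c k \<Longrightarrow> qdeg c l \<Longrightarrow> k = l"
  by (auto simp: qdeg_def dest: Mon_inject)

lemma qdeg_par: "qdeg (par v) (if v = Q_half then 1 else 0)"
proof -
  have "Mon (\<lambda>w. if w = v then 1 else 0) = par v"
    unfolding Mon_def by (subst prod.remove[of _ v]) (auto intro!: prod.neutral)
  then show ?thesis unfolding qdeg_def by (intro exI[of _ "\<lambda>w. if w = v then 1 else 0"]) auto
qed

lemma qdeg_power: "qdeg c k \<Longrightarrow> qdeg (c ^ m) (int m * k)"
proof (induction m)
  case 0 then show ?case using qdeg_1 by simp
next
  case (Suc m) then show ?case using qdeg_mult[of c k "c ^ m" "int m * k"] by (simp add: algebra_simps)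
qed

lemma qdeg_powi: "qdeg c k \<Longrightarrow> qdeg (c powi m) (m * k)"
  using qdeg_power[of c k "nat m"] qdeg_inverse[OF qdeg_power[of c k "nat (- m)"]]
  by (cases "0 \<le> m") (auto simp: power_int_def divide_inverse power_inverse)

lemma qdeg_prod: "finite A \<Longrightarrow> (\<And>a. a \<in> A \<Longrightarrow> qdeg (f a) 0) \<Longrightarrow> qdeg (prod f A) 0"
proof (induction A rule: finite_induct)
  case empty then show ?case using qdeg_1 by simp
next
  case (insert a A) then show ?case using qdeg_mult[of "f a" 0 "prod f A" 0] by simp
qed

text \<open>In a dominant vector the positions with entry at least \<open>k\<close> form an initial
  segment, which is known from its size.\<close>

lemma dominant_eqI:
  assumes d: "dominant n \<kappa>" "dominant n \<nu>" and lat: "\<kappa> \<in> lattice n" "\<nu> \<in> lattice n"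
    and c: "\<And>k. 1 \<le> k \<Longrightarrow> card {j \<in> {1..n}. k \<le> lk \<kappa> j} = card {j \<in> {1..n}. k \<le> lk \<nu> j}"
  shows "\<kappa> = \<nu>"
proof -
  have seg: "{j \<in> {1..n}. k \<le> lk \<mu> j} = {1..card {j \<in> {1..n}. k \<le> lk \<mu> j}}" if "dominant n \<mu>" for \<mu> :: expo and k
  proof -
    let ?S = "{j \<in> {1..n}. k \<le> lk \<mu> j}"
    have down: "i \<in> ?S" if "j \<in> ?S" "1 \<le> i" "i \<le> j" for i j
      using that dominant_mono[OF \<open>dominant n \<mu>\<close>, of i j] by auto
    show ?thesis
    proof (cases "?S = {}")
      case False
      define m where "m = Max ?S"
      have m: "m \<in> ?S" unfolding m_def using False by (intro Max_in) auto
      have "?S = {1..m}"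
      proof
        show "?S \<subseteq> {1..m}" unfolding m_def by (auto intro: Max_ge)
        show "{1..m} \<subseteq> ?S" using down[OF m] by auto
      qed
      then show ?thesis by (metis card_atLeastAtMost diff_Suc_1)
    qed auto
  qed
  have S: "{j \<in> {1..n}. k \<le> lk \<kappa> j} = {j \<in> {1..n}. k \<le> lk \<nu> j}" if "1 \<le> k" for k
    by (rule trans[OF seg[OF d(1)] trans[OF arg_cong[OF c[OF that], of "\<lambda>m. {1..m}"] seg[OF d(2), symmetric]]])
  have "k \<le> lk \<kappa> j \<longleftrightarrow> k \<le> lk \<nu> j" if "j \<in> {1..n}" "1 \<le> k" for j k
    using S[OF that(2)] that(1) by blast
  then have "lk \<kappa> j = lk \<nu> j" if "j \<in> {1..n}" for j
    using dominant_nonneg[OF d(1), of j] dominant_nonneg[OF d(2), of j] that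
    by (metis atLeastAtMost_iff dual_order.antisym int_one_le_iff_zero_less order_le_less order_refl)
  then show ?thesis using lat by (intro poly_mapping_eqI) (metis in_lattice)
qed

text \<open>Equal sums have equal multisets of monomials. For \<open>k \<ge> 1\<close>, the
  monomials of degree at least \<open>2 * k\<close> in \<open>q^(1/2)\<close> are all among the
  inverses \<open>1 / y j\<close>, and their number is the number of entries that are at least
  \<open>k\<close>.\<close>

lemma sum_Mon_inject:
  fixes y y' :: "nat \<Rightarrow> coeff"
  assumes d: "dominant n \<kappa>" "dominant n \<nu>" and lat: "\<kappa> \<in> lattice n" "\<nu> \<in> lattice n"
    and y: "\<And>j. j \<in> {1..n} \<Longrightarrow> qdeg (y j) (- 2 * lk \<kappa> j)" and y': "\<And>j. j \<in> {1..n} \<Longrightarrow> qdeg (y' j) (- 2 * lk \<nu> j)"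
    and eq: "(\<Sum>j=1..n. y j + 1 / y j) = (\<Sum>j=1..n. y' j + 1 / y' j)"
  shows "\<kappa> = \<nu>"
proof -
  obtain e where e: "\<And>j. j \<in> {1..n} \<Longrightarrow> y j = Mon (e j) \<and> e j Q_half = - 2 * lk \<kappa> j" using y unfolding qdeg_def by metis
  obtain e' where e': "\<And>j. j \<in> {1..n} \<Longrightarrow> y' j = Mon (e' j) \<and> e' j Q_half = - 2 * lk \<nu> j" using y' unfolding qdeg_def by metis
  define A where "A e = (\<Sum>j\<in>{1..n}. {#e j, \<lambda>v. - e j v#})" for e :: "nat \<Rightarrow> param \<Rightarrow> int"
  have s: "(\<Sum>x\<in>#(\<Sum>j\<in>J. {#e j, \<lambda>v. - e j v#}). Mon x) = (\<Sum>j\<in>J. Mon (e j) + 1 / Mon (e j))"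
    if "finite J" for J and e :: "nat \<Rightarrow> param \<Rightarrow> int"
    using that by (induction J) (simp_all add: Mon_inverse add_ac)
  have "(\<Sum>j=1..n. Mon (e j) + 1 / Mon (e j)) = (\<Sum>j=1..n. y j + 1 / y j)"
    by (rule sum.cong) (use e in auto)
  moreover have "(\<Sum>j=1..n. Mon (e' j) + 1 / Mon (e' j)) = (\<Sum>j=1..n. y' j + 1 / y' j)"
    by (rule sum.cong) (use e' in auto)
  ultimately have "(\<Sum>x\<in>#A e. Mon x) = (\<Sum>x\<in>#A e'. Mon x)"
    unfolding A_def s[OF finite_atLeastAtMost] using eq by simp
  then have AA: "A e = A e'" by (rule Mon_independent)
  have cc: "size (filter_mset (\<lambda>x. 2 * k \<le> x Q_half) (A e)) = card {j \<in> {1..n}. k \<le> lk \<mu> j}"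
    if "1 \<le> k" "\<And>j. j \<in> {1..n} \<Longrightarrow> e j Q_half = - 2 * lk \<mu> j" "dominant n \<mu>" for k :: int and e :: "nat \<Rightarrow> param \<Rightarrow> int" and \<mu>
  proof -
    have "size (filter_mset (\<lambda>x. 2 * k \<le> x Q_half) (\<Sum>j\<in>J. {#e j, \<lambda>v. - e j v#})) = card {j \<in> J. k \<le> lk \<mu> j}"
      if "finite J" "J \<subseteq> {1..n}" for J using that
    proof (induction J)
      case (insert j J)
      have "e j Q_half = - 2 * lk \<mu> j" "0 \<le> lk \<mu> j" using \<open>\<And>j. j \<in> {1..n} \<Longrightarrow> e j Q_half = - 2 * lk \<mu> j\<close>[of j] dominant_nonneg[OF \<open>dominant n \<mu>\<close>, of j] insert by auto
      moreover have "{j' \<in> insert j J. k \<le> lk \<mu> j'} = (if k \<le> lk \<mu> j then insert j {j' \<in> J. k \<le> lk \<mu> j'} else {j' \<in> J. k \<le> lk \<mu> j'})"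
        by auto
      ultimately show ?case using insert \<open>1 \<le> k\<close> by simp
    qed simp
    then show ?thesis by (simp add: A_def)
  qed
  show ?thesis
  proof (rule dominant_eqI[OF d lat])
    fix k :: int assume "1 \<le> k"
    then show "card {j \<in> {1..n}. k \<le> lk \<kappa> j} = card {j \<in> {1..n}. k \<le> lk \<nu> j}"
      using cc[of k e \<kappa>] cc[of k e' \<nu>] e e' d AA by simp
  qed
qed

lemma sum_Mon_nonzero: assumes "finite I" "I \<noteq> {}" shows "(\<Sum>i\<in>I. Mon (e i)) \<noteq> 0"
proof
  assume "(\<Sum>i\<in>I. Mon (e i)) = 0"
  then have "(\<Sum>x\<in>#image_mset e (mset_set I). Mon x) = (\<Sum>x\<in>#{#}. Mon x)"
    by (simp add: sum_unfold_sum_mset multiset.map_comp comp_def)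
  then have "image_mset e (mset_set I) = {#}" by (rule Mon_independent)
  then show False using assms by (simp add: mset_set_empty_iff)
qed

section \<open>Nonsymmetric polynomials of dominant weight\<close>

context rank
begin

lemma qdeg_cY: assumes "1 \<le> j" "j \<le> n" shows "qdeg (cY j \<kappa>) (- 2 * lk \<kappa> j)"
proof -
  have p: "qdeg q_h 1" "qdeg t_h 0" "qdeg t0_h 0" "qdeg tn_h 0"
    using qdeg_par[of Q_half] qdeg_par[of T_half] qdeg_par[of T0_half] qdeg_par[of Tn_half] by simp_all
  have i: "qdeg (1 / t_h) 0" "qdeg (1 / tn_h) 0" using qdeg_inverse p by fastforce+
  have tp: "qdeg t_par 0" using qdeg_power[OF p(2), of 2] by simp
  then have "qdeg ((1 / t_par) ^ k) 0" "qdeg (t_par ^ k) 0" for k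
    using qdeg_power[OF qdeg_inverse[OF tp], of k] qdeg_power[OF tp, of k] by simp_all
  then have R: "qdeg (cR j \<kappa>) 0"
    unfolding cR_def using qdeg_mult[OF i(2)] qdeg_mult[OF p(4)] by fastforce
  have P: "qdeg (\<Prod>m\<in>{1..<j}. if lk \<kappa> m = 0 \<and> lk \<kappa> j = 0 then t_h else 1 / t_h) 0"
    "qdeg (\<Prod>m\<in>{1..<j}. if lk \<kappa> m = lk \<kappa> j then 1 / t_h else t_h) 0"
    using p i by (auto intro!: qdeg_prod)
  have Q: "qdeg (if lk \<kappa> j = 0 then t0_h else q_par powi (- lk \<kappa> j) / t0_h) (- 2 * lk \<kappa> j)"
    using p qdeg_divide[OF qdeg_powi[OF qdeg_power[OF p(1), of 2], of "- lk \<kappa> j"] p(3)] by (auto simp: mult.commute)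
  show ?thesis using qdeg_mult[OF qdeg_mult[OF qdeg_mult[OF R P(1)] Q] P(2)] by (simp add: cY_def)
qed

lemma cY_nonzero: "1 \<le> j \<Longrightarrow> j \<le> n \<Longrightarrow> cY j \<kappa> \<noteq> 0"
  using qdeg_cY[of j \<kappa>] by (auto simp: qdeg_def)

definition central_eigenvalue :: "expo \<Rightarrow> coeff" where "central_eigenvalue \<kappa> = (\<Sum>j=1..n. cY j \<kappa> + 1 / cY j \<kappa>)"

lemma central_eigenvalue_inject:
  "dominant n \<kappa> \<Longrightarrow> dominant n \<nu> \<Longrightarrow> \<kappa> \<in> lat \<Longrightarrow> \<nu> \<in> lat \<Longrightarrow> central_eigenvalue \<kappa> = central_eigenvalue \<nu> \<Longrightarrow> \<kappa> = \<nu>"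
  using qdeg_cY[of _ \<kappa>] qdeg_cY[of _ \<nu>]
  by (intro sum_Mon_inject[of n \<kappa> \<nu> "\<lambda>j. cY j \<kappa>" "\<lambda>j. cY j \<nu>"]) (auto simp: central_eigenvalue_def)

lemma app_Y_Yi: "j \<le> n \<Longrightarrow> app (LH.Yi j) (app (LH.Y j) f) = f" "j \<le> n \<Longrightarrow> app (LH.Y j) (app (LH.Yi j) f) = f"
  using LH.Y_Yi[of j] by (metis app_simps(2) app_simps(6))+

lemma Yi_lead:
  assumes "dominant n \<kappa>" "\<kappa> \<in> lat" "1 \<le> j" "j \<le> n"
  shows "app (LH.Yi j) (mono \<kappa>) - scal (1 / cY j \<kappa>) * mono \<kappa> \<in> supp_in (below (nm n \<kappa>))"
proof -
  let ?c = "cY j \<kappa>"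
  have "app (LH.Yi j) (app (LH.Y j) (mono \<kappa>) - scal ?c * mono \<kappa>) \<in> supp_in (below (nm n \<kappa>))"
    using Y_lead[OF assms] stable_Y[OF good_below, of j "nm n \<kappa>"] assms(4) by (auto simp: tr_def stable_def)
  then have "mono \<kappa> - scal ?c * app (LH.Yi j) (mono \<kappa>) \<in> supp_in (below (nm n \<kappa>))"
    using lin_Y[OF assms(4)] assms(4) by (simp add: app_diff app_Y_Yi linD)
  then have "scal (- 1 / ?c) * (mono \<kappa> - scal ?c * app (LH.Yi j) (mono \<kappa>)) \<in> supp_in (below (nm n \<kappa>))"
    by (rule supp_in_scal)
  moreover have "scal (- 1 / ?c) * (mono \<kappa> - scal ?c * app (LH.Yi j) (mono \<kappa>)) =
     (scal (1 / ?c) * scal ?c) * app (LH.Yi j) (mono \<kappa>) - scal (1 / ?c) * mono \<kappa>"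
    by (simp add: algebra_simps del: scal_mult)
  ultimately show ?thesis using cY_nonzero[OF assms(3,4), of \<kappa>] by (simp flip: scal_mult)
qed

lemma Z_lead:
  assumes "dominant n \<kappa>" "\<kappa> \<in> lat"
  shows "app LH.Z (mono \<kappa>) - scal (central_eigenvalue \<kappa>) * mono \<kappa> \<in> supp_in (below (nm n \<kappa>))"
proof -
  have "app LH.Z (mono \<kappa>) - scal (central_eigenvalue \<kappa>) * mono \<kappa> = (\<Sum>j=1..n.
     (app (LH.Y j) (mono \<kappa>) - scal (cY j \<kappa>) * mono \<kappa>) + (app (LH.Yi j) (mono \<kappa>) - scal (1 / cY j \<kappa>) * mono \<kappa>))"
    by (simp add: LH.Z_def central_eigenvalue_def app_sum_left scal_sum sum_distrib_right sum_distrib_left algebra_simps sum.distrib sum_subtractf)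
  then show ?thesis
    using Y_lead[OF assms] Yi_lead[OF assms] by (auto simp: tr_def intro!: supp_in_sum supp_in_add)
qed

section \<open>Leading eigenvalues of \<open>Z\<close> on all monomials\<close>

lemma app_LT_Z: "1 \<le> i \<Longrightarrow> i \<le> n \<Longrightarrow> app (LT i) (app LH.Z f) = app LH.Z (app (LT i) f)"
  using LH.Z_central[of i] by (metis LH.commutes_def app_simps(6))

text \<open>Up to smaller norm, \<open>x^\<mu>\<close> is a multiple of \<open>T i\<close> applied
  to a monomial with fewer inversions. As \<open>Z\<close> commutes with \<open>T i\<close>, the
  leading eigenvalue is carried over from a dominant exponent of the same norm.\<close>

lemma Z_orbit:
  assumes "\<mu> \<in> lat"
  shows "\<exists>\<kappa>. dominant n \<kappa> \<and> \<kappa> \<in> lat \<and> nm n \<kappa> = nm n \<mu> \<and>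
    app LH.Z (mono \<mu>) - scal (central_eigenvalue \<kappa>) * mono \<mu> \<in> supp_in (below (nm n \<mu>))"
  using assms
proof (induction "inv_count n \<mu>" arbitrary: \<mu> rule: less_induct)
  case less
  show ?case
  proof (cases "dominant n \<mu>")
    case True
    then show ?thesis using Z_lead less.prems by blast
  next
    case False
    then obtain i where i: "1 \<le> i" "i \<le> n" "mm n i \<mu> < 0" by (auto simp: dominant_def not_le)
    define \<nu> where "\<nu> = refl n i \<mu>"
    have \<nu>: "\<nu> \<in> lat" "inv_count n \<nu> < inv_count n \<mu>" "mm n i \<nu> > 0" "refl n i \<nu> = \<mu>"
      using i less.prems n_pos inv_count_refl_neg[OF i] by (auto simp: \<nu>_def)
    have nm\<nu>: "nm n \<nu> = nm n \<mu>" using nm_sref[OF n_pos i(2), of \<mu>] i by (simp add: \<nu>_def sref_def)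
    obtain \<kappa> where \<kappa>: "dominant n \<kappa>" "\<kappa> \<in> lat" "nm n \<kappa> = nm n \<mu>"
      "app LH.Z (mono \<nu>) - scal (central_eigenvalue \<kappa>) * mono \<nu> \<in> supp_in (below (nm n \<mu>))"
      using less.hyps[OF \<nu>(2,1)] nm\<nu> by auto
    let ?B = "below (nm n \<mu>)" and ?z = "central_eigenvalue \<kappa>" and ?k = "kap n i"
    define r where "r = app (LT i) (mono \<nu>) - scal (1 / ?k) * mono \<mu>"
    have "zc i = 1" "m0 n i \<nu> > 0" "sref n i \<nu> = \<mu>" using i \<nu> by (simp_all add: zc_def m0_def sref_def)
    then have r: "r \<in> supp_in ?B" using hecke_lead(2)[OF i(2) \<nu>(1)] i(2) nm\<nu> by (simp add: r_def app_LT)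
    have m: "mono \<mu> = scal ?k * (app (LT i) (mono \<nu>) - r)"
      by (simp add: r_def flip: scal_mult mult.assoc)
    have "app LH.Z (mono \<mu>) - scal ?z * mono \<mu> =
      scal ?k * (app (LT i) (app LH.Z (mono \<nu>) - scal ?z * mono \<nu>) - app LH.Z r + scal ?z * r)"
      unfolding m by (simp only: linD[OF lin_Z] linD[OF lin_LT[OF i(2)]] app_LT_Z[OF i(1,2)] app_diff) (simp add: algebra_simps)
    also have "\<dots> \<in> supp_in ?B"
      using \<kappa>(4) r stableD[OF stable_LT[OF good_below i(2)]] stableD[OF stable_Z[OF good_below]]
      by (intro supp_in_scal supp_in_add supp_in_diff) auto
    finally show ?thesis using \<kappa> by blast
  qed
qed

text \<open>Chosen through its norm and eigenvalue. That a dominant exponent is sent to itself then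
  follows from the injectivity of \<open>central_eigenvalue\<close>.\<close>

definition dr :: "expo \<Rightarrow> expo" where
  "dr \<mu> = (SOME \<kappa>. dominant n \<kappa> \<and> \<kappa> \<in> lat \<and> nm n \<kappa> = nm n \<mu> \<and>
    app LH.Z (mono \<mu>) - scal (central_eigenvalue \<kappa>) * mono \<mu> \<in> supp_in (below (nm n \<mu>)))"

lemma dr: assumes "\<mu> \<in> lat"
  shows "dominant n (dr \<mu>)" "dr \<mu> \<in> lat" "nm n (dr \<mu>) = nm n \<mu>"
    "app LH.Z (mono \<mu>) - scal (central_eigenvalue (dr \<mu>)) * mono \<mu> \<in> supp_in (below (nm n \<mu>))"
  using someI_ex[OF Z_orbit[OF assms]] unfolding dr_def by blast+

lemma lk_app_top:
  assumes x: "lin x" and f: "f \<in> supp_in lat"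
    and top: "\<And>\<mu>. \<mu> \<in> Poly_Mapping.keys f \<Longrightarrow> lk (app x (mono \<mu>)) \<nu> = (if \<mu> = \<nu> then c else 0)"
  shows "lk (app x f) \<nu> = c * lk f \<nu>"
proof -
  have "lk (app x f) \<nu> = (\<Sum>\<mu>\<in>Poly_Mapping.keys f. lk f \<mu> * lk (app x (mono \<mu>)) \<nu>)"
    unfolding app_sum_mono[of x f] by (simp add: lookup_sum linD[OF x])
  also have "\<dots> = (\<Sum>\<mu>\<in>Poly_Mapping.keys f. if \<mu> = \<nu> then c * lk f \<nu> else 0)"
    by (rule sum.cong) (simp_all add: top)
  also have "\<dots> = c * lk f \<nu>" by (simp add: in_keys_iff)
  finally show ?thesis .
qed

lemma Z_top:
  assumes f: "f \<in> supp_in lat" and top: "\<And>\<mu>. \<mu> \<in> Poly_Mapping.keys f \<Longrightarrow> nm n \<mu> \<le> nm n \<nu>"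
  shows "lk (app LH.Z f) \<nu> = central_eigenvalue (dr \<nu>) * lk f \<nu>"
proof (rule lk_app_top[OF lin_Z f])
  fix \<mu> assume \<mu>: "\<mu> \<in> Poly_Mapping.keys f"
  then have "\<mu> \<in> lat" using f by (auto simp: supp_in_def)
  moreover have "\<nu> \<notin> below (nm n \<mu>)" using top[OF \<mu>] by (auto simp: below_def)
  ultimately have "lk (app LH.Z (mono \<mu>) - scal (central_eigenvalue (dr \<mu>)) * mono \<mu>) \<nu> = 0" by (intro supp_in_lk[OF dr(4)])
  then show "lk (app LH.Z (mono \<mu>)) \<nu> = (if \<mu> = \<nu> then central_eigenvalue (dr \<nu>) else 0)"
    by (auto simp: lookup_minus lookup_single when_def)
qed

lemma ex_top:
  fixes g :: "expo \<Rightarrow> 'b::linorder"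
  assumes "f \<noteq> 0" shows "\<exists>\<nu> \<in> Poly_Mapping.keys f. \<forall>\<mu> \<in> Poly_Mapping.keys f. g \<mu> \<le> g \<nu>"
proof -
  have ne: "Poly_Mapping.keys f \<noteq> {}" using assms by simp
  then have "Max (g ` Poly_Mapping.keys f) \<in> g ` Poly_Mapping.keys f" by (intro Max_in) auto
  then show ?thesis by (auto intro!: bexI Max_ge simp: image_iff) (metis Max_ge finite_imageI finite_keys image_eqI)
qed

lemma Z_eigen_top:
  assumes "f \<in> supp_in lat" "app LH.Z f = scal z * f" "\<nu> \<in> Poly_Mapping.keys f"
    "\<And>\<mu>. \<mu> \<in> Poly_Mapping.keys f \<Longrightarrow> nm n \<mu> \<le> nm n \<nu>"
  shows "central_eigenvalue (dr \<nu>) = z"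
  using Z_top[OF assms(1,4)] assms(2,3) by (simp add: in_keys_iff)

lemma dr_dominant: assumes "dominant n \<nu>" "\<nu> \<in> lat" shows "dr \<nu> = \<nu>"
proof -
  have "app LH.Z (mono \<nu>) - scal (central_eigenvalue \<nu>) * mono \<nu> - (app LH.Z (mono \<nu>) - scal (central_eigenvalue (dr \<nu>)) * mono \<nu>) \<in> supp_in (below (nm n \<nu>))"
    by (rule supp_in_diff[OF Z_lead[OF assms] dr(4)[OF assms(2)]])
  then have "scal (central_eigenvalue (dr \<nu>) - central_eigenvalue \<nu>) * mono \<nu> \<in> supp_in (below (nm n \<nu>))" by (simp add: left_diff_distrib)
  then have "lk (scal (central_eigenvalue (dr \<nu>) - central_eigenvalue \<nu>) * mono \<nu>) \<nu> = 0" by (rule supp_in_lk) (simp add: below_def)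
  then have "central_eigenvalue (dr \<nu>) = central_eigenvalue \<nu>" by (simp del: scal_simps)
  then show ?thesis using central_eigenvalue_inject dr[OF assms(2)] assms by blast
qed

text \<open>Peeling off norm layers: on the largest layer \<open>Z - z\<close> acts by the nonzero
  numbers \<open>central_eigenvalue (dr \<mu>) - z\<close> up to smaller norm, so division clears
  this layer, and the remainder is treated by induction.\<close>

lemma Z_solve:
  assumes C: "good C" and z: "\<And>\<mu>. \<mu> \<in> lat \<Longrightarrow> nm n \<mu> < int N \<Longrightarrow> central_eigenvalue (dr \<mu>) \<noteq> z" and r: "r \<in> supp_in (C \<inter> below (int N))"
  shows "\<exists>g \<in> supp_in (C \<inter> below (int N)). app LH.Z g - scal z * g = r"
  using z r
proof (induction N arbitrary: r)
  case 0
  have "below 0 = {}" using nm_nonneg by (auto simp: below_def not_less)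
  then have "r = 0" using 0 by (simp add: supp_in_def)
  then show ?case by (intro bexI[of _ 0]) auto
next
  case (Suc N)
  let ?D = "\<lambda>N. C \<inter> below (int N)"
  have gD: "good (?D N)" for N by (intro good_Int C good_below)
  define K where "K = {\<mu> \<in> Poly_Mapping.keys r. nm n \<mu> = int N}"
  define g where "g = (\<Sum>\<mu>\<in>K. Poly_Mapping.single \<mu> (lk r \<mu> / (central_eigenvalue (dr \<mu>) - z)))"
  have fK: "finite K" by (simp add: K_def)
  have lkg: "lk g \<nu> = (if \<nu> \<in> K then lk r \<nu> / (central_eigenvalue (dr \<nu>) - z) else 0)" for \<nu>
    using fK by (simp add: g_def lookup_sum lookup_single when_def)
  have KD: "K \<subseteq> ?D (Suc N)" using Suc.prems(2) by (auto simp: K_def supp_in_def)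
  then have gs: "g \<in> supp_in (?D (Suc N))" unfolding g_def by (intro supp_in_sum supp_in_single) auto
  have glat: "g \<in> supp_in lat" using supp_in_mono[OF _ gs, of lat] C by (auto simp: good_def)
  define r' where "r' = r - (app LH.Z g - scal z * g)"
  have r's: "r' \<in> supp_in (?D (Suc N))"
    unfolding r'_def using Suc.prems(2) gs stableD[OF stable_Z[OF gD] gs] by (intro supp_in_diff supp_in_scal) auto
  have "lk r' \<nu> = 0" if "nm n \<nu> = int N" "\<nu> \<in> lat" for \<nu>
  proof -
    have "lk (app LH.Z g) \<nu> = central_eigenvalue (dr \<nu>) * lk g \<nu>"
      by (rule Z_top[OF glat]) (auto simp: in_keys_iff lkg K_def that split: if_splits)
    moreover have "central_eigenvalue (dr \<nu>) - z \<noteq> 0" using Suc.prems(1)[of \<nu>] that by simp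
    moreover have "(central_eigenvalue (dr \<nu>) - z) * lk g \<nu> = lk r \<nu>"
      using that \<open>central_eigenvalue (dr \<nu>) - z \<noteq> 0\<close> by (simp add: lkg K_def in_keys_iff)
    moreover have "lk r' \<nu> = lk r \<nu> - (lk (app LH.Z g) \<nu> - z * lk g \<nu>)"
      unfolding r'_def lookup_minus lk_scal by simp
    ultimately show ?thesis by (simp add: left_diff_distrib)
  qed
  then have "r' \<in> supp_in (?D N)"
    using r's by (auto simp: supp_in_def subset_iff below_def in_keys_iff) (metis order_less_le zle_add1_eq_le add.commute)+
  then obtain g' where g': "g' \<in> supp_in (?D N)" "app LH.Z g' - scal z * g' = r'"
    using Suc.IH[of r'] Suc.prems(1) by auto
  have "?D N \<subseteq> ?D (Suc N)" by (auto simp: below_def)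
  then have "g + g' \<in> supp_in (?D (Suc N))" using supp_in_add[OF gs supp_in_mono[OF _ g'(1)]] by blast
  moreover have "app LH.Z (g + g') - scal z * (g + g') = r"
    using g'(2) by (simp add: app_add r'_def algebra_simps)
  ultimately show ?case by blast
qed

text \<open>Lower terms correct \<open>x^\<kappa>\<close> to an eigenvector \<open>E\<close> of
  \<open>Z\<close>. The defect of \<open>E\<close> under \<open>Y j\<close> is again an eigenvector
  of \<open>Z\<close> for the same eigenvalue, but of smaller norm, where this eigenvalue does not
  occur as a leading one; so it vanishes.\<close>

lemma E_exists:
  assumes C: "good C" "\<kappa> \<in> C" and d: "dominant n \<kappa>"
  shows "\<exists>E. E \<in> supp_in C \<and> E - mono \<kappa> \<in> supp_in (below (nm n \<kappa>)) \<and> app LH.Z E = scal (central_eigenvalue \<kappa>) * E \<and>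
    (\<forall>j \<in> {1..n}. app (LH.Y j) E = scal (cY j \<kappa>) * E)"
proof -
  have lat: "\<kappa> \<in> lat" using C by (auto simp: good_def)
  define N where "N = nat (nm n \<kappa>)"
  have N: "int N = nm n \<kappa>" using nm_nonneg by (simp add: N_def)
  let ?z = "central_eigenvalue \<kappa>" and ?D = "C \<inter> below (int N)"
  have ne: "central_eigenvalue (dr \<mu>) \<noteq> ?z" if "\<mu> \<in> lat" "nm n \<mu> < int N" for \<mu>
    using central_eigenvalue_inject[of "dr \<mu>" \<kappa>] dr[OF that(1)] that(2) d lat N by fastforce
  have "app LH.Z (mono \<kappa>) - scal ?z * mono \<kappa> \<in> supp_in ?D"
    using Z_lead[OF d lat] C stableD[OF stable_Z[OF C(1)], of "mono \<kappa>"]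
    by (auto simp: supp_in_Int N intro!: supp_in_diff supp_in_scal)
  then obtain g where g: "g \<in> supp_in ?D" "app LH.Z g - scal ?z * g = app LH.Z (mono \<kappa>) - scal ?z * mono \<kappa>"
    using Z_solve[OF C(1) ne] by blast
  define E where "E = mono \<kappa> - g"
  have ZE: "app LH.Z E = scal ?z * E" using g(2) by (simp add: E_def app_diff algebra_simps)
  have gb: "g \<in> supp_in (below (nm n \<kappa>))" "g \<in> supp_in C" using g(1) by (auto simp: supp_in_Int N)
  have "app (LH.Y j) E = scal (cY j \<kappa>) * E" if j: "j \<in> {1..n}" for j
  proof -
    define e where "e = app (LH.Y j) E - scal (cY j \<kappa>) * E"
    have "app (LH.Y j) (app LH.Z E) = app LH.Z (app (LH.Y j) E)"
      using arg_cong[OF LH.commutesD[OF LH.Z_commutes_Y[of j]], of "\<lambda>x. app x E"] j by simp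
    moreover have "lin (LH.Y j)" using lin_Y j by auto
    ultimately have "app LH.Z (app (LH.Y j) E) = scal ?z * app (LH.Y j) E" by (simp only: ZE linD)
    then have Ze: "app LH.Z e = scal ?z * e"
      by (simp only: e_def app_diff linD[OF lin_Z] ZE) (simp add: algebra_simps)
    have "e = (app (LH.Y j) (mono \<kappa>) - scal (cY j \<kappa>) * mono \<kappa>) - (app (LH.Y j) g - scal (cY j \<kappa>) * g)"
      by (simp add: e_def E_def app_diff algebra_simps)
    then have eb: "e \<in> supp_in (below (nm n \<kappa>))"
      using Y_lead[OF d lat, of j] j gb(1) stable_Y[OF good_below, of j "nm n \<kappa>"]
      by (auto simp: tr_def stable_def intro!: supp_in_diff supp_in_scal)
    have "e = 0"
    proof (rule ccontr)
      assume "e \<noteq> 0"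
      then obtain \<nu> where \<nu>: "\<nu> \<in> Poly_Mapping.keys e" "\<And>\<mu>. \<mu> \<in> Poly_Mapping.keys e \<Longrightarrow> nm n \<mu> \<le> nm n \<nu>"
        using ex_top[of e "nm n"] by blast
      have "\<nu> \<in> lat" "nm n \<nu> < int N" using eb \<nu>(1) by (auto simp: supp_in_def below_def N)
      moreover have "e \<in> supp_in lat" using supp_in_mono[OF _ eb] by (auto simp: below_def)
      ultimately show False using Z_eigen_top[of e ?z \<nu>] Ze \<nu> ne by blast
    qed
    then show ?thesis by (simp add: e_def)
  qed
  moreover have "E \<in> supp_in C" unfolding E_def using gb C by (intro supp_in_diff) auto
  moreover have "E - mono \<kappa> \<in> supp_in (below (nm n \<kappa>))"
    using supp_in_diff[OF supp_in_0 gb(1)] by (simp add: E_def)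
  ultimately show ?thesis using ZE by blast
qed

end

section \<open>Triangularity of each \<open>Y j\<close> and uniqueness of joint eigenvectors\<close>

context rank
begin

text \<open>Norm first, inversions second: on monomials that are not dominant, the terms with
  \<open>h\<close> in the cross relations can have the same norm, but they have fewer
  inversions.\<close>

definition low :: "expo \<Rightarrow> expo set" where
  "low \<mu> = {\<nu> \<in> lat. nm n \<nu> < nm n \<mu> \<or> nm n \<nu> = nm n \<mu> \<and> inv_count n \<nu> < inv_count n \<mu>}"

text \<open>A reflection adds at most one inversion, and for \<open>\<nu>\<close> it adds exactly
  one; so an exponent below \<open>\<nu>\<close> stays, with its reflection, below the reflected
  \<open>\<nu>\<close>.\<close>

lemma hecke_low:
  assumes i: "1 \<le> i" "i \<le> n" "mm n i \<nu> > 0" and \<nu>: "\<nu> \<in> lat" and f: "f \<in> supp_in (low \<nu>)"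
  shows "app (LT i) f \<in> supp_in (low (refl n i \<nu>))"
  unfolding app_sum_mono[of _ f]
proof (rule supp_in_sum)
  fix \<kappa> assume "\<kappa> \<in> Poly_Mapping.keys f"
  then have \<kappa>: "\<kappa> \<in> lat" "nm n \<kappa> < nm n \<nu> \<or> nm n \<kappa> = nm n \<nu> \<and> inv_count n \<kappa> < inv_count n \<nu>"
    using f by (auto simp: supp_in_def low_def)
  let ?L = "low (refl n i \<nu>)"
  have nms: "nm n (refl n i \<mu>) = nm n \<mu>" for \<mu> using nm_sref[OF n_pos i(2), of \<mu>] i by (simp add: sref_def)
  have inv: "inv_count n (refl n i \<nu>) = Suc (inv_count n \<nu>)" using inv_count_refl_pos i by blast
  have k1: "\<kappa> \<in> ?L" using \<kappa> by (auto simp: low_def nms inv)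
  have k2: "sref n i \<kappa> \<in> ?L" using \<kappa> inv_count_refl_le[OF i(1,2), of \<kappa>] n_pos i
    by (auto simp: low_def nms inv sref_def)
  have k3: "below (nm n \<kappa>) \<subseteq> ?L" using \<kappa> by (auto simp: low_def below_def nms)
  have d: "f \<in> supp_in ?L" if "f - g \<in> supp_in (below (nm n \<kappa>))" "g \<in> supp_in ?L" for f g
    using supp_in_add[OF supp_in_mono[OF k3 that(1)] that(2)] by simp
  have "hecke n i (mono \<kappa>) \<in> supp_in ?L"
  proof (cases "m0 n i \<kappa>" "0::int" rule: linorder_cases)
    case less then show ?thesis
      by (intro d[OF hecke_lead(3)[OF i(2) \<kappa>(1)]] supp_in_add supp_in_scal supp_in_single k1 k2)
  next
    case equal then show ?thesis using hecke_lead(1)[OF i(2) \<kappa>(1)] k1 by (simp add: supp_in_scal)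
  next
    case greater then show ?thesis by (intro d[OF hecke_lead(2)[OF i(2) \<kappa>(1)]] supp_in_scal supp_in_single k2)
  qed
  then show "app (LT i) (scal (lk f \<kappa>) * mono \<kappa>) \<in> supp_in ?L"
    by (subst linD[OF lin_LT[OF i(2)]], subst app_LT[OF i(2)]) (rule supp_in_scal)
qed

definition ytri :: "laurent endo \<Rightarrow> expo \<Rightarrow> int \<Rightarrow> bool" where
  "ytri x \<mu> k \<longleftrightarrow> (\<exists>c. qdeg c k \<and> app x (mono \<mu>) - scal c * mono \<mu> \<in> supp_in (low \<mu>))"

text \<open>The hypothesis on \<open>x\<close>, \<open>y\<close>, \<open>w\<close> is the common
  shape of all cross relations. Up to smaller norm \<open>T i\<close> maps \<open>x^\<nu>\<close> to
  a multiple of the reflected monomial, so the diagonal entry of \<open>y\<close> passes to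
  \<open>x\<close>.\<close>

lemma ytri_step:
  assumes i: "1 \<le> i" "i \<le> n" "mm n i \<nu> > 0" and \<nu>: "\<nu> \<in> lat"
    and x: "x * LT i = LT i * y + w" and lx: "lin x" "stable lat x" "\<And>N. stable (below N) x" and y: "ytri y \<nu> k"
    and w: "app w (mono \<nu>) \<in> supp_in (low (refl n i \<nu>))"
  shows "ytri x (refl n i \<nu>) k"
proof -
  let ?\<mu> = "refl n i \<nu>"
  obtain c where c: "qdeg c k" "app y (mono \<nu>) - scal c * mono \<nu> \<in> supp_in (low \<nu>)" using y by (auto simp: ytri_def)
  have nms: "nm n ?\<mu> = nm n \<nu>" using nm_sref[OF n_pos i(2), of \<nu>] i by (simp add: sref_def)
  have bl: "below (nm n \<nu>) \<subseteq> low ?\<mu>" by (auto simp: low_def below_def nms)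
  define r where "r = app (LT i) (mono \<nu>) - scal (1 / kap n i) * mono ?\<mu>"
  have "zc i = 1" "m0 n i \<nu> > 0" "sref n i \<nu> = ?\<mu>" using i \<nu> by (simp_all add: zc_def m0_def sref_def)
  then have r: "r \<in> supp_in (below (nm n \<nu>))" using hecke_lead(2)[OF i(2) \<nu>] i(2) by (simp add: r_def app_LT)
  have m: "mono ?\<mu> = scal (kap n i) * (app (LT i) (mono \<nu>) - r)"
    by (simp add: r_def flip: scal_mult mult.assoc)
  have xl: "app x (app (LT i) (mono \<nu>)) = app (LT i) (app y (mono \<nu>)) + app w (mono \<nu>)"
    using arg_cong[OF x, of "\<lambda>z. app z (mono \<nu>)"] by simp
  have "app x (mono ?\<mu>) - scal c * mono ?\<mu> = scal (kap n i) *
     (app (LT i) (app y (mono \<nu>) - scal c * mono \<nu>) + app w (mono \<nu>) - app x r + scal c * r)"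
    unfolding m by (simp only: linD[OF lx(1)] linD[OF lin_LT[OF i(2)]] xl app_diff) (simp add: algebra_simps)
  also have "\<dots> \<in> supp_in (low ?\<mu>)"
    using hecke_low[OF i \<nu> c(2)] w supp_in_mono[OF bl stableD[OF lx(3) r]] supp_in_mono[OF bl r]
    by (intro supp_in_scal supp_in_add supp_in_diff)
  finally show ?thesis using c(1) by (auto simp: ytri_def)
qed

text \<open>Induction from dominant exponents by reflections. The elements \<open>Y j\<close> and
  \<open>Yi j\<close> are treated together because the relation with \<open>T n\<close> exchanges
  \<open>Y n\<close> and \<open>Yi n\<close>.\<close>

lemma Y_triangular:
  assumes "\<mu> \<in> lat" "1 \<le> j" "j \<le> n"
  shows "ytri (LH.Y j) \<mu> (- 2 * lk \<mu> j) \<and> ytri (LH.Yi j) \<mu> (2 * lk \<mu> j)"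
  using assms
proof (induction "inv_count n \<mu>" arbitrary: \<mu> j rule: less_induct)
  case less
  show ?case
  proof (cases "dominant n \<mu>")
    case True
    have b: "below (nm n \<mu>) \<subseteq> low \<mu>" by (auto simp: low_def below_def)
    have "app (LH.Y j) (mono \<mu>) - scal (cY j \<mu>) * mono \<mu> \<in> supp_in (below (nm n \<mu>))"
      using Y_lead[OF True less.prems] by (simp add: tr_def)
    moreover have "qdeg (1 / cY j \<mu>) (2 * lk \<mu> j)" using qdeg_inverse[OF qdeg_cY[of j \<mu>]] less.prems by simp
    ultimately show ?thesis
      using qdeg_cY[of j \<mu>] less.prems supp_in_mono[OF b] Yi_lead[OF True less.prems] unfolding ytri_def by blast
  next
    case False
    then obtain i where i: "1 \<le> i" "i \<le> n" "mm n i \<mu> < 0" by (auto simp: dominant_def not_le)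
    define \<nu> where "\<nu> = refl n i \<mu>"
    have \<nu>: "\<nu> \<in> lat" "inv_count n \<nu> < inv_count n \<mu>" "mm n i \<nu> > 0" "refl n i \<nu> = \<mu>"
      using i less.prems n_pos inv_count_refl_neg[OF i] by (auto simp: \<nu>_def)
    have nm\<nu>: "nm n \<nu> = nm n \<mu>" using nm_sref[OF n_pos i(2), of \<mu>] i by (simp add: \<nu>_def sref_def)
    have IH: "ytri (LH.Y j) \<nu> (- 2 * lk \<nu> j)" "ytri (LH.Yi j) \<nu> (2 * lk \<nu> j)" if "1 \<le> j" "j \<le> n" for j
      using less.hyps[OF \<nu>(2,1) that] by auto
    have in1: "\<nu> \<in> low \<mu>" "low \<nu> \<subseteq> low \<mu>" using \<nu> by (auto simp: low_def nm\<nu>)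
    have yw: "app x (mono \<nu>) \<in> supp_in (low \<mu>)" if y: "ytri x \<nu> k" for x k
    proof -
      obtain c where "app x (mono \<nu>) - scal c * mono \<nu> \<in> supp_in (low \<nu>)" using y unfolding ytri_def by blast
      then have "(app x (mono \<nu>) - scal c * mono \<nu>) + scal c * mono \<nu> \<in> supp_in (low \<mu>)"
        using in1 by (intro supp_in_add supp_in_scal supp_in_single) (auto intro: supp_in_mono)
      then show ?thesis by simp
    qed
    have hw: "app (Lh l) f \<in> supp_in (low \<mu>)" if "f \<in> supp_in (low \<mu>)" for f l
      using that by (simp add: app_Lh supp_in_scal del: scal_simps)
    have step: "ytri x \<mu> k" if "x * LT i = LT i * y + w" "x = LH.Y j \<or> x = LH.Yi j" "ytri y \<nu> k" "app w (mono \<nu>) \<in> supp_in (low \<mu>)"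
      for x y w k
    proof -
      have "lin x" "stable lat x" "\<And>N. stable (below N) x"
        using that(2) lin_Y[OF less.prems(3)] stable_Y[OF good_lattice less.prems(3)] stable_Y[OF good_below less.prems(3)] by auto
      then show ?thesis using ytri_step[OF i(1,2) \<nu>(3,1) that(1) _ _ _ that(3)] that(4) \<nu>(4) by simp
    qed
    have neg: "app (- w) (mono \<nu>) \<in> supp_in (low \<mu>)" if "app w (mono \<nu>) \<in> supp_in (low \<mu>)" for w
      using supp_in_diff[OF supp_in_0 that] by simp
    have hy: "app (Lh l * x) (mono \<nu>) \<in> supp_in (low \<mu>)" if "ytri x \<nu> k" for l x k
      using hw[OF yw[OF that]] by simp
    have m\<nu>: "app (Lh l) (mono \<nu>) \<in> supp_in (low \<mu>)" for l using hw in1 by simp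
    consider "i < n" "j = i" | "i < n" "j = Suc i" | "i = n" "j = n" | "i < n" "j \<noteq> i" "j \<noteq> Suc i" | "i = n" "j \<noteq> n"
      using i by linarith
    then show ?thesis
    proof cases
      case 1
      have l: "lk \<nu> (Suc i) = lk \<mu> i" using 1 by (simp add: \<nu>_def lk_refl)
      have I: "ytri (LH.Y i) \<nu> (- 2 * lk \<nu> i)" "ytri (LH.Y (Suc i)) \<nu> (- 2 * lk \<mu> i)" "ytri (LH.Yi (Suc i)) \<nu> (2 * lk \<mu> i)"
        using IH[of i] IH[of "Suc i"] 1 i l by simp_all
      have a: "LH.Yi i * LT i = LT i * LH.Yi (Suc i) + - (Lh i * LH.Yi (Suc i))" using LH.T_Y(3)[OF i(1) 1(1)] by simp
      show ?thesis unfolding 1(2)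
        using step[OF LH.T_Y(1)[OF i(1) 1(1)] _ I(2) hy[OF I(1)]] step[OF a _ I(3) neg[OF hy[OF I(3)]]] 1 by blast
    next
      case 2
      have l: "lk \<nu> i = lk \<mu> (Suc i)" using 2 by (simp add: \<nu>_def lk_refl)
      have I: "ytri (LH.Yi (Suc i)) \<nu> (2 * lk \<nu> (Suc i))" "ytri (LH.Y i) \<nu> (- 2 * lk \<mu> (Suc i))" "ytri (LH.Yi i) \<nu> (2 * lk \<mu> (Suc i))"
        using IH[of i] IH[of "Suc i"] 2 i l by simp_all
      have a: "LH.Y (Suc i) * LT i = LT i * LH.Y i + - (Lh i * LH.Y i)" using LH.T_Y(2)[OF i(1) 2(1)] by simp
      show ?thesis unfolding 2(2)
        using step[OF LH.T_Y(4)[OF i(1) 2(1)] _ I(3) hy[OF I(1)]] step[OF a _ I(2) neg[OF hy[OF I(2)]]] 2 by blast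
    next
      case 3
      have l: "lk \<nu> n = - lk \<mu> n" using 3 by (simp add: \<nu>_def lk_refl)
      have a: "LH.Y n * LT n = LT n * LH.Yi n + (Lh n * LH.Y n + Lh 0)"
        "LH.Yi n * LT n = LT n * LH.Y n + (- (Lh n * LH.Y n) - Lh 0)"
        using LH.T_Yn by (simp_all add: algebra_simps)
      have I: "ytri (LH.Y n) \<nu> (2 * lk \<mu> n)" "ytri (LH.Yi n) \<nu> (- 2 * lk \<mu> n)"
        using IH[of n] n_pos l by simp_all
      have w: "app (Lh n * LH.Y n + Lh 0) (mono \<nu>) \<in> supp_in (low \<mu>)"
        using supp_in_add[OF hy[OF I(1)] m\<nu>] by simp
      have "- (Lh n * LH.Y n + Lh 0) = - (Lh n * LH.Y n) - Lh 0" by simp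
      then have w': "app (- (Lh n * LH.Y n) - Lh 0) (mono \<nu>) \<in> supp_in (low \<mu>)" using neg[OF w] by (simp only:)
      show ?thesis unfolding 3(2)
        using step[OF _ _ I(2) w, of "LH.Y n"] step[OF _ _ I(1) w', of "LH.Yi n"] a 3 by blast
    next
      case 4
      have "lk \<nu> j = lk \<mu> j" using 4 by (simp add: \<nu>_def lk_refl)
      moreover have "LH.commutes (LT i) (LH.Y j)"
        using 4 i less.prems LH.Y_commutes_high[of j i] LH.Y_commutes_low[of i j] by (cases "j < i") auto
      moreover from this have "LH.commutes (LT i) (LH.Yi j)" using LH.commutes_Yi less.prems by blast
      ultimately have c: "LH.Y j * LT i = LT i * LH.Y j + 0" "LH.Yi j * LT i = LT i * LH.Yi j + 0"
        and l: "lk \<nu> j = lk \<mu> j" by (simp_all add: LH.commutes_def)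
      have z: "app 0 (mono \<nu>) \<in> supp_in (low \<mu>)" by simp
      show ?thesis unfolding l[symmetric] using step[OF c(1) _ IH(1) z] step[OF c(2) _ IH(2) z] less.prems by blast
    next
      case 5
      have "lk \<nu> j = lk \<mu> j" using 5 by (simp add: \<nu>_def lk_refl)
      moreover have "LH.commutes (LT i) (LH.Y j)"
        using 5 i less.prems LH.Y_commutes_high[of j i] by auto
      moreover from this have "LH.commutes (LT i) (LH.Yi j)" using LH.commutes_Yi less.prems by blast
      ultimately have c: "LH.Y j * LT i = LT i * LH.Y j + 0" "LH.Yi j * LT i = LT i * LH.Yi j + 0"
        and l: "lk \<nu> j = lk \<mu> j" by (simp_all add: LH.commutes_def)
      have z: "app 0 (mono \<nu>) \<in> supp_in (low \<mu>)" by simp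
      show ?thesis unfolding l[symmetric] using step[OF c(1) _ IH(1) z] step[OF c(2) _ IH(2) z] less.prems by blast
    qed
  qed
qed

text \<open>At an exponent of largest norm and, within that norm, with most inversions, every
  \<open>Y j\<close> acts by its diagonal entry. The degree of that entry in \<open>q\<close> equals
  the one of \<open>cY j \<kappa>\<close>, so the exponent is \<open>\<kappa>\<close>.\<close>

lemma Y_eigen_key:
  assumes f: "f \<in> supp_in lat" "f \<noteq> 0" and \<kappa>: "\<kappa> \<in> lat"
    and ev: "\<And>j. j \<in> {1..n} \<Longrightarrow> app (LH.Y j) f = scal (cY j \<kappa>) * f"
  shows "\<kappa> \<in> Poly_Mapping.keys f"
proof -
  obtain \<nu>0 where \<nu>0: "\<nu>0 \<in> Poly_Mapping.keys f" "\<And>\<mu>. \<mu> \<in> Poly_Mapping.keys f \<Longrightarrow> nm n \<mu> \<le> nm n \<nu>0"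
    using ex_top[OF f(2), of "nm n"] by blast
  let ?S = "{\<nu> \<in> Poly_Mapping.keys f. nm n \<nu> = nm n \<nu>0}"
  have "Max (inv_count n ` ?S) \<in> inv_count n ` ?S" using \<nu>0 by (intro Max_in) auto
  then obtain \<nu> where \<nu>: "\<nu> \<in> ?S" "inv_count n \<nu> = Max (inv_count n ` ?S)" by auto
  have top: "\<nu> \<notin> low \<mu>" if "\<mu> \<in> Poly_Mapping.keys f" for \<mu>
  proof
    assume "\<nu> \<in> low \<mu>"
    then have "nm n \<mu> = nm n \<nu>0" "inv_count n \<nu> < inv_count n \<mu>" using \<nu> \<nu>0(2)[OF that] by (auto simp: low_def)
    then have "\<mu> \<in> ?S" using that by simp
    then have "inv_count n \<mu> \<le> Max (inv_count n ` ?S)" by (intro Max_ge) auto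
    then show False using \<open>inv_count n \<nu> < inv_count n \<mu>\<close> \<nu> by simp
  qed
  have \<nu>l: "\<nu> \<in> lat" using \<nu> f by (auto simp: supp_in_def)
  have "lk \<kappa> j = lk \<nu> j" if j: "j \<in> {1..n}" for j
  proof -
    have "\<exists>c. qdeg c (- 2 * lk \<mu> j) \<and> app (LH.Y j) (mono \<mu>) - scal c * mono \<mu> \<in> supp_in (low \<mu>)" if "\<mu> \<in> lat" for \<mu>
      using Y_triangular[OF that, of j] j by (auto simp: ytri_def)
    then obtain c where c: "\<And>\<mu>. \<mu> \<in> lat \<Longrightarrow> qdeg (c \<mu>) (- 2 * lk \<mu> j)"
      "\<And>\<mu>. \<mu> \<in> lat \<Longrightarrow> app (LH.Y j) (mono \<mu>) - scal (c \<mu>) * mono \<mu> \<in> supp_in (low \<mu>)" by metis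
    have "lin (LH.Y j)" using lin_Y j by auto
    then have "lk (app (LH.Y j) f) \<nu> = c \<nu> * lk f \<nu>"
    proof (rule lk_app_top[OF _ f(1)])
      fix \<mu> assume \<mu>: "\<mu> \<in> Poly_Mapping.keys f"
      then have "\<mu> \<in> lat" using f by (auto simp: supp_in_def)
      then have "lk (app (LH.Y j) (mono \<mu>) - scal (c \<mu>) * mono \<mu>) \<nu> = 0" using supp_in_lk[OF c(2) top[OF \<mu>]] by blast
      then show "lk (app (LH.Y j) (mono \<mu>)) \<nu> = (if \<mu> = \<nu> then c \<nu> else 0)"
        by (auto simp: lookup_minus lookup_single when_def)
    qed
    then have "c \<nu> = cY j \<kappa>" using ev[OF j] \<nu> by (auto simp: in_keys_iff)
    then have "- 2 * lk \<nu> j = - 2 * lk \<kappa> j"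
      using qdeg_unique[OF c(1)[OF \<nu>l], of "- 2 * lk \<kappa> j"] qdeg_cY[of j \<kappa>] j by simp
    then show ?thesis by simp
  qed
  then have "\<kappa> = \<nu>" using \<kappa> \<nu>l by (intro poly_mapping_eqI) (metis in_lattice)
  then show ?thesis using \<nu> by simp
qed

end

section \<open>The eigenvalues in terms of \<open>v_min\<close>\<close>

lemma antidominant_iff: "1 \<le> n \<Longrightarrow> antidominant n \<mu> \<longleftrightarrow> (\<forall>i. 1 \<le> i \<and> i \<le> n \<longrightarrow> mm n i \<mu> \<le> 0)"
proof
  assume n: "1 \<le> n" and *: "\<forall>i. 1 \<le> i \<and> i \<le> n \<longrightarrow> mm n i \<mu> \<le> 0"
  have s: "lk \<mu> i \<le> lk \<mu> (Suc i)" if "1 \<le> i" "i < n" for i using *[rule_format, of i] that by (simp add: mm_def)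
  have 0: "lk \<mu> n \<le> 0" using *[rule_format, of n] n by (simp add: mm_def)
  have "lk \<mu> i \<le> 0" if "1 \<le> i" "i \<le> n" for i
    using that(2)
  proof (induction rule: inc_induct)
    case (step k) then show ?case using s[of k] that(1) by linarith
  qed (rule 0)
  then show "antidominant n \<mu>" using s by (auto simp: antidominant_def)
qed (auto simp: antidominant_def mm_def)

lemma W_fin_inverse:
  assumes "w \<in> W_fin n" shows "\<exists>w' \<in> W_fin n. (\<forall>\<mu>. w' (w \<mu>) = \<mu>) \<and> (\<forall>\<mu>. w (w' \<mu>) = \<mu>)"
proof -
  obtain "is" where "is": "set is \<subseteq> {1..n}" "w = word_elem n is" using assms by (auto simp: W_fin_def)
  show ?thesis
    by (rule bexI[of _ "word_elem n (rev is)"])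
       (use "is" word_elem_rev[of n "is"] word_elem_rev[of n "rev is"] word_in_W[of "rev is" n] in auto)
qed

lemma len_inverse_le:
  assumes "w \<in> W_fin n" "w' \<in> W_fin n" "\<And>\<mu>. w' (w \<mu>) = \<mu>"
  shows "len n w' \<le> len n w"
proof -
  obtain "is" where "is": "set is \<subseteq> {1..n}" "word_elem n is = w" "length is = len n w"
    using word_of_inv_count[OF assms(1)] len_eq[OF assms(1)] by auto
  have "word_elem n (rev is) = w'"
  proof
    fix \<mu>
    have "w' (w (word_elem n (rev is) \<mu>)) = word_elem n (rev is) \<mu>" by (rule assms(3))
    moreover have "w (word_elem n (rev is) \<mu>) = \<mu>" using word_elem_rev[of n "rev is" \<mu>] "is" by simp
    ultimately show "word_elem n (rev is) \<mu> = w' \<mu>" by simp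
  qed
  then have "inv_count n (w' (rho n)) \<le> length (rev is)" using inv_count_word_le[of "rev is" n] "is" by simp
  then show ?thesis using len_eq[OF assms(2)] "is" by simp
qed

lemma W_fin_comp: assumes "v \<in> W_fin n" "w \<in> W_fin n" shows "v \<circ> w \<in> W_fin n"
proof -
  obtain "is" js where "set is \<subseteq> {1..n}" "v = word_elem n is" "set js \<subseteq> {1..n}" "w = word_elem n js"
    using assms by (auto simp: W_fin_def)
  then show ?thesis using word_in_W[of "is @ js" n] by (simp only: word_elem_append set_append Un_subset_iff)
qed

text \<open>A drop of at least one per step keeps \<open>\<tau> j + j\<close> from growing. Its
  value at the left end gives the upper bound, its value at the right end the lower one.\<close>

lemma strict_dec_interval:
  fixes \<tau> :: "nat \<Rightarrow> nat"
  assumes dec: "\<And>i. a \<le> i \<Longrightarrow> i < b \<Longrightarrow> \<tau> (Suc i) < \<tau> i" and r: "\<And>i. a \<le> i \<Longrightarrow> i \<le> b \<Longrightarrow> a \<le> \<tau> i \<and> \<tau> i \<le> b"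
    and j: "a \<le> j" "j \<le> b"
  shows "\<tau> j + j = a + b"
proof -
  have up: "\<tau> j + j \<le> a + b" using j
  proof (induction j rule: dec_induct)
    case base then show ?case using r[of a] by simp
  next
    case (step i) then show ?case using dec[of i] by simp
  qed
  have "a + b \<le> \<tau> j + j" using j(2)
  proof (induction rule: inc_induct)
    case base then show ?case using r[of b] j by simp
  next
    case (step i) then show ?case using dec[of i] j by simp
  qed
  with up show ?thesis by simp
qed

context rank
begin

text \<open>
  Minimality forces $v$ to reverse the blocks of equal positive entries and to fix the zero block.
\<close>

lemma v_min_data:
  assumes d: "dominant n \<kappa>" and lat: "\<kappa> \<in> lat"
  obtains \<tau> where "\<tau> permutes {1..n}"
    "\<And>j. j \<in> {1..n} \<Longrightarrow> lk \<kappa> (\<tau> j) = lk \<kappa> j"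
    "\<And>j. j \<in> {1..n} \<Longrightarrow> signed_index n (v_min n \<kappa>) j = (if lk \<kappa> j = 0 then int (\<tau> j) else - int (\<tau> j))"
    "\<And>i. 1 \<le> i \<Longrightarrow> i < n \<Longrightarrow> lk \<kappa> i = lk \<kappa> (Suc i) \<Longrightarrow> (if lk \<kappa> i = 0 then \<tau> i < \<tau> (Suc i) else \<tau> (Suc i) < \<tau> i)"
proof -
  let ?P = "\<lambda>v. v \<in> W_fin n \<and> antidominant n (v \<kappa>)"
  \<comment> \<open>A witness that the minimum in \<open>v_min\<close> is over a nonempty set: if
    the image of \<open>\<kappa>\<close> has the most inversions, no pairing of it can be positive,
    since reflecting would add an inversion.\<close>
  obtain w where w: "w \<in> W_fin n" "\<And>u. u \<in> W_fin n \<Longrightarrow> inv_count n (u \<kappa>) \<le> inv_count n (w \<kappa>)"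
  proof -
    let ?S = "(\<lambda>u. inv_count n (u \<kappa>)) ` W_fin n"
    have f: "finite ?S" "?S \<noteq> {}" using finite_W_fin[of n] W_fin_id[of n] by blast+
    then have "Max ?S \<in> ?S" by (rule Max_in)
    then obtain w where "w \<in> W_fin n" "Max ?S = inv_count n (w \<kappa>)" by auto
    moreover from this have "inv_count n (u \<kappa>) \<le> inv_count n (w \<kappa>)" if "u \<in> W_fin n" for u
      using Max_ge[OF f(1), of "inv_count n (u \<kappa>)"] that by simp
    ultimately show ?thesis using that by blast
  qed
  have "mm n i (w \<kappa>) \<le> 0" if i: "1 \<le> i" "i \<le> n" for i
  proof (rule ccontr)
    assume "\<not> ?thesis"
    then have "inv_count n (refl n i (w \<kappa>)) = Suc (inv_count n (w \<kappa>))" using inv_count_refl_pos[OF i] by simp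
    then show False using w(2)[OF W_fin_refl[OF w(1) i]] by simp
  qed
  then have "?P w" using w(1) antidominant_iff[OF n_pos] by simp
  define v where "v = v_min n \<kappa>"
  have v: "?P v" and vmin: "\<And>u. ?P u \<Longrightarrow> len n v \<le> len n u"
    using arg_min_nat_lemma[of ?P w "len n"] \<open>?P w\<close> unfolding v_def v_min_def by blast+
  obtain \<sigma> e where s: "\<sigma> permutes {1..n}" and e: "\<And>k. e k = 1 \<or> e k = (-1::int)"
    and vf: "\<And>\<mu> k. lk (v \<mu>) k = e k * lk \<mu> (\<sigma> k)" using W_fin_form[of v n] v by metis
  define \<tau> where "\<tau> = inv_into UNIV \<sigma>"
  have \<tau>: "\<tau> permutes {1..n}" unfolding \<tau>_def using s by (rule permutes_inv)
  have st: "\<sigma> (\<tau> j) = j" "\<tau> (\<sigma> j) = j" for j unfolding \<tau>_def using permutes_inverses[OF s] by auto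
  have \<tau>r: "\<tau> j \<in> {1..n} \<longleftrightarrow> j \<in> {1..n}" for j using permutes_in_image[OF \<tau>] .
  have ant: "mm n i (v \<kappa>) \<le> 0" if "1 \<le> i" "i \<le> n" for i using v antidominant_iff[OF n_pos] that by blast
  have le0: "lk (v \<kappa>) k \<le> 0" if "k \<in> {1..n}" for k using v that by (auto simp: antidominant_def)
  have nn: "0 \<le> lk \<kappa> k" if "k \<in> {1..n}" for k using dominant_nonneg[OF d] that by auto
  have neg: "lk (v \<kappa>) (\<tau> j) = - lk \<kappa> j" if "j \<in> {1..n}" for j
    using le0[of "\<tau> j"] nn[OF that] e[of "\<tau> j"] \<tau>r[of j] that by (auto simp: vf st)
  have "- v \<kappa> = \<kappa>"
  proof (rule dominant_eqI[OF _ d _ lat])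
    have "mm n i (- v \<kappa>) = - mm n i (v \<kappa>)" for i by (simp add: mm_def)
    then show "dominant n (- v \<kappa>)" using ant by (simp add: dominant_def)
    show "- v \<kappa> \<in> lat" using lat permutes_not_in[OF s] by (auto simp: in_lattice vf)
    fix k :: int
    have "bij_betw \<tau> {j \<in> {1..n}. k \<le> lk \<kappa> j} {j \<in> {1..n}. k \<le> lk (- v \<kappa>) j}"
    proof (rule bij_betwI[where g = \<sigma>])
      show "\<tau> \<in> {j \<in> {1..n}. k \<le> lk \<kappa> j} \<rightarrow> {j \<in> {1..n}. k \<le> lk (- v \<kappa>) j}"
        using \<tau>r by (simp add: neg)
      have "lk \<kappa> (\<sigma> j) = lk (- v \<kappa>) j" "\<sigma> j \<in> {1..n}" if "j \<in> {1..n}" for j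
        using neg[of "\<sigma> j"] permutes_in_image[OF s, of j] that by (simp_all add: st)
      then show "\<sigma> \<in> {j \<in> {1..n}. k \<le> lk (- v \<kappa>) j} \<rightarrow> {j \<in> {1..n}. k \<le> lk \<kappa> j}" by auto
    qed (simp_all add: st)
    from bij_betw_same_card[OF this, symmetric]
    show "card {j \<in> {1..n}. k \<le> lk (- v \<kappa>) j} = card {j \<in> {1..n}. k \<le> lk \<kappa> j}" .
  qed
  then have vk: "lk (v \<kappa>) k = - lk \<kappa> k" for k by (metis lookup_uminus minus_equation_iff)
  have lk\<tau>: "lk \<kappa> (\<tau> j) = lk \<kappa> j" if "j \<in> {1..n}" for j using neg[OF that] vk by simp
  obtain v' where v': "v' \<in> W_fin n" "\<And>\<mu>. v' (v \<mu>) = \<mu>" "\<And>\<mu>. v (v' \<mu>) = \<mu>"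
    using W_fin_inverse[of v n] v by blast
  have v'f: "lk (v' \<mu>) j = e (\<tau> j) * lk \<mu> (\<tau> j)" for \<mu> j
  proof -
    have "lk \<mu> (\<tau> j) = e (\<tau> j) * lk (v' \<mu>) j" using vf[of "v' \<mu>" "\<tau> j"] v'(3) st by simp
    then show ?thesis using e[of "\<tau> j"] by auto
  qed
  \<comment> \<open>If the reflection \<open>i\<close> fixes \<open>\<kappa>\<close>, composing it
    with \<open>v\<close> gives another candidate. By minimality of \<open>v\<close> it cannot be
    shorter, so \<open>i\<close> is not a descent of the inverse \<open>v'\<close>.\<close>
  have key: "0 \<le> mm n i (v' (rho n))" if i: "1 \<le> i" "i \<le> n" and m: "mm n i \<kappa> = 0" for i
  proof (rule ccontr)
    assume "\<not> ?thesis"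
    then have neg: "mm n i (v' (rho n)) < 0" by simp
    let ?u = "v \<circ> refl n i" and ?u' = "refl n i \<circ> v'"
    have ri: "refl n i \<in> W_fin n" using W_fin_refl[OF W_fin_id i] by (simp only: comp_id)
    have u: "?u \<in> W_fin n" "?u' \<in> W_fin n" using W_fin_comp v v' ri by auto
    have "?u \<kappa> = v \<kappa>" using mm_0_refl[OF m i(2)] by simp
    then have "len n v \<le> len n ?u" using vmin[of ?u] u(1) v by simp
    also have "\<dots> \<le> len n ?u'" by (rule len_inverse_le[OF u(2,1)]) (simp add: v')
    also have "\<dots> < len n v'"
      using inv_count_refl_neg[OF i neg] by (simp add: len_eq u v')
    also have "\<dots> \<le> len n v" by (rule len_inverse_le) (use v v' in auto)
    finally show False by simp
  qed
  have e0: "e (\<tau> j) = -1" if "j \<in> {1..n}" "lk \<kappa> j \<noteq> 0" for j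
    using neg[OF that(1)] e[of "\<tau> j"] that by (auto simp: vf st)
  have e1: "e (\<tau> j) = 1" if "1 \<le> j" "j \<le> n" "lk \<kappa> j = 0" for j
    using that(2,3)
  proof (induction rule: inc_induct)
    case base
    have "0 \<le> e (\<tau> n) * lk (rho n) (\<tau> n)" using key[of n] base n_pos by (simp add: mm_def v'f)
    then show ?case using e[of "\<tau> n"] \<tau>r[of n] n_pos by (auto simp: lk_rho)
  next
    case (step i)
    have z: "lk \<kappa> (Suc i) = 0" using step nn[of "Suc i"] dominant_mono[OF d, of i "Suc i"] that(1) by simp
    then have "0 \<le> mm n i (v' (rho n))" using key[of i] step that(1) by (simp add: mm_def)
    then show ?case using step z \<tau>r[of i] \<tau>r[of "Suc i"] e[of "\<tau> i"] that(1) by (auto simp: mm_def v'f lk_rho)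
  qed
  show ?thesis
  proof (rule that[OF \<tau> lk\<tau>])
    fix j assume j: "j \<in> {1..n}"
    have tj: "\<tau> j \<in> {1..n}" using \<tau>r j by simp
    have vu: "v (unit_vec (int j)) = Poly_Mapping.single (\<tau> j) (e (\<tau> j))"
    proof (rule poly_mapping_eqI)
      fix k
      have "\<sigma> k = j \<longleftrightarrow> k = \<tau> j" using st by metis
      then show "lk (v (unit_vec (int j))) k = lk (Poly_Mapping.single (\<tau> j) (e (\<tau> j))) k"
        using j by (auto simp: vf unit_vec_def lookup_single when_def)
    qed
    have uv: "v (unit_vec (int j)) = unit_vec k \<longleftrightarrow> nat \<bar>k\<bar> = \<tau> j \<and> sgn k = e (\<tau> j)" if "1 \<le> \<bar>k\<bar>" for k
    proof -
      have ne: "e (\<tau> j) \<noteq> 0" using e[of "\<tau> j"] by auto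
      have "\<tau> j = nat \<bar>k\<bar> \<and> e (\<tau> j) = sgn k"
        if eq: "Poly_Mapping.single (\<tau> j) (e (\<tau> j)) = Poly_Mapping.single (nat \<bar>k\<bar>) (sgn k)"
      proof -
        have "Poly_Mapping.keys (Poly_Mapping.single (\<tau> j) (e (\<tau> j))) = Poly_Mapping.keys (Poly_Mapping.single (nat \<bar>k\<bar>) (sgn k))"
          by (simp only: eq)
        then have 1: "\<tau> j = nat \<bar>k\<bar>" using ne by (auto split: if_splits)
        have "lk (Poly_Mapping.single (\<tau> j) (e (\<tau> j))) (\<tau> j) = lk (Poly_Mapping.single (nat \<bar>k\<bar>) (sgn k)) (\<tau> j)"
          by (simp only: eq)
        then show ?thesis using 1 by simp
      qed
      then show ?thesis unfolding vu unfolding unit_vec_def by auto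
    qed
    have "signed_index n v j = e (\<tau> j) * int (\<tau> j)"
      unfolding signed_index_def
    proof (rule the_equality)
      have "1 \<le> \<bar>e (\<tau> j) * int (\<tau> j)\<bar>" using tj e[of "\<tau> j"] by auto
      then show "1 \<le> \<bar>e (\<tau> j) * int (\<tau> j)\<bar> \<and> \<bar>e (\<tau> j) * int (\<tau> j)\<bar> \<le> int n \<and> v (unit_vec (int j)) = unit_vec (e (\<tau> j) * int (\<tau> j))"
        using uv tj e[of "\<tau> j"] by (auto simp: sgn_if)
      fix k assume k: "1 \<le> \<bar>k\<bar> \<and> \<bar>k\<bar> \<le> int n \<and> v (unit_vec (int j)) = unit_vec k"
      then have "nat \<bar>k\<bar> = \<tau> j" "sgn k = e (\<tau> j)" using uv by blast+
      then show "k = e (\<tau> j) * int (\<tau> j)" by (metis mult.commute abs_ge_zero int_nat_eq abs_mult_sgn)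
    qed
    then show "signed_index n (v_min n \<kappa>) j = (if lk \<kappa> j = 0 then int (\<tau> j) else - int (\<tau> j))"
      using e0[OF j] e1[of j] j by (auto simp: v_def)
  next
    fix i assume i: "1 \<le> i" "i < n" "lk \<kappa> i = lk \<kappa> (Suc i)"
    have "0 \<le> mm n i (v' (rho n))" using key[of i] i by (simp add: mm_def)
    moreover have "\<tau> i \<noteq> \<tau> (Suc i)" using st by (metis n_not_Suc_n)
    moreover have "\<tau> i \<in> {1..n}" "\<tau> (Suc i) \<in> {1..n}" using \<tau>r i by auto
    ultimately show "if lk \<kappa> i = 0 then \<tau> i < \<tau> (Suc i) else \<tau> (Suc i) < \<tau> i"
      using e0[of i] e0[of "Suc i"] e1[of i] e1[of "Suc i"] i
      by (cases "lk \<kappa> i = 0") (auto simp: mm_def v'f lk_rho)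
  qed
qed

end

context rank
begin

lemma block:
  assumes d: "dominant n \<kappa>" and j: "j \<in> {1..n}"
  obtains a b where "1 \<le> a" "a \<le> j" "j \<le> b" "b \<le> n" "\<And>k. k \<in> {1..n} \<Longrightarrow> lk \<kappa> k = lk \<kappa> j \<longleftrightarrow> a \<le> k \<and> k \<le> b"
    "\<And>k. 1 \<le> k \<Longrightarrow> k < a \<Longrightarrow> lk \<kappa> j < lk \<kappa> k" "\<And>k. b < k \<Longrightarrow> k \<le> n \<Longrightarrow> lk \<kappa> k < lk \<kappa> j"
proof -
  let ?B = "{k \<in> {1..n}. lk \<kappa> k = lk \<kappa> j}"
  define a b where "a = Min ?B" and "b = Max ?B"
  have B: "finite ?B" "j \<in> ?B" using j by auto
  have a: "a \<in> ?B" "\<And>k. k \<in> ?B \<Longrightarrow> a \<le> k" unfolding a_def using Min_in[OF B(1)] B(2) Min_le[OF B(1)] by (blast, blast)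
  have b: "b \<in> ?B" "\<And>k. k \<in> ?B \<Longrightarrow> k \<le> b" unfolding b_def using Max_in[OF B(1)] B(2) Max_ge[OF B(1)] by (blast, blast)
  have ab: "1 \<le> a" "a \<le> j" "j \<le> b" "b \<le> n" "lk \<kappa> a = lk \<kappa> j" "lk \<kappa> b = lk \<kappa> j" using a b B by auto
  have eq: "lk \<kappa> k = lk \<kappa> j \<longleftrightarrow> a \<le> k \<and> k \<le> b" if "k \<in> {1..n}" for k
  proof
    show "a \<le> k \<and> k \<le> b" if "lk \<kappa> k = lk \<kappa> j" using a(2) b(2) that \<open>k \<in> {1..n}\<close> by blast
    show "lk \<kappa> k = lk \<kappa> j" if "a \<le> k \<and> k \<le> b"
      using dominant_mono[OF d, of a k] dominant_mono[OF d, of k b] ab that by simp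
  qed
  show ?thesis
  proof (rule that[OF ab(1-4) eq])
    show "lk \<kappa> j < lk \<kappa> k" if "1 \<le> k" "k < a" for k
    proof -
      have "lk \<kappa> j \<le> lk \<kappa> k" using dominant_mono[OF d that(1), of j] ab that by simp
      moreover have "lk \<kappa> k \<noteq> lk \<kappa> j" using eq[of k] ab that by simp
      ultimately show ?thesis by simp
    qed
    show "lk \<kappa> k < lk \<kappa> j" if "b < k" "k \<le> n" for k
    proof -
      have "lk \<kappa> k \<le> lk \<kappa> j" using dominant_mono[OF d, of j k] ab that j by simp
      moreover have "lk \<kappa> k \<noteq> lk \<kappa> j" using eq[of k] ab that by simp
      ultimately show ?thesis by simp
    qed
  qed
qed

lemma v_min_index:
  assumes d: "dominant n \<kappa>" and \<tau>: "\<tau> permutes {1..n}" "\<And>j. j \<in> {1..n} \<Longrightarrow> lk \<kappa> (\<tau> j) = lk \<kappa> j"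
    "\<And>i. 1 \<le> i \<Longrightarrow> i < n \<Longrightarrow> lk \<kappa> i = lk \<kappa> (Suc i) \<Longrightarrow> (if lk \<kappa> i = 0 then \<tau> i < \<tau> (Suc i) else \<tau> (Suc i) < \<tau> i)"
    and j: "j \<in> {1..n}" and ab: "a \<le> j" "j \<le> b" "1 \<le> a" "b \<le> n" "\<And>k. k \<in> {1..n} \<Longrightarrow> lk \<kappa> k = lk \<kappa> j \<longleftrightarrow> a \<le> k \<and> k \<le> b"
  shows "if lk \<kappa> j = 0 then \<tau> j = j else \<tau> j + j = a + b"
proof -
  have r: "a \<le> \<tau> i \<and> \<tau> i \<le> b" if "a \<le> i" "i \<le> b" for i
  proof -
    have i: "i \<in> {1..n}" using that ab by auto
    then have "lk \<kappa> (\<tau> i) = lk \<kappa> j" using \<tau>(2) ab(5) that by metis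
    moreover have "\<tau> i \<in> {1..n}" using permutes_in_image[OF \<tau>(1)] i by simp
    ultimately show ?thesis using ab(5) by blast
  qed
  have step: "if lk \<kappa> j = 0 then \<tau> i < \<tau> (Suc i) else \<tau> (Suc i) < \<tau> i" if "a \<le> i" "i < b" for i
    using \<tau>(3)[of i] ab(5)[of i] ab(5)[of "Suc i"] that ab(3,4) by simp
  show ?thesis
  proof (cases "lk \<kappa> j = 0")
    case True
    \<comment> \<open>Reversing the values turns the increasing case on the zero block into the
      decreasing one.\<close>
    have "(a + b - \<tau> j) + j = a + b"
    proof (rule strict_dec_interval)
      show "a + b - \<tau> (Suc i) < a + b - \<tau> i" if "a \<le> i" "i < b" for i
        using step[OF that] True r[of i] r[of "Suc i"] that by auto
    qed (use r ab in fastforce)+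
    then show ?thesis using True r[of j] ab by simp
  next
    case False
    then show ?thesis using strict_dec_interval[of a b \<tau> j] step r ab by simp
  qed
qed

text \<open>On a block \<open>a..b\<close> of equal positive entries the minimal element sends
  \<open>j\<close> to \<open>-(a + b - j)\<close>, and on both sides the exponent of
  \<open>t\<close> is \<open>a + b - j - n\<close>. For a zero entry \<open>j\<close> is fixed and
  the exponent is \<open>n - j\<close>.\<close>

lemma Y_eigenvalue_dominant:
  assumes d: "dominant n \<kappa>" and lat: "\<kappa> \<in> lat" and j: "j \<in> {1..n}"
  shows "Y_eigenvalue n \<kappa> j = cY j \<kappa>"
proof -
  obtain \<tau> where \<tau>: "\<tau> permutes {1..n}" "\<And>j. j \<in> {1..n} \<Longrightarrow> lk \<kappa> (\<tau> j) = lk \<kappa> j"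
    and si: "\<And>j. j \<in> {1..n} \<Longrightarrow> signed_index n (v_min n \<kappa>) j = (if lk \<kappa> j = 0 then int (\<tau> j) else - int (\<tau> j))"
    and \<tau>3: "\<And>i. 1 \<le> i \<Longrightarrow> i < n \<Longrightarrow> lk \<kappa> i = lk \<kappa> (Suc i) \<Longrightarrow> (if lk \<kappa> i = 0 then \<tau> i < \<tau> (Suc i) else \<tau> (Suc i) < \<tau> i)"
    apply (rule v_min_data[OF d lat])
    subgoal premises p for \<tau> by (rule p(1)[OF p(2) p(3) p(4) p(5)])
    done
  obtain a b where ab: "1 \<le> a" "a \<le> j" "j \<le> b" "b \<le> n" "\<And>k. k \<in> {1..n} \<Longrightarrow> lk \<kappa> k = lk \<kappa> j \<longleftrightarrow> a \<le> k \<and> k \<le> b"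
    "\<And>k. 1 \<le> k \<Longrightarrow> k < a \<Longrightarrow> lk \<kappa> j < lk \<kappa> k" "\<And>k. b < k \<Longrightarrow> k \<le> n \<Longrightarrow> lk \<kappa> k < lk \<kappa> j"
    apply (rule block[OF d j])
    subgoal premises p for a b by (rule p(1)[OF p(2) p(3) p(4) p(5) p(6) p(7) p(8)])
    done
  have ti: "if lk \<kappa> j = 0 then \<tau> j = j else \<tau> j + j = a + b"
    by (rule v_min_index[OF d \<tau> \<tau>3 j ab(2,3,1,4,5)]) auto
  have tj: "\<tau> j \<in> {1..n}" using permutes_in_image[OF \<tau>(1)] j by simp
  show ?thesis
  proof (cases "lk \<kappa> j = 0")
    case True
    have "(\<Prod>m\<in>{1..<j}. if lk \<kappa> m = 0 \<and> lk \<kappa> j = 0 then t_h else 1 / t_h) * (\<Prod>m\<in>{1..<j}. if lk \<kappa> m = lk \<kappa> j then 1 / t_h else t_h) = 1"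
      unfolding prod.distrib[symmetric] by (rule prod.neutral) (auto simp: True)
    then have "cY j \<kappa> = tn_h * t_par ^ (n - j) * t0_h"
      by (simp add: cY_def cR_def True)
    moreover have "t_par ^ n = t_par ^ (n - j) * t_par ^ j" using j by (simp flip: power_add)
    ultimately show ?thesis using ti True j
      by (simp add: Y_eigenvalue_def si power_int_minus field_simps)
  next
    case False
    then have pos: "0 < lk \<kappa> j" using dominant_nonneg[OF d, of j] j by auto
    have "{k. j < k \<and> k \<le> n \<and> lk \<kappa> k < lk \<kappa> j} = {Suc b..n}"
    proof (intro set_eqI iffI)
      fix k assume "k \<in> {k. j < k \<and> k \<le> n \<and> lk \<kappa> k < lk \<kappa> j}"
      then show "k \<in> {Suc b..n}" using ab(5)[of k] ab(1,2) by auto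
    next
      fix k assume "k \<in> {Suc b..n}"
      then show "k \<in> {k. j < k \<and> k \<le> n \<and> lk \<kappa> k < lk \<kappa> j}" using ab(7)[of k] ab(3) by auto
    qed
    then have cR: "cR j \<kappa> = 1 / tn_h * (1 / t_par) ^ (n - b)" using pos by (simp add: cR_def)
    have p1: "(\<Prod>m\<in>{1..<j}. if lk \<kappa> m = 0 \<and> lk \<kappa> j = 0 then t_h else 1 / t_h) = (1 / t_h) ^ (j - 1)"
      using False by simp
    have "(\<Prod>m\<in>{1..<j}. if lk \<kappa> m = lk \<kappa> j then 1 / t_h else t_h) =
      (\<Prod>m\<in>{1..<a}. if lk \<kappa> m = lk \<kappa> j then 1 / t_h else t_h) * (\<Prod>m\<in>{a..<j}. if lk \<kappa> m = lk \<kappa> j then 1 / t_h else t_h)"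
      by (rule prod.atLeastLessThan_concat[OF ab(1,2), symmetric])
    moreover have "(\<Prod>m\<in>{1..<a}. if lk \<kappa> m = lk \<kappa> j then 1 / t_h else t_h) = (\<Prod>m\<in>{1..<a}. t_h)"
      using ab j by (intro prod.cong) auto
    moreover have "(\<Prod>m\<in>{a..<j}. if lk \<kappa> m = lk \<kappa> j then 1 / t_h else t_h) = (\<Prod>m\<in>{a..<j}. 1 / t_h)"
      using ab j by (intro prod.cong) auto
    ultimately have p2: "(\<Prod>m\<in>{1..<j}. if lk \<kappa> m = lk \<kappa> j then 1 / t_h else t_h) = t_h ^ (a - 1) * (1 / t_h) ^ (j - a)"
      by (simp only: prod_constant card_atLeastLessThan)
    \<comment> \<open>Writing the indices through their differences removes truncated subtraction
      from the comparison of powers.\<close>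
    obtain a' where a': "a = Suc a'" using ab(1) by (cases a) auto
    obtain x where x: "j = a + x" using ab(2) le_Suc_ex by blast
    obtain z where z: "b = j + z" using ab(3) le_Suc_ex by blast
    obtain y where y: "n = b + y" using ab(4) le_Suc_ex by blast
    have t: "\<tau> j = Suc (a' + z)" using ti False a' x z by simp
    have "sgn (- int (Suc (a' + z))) = -1" "- (- int (Suc (a' + z))) = int (Suc (a' + z))" by simp_all
    then have "Y_eigenvalue n \<kappa> j = q_par powi (- lk \<kappa> j) * t_par ^ Suc (a' + z) / (t0_h * tn_h * t_par ^ n)"
      unfolding Y_eigenvalue_def si[OF j] t using False by (simp only: if_False power_int_of_nat power_int_minus divide_inverse power_int_1_right mult.assoc)
    moreover have "cY j \<kappa> = q_par powi (- lk \<kappa> j) * (((1 / t_par) ^ (n - b) * (1 / t_h) ^ (j - 1) * (t_h ^ (a - 1) * (1 / t_h) ^ (j - a))) / (t0_h * tn_h))"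
      unfolding cY_def cR p1 p2 using False by (simp add: mult_ac)
    moreover have "(1 / t_par) ^ (n - b) * (1 / t_h) ^ (j - 1) * (t_h ^ (a - 1) * (1 / t_h) ^ (j - a)) = t_par ^ Suc (a' + z) / t_par ^ n"
      by (simp add: y z x a' power_add power_divide field_simps flip: power_mult, simp add: mult_2_right power_add)
    ultimately show ?thesis by simp
  qed
qed

text \<open>Free of the block structure of \<open>\<kappa>\<close>: up to inversion and a
  permutation of the positions these are the eigenvalues \<open>cY\<close>. In this form the effect
  of a parameter shift on the weight is visible.\<close>

definition yo :: "expo \<Rightarrow> nat \<Rightarrow> coeff" where
  "yo \<kappa> k = q_par powi lk \<kappa> k * t_par ^ (n - k) * t0_h * tn_h"

lemma central_eigenvalue_eq:
  assumes d: "dominant n \<kappa>" and lat: "\<kappa> \<in> lat"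
  shows "central_eigenvalue \<kappa> = (\<Sum>k=1..n. yo \<kappa> k + 1 / yo \<kappa> k)"
proof -
  obtain \<tau> where \<tau>: "\<tau> permutes {1..n}" "\<And>j. j \<in> {1..n} \<Longrightarrow> lk \<kappa> (\<tau> j) = lk \<kappa> j"
    and si: "\<And>j. j \<in> {1..n} \<Longrightarrow> signed_index n (v_min n \<kappa>) j = (if lk \<kappa> j = 0 then int (\<tau> j) else - int (\<tau> j))"
    and \<tau>3: "\<And>i. 1 \<le> i \<Longrightarrow> i < n \<Longrightarrow> lk \<kappa> i = lk \<kappa> (Suc i) \<Longrightarrow> (if lk \<kappa> i = 0 then \<tau> i < \<tau> (Suc i) else \<tau> (Suc i) < \<tau> i)"
    apply (rule v_min_data[OF d lat])
    subgoal premises p for \<tau> by (rule p(1)[OF p(2) p(3) p(4) p(5)])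
    done
  have "cY j \<kappa> + 1 / cY j \<kappa> = yo \<kappa> (\<tau> j) + 1 / yo \<kappa> (\<tau> j)" if j: "j \<in> {1..n}" for j
  proof -
    have tj: "\<tau> j \<in> {1..n}" using permutes_in_image[OF \<tau>(1)] j by simp
    then have tn: "t_par ^ n = t_par ^ (n - \<tau> j) * t_par ^ (\<tau> j)" by (simp flip: power_add)
    show ?thesis
    proof (cases "lk \<kappa> j = 0")
      case True
      have "cY j \<kappa> = yo \<kappa> (\<tau> j)" unfolding Y_eigenvalue_dominant[OF d lat j, symmetric] Y_eigenvalue_def si[OF j] yo_def \<tau>(2)[OF j]
        using True tn tj by (simp add: power_int_minus field_simps)
      then show ?thesis by simp
    next
      case False
      have "sgn (- int (\<tau> j)) = -1" using tj by simp
      then have "cY j \<kappa> = 1 / yo \<kappa> (\<tau> j)" unfolding Y_eigenvalue_dominant[OF d lat j, symmetric] Y_eigenvalue_def si[OF j] yo_def \<tau>(2)[OF j]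
        using False tn tj by (simp add: power_int_minus field_simps)
      then show ?thesis by simp
    qed
  qed
  then have "central_eigenvalue \<kappa> = (\<Sum>j=1..n. yo \<kappa> (\<tau> j) + 1 / yo \<kappa> (\<tau> j))" unfolding central_eigenvalue_def by (intro sum.cong) auto
  also have "\<dots> = (\<Sum>k=1..n. yo \<kappa> k + 1 / yo \<kappa> k)"
    by (rule sum.reindex_bij_betw[OF permutes_imp_bij[OF \<tau>(1)]])
  finally show ?thesis .
qed

end

section \<open>The operators of the definitions inside the Hecke algebra\<close>

context rank
begin

text \<open>The operator has a two-sided inverse that preserves the Laurent ring, so the value of
  \<open>inv_into\<close> is forced.\<close>

lemma inv_hecke: assumes "i \<le> n" "g \<in> laurent_ring n"
  shows "inv_into (laurent_ring n) (hecke n i) g = app (LH.Ti i) g"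
proof (rule inv_into_f_eq)
  have "app (LH.Ti i) (hecke n i f) = f" for f
    using assms(1) arg_cong[OF LH.Ti_T[OF assms(1)], of "\<lambda>x. app x f"] by (simp add: app_LT)
  then show "inj_on (hecke n i) (laurent_ring n)" by (metis inj_onI)
  show "app (LH.Ti i) g \<in> laurent_ring n" using stableD[OF stable_Ti[OF good_lattice assms(1)]] assms(2)
    by (simp add: laurent_ring_supp)
  show "hecke n i (app (LH.Ti i) g) = g"
    using assms(1) arg_cong[OF LH.T_Ti[OF assms(1)], of "\<lambda>x. app x g"] by (simp add: app_LT)
qed

lemma hecke_word_app: "set is \<subseteq> {..n} \<Longrightarrow> hecke_word n is f = app (prod_list (map LT is)) f"
  by (induction "is") (auto simp: hecke_word_def app_LT)

lemma hecke_inv_word_app: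
  assumes "set is \<subseteq> {..n}" "f \<in> laurent_ring n"
  shows "hecke_inv_word n is f = app (prod_list (map LH.Ti is)) f \<and> hecke_inv_word n is f \<in> laurent_ring n"
  using assms(1)
proof (induction "is")
  case (Cons i "is")
  then have i: "i \<le> n" and h: "hecke_inv_word n is f = app (prod_list (map LH.Ti is)) f" "hecke_inv_word n is f \<in> laurent_ring n" by auto
  have "hecke_inv_word n (i # is) f = app (LH.Ti i) (hecke_inv_word n is f)"
    using inv_hecke[OF i h(2)] by (simp add: hecke_inv_word_def)
  then show ?case using h stableD[OF stable_Ti[OF good_lattice i]] by (simp add: laurent_ring_supp)
qed (simp add: hecke_inv_word_def assms)

lemma R_word: "m < n \<Longrightarrow> LH.R m = prod_list (map LT ([n - m..<n] @ [n] @ rev [n - m..<n]))"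
proof (induction m)
  case (Suc m)
  then have "[n - Suc m..<n] = (n - Suc m) # [n - m..<n]" by (simp add: upt_conv_Cons Suc_diff_Suc)
  then show ?case using Suc by (simp add: mult.assoc)
qed simp

lemma Tup_word: "LH.Tup k = prod_list (map LT [1..<Suc k])"
  by (induction k) auto

lemma Tdown_word: "LH.Tdown k = prod_list (map LH.Ti (rev [1..<Suc k]))"
  by (induction k) auto

lemma Y_op_app:
  assumes j: "j \<in> {1..n}" and f: "f \<in> laurent_ring n" shows "Y_op n j f = app (LH.Y j) f"
proof -
  obtain k where k: "j = Suc k" "k < n" using j by (cases j) auto
  let ?w = "[0..<n] @ [n] @ rev [j..<n]"
  have "[0..<n] = [0] @ [1..<Suc k] @ [Suc k..<n]"
    using k by (metis append_Cons append_Nil le_add1 less_eq_nat.simps(1) plus_1_eq_Suc upt_add_eq_append upt_conv_Cons upt_rec le_Suc_ex Suc_leI zero_less_Suc One_nat_def)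
  moreover have "n - (n - Suc k) = Suc k" using k by simp
  ultimately have "prod_list (map LT ?w) = LT 0 * (LH.Tup k * LH.R (n - Suc k))"
    unfolding Tup_word using R_word[of "n - Suc k"] k by (simp add: mult.assoc)
  moreover have "hecke_word n ?w f = app (prod_list (map LT ?w)) f" using j by (intro hecke_word_app) auto
  ultimately have w: "hecke_word n ?w f = app (LT 0 * (LH.Tup k * LH.R (n - Suc k))) f" by simp
  have Y: "LH.Y j = LH.Tdown k * (LT 0 * (LH.Tup k * LH.R (n - Suc k)))" using LH.Y_word k by simp
  have "stable lat (LT 0 * (LH.Tup k * LH.R (n - Suc k)))"
  proof (intro stable_intros)
    show "stable lat (LH.Tup k)" using k(2) by (induction k) (auto intro!: stable_intros stable_LT good_lattice)
  qed (use k stable_R good_lattice stable_LT in auto)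
  then have "hecke_word n ?w f \<in> laurent_ring n" unfolding w using f stableD unfolding laurent_ring_supp by blast
  moreover have "set (rev [1..<j]) \<subseteq> {..n}" using j by auto
  ultimately have "Y_op n j f = app (LH.Tdown k) (hecke_word n ?w f)"
    using hecke_inv_word_app[of "rev [1..<j]" "hecke_word n ?w f"] by (simp only: Y_op_def Tdown_word k(1) comp_apply)
  then show ?thesis unfolding Y w by simp
qed

text \<open>Existence is \<open>E_exists\<close>. Two normalized solutions differ by a joint
  eigenvector with coefficient 0 at \<open>\<kappa>\<close>, which \<open>Y_eigen_key\<close>
  excludes unless it is zero.\<close>

lemma E_poly:
  assumes \<kappa>: "\<kappa> \<in> lat" and d: "dominant n \<kappa>"
  shows "\<And>C. good C \<Longrightarrow> \<kappa> \<in> C \<Longrightarrow> E_poly n \<kappa> \<in> supp_in C" "E_poly n \<kappa> - mono \<kappa> \<in> supp_in (below (nm n \<kappa>))"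
    "app LH.Z (E_poly n \<kappa>) = scal (central_eigenvalue \<kappa>) * E_poly n \<kappa>"
proof -
  have ev: "Y_op n j f = scal (Y_eigenvalue n \<kappa> j) * f \<longleftrightarrow> app (LH.Y j) f = scal (cY j \<kappa>) * f"
    if "j \<in> {1..n}" "f \<in> laurent_ring n" for j f
    using that Y_op_app Y_eigenvalue_dominant[OF d \<kappa>] by simp
  have E: "E_poly n \<kappa> = E" if E: "E \<in> supp_in lat" "E - mono \<kappa> \<in> supp_in (below (nm n \<kappa>))"
    "\<forall>j \<in> {1..n}. app (LH.Y j) E = scal (cY j \<kappa>) * E" for E
    unfolding E_poly_def
  proof (rule the_equality)
    have "lk (E - mono \<kappa>) \<kappa> = 0" by (rule supp_in_lk[OF E(2)]) (simp add: below_def)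
    then have k: "lk E \<kappa> = 1" by (simp add: lookup_minus)
    then show "E \<in> laurent_ring n \<and> lk E \<kappa> = 1 \<and> (\<forall>j\<in>{1..n}. Y_op n j E = scal (Y_eigenvalue n \<kappa> j) * E)"
      using E ev by (simp add: laurent_ring_supp)
    fix f assume f: "f \<in> laurent_ring n \<and> lk f \<kappa> = 1 \<and> (\<forall>j\<in>{1..n}. Y_op n j f = scal (Y_eigenvalue n \<kappa> j) * f)"
    show "f = E"
    proof (rule ccontr)
      assume "f \<noteq> E"
      have "\<kappa> \<in> Poly_Mapping.keys (f - E)"
      proof (rule Y_eigen_key[OF _ _ \<kappa>])
        show "f - E \<in> supp_in lat" using f E supp_in_diff by (simp add: laurent_ring_supp)
        show "f - E \<noteq> 0" using \<open>f \<noteq> E\<close> by simp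
        fix j assume j: "j \<in> {1..n}"
        then have "app (LH.Y j) f = scal (cY j \<kappa>) * f" using f ev by blast
        then show "app (LH.Y j) (f - E) = scal (cY j \<kappa>) * (f - E)"
          using E(3) j by (simp add: app_diff right_diff_distrib)
      qed
      then show False using k f by (simp add: lookup_minus in_keys_iff)
    qed
  qed
  have key: "E_poly n \<kappa> \<in> supp_in C \<and> E_poly n \<kappa> - mono \<kappa> \<in> supp_in (below (nm n \<kappa>)) \<and> app LH.Z (E_poly n \<kappa>) = scal (central_eigenvalue \<kappa>) * E_poly n \<kappa>"
    if C: "good C" "\<kappa> \<in> C" for C
  proof -
    obtain F where F: "F \<in> supp_in C" "F - mono \<kappa> \<in> supp_in (below (nm n \<kappa>))" "app LH.Z F = scal (central_eigenvalue \<kappa>) * F"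
      "\<forall>j \<in> {1..n}. app (LH.Y j) F = scal (cY j \<kappa>) * F" using E_exists[OF C d] by blast
    have "F \<in> supp_in lat" using F(1) C(1) supp_in_mono unfolding good_def by blast
    then show ?thesis using E[OF _ F(2,4)] F by simp
  qed
  from key show "\<And>C. good C \<Longrightarrow> \<kappa> \<in> C \<Longrightarrow> E_poly n \<kappa> \<in> supp_in C" by blast
  from key[OF good_lattice \<kappa>] show "E_poly n \<kappa> - mono \<kappa> \<in> supp_in (below (nm n \<kappa>))"
    "app LH.Z (E_poly n \<kappa>) = scal (central_eigenvalue \<kappa>) * E_poly n \<kappa>" by blast+
qed

end

section \<open>Symmetrizers and isotypic Laurent polynomials\<close>

lemma chi_cases: "1 \<le> i \<Longrightarrow> chi \<Xi> n i = kap n i \<or> chi \<Xi> n i = - 1 / kap n i"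
  by (simp add: chi_def kap_def)

lemma chi_nonzero [simp]: "chi \<Xi> n i \<noteq> 0"
  by (auto simp: chi_def)

lemma chi_elem_nonzero [simp]: "chi_elem \<Xi> n w \<noteq> 0"
  by (auto simp: chi_elem_def prod_list_zero_iff)

lemma chi_Plus: "1 \<le> i \<Longrightarrow> chi Plus n i = kap n i"
  by (simp add: chi_def kap_def)

text \<open>Multiplications by the character values satisfy the braid relations too, so
  \<open>matsumoto\<close> also makes \<open>chi_elem\<close> independent of the chosen reduced
  word.\<close>

interpretation chi_ops: braid_ops n "\<lambda>i x. chi \<Xi> n i * x" for \<Xi> n
  by standard (auto simp: chi_def)

lemma chi_op_word: "chi_ops.op_word \<Xi> n is 1 = prod_list (map (chi \<Xi> n) is)"
  by (induction "is") auto

lemma chi_elem_word: "reduced_word n w is \<Longrightarrow> chi_elem \<Xi> n w = prod_list (map (chi \<Xi> n) is)"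
  using chi_ops.matsumoto[of n w "some_reduced_word n w" "is" \<Xi>] some_reduced_word[of w n] word_in_W[of "is" n]
  by (auto simp: chi_elem_def reduced_word_iff simp flip: chi_op_word)

context rank
begin

sublocale HB: braid_ops n "hecke n"
  by standard (use hecke_rel n_pos in auto)

lemma hecke_elem_word: "reduced_word n w is \<Longrightarrow> hecke_elem n w = hecke_word n is"
  using HB.matsumoto[of w "some_reduced_word n w" "is"] some_reduced_word[of w n] word_in_W[of "is" n]
  unfolding hecke_elem_def hecke_word_def HB.op_word_def[symmetric] by (auto simp: reduced_word_iff)

lemma elem_ascent:
  assumes "w \<in> W_fin n" "1 \<le> i" "i \<le> n" "mm n i (w (rho n)) > 0"
  shows "hecke_elem n (refl n i \<circ> w) f = hecke n i (hecke_elem n w f)"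
    "chi_elem \<Xi> n (refl n i \<circ> w) = chi \<Xi> n i * chi_elem \<Xi> n w"
  using hecke_elem_word[OF reduced_word_ConsI[OF some_reduced_word[OF assms(1)] assms(2-4)]]
    chi_elem_word[OF reduced_word_ConsI[OF some_reduced_word[OF assms(1)] assms(2-4)]]
  by (auto simp: hecke_elem_def hecke_word_def chi_elem_def)

lemma chi_quad: assumes "1 \<le> i" shows "chi \<Xi> n i * chi \<Xi> n i = base.hh n i * chi \<Xi> n i + 1"
  using chi_cases[OF assms, of \<Xi> n]
  by (elim disjE, simp_all only:) (simp_all add: base.hh_def field_simps)

definition sym :: "char_sign \<Rightarrow> laurent \<Rightarrow> laurent" where
  "sym \<Xi> f = (\<Sum>w \<in> W_fin n. scal (chi_elem \<Xi> n w) * hecke_elem n w f)"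

definition isotypic :: "char_sign \<Rightarrow> laurent \<Rightarrow> bool" where
  "isotypic \<Xi> f \<longleftrightarrow> f \<in> supp_in lat \<and> (\<forall>i \<in> {1..n}. hecke n i f = scal (chi \<Xi> n i) * f)"

text \<open>The group splits into pairs \<open>w\<close> and \<open>refl n i \<circ> w\<close>, the
  second being longer. A pair contributes \<open>x + \<chi> T x\<close>, and
  \<open>\<chi>^2 = h \<chi> + 1\<close> makes this an eigenvector of \<open>T\<close>.\<close>

lemma hecke_sym: assumes i: "1 \<le> i" "i \<le> n" shows "hecke n i (sym \<Xi> f) = scal (chi \<Xi> n i) * sym \<Xi> f"
proof -
  let ?W = "{w \<in> W_fin n. mm n i (w (rho n)) > 0}" and ?V = "{w \<in> W_fin n. mm n i (w (rho n)) < 0}"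
  let ?c = "scal (chi \<Xi> n i)" and ?F = "\<lambda>w. scal (chi_elem \<Xi> n w) * hecke_elem n w f"
  have W: "W_fin n = ?W \<union> ?V" using W_fin_mm_rho(1)[OF _ i] by fastforce
  have inj: "inj_on ((\<circ>) (refl n i)) ?W" by (rule inj_onI) (metis comp_assoc comp_id fun_eq_iff comp_apply refl_refl)
  have im: "(\<circ>) (refl n i) ` ?W = ?V"
  proof (intro set_eqI iffI)
    fix v assume v: "v \<in> ?V"
    then have "refl n i \<circ> v \<in> ?W" using W_fin_refl i by auto
    moreover have "v = refl n i \<circ> (refl n i \<circ> v)" by (simp add: fun_eq_iff)
    ultimately show "v \<in> (\<circ>) (refl n i) ` ?W" by blast
  qed (use W_fin_refl i in auto)
  have "sym \<Xi> f = (\<Sum>w\<in>?W. ?F w) + (\<Sum>w\<in>?V. ?F w)"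
    unfolding sym_def by (subst W, rule sum.union_disjoint) (auto intro: finite_subset[OF _ finite_W_fin])
  also have "(\<Sum>w\<in>?V. ?F w) = (\<Sum>w\<in>?W. ?F (refl n i \<circ> w))"
    unfolding im[symmetric] by (subst sum.reindex[OF inj]) (simp add: comp_def)
  also have "\<dots> = (\<Sum>w\<in>?W. scal (chi \<Xi> n i) * hecke n i (?F w))"
    using elem_ascent i by (intro sum.cong refl) (simp add: hecke_scal[OF n_pos] mult.left_commute del: scal_simps)
  finally have S: "sym \<Xi> f = (\<Sum>w\<in>?W. ?F w + ?c * hecke n i (?F w))" by (simp add: sum.distrib)
  have "hecke n i (x + ?c * hecke n i x) = ?c * (x + ?c * hecke n i x)" for x
  proof -
    have "?c * ?c = scal (base.hh n i) * ?c + 1"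
      using arg_cong[OF chi_quad[OF i(1)], of scal \<Xi>] by (simp only: scal_mult scal_simps)
    then have "?c * (?c * hecke n i x) = (scal (base.hh n i) * ?c + 1) * hecke n i x"
      by (simp only: mult.assoc[symmetric])
    moreover have "hecke n i (x + ?c * hecke n i x) = hecke n i x + ?c * (scal (base.hh n i) * hecke n i x + x)"
      by (simp only: hecke_add[OF n_pos i(2)] hecke_scal[OF n_pos i(2)] hecke_rel(1)[OF i(2)])
    ultimately show ?thesis by (simp only: distrib_left distrib_right) (simp only: mult.commute mult.left_commute ac_simps mult_1_left)
  qed
  moreover have "hecke n i (\<Sum>w\<in>A. G w) = (\<Sum>w\<in>A. hecke n i (G w))" for A and G :: "(expo \<Rightarrow> expo) \<Rightarrow> laurent"
    using app_sum[of "LT i" G A] i by (simp add: app_LT)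
  ultimately show ?thesis unfolding S by (simp only: sum_distrib_left)
qed

lemma hecke_elem_app: "w \<in> W_fin n \<Longrightarrow> hecke_elem n w f = app (prod_list (map LT (some_reduced_word n w))) f"
  unfolding hecke_elem_def using some_reduced_word[of w n]
  by (intro hecke_word_app) (auto simp: reduced_word_iff)

lemma word_LT:
  assumes "set is \<subseteq> {1..n}"
  shows "lin (prod_list (map LT is))" "good C \<Longrightarrow> stable C (prod_list (map LT is))"
    "app (prod_list (map LT is)) (app LH.Z f) = app LH.Z (app (prod_list (map LT is)) f)"
  using assms by (induction "is") (auto intro!: lin_intros lin_LT stable_intros stable_LT simp: app_LT_Z)

lemma word_set: "w \<in> W_fin n \<Longrightarrow> set (some_reduced_word n w) \<subseteq> {1..n}"
  using some_reduced_word by (auto simp: reduced_word_iff)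

lemma sym_supp: "good C \<Longrightarrow> f \<in> supp_in C \<Longrightarrow> sym \<Xi> f \<in> supp_in C"
  unfolding sym_def using word_LT(2)[OF word_set]
  by (intro supp_in_sum supp_in_scal) (simp add: hecke_elem_app stable_def)

lemma sym_Z: "app LH.Z (sym \<Xi> f) = sym \<Xi> (app LH.Z f)"
  unfolding sym_def app_sum
  by (intro sum.cong refl) (simp only: linD[OF lin_Z] hecke_elem_app word_LT(3)[OF word_set])

text \<open>Along a reduced word the pairings of the dominant \<open>\<kappa>\<close> stay
  nonnegative, so leading terms compose. A letter that moves the exponent creates an inversion;
  hence a word that ends at \<open>\<kappa>\<close> consists of letters fixing it.\<close>

lemma word_lead:
  assumes "reduced_word n w is" and d: "dominant n \<kappa>" and \<kappa>: "\<kappa> \<in> lat"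
  shows "\<exists>c. tr (prod_list (map LT is)) \<kappa> c (w \<kappa>) \<and>
    (w \<kappa> = \<kappa> \<longrightarrow> c = prod_list (map (kap n) is) \<and> (\<forall>i\<in>set is. mm n i \<kappa> = 0))"
  using assms(1)
proof (induction "is" arbitrary: w)
  case Nil
  then show ?case using tr_1[OF \<kappa>] by (auto simp: reduced_word_iff)
next
  case (Cons i "is")
  note r = reduced_word_Cons[OF Cons.prems]
  define v where "v = word_elem n is"
  obtain c where c: "tr (prod_list (map LT is)) \<kappa> c (v \<kappa>)"
    "v \<kappa> = \<kappa> \<Longrightarrow> c = prod_list (map (kap n) is) \<and> (\<forall>i\<in>set is. mm n i \<kappa> = 0)"
    using Cons.IH[OF r(3)] v_def by blast
  have m: "mm n i (v \<kappa>) \<ge> 0" using W_fin_mm_rho(2)[OF r(6) r(1,2) d r(5)] by (simp add: v_def)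
  have sr: "sref n i \<mu> = refl n i \<mu>" and mz: "m0 n i \<mu> = mm n i \<mu>" for \<mu> using r(1) by (auto simp: sref_def m0_def)
  let ?c = "if m0 n i (v \<kappa>) = 0 then kap n i else zc i powi zb n i (v \<kappa>) / kap n i"
  have "tr (LT i) (v \<kappa>) ?c (refl n i (v \<kappa>))"
    using tr_LT[OF r(2), of "v \<kappa>"] c(1) m unfolding sr mz by (simp add: tr_def)
  then have "tr (LT i * prod_list (map LT is)) \<kappa> (c * ?c) (w \<kappa>)"
    using tr_comp[OF c(1)] r(4) by (simp add: v_def)
  moreover have "mm n i (v \<kappa>) = 0 \<and> v \<kappa> = \<kappa>" if "w \<kappa> = \<kappa>"
  proof -
    have m0: "mm n i (v \<kappa>) = 0"
    proof (rule ccontr)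
      assume "mm n i (v \<kappa>) \<noteq> 0"
      then have "inv_count n (refl n i (v \<kappa>)) \<noteq> 0" using inv_count_refl_pos[OF r(1,2)] m by fastforce
      then show False using that d inv_count_0_iff r(4) by (simp add: v_def)
    qed
    then show ?thesis using mm_0_refl[OF m0 r(2)] that r(4) by (simp add: v_def)
  qed
  ultimately show ?case using c(2) by (intro exI[of _ "c * ?c"] conjI impI) (auto simp: mz mult.commute)
qed

text \<open>The possible dominant leading exponents of isotypic elements: if the reflection
  \<open>i\<close> fixes the leading exponent, \<open>T i\<close> acts there by
  \<open>kap n i\<close>, which forces this character value.\<close>

definition reg :: "char_sign \<Rightarrow> expo \<Rightarrow> bool" where
  "reg \<Xi> \<kappa> \<longleftrightarrow> dominant n \<kappa> \<and> \<kappa> \<in> lat \<and> (\<forall>i\<in>{1..n}. chi \<Xi> n i \<noteq> kap n i \<longrightarrow> mm n i \<kappa> \<noteq> 0)"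

lemma prod_list_kap: "set is \<subseteq> {1..n} \<Longrightarrow>
    t_par ^ length (filter (\<lambda>i. i < n) is) * tn_par ^ length (filter (\<lambda>i. i = n) is) = prod_list (map (kap n) is) ^ 2"
  by (induction "is") (auto simp: kap_def power_mult_distrib)

text \<open>For \<open>w\<close> in the stabilizer, the character value and the leading coefficient
  of \<open>T_w\<close> are the same product of \<open>kap\<close>s. Their product is a square,
  which is the summand of the Poincare polynomial that the normalization divides out.\<close>

lemma lk_elem_E:
  assumes w: "w \<in> W_fin n" and r: "reg \<Xi> \<kappa>"
  shows "chi_elem \<Xi> n w * lk (hecke_elem n w (E_poly n \<kappa>)) \<kappa> =
    (if w \<kappa> = \<kappa> then t_par ^ len_s n w * tn_par ^ len_d n w else 0)"
proof -
  have d: "dominant n \<kappa>" and \<kappa>: "\<kappa> \<in> lat" using r by (auto simp: reg_def)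
  let ?i = "some_reduced_word n w"
  let ?x = "prod_list (map LT ?i)"
  obtain c where c: "tr ?x \<kappa> c (w \<kappa>)"
    "w \<kappa> = \<kappa> \<Longrightarrow> c = prod_list (map (kap n) ?i) \<and> (\<forall>i\<in>set ?i. mm n i \<kappa> = 0)"
    using word_lead[OF some_reduced_word[OF w] d \<kappa>] by blast
  have "app ?x (E_poly n \<kappa> - mono \<kappa>) \<in> supp_in (below (nm n \<kappa>))"
    using stableD[OF word_LT(2)[OF word_set[OF w] good_below] E_poly(2)[OF \<kappa> d]] .
  then have "(app ?x (mono \<kappa>) - scal c * mono (w \<kappa>)) + app ?x (E_poly n \<kappa> - mono \<kappa>) \<in> supp_in (below (nm n \<kappa>))"
    using c(1) by (auto simp: tr_def intro!: supp_in_add)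
  then have "lk (app ?x (E_poly n \<kappa>) - scal c * mono (w \<kappa>)) \<kappa> = 0"
    by (intro supp_in_lk[of _ "below (nm n \<kappa>)"]) (auto simp: app_diff below_def algebra_simps)
  then have l: "lk (hecke_elem n w (E_poly n \<kappa>)) \<kappa> = (if w \<kappa> = \<kappa> then c else 0)"
    by (simp add: hecke_elem_app[OF w] lookup_minus lookup_single when_def)
  show ?thesis
  proof (cases "w \<kappa> = \<kappa>")
    case True
    have "chi_elem \<Xi> n w = prod_list (map (kap n) ?i)"
      unfolding chi_elem_def using c(2)[OF True] r word_set[OF w] by (intro arg_cong[where f=prod_list] map_cong) (auto simp: reg_def)
    then show ?thesis using l c(2)[OF True] True prod_list_kap[OF word_set[OF w]]
      by (simp add: len_s_def len_d_def power2_eq_square)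
  qed (simp add: l)
qed

text \<open>A nonempty sum of monomials with coefficient 1 cannot vanish.\<close>

lemma stab_poincare_nonzero: "stab_poincare n \<nu> \<noteq> 0"
proof -
  let ?e = "\<lambda>w v. if v = T_half then 2 * int (len_s n w) else if v = Tn_half then 2 * int (len_d n w) else 0"
  have "stab_poincare n \<nu> = (\<Sum>w | w \<in> W_fin n \<and> w \<nu> = \<nu>. Mon (?e w))"
    unfolding stab_poincare_def
    by (intro sum.cong refl) (simp add: Mon_def UNIV_param power_int_def nat_mult_distrib flip: power_mult)
  moreover have "id \<in> {w. w \<in> W_fin n \<and> w \<nu> = \<nu>}" by simp
  ultimately show ?thesis using sum_Mon_nonzero[of "{w. w \<in> W_fin n \<and> w \<nu> = \<nu>}" ?e] finite_subset[OF _ finite_W_fin]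
    by (metis (no_types, lifting) empty_iff mem_Collect_eq subsetI)
qed

lemma sym_poly_eq: "sym_poly \<Xi> n \<kappa> =
    scal (chi_elem Plus n (longest n) / stab_poincare n \<kappa> / chi_elem \<Xi> n (longest n)) * sym \<Xi> (E_poly n \<kappa>)"
  by (simp add: sym_poly_def symmetrizer_def sym_def scal_mult divide_inverse flip: mult.assoc)

lemma sym_poly:
  assumes r: "reg \<Xi> \<kappa>"
  shows "isotypic \<Xi> (sym_poly \<Xi> n \<kappa>)" "app LH.Z (sym_poly \<Xi> n \<kappa>) = scal (central_eigenvalue \<kappa>) * sym_poly \<Xi> n \<kappa>"
    "good C \<Longrightarrow> \<kappa> \<in> C \<Longrightarrow> sym_poly \<Xi> n \<kappa> \<in> supp_in C"
    "lk (sym_poly \<Xi> n \<kappa>) \<kappa> = chi_elem Plus n (longest n) / chi_elem \<Xi> n (longest n)"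
proof -
  have d: "dominant n \<kappa>" and \<kappa>: "\<kappa> \<in> lat" using r by (auto simp: reg_def)
  show s: "sym_poly \<Xi> n \<kappa> \<in> supp_in C" if "good C" "\<kappa> \<in> C" for C
    unfolding sym_poly_eq using E_poly(1)[OF \<kappa> d that] that by (intro supp_in_scal sym_supp)
  show "isotypic \<Xi> (sym_poly \<Xi> n \<kappa>)"
    unfolding isotypic_def using s[OF good_lattice \<kappa>]
    by (simp only: sym_poly_eq) (simp add: hecke_scal[OF n_pos] hecke_sym mult.left_commute del: scal_simps)
  show "app LH.Z (sym_poly \<Xi> n \<kappa>) = scal (central_eigenvalue \<kappa>) * sym_poly \<Xi> n \<kappa>"
  proof -
    have "sym \<Xi> (scal c * f) = scal c * sym \<Xi> f" for c f
      unfolding sym_def sum_distrib_left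
      by (intro sum.cong refl) (simp only: hecke_elem_app linD[OF word_LT(1)[OF word_set]] mult.left_commute)
    then show ?thesis unfolding sym_poly_eq by (simp only: linD[OF lin_Z] sym_Z E_poly(3)[OF \<kappa> d] mult.left_commute)
  qed
  have "lk (sym \<Xi> (E_poly n \<kappa>)) \<kappa> = (\<Sum>w\<in>W_fin n. if w \<kappa> = \<kappa> then t_par ^ len_s n w * tn_par ^ len_d n w else 0)"
    unfolding sym_def lookup_sum using lk_elem_E[OF _ r] by (intro sum.cong refl) (simp add: lk_scal)
  also have "\<dots> = stab_poincare n \<kappa>"
    unfolding stab_poincare_def by (subst sum.inter_filter[symmetric]) (auto simp: finite_W_fin)
  finally show "lk (sym_poly \<Xi> n \<kappa>) \<kappa> = chi_elem Plus n (longest n) / chi_elem \<Xi> n (longest n)"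
    using stab_poincare_nonzero[of \<kappa>] by (simp add: sym_poly_eq lk_scal)
qed

end

section \<open>Isotypic elements are determined by one coefficient\<close>

context rank
begin

lemma lk_app:
  assumes "lin x"
  shows "lk (app x f) \<nu> = (\<Sum>\<mu>\<in>Poly_Mapping.keys f. lk f \<mu> * lk (app x (mono \<mu>)) \<nu>)"
  by (subst app_sum_mono) (simp only: linD[OF assms] lookup_sum lk_scal)

text \<open>Among exponents of at most this norm only the reflection of \<open>\<nu>\<close>
  contributes: \<open>x^\<nu>\<close> gives no separate diagonal term, since its pairing is not
  negative.\<close>

lemma lk_hecke_top:
  assumes i: "1 \<le> i" "i \<le> n" and f: "f \<in> supp_in lat"
    and top: "\<And>\<mu>. \<mu> \<in> Poly_Mapping.keys f \<Longrightarrow> nm n \<mu> \<le> nm n \<nu>" and m: "0 \<le> mm n i \<nu>"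
  shows "lk (hecke n i f) \<nu> = kap n i * lk f (refl n i \<nu>)"
proof -
  have "lk (hecke n i (mono \<mu>)) \<nu> = (if \<mu> = refl n i \<nu> then kap n i else 0)" if \<mu>: "\<mu> \<in> Poly_Mapping.keys f" for \<mu>
  proof -
    have lat: "\<mu> \<in> lat" and nm: "\<nu> \<notin> below (nm n \<mu>)" using f \<mu> top[OF \<mu>] by (auto simp: supp_in_def below_def)
    have s: "sref n i \<mu> = refl n i \<mu>" "m0 n i \<mu> = mm n i \<mu>" "zc i = 1" using i by (auto simp: sref_def m0_def zc_def)
    have r: "refl n i \<mu> = \<nu> \<longleftrightarrow> \<mu> = refl n i \<nu>" by (metis refl_refl)
    note h = hecke_lead[OF i(2) lat, unfolded s]
    consider "mm n i \<mu> = 0" | "mm n i \<mu> > 0" | "mm n i \<mu> < 0" by linarith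
    then show ?thesis
    proof cases
      case 1
      then have "\<mu> = \<nu> \<longleftrightarrow> \<mu> = refl n i \<nu>" using mm_0_refl[OF 1 i(2)] r by metis
      then show ?thesis using h(1)[OF 1] by (auto simp: lookup_single when_def)
    next
      case 2
      then have ne: "\<not> refl n i \<mu> = \<nu>" using m mm_refl[of n i \<mu>] by auto
      then have "\<mu> \<noteq> refl n i \<nu>" using r by blast
      then show ?thesis using supp_in_lk[OF h(2)[OF 2] nm] ne by (simp add: lookup_minus lookup_single)
    next
      case 3
      then have "\<mu> \<noteq> \<nu>" using m by auto
      then show ?thesis using supp_in_lk[OF h(3)[OF 3] nm]
        by (cases "refl n i \<mu> = \<nu>") (simp_all add: lookup_minus lookup_add lookup_single r flip: scal_mult)
    qed
  qed
  then have "lk (hecke n i f) \<nu> = (\<Sum>\<mu>\<in>Poly_Mapping.keys f. lk f \<mu> * (if \<mu> = refl n i \<nu> then kap n i else 0))"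
    using lk_app[OF lin_LT[OF i(2)], of f \<nu>] by (simp add: app_LT i cong: sum.cong)
  also have "\<dots> = (\<Sum>\<mu>\<in>Poly_Mapping.keys f. if refl n i \<nu> = \<mu> then kap n i * lk f \<mu> else 0)"
    by (intro sum.cong) auto
  also have "\<dots> = kap n i * lk f (refl n i \<nu>)" unfolding sum.delta'[OF finite_keys] by (simp add: in_keys_iff)
  finally show ?thesis .
qed

text \<open>On the layer of largest norm the coefficients at an exponent and at its reflection are
  proportional with nonzero factors. An exponent there with fewest inversions must then be
  dominant.\<close>

lemma isotypic_top:
  assumes f: "isotypic \<Xi> f" "f \<noteq> 0"
  obtains \<nu> where "\<nu> \<in> Poly_Mapping.keys f" "\<And>\<mu>. \<mu> \<in> Poly_Mapping.keys f \<Longrightarrow> nm n \<mu> \<le> nm n \<nu>" "reg \<Xi> \<nu>"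
proof -
  have lat: "f \<in> supp_in lat" and h: "\<And>i. i \<in> {1..n} \<Longrightarrow> hecke n i f = scal (chi \<Xi> n i) * f"
    using f by (auto simp: isotypic_def)
  obtain \<nu>0 where \<nu>0: "\<nu>0 \<in> Poly_Mapping.keys f" "\<And>\<mu>. \<mu> \<in> Poly_Mapping.keys f \<Longrightarrow> nm n \<mu> \<le> nm n \<nu>0"
    using ex_top[OF f(2), of "nm n"] by blast
  define S where "S = {\<nu> \<in> Poly_Mapping.keys f. nm n \<nu> = nm n \<nu>0}"
  have "\<nu>0 \<in> S" using \<nu>0 by (simp add: S_def)
  then obtain \<nu> where \<nu>: "\<nu> \<in> S" "\<And>\<mu>. \<mu> \<in> S \<Longrightarrow> inv_count n \<nu> \<le> inv_count n \<mu>"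
    using ex_has_least_nat[of "\<lambda>x. x \<in> S"] by blast
  have rel: "chi \<Xi> n i * lk f \<mu> = kap n i * lk f (refl n i \<mu>)"
    if "i \<in> {1..n}" "nm n \<mu> = nm n \<nu>0" "0 \<le> mm n i \<mu>" for i \<mu>
    using lk_hecke_top[of i f \<mu>] that h lat \<nu>0 by (simp add: lk_scal)
  have key: "\<nu> \<in> Poly_Mapping.keys f" "nm n \<nu> = nm n \<nu>0" using \<nu>(1) by (auto simp: S_def)
  have latt: "\<nu> \<in> lat" using key lat by (auto simp: supp_in_def)
  have d: "dominant n \<nu>"
    unfolding dominant_def
  proof (intro allI impI, rule ccontr)
    fix i assume i: "1 \<le> i \<and> i \<le> n" and neg: "\<not> 0 \<le> mm n i \<nu>"
    have nmr: "nm n (refl n i \<nu>) = nm n \<nu>0" using nm_sref[OF n_pos, of i \<nu>] i key by (simp add: sref_def)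
    have "chi \<Xi> n i * lk f (refl n i \<nu>) = kap n i * lk f \<nu>"
      using rel[of i "refl n i \<nu>"] nmr i neg by simp
    then have "lk f (refl n i \<nu>) \<noteq> 0" using key by (auto simp: in_keys_iff)
    then have "refl n i \<nu> \<in> S" using nmr by (simp add: S_def in_keys_iff)
    then show False using \<nu>(2) inv_count_refl_neg[of i n \<nu>] i neg by fastforce
  qed
  have "mm n i \<nu> \<noteq> 0" if "i \<in> {1..n}" "chi \<Xi> n i \<noteq> kap n i" for i
    using rel[OF that(1) key(2)] that key(1) mm_0_refl[of n i \<nu>] by (auto simp: in_keys_iff)
  then have "reg \<Xi> \<nu>" using d latt by (simp add: reg_def)
  then show ?thesis using that[of \<nu>] key \<nu>0 by simp
qed

text \<open>A nonzero \<open>f\<close> would have a dominant leading exponent with the eigenvalue of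
  \<open>\<kappa>\<close>, that is, \<open>\<kappa>\<close> itself.\<close>

lemma isotypic_unique:
  assumes f: "isotypic \<Xi> f" "app LH.Z f = scal (central_eigenvalue \<kappa>) * f" and \<kappa>: "dominant n \<kappa>" "\<kappa> \<in> lat" "lk f \<kappa> = 0"
  shows "f = 0"
proof (rule ccontr)
  assume "f \<noteq> 0"
  then obtain \<nu> where \<nu>: "\<nu> \<in> Poly_Mapping.keys f" "\<And>\<mu>. \<mu> \<in> Poly_Mapping.keys f \<Longrightarrow> nm n \<mu> \<le> nm n \<nu>" "reg \<Xi> \<nu>"
    using isotypic_top[OF f(1)] by metis
  have "central_eigenvalue (dr \<nu>) = central_eigenvalue \<kappa>" using Z_eigen_top[OF _ f(2) \<nu>(1,2)] f(1) by (auto simp: isotypic_def)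
  then have "\<nu> = \<kappa>" using central_eigenvalue_inject[of \<nu> \<kappa>] dr_dominant[of \<nu>] \<nu>(3) \<kappa> by (simp add: reg_def)
  then show False using \<nu>(1) \<kappa>(3) by (simp add: in_keys_iff)
qed

text \<open>Weak submajorization of absolute values: for dominant \<open>\<kappa>\<close> these are
  the lattice points in the convex hull of its orbit. Such sets are compatible with products, which
  norm balls are not.\<close>

definition dom :: "expo \<Rightarrow> expo set" where
  "dom \<kappa> = {\<nu> \<in> lat. \<forall>J \<subseteq> {1..n}. (\<Sum>j\<in>J. \<bar>lk \<nu> j\<bar>) \<le> (\<Sum>i=1..card J. lk \<kappa> i)}"

lemma lk_sref_abs:
  assumes "i \<le> n" obtains \<tau> where "\<tau> permutes {1..n}" "\<And>\<nu> j. \<bar>lk (sref n i \<nu>) j\<bar> = \<bar>lk \<nu> (\<tau> j)\<bar>"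
proof (cases "1 \<le> i \<and> i < n")
  case True
  show ?thesis
    by (rule that[of "Transposition.transpose i (Suc i)"])
       (use True in \<open>auto simp: sref_def lk_refl_less intro!: permutes_swap_id\<close>)
next
  case False
  then have "i = 0 \<or> i = n" using assms by auto
  then show ?thesis by (intro that[of id]) (auto simp: sref_def permutes_id)
qed

text \<open>The bounds are invariant under reflections, and a point of a string is a convex
  combination of its two ends. The factor \<open>\<bar>?b\<bar>\<close> clears the denominator of
  this combination.\<close>

lemma good_dom: "good (dom \<kappa>)"
  unfolding good_def
proof (intro conjI allI impI ballI)
  show "dom \<kappa> \<subseteq> lat" by (auto simp: dom_def)
  fix i \<mu> assume i: "i \<le> n" and \<mu>: "\<mu> \<in> dom \<kappa>"
  have lat: "\<mu> \<in> lat" and b: "\<And>J. J \<subseteq> {1..n} \<Longrightarrow> (\<Sum>j\<in>J. \<bar>lk \<mu> j\<bar>) \<le> (\<Sum>i=1..card J. lk \<kappa> i)"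
    using \<mu> by (auto simp: dom_def)
  obtain \<tau> where \<tau>: "\<tau> permutes {1..n}" "\<And>\<nu> j. \<bar>lk (sref n i \<nu>) j\<bar> = \<bar>lk \<nu> (\<tau> j)\<bar>" using lk_sref_abs[OF i] by metis
  have bs: "(\<Sum>j\<in>J. \<bar>lk (sref n i \<mu>) j\<bar>) \<le> (\<Sum>i=1..card J. lk \<kappa> i)" if J: "J \<subseteq> {1..n}" for J
  proof -
    have inj: "inj_on \<tau> J" using permutes_inj[OF \<tau>(1)] by (auto simp: inj_on_def)
    have "(\<Sum>j\<in>J. \<bar>lk (sref n i \<mu>) j\<bar>) = (\<Sum>j\<in>\<tau> ` J. \<bar>lk \<mu> j\<bar>)" by (simp add: \<tau>(2) sum.reindex[OF inj])
    also have "\<dots> \<le> (\<Sum>i=1..card (\<tau> ` J). lk \<kappa> i)" using permutes_image[OF \<tau>(1)] J by (intro b) blast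
    finally show ?thesis by (simp add: card_image[OF inj])
  qed
  have ls: "sref n i \<mu> \<in> lat" by (rule sref_lattice[OF n_pos i lat])
  show "sref n i \<mu> \<in> dom \<kappa>" using bs ls by (simp add: dom_def)
  show "string_int n i \<mu> \<subseteq> dom \<kappa>"
  proof
    fix \<nu> assume \<nu>s: "\<nu> \<in> string_int n i \<mu>"
    then obtain k where k: "\<nu> = \<mu> + frag_cmul k (ze n i)" "min 0 (zb n i \<mu>) < k" "k < max 0 (zb n i \<mu>)"
      by (auto simp: string_int_def)
    let ?b = "zb n i \<mu>"
    have \<nu>l: "\<nu> \<in> lat" using good_lattice i lat \<nu>s by (auto simp: good_def)
    have sl: "lk (sref n i \<mu>) j = lk \<mu> j + ?b * lk (ze n i) j" and nl: "lk \<nu> j = lk \<mu> j + k * lk (ze n i) j" for j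
      by (auto simp: sref_eq k(1) lookup_add)
    have "\<bar>?b\<bar> * \<bar>lk \<nu> j\<bar> \<le> \<bar>?b - k\<bar> * \<bar>lk \<mu> j\<bar> + \<bar>k\<bar> * \<bar>lk (sref n i \<mu>) j\<bar>" for j
    proof -
      have "?b * lk \<nu> j = (?b - k) * lk \<mu> j + k * lk (sref n i \<mu>) j" by (simp add: sl nl algebra_simps)
      then show ?thesis using abs_triangle_ineq[of "(?b - k) * lk \<mu> j" "k * lk (sref n i \<mu>) j"]
        by (simp add: abs_mult[symmetric])
    qed
    moreover have e: "\<bar>?b - k\<bar> + \<bar>k\<bar> = \<bar>?b\<bar>" and bpos: "0 < \<bar>?b\<bar>" using k by (auto simp: min_def max_def split: if_splits)
    have "(\<Sum>j\<in>J. \<bar>lk \<nu> j\<bar>) \<le> (\<Sum>i=1..card J. lk \<kappa> i)" if J: "J \<subseteq> {1..n}" for J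
    proof -
      let ?S = "\<Sum>i=1..card J. lk \<kappa> i"
      have "\<bar>?b\<bar> * (\<Sum>j\<in>J. \<bar>lk \<nu> j\<bar>) \<le> (\<Sum>j\<in>J. \<bar>?b - k\<bar> * \<bar>lk \<mu> j\<bar> + \<bar>k\<bar> * \<bar>lk (sref n i \<mu>) j\<bar>)"
        unfolding sum_distrib_left by (rule sum_mono) (rule calculation)
      also have "\<dots> = \<bar>?b - k\<bar> * (\<Sum>j\<in>J. \<bar>lk \<mu> j\<bar>) + \<bar>k\<bar> * (\<Sum>j\<in>J. \<bar>lk (sref n i \<mu>) j\<bar>)"
        by (simp add: sum.distrib sum_distrib_left)
      also have "\<dots> \<le> \<bar>?b - k\<bar> * ?S + \<bar>k\<bar> * ?S"
        using b[OF J] bs[OF J] by (intro add_mono mult_left_mono) auto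
      also have "\<dots> = \<bar>?b\<bar> * ?S" by (simp only: e[symmetric] distrib_right)
      finally show ?thesis using bpos by simp
    qed
    then show "\<nu> \<in> dom \<kappa>" using \<nu>l by (simp add: dom_def)
  qed
qed

lemma sum_le_initial:
  assumes d: "dominant n \<kappa>" and J: "J \<subseteq> {1..n}"
  shows "(\<Sum>j\<in>J. lk \<kappa> j) \<le> (\<Sum>i=1..card J. lk \<kappa> i)"
  using J
proof (induction "card J" arbitrary: J)
  case 0
  then have "J = {}" using finite_subset[OF 0(2)] by auto
  then show ?case by simp
next
  case (Suc k)
  have fin: "finite J" using finite_subset[OF Suc(3)] by simp
  then have m: "Max J \<in> J" using Suc(2) by (intro Max_in) auto
  define m where "m = Max J"
  have mJ: "m \<in> J" "m \<in> {1..n}" using m Suc(3) by (auto simp: m_def)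
  have "J \<subseteq> {1..m}" using Suc(3) fin by (auto simp: m_def)
  then have "Suc k \<le> m" using card_mono[of "{1..m}" J] Suc(2) by simp
  then have "lk \<kappa> m \<le> lk \<kappa> (Suc k)" using dominant_mono[OF d, of "Suc k" m] mJ by simp
  moreover have "(\<Sum>j\<in>J - {m}. lk \<kappa> j) \<le> (\<Sum>i=1..card (J - {m}). lk \<kappa> i)" using Suc mJ fin by (intro Suc(1)) auto
  moreover have "card (J - {m}) = k" using mJ(1) fin Suc(2) by simp
  moreover have "(\<Sum>i=1..card J. lk \<kappa> i) = (\<Sum>i=1..k. lk \<kappa> i) + lk \<kappa> (Suc k)" by (simp flip: Suc(2))
  ultimately show ?case unfolding sum.remove[OF fin mJ(1)] by simp
qed

lemma self_dom: assumes "dominant n \<kappa>" "\<kappa> \<in> lat" shows "\<kappa> \<in> dom \<kappa>"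
proof -
  have "(\<Sum>j\<in>J. \<bar>lk \<kappa> j\<bar>) = (\<Sum>j\<in>J. lk \<kappa> j)" if "J \<subseteq> {1..n}" for J
    using that dominant_nonneg[OF assms(1)] by (intro sum.cong) auto
  then show ?thesis using sum_le_initial[OF assms(1)] assms(2) by (simp add: dom_def)
qed

text \<open>The partial sums of \<open>a\<close> and \<open>b\<close> are bounded by those of
  \<open>\<delta>\<close> and \<open>\<kappa>\<close>, and the totals agree, so each bound is
  attained.\<close>

lemma dom_add:
  assumes a: "a \<in> dom \<delta>" and b: "b \<in> dom \<kappa>" and eq: "a + b = \<delta> + \<kappa>" and lat: "\<delta> \<in> lat"
  shows "a = \<delta>"
proof -
  have le: "(\<Sum>j=1..k. lk x j) \<le> (\<Sum>j=1..k. lk y j)" if "x \<in> dom y" "k \<le> n" for x y k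
  proof -
    have "(\<Sum>j=1..k. lk x j) \<le> (\<Sum>j\<in>{1..k}. \<bar>lk x j\<bar>)" by (intro sum_mono) auto
    also have "\<dots> \<le> (\<Sum>i=1..card {1..k}. lk y i)" using that unfolding dom_def by (auto dest!: spec[of _ "{1..k}"])
    finally show ?thesis by simp
  qed
  have eqs: "(\<Sum>j=1..k. lk a j) = (\<Sum>j=1..k. lk \<delta> j)" if "k \<le> n" for k
  proof -
    have "(\<Sum>j=1..k. lk a j) + (\<Sum>j=1..k. lk b j) = (\<Sum>j=1..k. lk \<delta> j) + (\<Sum>j=1..k. lk \<kappa> j)"
      using arg_cong[OF eq, of "\<lambda>x. \<Sum>j=1..k. lk x j"] by (simp add: lookup_add sum.distrib)
    then show ?thesis using le[OF a that] le[OF b that] by simp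
  qed
  show ?thesis
  proof (rule poly_mapping_eqI)
    fix k
    show "lk a k = lk \<delta> k"
    proof (cases "k \<in> {1..n}")
      case True
      then obtain l where "k = Suc l" by (cases k) auto
      then show ?thesis using eqs[of k] eqs[of l] True by simp
    next
      case False
      then show ?thesis using a lat by (auto simp: dom_def in_lattice)
    qed
  qed
qed

lemma lk_times_top:
  assumes f: "f \<in> supp_in (dom \<delta>)" and g: "g \<in> supp_in (dom \<kappa>)" and lat: "\<delta> \<in> lat"
  shows "lk (f * g) (\<delta> + \<kappa>) = lk f \<delta> * lk g \<kappa>"
proof -
  define f' g' where "f' = f - scal (lk f \<delta>) * mono \<delta>" and "g' = g - scal (lk g \<kappa>) * mono \<kappa>"
  have sp: "x \<in> Poly_Mapping.keys h \<and> x \<noteq> \<nu>" if "x \<in> Poly_Mapping.keys (h - scal (lk h \<nu>) * mono \<nu>)" for x \<nu> h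
    using that by (auto simp: in_keys_iff lookup_minus lookup_single lk_scal when_def split: if_splits)
  have z: "lk (f' * g) (\<delta> + \<kappa>) = 0"
  proof (rule ccontr)
    assume "lk (f' * g) (\<delta> + \<kappa>) \<noteq> 0"
    then obtain a b where ab: "a \<in> Poly_Mapping.keys f'" "b \<in> Poly_Mapping.keys g" "a + b = \<delta> + \<kappa>"
      using keys_mult[of f' g] by (auto simp: in_keys_iff)
    then show False using dom_add[of a \<delta> b \<kappa>] sp[of a f \<delta>] f g lat by (auto simp: f'_def supp_in_def)
  qed
  have "lk (mono \<delta> * g') (\<delta> + \<kappa>) = 0"
  proof (rule ccontr)
    assume "lk (mono \<delta> * g') (\<delta> + \<kappa>) \<noteq> 0"
    then have "\<delta> + \<kappa> \<in> Poly_Mapping.keys (mono \<delta> * g')" by (simp add: in_keys_iff)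
    then obtain a b where "a \<in> Poly_Mapping.keys (mono \<delta>)" "b \<in> Poly_Mapping.keys g'" "a + b = \<delta> + \<kappa>"
      using subsetD[OF keys_mult] by force
    then show False using sp[of b g \<kappa>] by (auto simp: g'_def)
  qed
  moreover have "f * g = f' * g + (scal (lk f \<delta>) * (mono \<delta> * g') + scal (lk f \<delta> * lk g \<kappa>) * mono (\<delta> + \<kappa>))"
    by (simp add: f'_def g'_def algebra_simps mult_single)
  ultimately show ?thesis using z by (simp only: lookup_add lk_scal) (simp add: lookup_single)
qed

end

section \<open>Orbits of points\<close>

text \<open>The reflections \<open>spt\<close> with \<open>i \<ge> 1\<close>, stated without the
  coefficient map, so that orbits are literally the same sets for the original and the shifted
  parameters.\<close>

definition rp :: "nat \<Rightarrow> nat \<Rightarrow> (nat \<Rightarrow> 'k::field) \<Rightarrow> nat \<Rightarrow> 'k" where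
  "rp n i p = (if i < n then p(i := p (Suc i), Suc i := p i) else p(n := 1 / p n))"

lemma rp_rp [simp]: "rp n i (rp n i p) = p"
  by (auto simp: rp_def)

inductive_set orb :: "nat \<Rightarrow> (nat \<Rightarrow> 'k::field) \<Rightarrow> (nat \<Rightarrow> 'k) set" for n p where
  orb_refl [simp]: "p \<in> orb n p"
| orb_rp: "z \<in> orb n p \<Longrightarrow> 1 \<le> i \<Longrightarrow> i \<le> n \<Longrightarrow> rp n i z \<in> orb n p"

lemma orb_trans: "y \<in> orb n z \<Longrightarrow> z \<in> orb n p \<Longrightarrow> y \<in> orb n p"
  by (induction rule: orb.induct) (auto intro: orb_rp)

lemma orb_rp_iff: "1 \<le> i \<Longrightarrow> i \<le> n \<Longrightarrow> rp n i z \<in> orb n p \<longleftrightarrow> z \<in> orb n p"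
  using orb_rp[of "rp n i z" n p i] orb_rp[of z n p i] by auto

lemma orb_sym: "z \<in> orb n p \<Longrightarrow> p \<in> orb n z"
proof (induction rule: orb.induct)
  case (orb_rp z i)
  have "z \<in> orb n (rp n i z)" using orb.orb_rp[OF orb_refl[of "rp n i z" n], of i] orb_rp by simp
  then show ?case using orb_trans orb_rp by blast
qed simp

lemma orb_eq: "z \<in> orb n p \<Longrightarrow> orb n z = orb n p"
  using orb_trans orb_sym by blast

lemma orb_coord:
  "z \<in> orb n p \<Longrightarrow> (i \<in> {1..n} \<longrightarrow> (\<exists>j\<in>{1..n}. z i = p j powi 1 \<or> z i = p j powi (-1))) \<and> (i \<notin> {1..n} \<longrightarrow> z i = p i)"
proof (induction arbitrary: i rule: orb.induct)
  case (orb_rp z k)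
  have v: "rp n k z i = (if k < n then (if i = k then z (Suc k) else if i = Suc k then z k else z i)
    else if i = n then 1 / z n else z i)" by (auto simp: rp_def)
  show ?case
  proof (cases "k < n")
    case True
    have "\<exists>i'. rp n k z i = z i' \<and> (i' \<in> {1..n} \<longleftrightarrow> i \<in> {1..n}) \<and> (i \<notin> {1..n} \<longrightarrow> i' = i)"
      using True orb_rp(2,3) unfolding v by auto
    then show ?thesis using orb_rp.IH by metis
  next
    case False
    then have k: "k = n" using orb_rp by simp
    obtain j where j: "j \<in> {1..n}" "z n = p j powi 1 \<or> z n = p j powi (-1)"
    proof -
      have "n \<in> {1..n}" using orb_rp(2) k by simp
      then show ?thesis using orb_rp.IH[of n] that by blast
    qed
    then have "1 / z n = p j powi 1 \<or> 1 / z n = p j powi (-1)" by (auto simp: power_int_minus divide_inverse)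
    then show ?thesis using orb_rp.IH[of i] j(1) False orb_rp(2) k unfolding v by (cases "i = n") auto
  qed
qed auto

lemma finite_orb: "finite (orb n p)"
proof -
  let ?C = "(\<lambda>j. p j powi 1) ` {1..n} \<union> (\<lambda>j. p j powi (-1)) ` {1..n}"
  let ?r = "\<lambda>z i. if i \<in> {1..n} then z i else 0"
  let ?F = "{f. \<forall>i. (i \<in> {1..n} \<longrightarrow> f i \<in> ?C) \<and> (i \<notin> {1..n} \<longrightarrow> f i = 0)}"
  have "finite ?F" by (rule finite_set_of_finite_funs) auto
  moreover have "?r ` orb n p \<subseteq> ?F"
  proof
    fix f assume "f \<in> ?r ` orb n p"
    then obtain z where z: "z \<in> orb n p" "f = ?r z" by blast
    have "z i \<in> ?C" if "i \<in> {1..n}" for i using orb_coord[OF z(1), of i] that by blast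
    then show "f \<in> ?F" using z(2) by simp
  qed
  moreover have "inj_on ?r (orb n p)"
  proof (rule inj_onI, rule ext)
    fix y z i assume yz: "y \<in> orb n p" "z \<in> orb n p" "?r y = ?r z"
    show "y i = z i"
      using fun_cong[OF yz(3), of i] orb_coord[OF yz(1), of i] orb_coord[OF yz(2), of i] by (cases "i \<in> {1..n}") auto
  qed
  ultimately show ?thesis by (meson finite_subset finite_imageD)
qed

definition winv :: "nat \<Rightarrow> ((nat \<Rightarrow> 'k::field) \<Rightarrow> 'b) \<Rightarrow> bool" where
  "winv n \<psi> \<longleftrightarrow> (\<forall>p i. 1 \<le> i \<and> i \<le> n \<longrightarrow> \<psi> (rp n i p) = \<psi> p)"

lemma winv_orb: "winv n \<psi> \<Longrightarrow> z \<in> orb n p \<Longrightarrow> \<psi> z = \<psi> p"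
  by (rotate_tac 1, induction rule: orb.induct) (auto simp: winv_def)

lemma winv_indicator: "winv n (\<lambda>z. if z \<in> orb n y then 1 else 0)"
  by (auto simp: winv_def orb_rp_iff)

lemma q_par_ne_1: "q_par \<noteq> 1" "q_par ^ 2 \<noteq> 1"
proof -
  have m: "Mon (\<lambda>v. if v = Q_half then k else 0) = q_h powi k" for k by (simp add: Mon_def UNIV_param)
  have "q_h powi k \<noteq> 1" if "k \<noteq> 0" for k
  proof
    assume "q_h powi k = 1"
    then have "Mon (\<lambda>v. if v = Q_half then k else 0) = Mon (\<lambda>_. 0)" using m by simp
    from fun_cong[OF Mon_inject[OF this], of Q_half] show False using that by simp
  qed
  from this[of 2] this[of 4] show "q_par \<noteq> 1" "q_par ^ 2 \<noteq> 1" by simp_all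
qed

context eval_rep
begin

lemma sp_rp: "1 \<le> i \<Longrightarrow> i \<le> n \<Longrightarrow> sp i p = rp n i p"
  by (simp add: spt_def rp_def)

lemma gen_orb: "z \<in> orb n p \<Longrightarrow> gen p \<Longrightarrow> gen z"
  by (induction rule: orb.induct) (auto simp flip: sp_rp)

lemma mon_gen: assumes "gen p" "mon p \<mu> = \<iota> c" shows "c = 1 \<and> \<mu> = 0"
proof -
  have "ev p (mono \<mu>) = ev p (scal c)" using assms(2) by (simp add: ev_single hom_1)
  then have e: "mono \<mu> = scal c" using gen_eq_iff[OF assms(1)] by blast
  have "\<mu> = 0"
  proof (rule ccontr)
    assume "\<mu> \<noteq> 0"
    then have "lk (mono \<mu>) \<mu> = 1" "lk (scal c) \<mu> = 0" by (auto simp: scal_def lookup_single when_def)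
    then show False using e by simp
  qed
  then show ?thesis using arg_cong[OF e, of "\<lambda>f. lk f 0"] by (simp add: scal_def)
qed

lemma mon_pair: "gen p \<Longrightarrow> mon p (Poly_Mapping.single j a + Poly_Mapping.single k b) = p j powi a * p k powi b"
  by (subst mon_add) (auto simp: gen_nonzero)

lemma gen_pair: assumes "gen p" "p j powi a * p k powi b = \<iota> c" shows "c = 1 \<and> Poly_Mapping.single j a + Poly_Mapping.single k b = 0"
  using mon_gen[OF assms(1), of "Poly_Mapping.single j a + Poly_Mapping.single k b" c] mon_pair[OF assms(1)] assms(2) by simp

lemma gen_ne:
  assumes "gen p" shows "j \<noteq> k \<Longrightarrow> p j \<noteq> p k" "j \<noteq> k \<Longrightarrow> p j \<noteq> 1 / p k" "p j \<noteq> 1 / p j"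
proof -
  have nz: "\<And>i. p i \<noteq> 0" using assms gen_nonzero by blast
  have s: "Poly_Mapping.single j (1::int) + Poly_Mapping.single k b \<noteq> 0" if "j \<noteq> k \<or> b = 1" for b
  proof
    assume "Poly_Mapping.single j (1::int) + Poly_Mapping.single k b = 0"
    from arg_cong[OF this, of "\<lambda>x. lk x j"] show False using that by (auto simp: lookup_add lookup_single when_def split: if_splits)
  qed
  show "j \<noteq> k \<Longrightarrow> p j \<noteq> p k"
    using gen_pair[OF assms, of j 1 k "-1" 1] s[of "-1"] nz by (auto simp: hom_1 power_int_minus)
  show "j \<noteq> k \<Longrightarrow> p j \<noteq> 1 / p k"
    using gen_pair[OF assms, of j 1 k 1 1] s[of 1] nz by (auto simp: hom_1)
  show "p j \<noteq> 1 / p j"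
  proof
    assume "p j = 1 / p j"
    then have "p j powi 1 * p j powi 1 = \<iota> 1" using nz[of j] by (simp add: hom_1 field_simps)
    then have "Poly_Mapping.single j (1::int) + Poly_Mapping.single j 1 = 0" using gen_pair[OF assms] by blast
    from arg_cong[OF this, of "\<lambda>x. lk x j"] show False by (simp only: lookup_add lookup_single_eq lookup_zero)
  qed
qed

definition q0 :: "(nat \<Rightarrow> 'a) \<Rightarrow> nat \<Rightarrow> 'a" where "q0 p = p(1 := \<iota> q_par / p 1)"

lemma sp_0: "sp 0 p = q0 p" by (simp add: spt_def q0_def)

lemma gen_q0: "gen p \<Longrightarrow> gen (q0 p)" using gen_sp[of p 0] by (simp add: sp_0)

text \<open>Any coincidence would be a relation \<open>y_j^a y_k^b = \<iota> c\<close> between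
  coordinates with \<open>c\<close> equal to \<open>q\<close> or \<open>q^2\<close>; genericity
  allows only \<open>c = 1\<close>.\<close>

lemma q0_orb:
  assumes y: "gen y" and z: "z \<in> orb n y"
  shows "q0 y \<notin> orb n z" "q0 z \<in> orb n (q0 y) \<Longrightarrow> z 1 = y 1"
proof -
  have one: "1 \<in> {1..n}" using n_pos by simp
  have nz: "\<And>i. y i \<noteq> 0" using y gen_nonzero by blast
  show "q0 y \<notin> orb n z"
  proof
    assume "q0 y \<in> orb n z"
    then have "q0 y \<in> orb n y" using orb_trans z by blast
    then obtain j where j: "q0 y 1 = y j powi 1 \<or> q0 y 1 = y j powi (-1)" using orb_coord[of "q0 y" n y 1] one by blast
    then have "y j powi 1 * y 1 powi 1 = \<iota> q_par \<or> y j powi (-1) * y 1 powi 1 = \<iota> q_par" using nz by (auto simp: q0_def field_simps)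
    then show False using gen_pair[OF y] q_par_ne_1 by blast
  qed
  assume "q0 z \<in> orb n (q0 y)"
  then obtain k where k: "k \<in> {1..n}" "q0 z 1 = q0 y k powi 1 \<or> q0 z 1 = q0 y k powi (-1)"
    using orb_coord[of "q0 z" n "q0 y" 1] one by blast
  obtain j e where j: "z 1 = y j powi e" using orb_coord[OF z, of 1] one by blast
  have znz: "z 1 \<noteq> 0" using gen_nonzero[OF gen_orb[OF z y]] by blast
  show "z 1 = y 1"
  proof (cases "k = 1")
    case False
    then have "q0 y k = y k" by (simp add: q0_def)
    then have "y k powi 1 * y j powi e = \<iota> q_par \<or> y k powi (-1) * y j powi e = \<iota> q_par"
      using k(2) znz j by (auto simp: q0_def field_simps)
    then show ?thesis using gen_pair[OF y] q_par_ne_1 by blast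
  next
    case True
    have qn: "\<iota> q_par \<noteq> 0" by simp
    show ?thesis
    proof (rule ccontr)
      assume ne: "z 1 \<noteq> y 1"
      have "\<iota> q_par / z 1 \<noteq> \<iota> q_par / y 1" using ne qn znz nz by (simp add: field_simps)
      then have "\<iota> q_par / z 1 = y 1 / \<iota> q_par" using k(2) True by (simp add: q0_def power_int_minus)
      then have "y 1 powi 1 * y j powi e = \<iota> (q_par ^ 2)" using znz qn unfolding j[symmetric]
        by (simp add: hom_simps field_simps power2_eq_square)
      then show False using gen_pair[OF y] q_par_ne_1 by blast
    qed
  qed
qed

end

section \<open>Subalgebras generated by some of the \<open>T i\<close>\<close>

context affine_hecke
begin

inductive_set alg :: "nat set \<Rightarrow> 'a set" for I where
  alg_T: "i \<in> I \<Longrightarrow> T i \<in> alg I"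
| alg_h: "i \<in> I \<Longrightarrow> h i \<in> alg I"
| alg_1: "1 \<in> alg I"
| alg_add: "x \<in> alg I \<Longrightarrow> y \<in> alg I \<Longrightarrow> x + y \<in> alg I"
| alg_diff: "x \<in> alg I \<Longrightarrow> y \<in> alg I \<Longrightarrow> x - y \<in> alg I"
| alg_mult: "x \<in> alg I \<Longrightarrow> y \<in> alg I \<Longrightarrow> x * y \<in> alg I"

lemma alg_Ti: "i \<in> I \<Longrightarrow> Ti i \<in> alg I"
  unfolding Ti_def by (intro alg.intros)

lemma alg_Tup: "{1..n} \<subseteq> I \<Longrightarrow> k \<le> n \<Longrightarrow> Tup k \<in> alg I \<and> Tdown k \<in> alg I"
  by (induction k) (auto intro!: alg.intros alg_Ti)

lemma alg_R: "{1..n} \<subseteq> I \<Longrightarrow> k < n \<Longrightarrow> R k \<in> alg I \<and> Ri k \<in> alg I"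
  using n_pos by (induction k) (auto intro!: alg.intros alg_Ti)

text \<open>The affine generator occurs once, between words of finite type. The word to its right
  acts on isotypic functions by a scalar.\<close>

lemma Yi_word: "k < n \<Longrightarrow> Yi (Suc k) = Ri (n - Suc k) * Tdown k * Ti 0 * Tup k"
proof (induction k)
  case (Suc k)
  have r: "n - Suc k = Suc (n - Suc (Suc k))" "n - Suc (n - Suc (Suc k)) = Suc k" using Suc.prems by auto
  have "T (Suc k) * Ri (n - Suc k) = Ri (n - Suc (Suc k)) * Ti (Suc k)"
    using T_Ti[of "Suc k"] Suc.prems r by (simp add: mult.assoc[symmetric])
  moreover have "Yi (Suc (Suc k)) = T (Suc k) * Yi (Suc k) * T (Suc k)" by (rule Yi_Suc) simp
  ultimately show ?case using Suc by (simp add: mult.assoc) (simp add: mult.assoc[symmetric])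
qed simp

lemma alg_sum: "(\<And>a. a \<in> A \<Longrightarrow> f a \<in> alg I) \<Longrightarrow> sum f A \<in> alg I"
proof (induction A rule: infinite_finite_induct)
  case (infinite A)
  then show ?case using alg_diff[OF alg_1 alg_1] by simp
next
  case empty
  then show ?case using alg_diff[OF alg_1 alg_1] by simp
qed (auto intro: alg_add)

lemma alg_Z: "Z \<in> alg {..n}"
proof -
  have "Y (Suc k) + Yi (Suc k) \<in> alg {..n}" if "k < n" for k
    using that alg_Tup[of "{..n}" k] alg_R[of "{..n}" "n - Suc k"] unfolding Y_word[OF that] Yi_word[OF that]
    by (intro alg.intros alg_Ti) auto
  then have "Y j + Yi j \<in> alg {..n}" if "j \<in> {1..n}" for j using that by (cases j) auto
  then show ?thesis unfolding Z_def by (intro alg_sum) auto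
qed

end

lemma sum_apply: "sum F A x = (\<Sum>a\<in>A. F a x)"
  by (induction A rule: infinite_finite_induct) simp_all

section \<open>Isotypic functions and the action of \<open>Z\<close> on them\<close>

context eval_rep
begin

definition cc :: "nat \<Rightarrow> (nat \<Rightarrow> 'a) \<Rightarrow> 'a" where "cc i p = \<iota> (kap n i) - bb n i p"

lemma FT_cc: "gen p \<Longrightarrow> FT i F p = \<iota> (kap n i) * F p + cc i p * (F (sp i p) - F p)"
  by (simp add: FT_gen cc_def algebra_simps)

lemma cc_sp: "gen p \<Longrightarrow> i \<le> n \<Longrightarrow> cc i (sp i p) = \<iota> (kap n i) + 1 / \<iota> (kap n i) - cc i p"
  by (simp add: cc_def bb_sp hh_def hom_simps)

lemma cc_eq: assumes "gen p" shows "cc i p = (1 / \<iota> (kap n i) + \<iota> (gam n i / kap n i) * zv n i p - \<iota> (kap n i) * zv n i p powi zd n i) / (1 - zv n i p powi zd n i)"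
  unfolding cc_def bb_def hh_def using zv_den[OF n_pos assms, of i] by (simp add: hom_simps divide_simps) (simp add: algebra_simps)

text \<open>The numerator is the value of a Laurent polynomial with constant coefficient
  \<open>1 / kap n i\<close>, so it is nonzero at a generic point.\<close>

lemma cc_nonzero: assumes p: "gen p" shows "cc i p \<noteq> 0"
proof
  assume "cc i p = 0"
  then have "1 / \<iota> (kap n i) + \<iota> (gam n i / kap n i) * zv n i p - \<iota> (kap n i) * zv n i p powi zd n i = 0"
    using zv_den[OF n_pos p, of i] by (simp add: cc_eq[OF p])
  then have "ev p (scal (1 / kap n i) + scal (gam n i / kap n i) * zp n i 1 - scal (kap n i) * zp n i (zd n i)) = 0"
    using p gen_nonzero[OF p] by (simp add: ev_add ev_diff ev_mult ev_zp hom_simps)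
  then have e: "scal (1 / kap n i) + scal (gam n i / kap n i) * zp n i 1 - scal (kap n i) * zp n i (zd n i) = 0"
    using p unfolding gen_def by blast
  have "lk (zp n i k) 0 = 0" if "k \<noteq> 0" for k
  proof -
    have "lk (frag_cmul k (ze n i)) (if i = 0 then 1 else if i < n then i else n) \<noteq> 0"
      using that by (auto simp: ze_def lookup_minus lookup_single)
    then have "frag_cmul k (ze n i) \<noteq> 0" by auto
    then show ?thesis by (simp add: zp_def lookup_single)
  qed
  then have "lk (scal (1 / kap n i) + scal (gam n i / kap n i) * zp n i 1 - scal (kap n i) * zp n i (zd n i)) 0 = 1 / kap n i"
    by (simp add: lookup_add lookup_minus lk_scal zd_def del: scal_simps) (simp add: scal_def)
  then show False using e by simp
qed

definition iso :: "char_sign \<Rightarrow> ((nat \<Rightarrow> 'a) \<Rightarrow> 'a) \<Rightarrow> bool" where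
  "iso \<Xi> F \<longleftrightarrow> (\<forall>i\<in>{1..n}. FT i F = (\<lambda>p. \<iota> (chi \<Xi> n i) * F p))"

lemma iso_step:
  assumes F: "iso \<Xi> F" and p: "gen p" and i: "1 \<le> i" "i \<le> n"
  shows "chi \<Xi> n i = kap n i \<Longrightarrow> F (rp n i p) = F p"
    "chi \<Xi> n i \<noteq> kap n i \<Longrightarrow> cc i p * F (rp n i p) = - cc i (rp n i p) * F p"
proof -
  have e: "\<iota> (kap n i) * F p + cc i p * (F (rp n i p) - F p) = \<iota> (chi \<Xi> n i) * F p"
    using F i FT_cc[OF p, of i F] by (simp add: iso_def sp_rp fun_eq_iff)
  show "F (rp n i p) = F p" if "chi \<Xi> n i = kap n i" using e that cc_nonzero[OF p, of i] by simp
  assume "chi \<Xi> n i \<noteq> kap n i"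
  then have "\<iota> (chi \<Xi> n i) = - (1 / \<iota> (kap n i))" using chi_cases[OF i(1), of \<Xi> n] by (simp add: hom_simps)
  then show "cc i p * F (rp n i p) = - cc i (rp n i p) * F p"
    using e cc_sp[OF p i(2)] unfolding sp_rp[OF i] by algebra
qed

lemma iso_times: assumes F: "iso \<Xi> A" and w: "winv n \<psi>" shows "iso \<Xi> (\<lambda>p. A p * \<psi> p)"
  unfolding iso_def
proof (intro ballI ext)
  fix i p assume i: "i \<in> {1..n}"
  have "\<psi> (sp i p) = \<psi> p" using w i by (simp add: winv_def sp_rp)
  then have "FT i (\<lambda>p. A p * \<psi> p) p = FT i A p * \<psi> p" by (simp add: FT_def algebra_simps)
  then show "FT i (\<lambda>p. A p * \<psi> p) p = \<iota> (chi \<Xi> n i) * (A p * \<psi> p)" using F i by (simp add: iso_def)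
qed

text \<open>The character prescribes how a value changes under each reflection, by a factor that is
  the same for all isotypic functions; so any two are proportional on an orbit.\<close>

lemma iso_ratio:
  assumes F: "iso \<Xi> F" "iso \<Xi> A" and nz: "\<And>z. gen z \<Longrightarrow> A z \<noteq> 0" and p: "gen p"
  shows "z \<in> orb n p \<Longrightarrow> F z * A p = F p * A z"
proof (induction rule: orb.induct)
  case (orb_rp z i)
  have g: "gen z" using gen_orb orb_rp p by blast
  have "F (rp n i z) * A z = F z * A (rp n i z)"
  proof (cases "chi \<Xi> n i = kap n i")
    case True
    then show ?thesis using iso_step(1)[OF F(1) g] iso_step(1)[OF F(2) g] orb_rp by simp
  next
    case False
    have "cc i z * (F (rp n i z) * A z) = cc i z * (F z * A (rp n i z))"
      using iso_step(2)[OF F(1) g orb_rp(2,3) False] iso_step(2)[OF F(2) g orb_rp(2,3) False] by algebra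
    then show ?thesis using cc_nonzero[OF g] by simp
  qed
  then have "(F (rp n i z) * A p) * A z = (F p * A (rp n i z)) * A z" using orb_rp.IH by algebra
  then show ?case using nz[OF g] by simp
qed simp

lemma iso_scalar: "x \<in> FH.alg {1..n} \<Longrightarrow> \<exists>c. \<forall>F. iso \<Xi> F \<longrightarrow> app x F = (\<lambda>p. c * F p)"
proof (induction rule: FH.alg.induct)
  case (alg_add x y)
  then obtain c d where "\<forall>F. iso \<Xi> F \<longrightarrow> app x F = (\<lambda>p. c * F p)" "\<forall>F. iso \<Xi> F \<longrightarrow> app y F = (\<lambda>p. d * F p)" by blast
  then show ?case by (intro exI[of _ "c + d"]) (simp add: fun_eq_iff distrib_right)
next
  case (alg_diff x y)
  then obtain c d where "\<forall>F. iso \<Xi> F \<longrightarrow> app x F = (\<lambda>p. c * F p)" "\<forall>F. iso \<Xi> F \<longrightarrow> app y F = (\<lambda>p. d * F p)" by blast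
  then show ?case by (intro exI[of _ "c - d"]) (simp add: fun_eq_iff left_diff_distrib)
next
  case (alg_mult x y)
  then obtain c d where c: "\<forall>F. iso \<Xi> F \<longrightarrow> app x F = (\<lambda>p. c * F p)" "\<forall>F. iso \<Xi> F \<longrightarrow> app y F = (\<lambda>p. d * F p)" by blast
  have "iso \<Xi> (\<lambda>p. d * F p)" if "iso \<Xi> F" for F using that by (simp add: iso_def FT_scale fun_eq_iff)
  then show ?case using c by (intro exI[of _ "c * d"]) (simp add: mult.assoc)
qed (auto simp: iso_def intro: exI[of _ "1"])

lemma scale_app: "x \<in> FH.alg I \<Longrightarrow> app x (\<lambda>p. c * F p) = (\<lambda>p. c * app x F p)"
proof (induction arbitrary: F rule: FH.alg.induct)
  case (alg_mult x y)
  then show ?case by simp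
qed (simp_all add: FT_scale fun_eq_iff algebra_simps)

lemma iso_Z: assumes "iso \<Xi> F" shows "iso \<Xi> (app FH.Z F)"
  unfolding iso_def
proof
  fix i assume i: "i \<in> {1..n}"
  have "FTe i * FH.Z = FH.Z * FTe i" using FH.commutesD[OF FH.Z_central] i by simp
  then have "app (FTe i * FH.Z) F = app (FH.Z * FTe i) F" by (rule arg_cong)
  then show "FT i (app FH.Z F) = (\<lambda>p. \<iota> (chi \<Xi> n i) * app FH.Z F p)"
    using assms i by (simp add: iso_def scale_app[OF FH.alg_Z])
qed

lemma app_local:
  assumes "x \<in> FH.alg {1..n}" "gen p" "\<And>z. z \<in> orb n p \<Longrightarrow> F z = G z" shows "app x F p = app x G p"
  using assms
proof (induction arbitrary: F G p rule: FH.alg.induct)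
  case (alg_T i)
  then show ?case by (simp add: FT_gen sp_rp orb_rp)
next
  case (alg_mult x y)
  have "app y F z = app y G z" if "z \<in> orb n p" for z
    using alg_mult.IH(2)[of z F G] alg_mult.prems gen_orb[OF that] orb_trans[OF _ that] by blast
  then show ?case using alg_mult.IH(1)[of p "app y F" "app y G"] alg_mult.prems by simp
next
  case (alg_add x y)
  have "app x F p = app x G p" "app y F p = app y G p" by (rule alg_add.IH; use alg_add.prems in blast)+
  then show ?case by simp
next
  case (alg_diff x y)
  have "app x F p = app x G p" "app y F p = app y G p" by (rule alg_diff.IH; use alg_diff.prems in blast)+
  then show ?case by simp
next
  case (alg_h i)
  show ?case using alg_h(3)[of p] by simp
next
  case alg_1
  show ?case using alg_1(2)[of p] by simp
qed

lemma app_Ti: "gen p \<Longrightarrow> app (FH.Ti i) F p = (1 / \<iota> (kap n i) - cc i p) * F p + cc i p * F (sp i p)"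
  by (simp add: FH.Ti_def FT_cc hh_def hom_simps algebra_simps)

text \<open>In the words for \<open>Y\<close> and \<open>Yi\<close> the letters to the right of the
  affine generator act on isotypic functions by scalars. What remains is one application of
  \<open>T 0\<close> or its inverse, followed by finite words.\<close>

lemma Z_iso:
  obtains a b where "\<And>F p. iso \<Xi> F \<Longrightarrow> app FH.Z F p = (\<Sum>k<n. a k * app (FH.Tdown k) (FT 0 F) p +
      b k * app (FH.Ri (n - Suc k) * FH.Tdown k) (app (FH.Ti 0) F) p)" "b 0 = 1"
proof -
  have "\<exists>a. \<forall>F. iso \<Xi> F \<longrightarrow> app (FH.Tup k * FH.R (n - Suc k)) F = (\<lambda>p. a * F p)" if "k < n" for k
    using that FH.alg_Tup[of "{1..n}" k] FH.alg_R[of "{1..n}" "n - Suc k"] by (intro iso_scalar FH.alg.intros) auto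
  then obtain a where a: "\<And>k F. k < n \<Longrightarrow> iso \<Xi> F \<Longrightarrow> app (FH.Tup k * FH.R (n - Suc k)) F = (\<lambda>p. a k * F p)" by metis
  have "\<exists>b. \<forall>F. iso \<Xi> F \<longrightarrow> app (FH.Tup k) F = (\<lambda>p. b * F p)" if "k < n" for k
    using that FH.alg_Tup[of "{1..n}" k] by (intro iso_scalar) auto
  then obtain b where b: "\<And>k F. k < n \<Longrightarrow> iso \<Xi> F \<Longrightarrow> app (FH.Tup k) F = (\<lambda>p. b k * F p)" by metis
  \<comment> \<open>For \<open>k = 0\<close> the word is the identity, so the scalar 1 is a correct
    choice; the existence statement alone does not fix it. The explicit value is used in
    \<open>Z_long_path\<close>.\<close>
  define b' where "b' = b(0 := 1)"
  have b': "k < n \<Longrightarrow> iso \<Xi> F \<Longrightarrow> app (FH.Tup k) F = (\<lambda>p. b' k * F p)" for k F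
    using b[of k F] by (cases k) (auto simp: b'_def)
  have "app FH.Z F p = (\<Sum>k<n. a k * app (FH.Tdown k) (FT 0 F) p +
      b' k * app (FH.Ri (n - Suc k) * FH.Tdown k) (app (FH.Ti 0) F) p)" if F: "iso \<Xi> F" for F p
  proof -
    have "FH.Z = (\<Sum>k<n. FH.Y (Suc k) + FH.Yi (Suc k))"
      unfolding FH.Z_def using sum.atLeast_Suc_atMost_Suc_shift[of "\<lambda>j. FH.Y j + FH.Yi j" 0 "n - 1"] n_pos
      by (simp add: atLeast0AtMost lessThan_Suc_atMost[symmetric] comp_def)
    then have "app FH.Z F p = (\<Sum>k<n. app (FH.Y (Suc k)) F p + app (FH.Yi (Suc k)) F p)"
      by (simp add: app_sum_left sum_apply)
    also have "\<dots> = (\<Sum>k<n. a k * app (FH.Tdown k) (FT 0 F) p + b' k * app (FH.Ri (n - Suc k) * FH.Tdown k) (app (FH.Ti 0) F) p)"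
    proof (rule sum.cong[OF refl])
      fix k assume "k \<in> {..<n}"
      then have k: "k < n" by simp
      have al: "FH.Tdown k * FTe 0 \<in> FH.alg {..n}" "FH.Ri (n - Suc k) * FH.Tdown k * FH.Ti 0 \<in> FH.alg {..n}"
        using k FH.alg_Tup[of "{..n}" k] FH.alg_R[of "{..n}" "n - Suc k"] by (auto intro!: FH.alg.intros FH.alg_Ti)
      have "app (FH.Y (Suc k)) F = app (FH.Tdown k * FTe 0) (app (FH.Tup k * FH.R (n - Suc k)) F)"
        by (simp add: FH.Y_word[OF k])
      moreover have "app (FH.Yi (Suc k)) F = app (FH.Ri (n - Suc k) * FH.Tdown k * FH.Ti 0) (app (FH.Tup k) F)"
        by (simp add: FH.Yi_word[OF k])
      ultimately show "app (FH.Y (Suc k)) F p + app (FH.Yi (Suc k)) F p =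
        a k * app (FH.Tdown k) (FT 0 F) p + b' k * app (FH.Ri (n - Suc k) * FH.Tdown k) (app (FH.Ti 0) F) p"
        unfolding a[OF k F] b'[OF k F] scale_app[OF al(1)] scale_app[OF al(2)] by simp
    qed
    finally show ?thesis .
  qed
  moreover have "b' 0 = 1" by (simp add: b'_def)
  ultimately show ?thesis by (rule that)
qed

text \<open>The affine generator and its inverse look at a point \<open>z\<close> and at
  \<open>q0 z\<close> only, and the finite words stay inside the orbit.\<close>

lemma Z_local:
  assumes F: "iso \<Xi> F" "iso \<Xi> G" and p: "gen p"
    and eq: "\<And>z. z \<in> orb n p \<Longrightarrow> F z = G z" "\<And>z. z \<in> orb n p \<Longrightarrow> F (q0 z) = G (q0 z)"
  shows "app FH.Z F p = app FH.Z G p"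
proof -
  obtain a b where Z: "\<And>F p. iso \<Xi> F \<Longrightarrow> app FH.Z F p = (\<Sum>k<n. a k * app (FH.Tdown k) (FT 0 F) p +
      b k * app (FH.Ri (n - Suc k) * FH.Tdown k) (app (FH.Ti 0) F) p)" by (rule Z_iso[of \<Xi>]) (rule that)
  have T: "FT 0 F z = FT 0 G z" "app (FH.Ti 0) F z = app (FH.Ti 0) G z" if z: "z \<in> orb n p" for z
    using eq[OF z] gen_orb[OF z p] by (simp_all add: FT_gen app_Ti sp_0)
  have "app (FH.Tdown k) (FT 0 F) p = app (FH.Tdown k) (FT 0 G) p"
    "app (FH.Ri (n - Suc k) * FH.Tdown k) (app (FH.Ti 0) F) p = app (FH.Ri (n - Suc k) * FH.Tdown k) (app (FH.Ti 0) G) p" if k: "k < n" for k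
    using k T FH.alg_Tup[of "{1..n}" k] FH.alg_R[of "{1..n}" "n - Suc k"]
    by (auto intro!: app_local[OF _ p] FH.alg.intros simp del: app_simps)
  then show ?thesis unfolding Z[OF F(1)] Z[OF F(2)] by (intro sum.cong) auto
qed

end

text \<open>The first coordinate is taken out and \<open>v\<close> is inserted at position
  \<open>m\<close>, the coordinates in between moving one place left. With \<open>v\<close> the
  first coordinate or its inverse, these are the points along its path through the orbit.\<close>

definition ins :: "(nat \<Rightarrow> 'k) \<Rightarrow> nat \<Rightarrow> 'k \<Rightarrow> nat \<Rightarrow> 'k" where
  "ins y m v i = (if 1 \<le> i \<and> i < m then y (Suc i) else if i = m then v else y i)"

lemma ins_1: "ins y 1 v = y(1 := v)"
  by (auto simp: ins_def fun_eq_iff)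

lemma rp_ins: "1 \<le> m \<Longrightarrow> m < n \<Longrightarrow> rp n m (ins y m v) = ins y (Suc m) v"
  by (auto simp: ins_def rp_def fun_eq_iff)

lemma rp_ins': "1 \<le> m \<Longrightarrow> m < n \<Longrightarrow> rp n m (ins y (Suc m) v) = ins y m v"
  using arg_cong[OF rp_ins, of m n "rp n m" y v] by simp

lemma rp_ins_n: "1 \<le> n \<Longrightarrow> rp n n (ins y n v) = ins y n (1 / v)"
  by (auto simp: ins_def rp_def fun_eq_iff)

lemma ins_orb:
  assumes n: "1 \<le> n" and m: "1 \<le> m" "m \<le> n"
  shows "ins y m (y 1) \<in> orb n y" "ins y m (1 / y 1) \<in> orb n y"
proof -
  have up: "ins y m (y 1) \<in> orb n y" if "1 \<le> m" "m \<le> n" for m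
    using that
  proof (induction m rule: nat_induct_at_least)
    case base
    have "ins y 1 (y 1) = y" unfolding ins_1 by simp
    then show ?case by simp
  next
    case (Suc m)
    then show ?case using orb_rp[of "ins y m (y 1)" n y m] rp_ins[of m n y "y 1"] by simp
  qed
  from up[OF m] show "ins y m (y 1) \<in> orb n y" .
  have e: "ins y n (1 / y 1) \<in> orb n y"
    using orb_rp[OF up[OF n order_refl], of n] rp_ins_n[OF n, of y "y 1"] n by simp
  show "ins y m (1 / y 1) \<in> orb n y"
    using m(2,1)
  proof (induction m rule: inc_induct)
    case (step m)
    then show ?case using orb_rp[of "ins y (Suc m) (1 / y 1)" n y m] rp_ins'[of m n y "1 / y 1"] by simp
  qed (rule e)
qed

section \<open>Paths that carry one coordinate to the end and back\<close>

context eval_rep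
begin

lemma Ri_Tdown:
  assumes m: "1 \<le> m" "m < n"
  shows "FH.Ri (n - m) * FH.Tdown (m - 1) = FH.Ti m * (FH.Ri (n - Suc m) * FH.Tdown m)"
proof -
  have r: "n - m = Suc (n - Suc m)" "n - Suc (n - Suc m) = m" using m by auto
  have "FH.Tdown m = FH.Ti m * FH.Tdown (m - 1)" using m by (cases m) auto
  then show ?thesis unfolding r(1) using r(2) by (simp add: mult.assoc)
qed

text \<open>
  Words in the inverse generators move the entry \<open>a\<close> around. A function supported
  where the first entry is \<open>a\<close> is carried to points that can be moved there.
\<close>

lemma Tdown_support:
  assumes p: "gen p" and G: "\<And>z. z \<in> orb n p \<Longrightarrow> z 1 \<noteq> a \<Longrightarrow> G z = 0" and k: "k < n"
  shows "z \<in> orb n p \<Longrightarrow> (\<And>j. 1 \<le> j \<Longrightarrow> j \<le> Suc k \<Longrightarrow> z j \<noteq> a) \<Longrightarrow> app (FH.Tdown k) G z = 0"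
  using k
proof (induction k arbitrary: z)
  case (Suc k)
  have g: "gen z" using gen_orb Suc.prems(1) p by blast
  have "app (FH.Tdown k) G z = 0" using Suc by simp
  moreover have "app (FH.Tdown k) G (rp n (Suc k) z) = 0"
  proof (rule Suc.IH)
    show "rp n (Suc k) z j \<noteq> a" if "1 \<le> j" "j \<le> Suc k" for j
      using Suc.prems(2)[of j] Suc.prems(2)[of "Suc (Suc k)"] Suc.prems(3) that by (auto simp: rp_def)
  qed (use Suc.prems orb_rp[OF Suc.prems(1), of "Suc k"] in auto)
  ultimately show ?case using app_Ti[OF g, of "Suc k"] Suc.prems(3) by (simp add: sp_rp)
qed (use G in auto)

lemma Ri_support:
  assumes p: "gen p" and G: "\<And>z. z \<in> orb n p \<Longrightarrow> z 1 \<noteq> a \<Longrightarrow> G z = 0" and m: "m \<le> n" "1 \<le> m"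
  shows "z \<in> orb n p \<Longrightarrow> (\<And>j. 1 \<le> j \<Longrightarrow> j \<le> n \<Longrightarrow> z j \<noteq> a) \<Longrightarrow> (\<And>j. m \<le> j \<Longrightarrow> j \<le> n \<Longrightarrow> z j \<noteq> 1 / a) \<Longrightarrow>
    app (FH.Ri (n - m) * FH.Tdown (m - 1)) G z = 0"
  using m
proof (induction m arbitrary: z rule: inc_induct)
  case base
  have g: "gen z" using gen_orb base.prems(1) p by blast
  have D: "app (FH.Tdown (n - 1)) G y = 0" if "y \<in> orb n p" "\<And>j. 1 \<le> j \<Longrightarrow> j \<le> n \<Longrightarrow> y j \<noteq> a" for y
    using Tdown_support[OF p G, where k = "n - 1"] that n_pos by simp
  have "app (FH.Tdown (n - 1)) G (rp n n z) = 0"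
  proof (rule D)
    show "rp n n z j \<noteq> a" if "1 \<le> j" "j \<le> n" for j
      using base.prems(2)[OF that] base.prems(3)[of n] by (auto simp: rp_def)
  qed (use orb_rp[OF base.prems(1), of n] n_pos in auto)
  then show ?case using app_Ti[OF g, of n] D[OF base.prems(1,2)] n_pos by (simp add: sp_rp)
next
  case (step m)
  have g: "gen z" using gen_orb step.prems(1) p by blast
  let ?D = "app (FH.Ri (n - Suc m) * FH.Tdown m) G"
  have "?D z = 0" using step.IH[of z] step.prems by simp
  moreover have "?D (rp n m z) = 0"
  proof -
    have a: "rp n m z j \<noteq> a" if "1 \<le> j" "j \<le> n" for j
      using step.prems(2)[of j] step.prems(2)[of m] step.prems(2)[of "Suc m"] step that by (auto simp: rp_def)
    moreover have "rp n m z j \<noteq> 1 / a" if "Suc m \<le> j" "j \<le> n" for j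
      using step.prems(3)[of j] step.prems(3)[of m] step that by (auto simp: rp_def)
    ultimately show ?thesis using step.IH[of "rp n m z"] step.prems step.hyps orb_rp[OF step.prems(1), of m] by simp
  qed
  ultimately show ?case using app_Ti[OF g, of m] step.prems step.hyps Ri_Tdown[of m] by (simp add: sp_rp)
qed

text \<open>The product of the coefficients \<open>cc\<close> along one path from \<open>y\<close>
  with inverted first coordinate to \<open>y\<close>: \<open>1 / y 1\<close> travels to position
  \<open>n\<close>, is inverted there, and \<open>y 1\<close> travels to the front.\<close>

definition Mc :: "(nat \<Rightarrow> 'a) \<Rightarrow> 'a" where
  "Mc y = (\<Prod>m=1..<n. cc m (ins y m (1 / y 1))) * cc n (ins y n (1 / y 1)) * (\<Prod>m=1..<n. cc m (ins y (Suc m) (y 1)))"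

text \<open>Each letter either keeps or reflects the point, and \<open>G\<close> vanishes unless
  \<open>y 1\<close> stands in front. The path starts with \<open>1 / y 1\<close> in front, so it
  must reach position \<open>n\<close>, be inverted and return: only the full word does this, with
  every letter reflecting. The shorter words contribute nothing.\<close>

lemma long_path:
  assumes y: "gen y" and G: "\<And>z. z \<in> orb n y \<Longrightarrow> z 1 \<noteq> y 1 \<Longrightarrow> G z = 0"
  shows "app (FH.Ri (n - 1)) G (y(1 := 1 / y 1)) = Mc y * G y"
    and "k < n \<Longrightarrow> app (FH.Tdown k) G (y(1 := 1 / y 1)) = 0"
    and "k < n \<Longrightarrow> k \<noteq> 0 \<Longrightarrow> app (FH.Ri (n - Suc k) * FH.Tdown k) G (y(1 := 1 / y 1)) = 0"
proof -
  let ?a = "y 1"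
  have ne: "y j \<noteq> ?a" "y j \<noteq> 1 / ?a" "?a \<noteq> 1 / ?a" "1 / ?a \<noteq> ?a" if "j \<noteq> 1" for j
    using gen_ne[OF y] that by (blast, blast, blast, metis)
  have ine: "ins y m (1 / ?a) j \<noteq> ?a" if "1 \<le> m" for m j
  proof (cases "j = m")
    case True
    then show ?thesis using gen_ne(3)[OF y, of 1] by (simp add: ins_def)
  next
    case False
    then show ?thesis using ne(1)[of j] ne(1)[of "Suc j"] that by (cases "j = 1") (auto simp: ins_def)
  qed
  have ineq: "ins y m (1 / ?a) j \<noteq> 1 / ?a" if "m < j" "1 \<le> m" for m j
    using ne[of j] that by (auto simp: ins_def)
  have ina: "ins y m ?a j \<noteq> ?a" if "1 \<le> j" "j < m" for m j
    using ne[of "Suc j"] that by (auto simp: ins_def)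
  note o = ins_orb[OF n_pos, where y = y]
  have down: "app (FH.Tdown k) G (ins y (Suc k) ?a) = (\<Prod>m=1..<Suc k. cc m (ins y (Suc m) ?a)) * G y" if "k < n" for k
    using that
  proof (induction k)
    case 0
    have "ins y (Suc 0) ?a = y" using ins_1[of y ?a] by simp
    then show ?case by simp
  next
    case (Suc k)
    let ?z = "ins y (Suc (Suc k)) ?a"
    have g: "gen ?z" using gen_orb[OF o(1) y, of "Suc (Suc k)"] Suc.prems by simp
    have "app (FH.Tdown k) G ?z = 0"
      by (rule Tdown_support[OF y G]) (use Suc.prems o ina in auto)
    then have "app (FH.Tdown (Suc k)) G ?z = cc (Suc k) ?z * app (FH.Tdown k) G (ins y (Suc k) ?a)"
      using app_Ti[OF g, of "Suc k"] Suc.prems rp_ins'[of "Suc k" n y ?a] by (simp add: sp_rp)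
    then show ?case using Suc by simp
  qed
  have up: "app (FH.Ri (n - m) * FH.Tdown (m - 1)) G (ins y m (1 / ?a)) =
    (\<Prod>l=m..<n. cc l (ins y l (1 / ?a))) * cc n (ins y n (1 / ?a)) * (\<Prod>l=1..<n. cc l (ins y (Suc l) ?a)) * G y" if "m \<le> n" "1 \<le> m" for m
    using that
  proof (induction m rule: inc_induct)
    case base
    let ?z = "ins y n (1 / ?a)"
    have g: "gen ?z" using gen_orb[OF o(2) y, of n] n_pos by simp
    have "app (FH.Tdown (n - 1)) G ?z = 0"
      by (rule Tdown_support[OF y G]) (use n_pos o ine in auto)
    then have "app (FH.Ti n * FH.Tdown (n - 1)) G ?z = cc n ?z * app (FH.Tdown (n - 1)) G (ins y n ?a)"
      using app_Ti[OF g, of n] n_pos rp_ins_n[OF n_pos, of y "1 / ?a"] by (simp add: sp_rp)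
    then show ?case using down[of "n - 1"] n_pos by simp
  next
    case (step m)
    let ?z = "ins y m (1 / ?a)"
    have g: "gen ?z" using gen_orb[OF o(2) y, of m] step by simp
    have "app (FH.Ri (n - Suc m) * FH.Tdown (Suc m - 1)) G ?z = 0"
      by (rule Ri_support[OF y G]) (use step o ine ineq in auto)
    then have "app (FH.Ti m * (FH.Ri (n - Suc m) * FH.Tdown m)) G ?z =
        cc m ?z * app (FH.Ri (n - Suc m) * FH.Tdown (Suc m - 1)) G (ins y (Suc m) (1 / ?a))"
      using app_Ti[OF g, of m] step rp_ins[of m n y "1 / ?a"] by (simp add: sp_rp)
    then show ?case using step Ri_Tdown[of m] by (simp add: prod.atLeast_Suc_lessThan)
  qed
  from up[of 1] show "app (FH.Ri (n - 1)) G (y(1 := 1 / ?a)) = Mc y * G y"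
    using n_pos by (simp add: ins_1[unfolded One_nat_def] Mc_def)
  have p': "y(1 := 1 / ?a) \<in> orb n y" using o(2)[of 1] n_pos by (simp add: ins_1[unfolded One_nat_def])
  have na: "(y(1 := 1 / ?a)) j \<noteq> ?a" for j using ine[of 1 j] by (simp add: ins_1[unfolded One_nat_def])
  show "app (FH.Tdown k) G (y(1 := 1 / ?a)) = 0" if "k < n"
    by (rule Tdown_support[OF y G that p' na])
  show "app (FH.Ri (n - Suc k) * FH.Tdown k) G (y(1 := 1 / ?a)) = 0" if "k < n" "k \<noteq> 0"
  proof -
    have "(y(1 := 1 / ?a)) j \<noteq> 1 / ?a" if "Suc k \<le> j" for j
      using ineq[of 1 j] that \<open>k \<noteq> 0\<close> by (simp add: ins_1[unfolded One_nat_def])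
    with Ri_support[where m = "Suc k" and G = G and a = ?a and p = y and z = "y(1 := 1 / ?a)", OF y _ _ _ p' na] G that
    show ?thesis by simp
  qed
qed

text \<open>Of the sum in \<open>Z_iso\<close> only the inverse word with \<open>k = 0\<close>
  survives, and there the unknown scalar is 1.\<close>

lemma Z_long_path:
  assumes F: "iso \<Xi> F" and y: "gen y" and F0: "\<And>z. z \<in> orb n y \<Longrightarrow> F z = 0"
    and F1: "\<And>z. z \<in> orb n y \<Longrightarrow> z 1 \<noteq> y 1 \<Longrightarrow> F (q0 z) = 0"
  shows "app FH.Z F (y(1 := 1 / y 1)) = Mc y * cc 0 y * F (q0 y)"
proof -
  let ?p = "y(1 := 1 / y 1)"
  obtain a b where Z: "\<And>F p. iso \<Xi> F \<Longrightarrow> app FH.Z F p = (\<Sum>k<n. a k * app (FH.Tdown k) (FT 0 F) p +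
      b k * app (FH.Ri (n - Suc k) * FH.Tdown k) (app (FH.Ti 0) F) p)" and b: "b 0 = 1" by (rule Z_iso[of \<Xi>]) (rule that)
  have v: "FT 0 F z = cc 0 z * F (q0 z)" "app (FH.Ti 0) F z = cc 0 z * F (q0 z)" if "z \<in> orb n y" for z
    using F0[OF that] gen_orb[OF that y] by (simp_all add: FT_cc app_Ti sp_0)
  have G: "FT 0 F z = 0" "app (FH.Ti 0) F z = 0" if "z \<in> orb n y" "z 1 \<noteq> y 1" for z
    using v[OF that(1)] F1[OF that] by auto
  have "app FH.Z F ?p = (\<Sum>k<n. if k = 0 then Mc y * cc 0 y * F (q0 y) else 0)"
    unfolding Z[OF F]
  proof (rule sum.cong[OF refl])
    fix k assume "k \<in> {..<n}"
    then have k: "k < n" by simp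
    have A: "app (FH.Tdown k) (FT 0 F) ?p = 0" by (rule long_path(2)[OF y G(1) k])
    show "a k * app (FH.Tdown k) (FT 0 F) ?p + b k * app (FH.Ri (n - Suc k) * FH.Tdown k) (app (FH.Ti 0) F) ?p =
      (if k = 0 then Mc y * cc 0 y * F (q0 y) else 0)"
    proof (cases "k = 0")
      case True
      have "app (FH.Ri (n - 1)) (app (FH.Ti 0) F) ?p = Mc y * app (FH.Ti 0) F y" by (rule long_path(1)[OF y G(2)])
      then show ?thesis using A True b v(2)[OF orb_refl] by (simp del: fun_upd_apply)
    next
      case False
      have "app (FH.Ri (n - Suc k) * FH.Tdown k) (app (FH.Ti 0) F) ?p = 0" by (rule long_path(3)[OF y G(2) k False])
      then show ?thesis using A False by simp
    qed
  qed
  then show ?thesis using n_pos by simp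
qed

text \<open>
  For invariant \<open>\<psi>\<close>, the value of the centre on \<open>A \<psi>\<close> is determined by \<open>Z A\<close> and by the values
  on orbit indicators. These are read off at a point where a single path contributes.
\<close>

theorem Z_invariant:
  assumes A: "iso \<Xi> A" "\<And>z. gen z \<Longrightarrow> A z \<noteq> 0" "\<And>z. gen z \<Longrightarrow> app FH.Z A z = c * A z"
    and \<psi>: "winv n \<psi>" and p: "gen p"
  defines "K \<equiv> \<lambda>y. Mc y * cc 0 y * A (q0 y) / A (y(1 := 1 / y 1))"
  shows "app FH.Z (\<lambda>z. A z * \<psi> z) p = A p * (c * \<psi> p +
    (\<Sum>o' \<in> (\<lambda>y. orb n (q0 y)) ` orb n p. let y = (SOME y. y \<in> orb n p \<and> o' = orb n (q0 y)) in (\<psi> (q0 y) - \<psi> p) * K y))"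
proof -
  let ?O = "(\<lambda>y. orb n (q0 y)) ` orb n p"
  define r where "r o' = (SOME y. y \<in> orb n p \<and> o' = orb n (q0 y))" for o'
  have r: "r o' \<in> orb n p \<and> o' = orb n (q0 (r o'))" if "o' \<in> ?O" for o'
    using someI_ex[of "\<lambda>y. y \<in> orb n p \<and> o' = orb n (q0 y)"] that unfolding r_def by blast
  define I :: "(nat \<Rightarrow> 'a) set \<Rightarrow> (nat \<Rightarrow> 'a) \<Rightarrow> 'a" where "I o' z = (if z \<in> o' then 1 else 0)" for o' z
  have I: "winv n (I o')" if "o' \<in> ?O" for o'
    using winv_indicator[of n "q0 (r o')"] r[OF that] unfolding I_def by metis
  have fin: "finite ?O" using finite_orb by blast
  have out: "z \<notin> o'" if "o' \<in> ?O" "z \<in> orb n p" for z o'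
    using q0_orb(1)[OF gen_orb[of "r o'" p] , of z] r[OF that(1)] that(2) p orb_eq orb_sym by metis
  define F where "F = (\<lambda>o' z. A z * I o' z)"
  have isoF: "iso \<Xi> (F o')" if "o' \<in> ?O" for o' unfolding F_def by (rule iso_times[OF A(1) I[OF that]])
  have ZF: "app FH.Z (F o') p = A p * K (r o')" if o: "o' \<in> ?O" for o'
  proof -
    let ?y = "r o'" and ?p = "(r o')(1 := 1 / r o' 1)"
    have y: "?y \<in> orb n p" "o' = orb n (q0 ?y)" using r[OF o] by auto
    have g: "gen ?y" using gen_orb[OF y(1) p] .
    have oy: "orb n ?y = orb n p" by (rule orb_eq[OF y(1)])
    have "app FH.Z (F o') ?p = Mc ?y * cc 0 ?y * F o' (q0 ?y)"
    proof (rule Z_long_path[OF isoF[OF o] g])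
      fix z assume z: "z \<in> orb n ?y"
      show "F o' z = 0" using out[OF o] z oy by (simp add: F_def I_def)
      assume "z 1 \<noteq> ?y 1"
      then have "q0 z \<notin> o'" using q0_orb(2)[OF g z] y(2) by blast
      then show "F o' (q0 z) = 0" by (simp add: F_def I_def)
    qed
    moreover have "I o' (q0 ?y) = 1" unfolding I_def by (subst (2) y(2)) simp
    ultimately have Zp: "app FH.Z (F o') ?p = Mc ?y * cc 0 ?y * A (q0 ?y)" by (simp add: F_def)
    have p': "?p \<in> orb n p" using ins_orb(2)[OF n_pos, of 1 ?y] n_pos oy by (simp add: ins_1[unfolded One_nat_def])
    \<comment> \<open>The value was computed at the special point \<open>?p\<close> of the orbit;
      isotypy transports it to \<open>p\<close>.\<close>
    have "app FH.Z (F o') ?p * A p = app FH.Z (F o') p * A ?p"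
      by (rule iso_ratio[OF iso_Z[OF isoF[OF o]] A(1,2) p p'])
    then show ?thesis using A(2)[OF gen_orb[OF p' p]] unfolding Zp K_def by (simp add: field_simps)
  qed
  \<comment> \<open>A combination of the constant 1 and of indicators that agrees with
    \<open>\<psi>\<close> wherever \<open>Z\<close> looks from \<open>p\<close>: on the orbit all
    indicators vanish, and at \<open>q0 z\<close> exactly one of them is 1.\<close>
  define \<psi>' where "\<psi>' z = \<psi> p + (\<Sum>o'\<in>?O. (\<psi> (q0 (r o')) - \<psi> p) * I o' z)" for z
  have w': "winv n \<psi>'" using I unfolding winv_def \<psi>'_def by auto
  have "app FH.Z (\<lambda>z. A z * \<psi> z) p = app FH.Z (\<lambda>z. A z * \<psi>' z) p"
  proof (rule Z_local[OF iso_times[OF A(1) \<psi>] iso_times[OF A(1) w'] p])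
    fix z assume z: "z \<in> orb n p"
    have "\<psi>' z = \<psi> p" using out[OF _ z] by (simp add: \<psi>'_def I_def)
    then show "A z * \<psi> z = A z * \<psi>' z" using winv_orb[OF \<psi> z] by simp
    have oz: "orb n (q0 z) \<in> ?O" using z by blast
    have "I o' (q0 z) = (if o' = orb n (q0 z) then 1 else 0)" if "o' \<in> ?O" for o'
    proof -
      have "q0 z \<in> o' \<longleftrightarrow> o' = orb n (q0 z)"
        using r[OF that] orb_eq[of "q0 z" n "q0 (r o')"] orb_refl[of "q0 z" n] by metis
      then show ?thesis by (simp only: I_def)
    qed
    then have "\<psi>' (q0 z) = \<psi> p + (\<Sum>o'\<in>?O. if o' = orb n (q0 z) then \<psi> (q0 (r o')) - \<psi> p else 0)"
      unfolding \<psi>'_def by (intro arg_cong[where f = "\<lambda>x. \<psi> p + x"] sum.cong) auto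
    also have "\<dots> = \<psi> (q0 (r (orb n (q0 z))))" using oz fin by simp
    also have "\<dots> = \<psi> (q0 z)" using r[OF oz] winv_orb[OF \<psi>, of "q0 (r (orb n (q0 z)))" "q0 z"] orb_refl by metis
    finally show "A (q0 z) * \<psi> (q0 z) = A (q0 z) * \<psi>' (q0 z)" by simp
  qed
  also have "(\<lambda>z. A z * \<psi>' z) = (\<lambda>z. \<psi> p * A z) + (\<Sum>o'\<in>?O. (\<lambda>z. (\<psi> (q0 (r o')) - \<psi> p) * F o' z))"
    by (rule ext) (simp add: \<psi>'_def F_def sum_apply distrib_left sum_distrib_left mult_ac)
  also have "app FH.Z \<dots> p = \<psi> p * app FH.Z A p + (\<Sum>o'\<in>?O. (\<psi> (q0 (r o')) - \<psi> p) * app FH.Z (F o') p)"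
    by (simp add: app_add app_sum sum_apply scale_app[OF FH.alg_Z])
  also have "\<dots> = \<psi> p * (c * A p) + (\<Sum>o'\<in>?O. (\<psi> (q0 (r o')) - \<psi> p) * (A p * K (r o')))"
    using ZF A(3)[OF p] by simp
  also have "\<dots> = A p * (c * \<psi> p + (\<Sum>o'\<in>?O. let y = r o' in (\<psi> (q0 y) - \<psi> p) * K y))"
    by (simp add: Let_def distrib_left sum_distrib_left mult_ac)
  finally show ?thesis unfolding r_def .
qed

end

section \<open>The Weyl denominators\<close>

definition sgn_s :: "char_sign \<Rightarrow> bool" where "sgn_s \<Xi> \<longleftrightarrow> \<Xi> = Minus \<or> \<Xi> = MinusPlus"
definition sgn_d :: "char_sign \<Rightarrow> bool" where "sgn_d \<Xi> \<longleftrightarrow> \<Xi> = Minus \<or> \<Xi> = PlusMinus"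

text \<open>Equality would give \<open>par v ^ 2 + 1 = 0\<close>, but this is a sum of two different
  monomials.\<close>

lemma kap_ne: "1 \<le> i \<Longrightarrow> kap n i \<noteq> - (1 / kap n i)"
proof -
  have "par v * par v + 1 \<noteq> 0" for v
  proof -
    let ?e = "\<lambda>(k::nat) w. if w = v then int k else 0"
    have m: "Mon (?e k) = par v ^ k" for k by (cases v) (simp_all add: Mon_def UNIV_param)
    have "(\<Sum>k\<in>{0,2}. Mon (?e k)) \<noteq> 0" by (rule sum_Mon_nonzero) auto
    then show ?thesis by (simp only: m) (simp add: power2_eq_square add.commute)
  qed
  then have "x * x + 1 \<noteq> 0 \<Longrightarrow> x \<noteq> 0 \<Longrightarrow> x \<noteq> - (1 / x)" "t_h * t_h + 1 \<noteq> 0" "tn_h * tn_h + 1 \<noteq> 0" for x :: coeff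
    by (auto simp: field_simps eq_neg_iff_add_eq_0)
  then show "1 \<le> i \<Longrightarrow> kap n i \<noteq> - (1 / kap n i)" by (simp add: kap_def)
qed

lemma chi_ne_kap: assumes "1 \<le> i" "i \<le> n" shows "chi \<Xi> n i \<noteq> kap n i \<longleftrightarrow> (if i < n then sgn_s \<Xi> else sgn_d \<Xi>)"
  using kap_ne[OF assms(1), of n] assms by (cases \<Xi>) (auto simp: chi_def kap_def sgn_s_def sgn_d_def)

abbreviation ve :: "nat \<Rightarrow> expo" where "ve a \<equiv> Poly_Mapping.single a 1"

text \<open>\<open>x_a^-1 (1 - t x_a x_b) (1 - t x_a / x_b)\<close> multiplied out; the expanded
  form shows the invariance under inverting \<open>x_b\<close>.\<close>

definition gsL :: "nat \<Rightarrow> nat \<Rightarrow> laurent" where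
  "gsL a b = mono (- ve a) + scal (t_par ^ 2) * mono (ve a) - scal t_par * (mono (ve b) + mono (- ve b))"

text \<open>\<open>x_a^-1 (1 - tn_h un_h x_a) (1 + (tn_h / un_h) x_a)\<close> multiplied out. The
  arguments of \<open>gam 0 1\<close> select the last branch of \<open>gam\<close>, which is the
  coefficient of the end node for every \<open>n\<close>.\<close>

definition gnL :: "nat \<Rightarrow> laurent" where
  "gnL a = mono (- ve a) + scal (gam 0 1) * mono 0 - scal tn_par * mono (ve a)"

definition prs :: "nat \<Rightarrow> (nat \<times> nat) set" where "prs n = (SIGMA a:{1..n}. {a<..n})"

definition weyl_denom :: "char_sign \<Rightarrow> nat \<Rightarrow> laurent" where
  "weyl_denom \<Xi> n = (if sgn_s \<Xi> then \<Prod>(a, b)\<in>prs n. gsL a b else 1) * (if sgn_d \<Xi> then \<Prod>a=1..n. gnL a else 1)"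

definition denom_weight :: "char_sign \<Rightarrow> nat \<Rightarrow> expo" where
  "denom_weight \<Xi> n = (if sgn_s \<Xi> then pi_vec n else 0) + (if sgn_d \<Xi> then omega n else 0)"

lemma lk_pi: "lk (pi_vec n) k = (if k \<in> {1..n} then int n - int k else 0)"
  by (simp add: pi_vec_def lookup_sum lookup_single when_def)

lemma lk_omega: "lk (omega n) k = (if k \<in> {1..n} then 1 else 0)"
  by (simp add: omega_def lookup_sum lookup_single when_def)

lemma lk_denom_weight: "lk (denom_weight \<Xi> n) k = (if k \<in> {1..n} then (if sgn_s \<Xi> then int n - int k else 0) + (if sgn_d \<Xi> then 1 else 0) else 0)"
  by (simp add: denom_weight_def lookup_add lk_pi lk_omega)

lemma finite_prs [simp]: "finite (prs n)" by (simp add: prs_def)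

lemma ve_ne: "ve a \<noteq> - ve b" "- ve a \<noteq> ve b" "a \<noteq> b \<Longrightarrow> ve a \<noteq> ve b" "ve a \<noteq> 0"
proof -
  show *: "ve a \<noteq> - ve b" for a b
  proof
    assume "ve a = - ve b"
    then have "lk (ve a) a = - lk (ve b) a" by (metis lookup_uminus)
    then show False by (simp add: lookup_single when_def split: if_splits)
  qed
  show "- ve a \<noteq> ve b" using *[of b a] by metis
  show "ve a \<noteq> ve b" if "a \<noteq> b"
  proof
    assume "ve a = ve b"
    then have "lk (ve a) a = lk (ve b) a" by simp
    then show False using that by (simp add: lookup_single when_def)
  qed
qed simp

lemma gsL_nonzero: assumes "a \<noteq> b" shows "gsL a b \<noteq> 0"
proof -
  have "lk (gsL a b) (- ve a) = 1"
    using ve_ne(1)[of b a] ve_ne(1)[of a a] ve_ne(1)[of a b] ve_ne(2)[of a a] ve_ne(2)[of a b] ve_ne(3)[of a b] assms unfolding gsL_def lookup_add lookup_minus distrib_left lk_scal lookup_single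
    by (auto simp: when_def)
  then show ?thesis by fastforce
qed

lemma gnL_nonzero: "gnL a \<noteq> 0"
proof -
  have "lk (gnL a) (- ve a) = 1"
    using ve_ne(1)[of a a] ve_ne(2)[of a a] ve_ne(4)[of a] unfolding gnL_def lookup_add lookup_minus lk_scal lookup_single
    by (auto simp: when_def)
  then show ?thesis by fastforce
qed

lemma weyl_denom_nonzero: "weyl_denom \<Xi> n \<noteq> 0"
  using gsL_nonzero gnL_nonzero by (auto simp: weyl_denom_def prod_zero_iff prs_def)

context coeff_hom
begin

definition gs :: "'k \<Rightarrow> 'k \<Rightarrow> 'k" where "gs x y = 1 / x + \<iota> t_par ^ 2 * x - \<iota> t_par * (y + 1 / y)"
definition gn :: "'k \<Rightarrow> 'k" where "gn x = 1 / x + \<iota> (gam 0 1) - \<iota> tn_par * x"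
definition PS :: "nat \<Rightarrow> (nat \<Rightarrow> 'k) \<Rightarrow> 'k" where "PS n p = (\<Prod>(a, b)\<in>prs n. gs (p a) (p b))"
definition PD :: "nat \<Rightarrow> (nat \<Rightarrow> 'k) \<Rightarrow> 'k" where "PD n p = (\<Prod>a=1..n. gn (p a))"

lemma ev_gL: assumes nz: "\<And>i. p i \<noteq> 0"
  shows "ev p (gsL a b) = gs (p a) (p b)" "ev p (gnL a) = gn (p a)"
proof -
  have m: "ev p (mono (ve a)) = p a" "ev p (mono (- ve a)) = 1 / p a" for a
    using nz by (simp_all add: ev_single hom_1 mon_uminus divide_inverse)
  show "ev p (gsL a b) = gs (p a) (p b)" "ev p (gnL a) = gn (p a)"
    unfolding gsL_def gnL_def ev_add ev_diff ev_mult[OF nz] m ev_scal gs_def gn_def by (simp_all add: hom_simps ev_single)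
qed

lemma ev_weyl_denom: assumes nz: "\<And>i. p i \<noteq> 0"
  shows "ev p (weyl_denom \<Xi> n) = (if sgn_s \<Xi> then PS n p else 1) * (if sgn_d \<Xi> then PD n p else 1)"
  by (simp add: weyl_denom_def ev_mult[OF nz] ev_prod[OF nz] ev_gL[OF nz] PS_def PD_def case_prod_unfold)

text \<open>Swapping two neighbouring coordinates permutes the index pairs other than
  \<open>(i, Suc i)\<close>, so only the factor of that pair changes.\<close>

lemma PS_swap: assumes i: "1 \<le> i" "i < n"
  shows "PS n (rp n i p) * gs (p i) (p (Suc i)) = PS n p * gs (p (Suc i)) (p i)"
proof -
  let ?t = "Transposition.transpose i (Suc i)" and ?Q = "prs n - {(i, Suc i)}"
  have r: "rp n i p a = p (?t a)" for a using i by (auto simp: rp_def transpose_def)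
  have mem: "(i, Suc i) \<in> prs n" using i by (auto simp: prs_def)
  have "(\<Prod>(a, b)\<in>?Q. gs (rp n i p a) (rp n i p b)) = (\<Prod>(a, b)\<in>?Q. gs (p a) (p b))"
  proof (rule prod.reindex_bij_witness[where i = "\<lambda>(a, b). (?t a, ?t b)" and j = "\<lambda>(a, b). (?t a, ?t b)"])
    fix x assume "x \<in> ?Q"
    then obtain a b where x: "x = (a, b)" "1 \<le> a" "a < b" "b \<le> n" "\<not> (a = i \<and> b = Suc i)" by (cases x) (auto simp: prs_def)
    then show "(case x of (a, b) \<Rightarrow> (?t a, ?t b)) \<in> ?Q" using i by (auto simp: prs_def transpose_def)
    then show "(case x of (a, b) \<Rightarrow> (?t a, ?t b)) \<in> ?Q" .
  qed (auto simp: r)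
  then show ?thesis unfolding PS_def prod.remove[OF finite_prs mem] by (simp add: r)
qed

lemma PD_swap: assumes i: "1 \<le> i" "i < n" shows "PD n (rp n i p) = PD n p"
proof -
  let ?t = "Transposition.transpose i (Suc i)"
  have r: "rp n i p a = p (?t a)" for a using i by (auto simp: rp_def transpose_def)
  have "?t permutes {1..n}" using i by (intro permutes_swap_id) auto
  then show ?thesis unfolding PD_def r using prod.permute[of ?t "{1..n}" "\<lambda>a. gn (p a)"] by (simp add: comp_def)
qed

lemma PS_neg: "PS n (rp n n p) = PS n p"
  unfolding PS_def by (intro prod.cong refl) (auto simp: prs_def rp_def gs_def add.commute)

lemma PD_neg: assumes "1 \<le> n" shows "PD n (rp n n p) * gn (p n) = PD n p * gn (1 / p n)"
proof -
  have n: "finite {1..n}" "n \<in> {1..n}" using assms by auto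
  have "(\<Prod>a\<in>{1..n} - {n}. gn (rp n n p a)) = (\<Prod>a\<in>{1..n} - {n}. gn (p a))"
    by (intro prod.cong) (auto simp: rp_def)
  then show ?thesis unfolding PD_def prod.remove[OF n] by (simp add: rp_def)
qed

end

context eval_rep
begin

lemma cc_less: "gen p \<Longrightarrow> 1 \<le> i \<Longrightarrow> i < n \<Longrightarrow>
    cc i p = (1 / \<iota> t_h - \<iota> t_h * (p i / p (Suc i))) / (1 - p i / p (Suc i))"
  by (simp add: cc_eq kap_def gam_def zv_def zd_def hom_simps)

lemma gam_n: "gam n n = gam 0 1" using n_pos by (simp add: gam_def)

lemma cc_n: "gen p \<Longrightarrow> cc n p = p n * gn (p n) / (\<iota> tn_h * (1 - p n ^ 2))"
  using n_pos gen_nonzero[of p n]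
  by (simp add: cc_eq kap_def gam_n zv_def zd_def hom_simps gn_def divide_simps) (simp add: power2_eq_square algebra_simps)

lemma gs_factor: "x \<noteq> 0 \<Longrightarrow> y \<noteq> 0 \<Longrightarrow> gs x y = (1 - \<iota> t_par * x * y) * (y - \<iota> t_par * x) / (x * y)"
  by (simp add: gs_def field_simps power2_eq_square)

text \<open>Where the character takes the value \<open>kap n i\<close>, the product is invariant.
  Elsewhere exactly one factor changes, and its two values are in the ratio of \<open>cc\<close> at
  the two points up to sign, which is the rule of \<open>iso_step\<close>.\<close>

lemma iso_weyl_denom: "iso \<Xi> (evf (weyl_denom \<Xi> n))"
  unfolding iso_def
proof (intro ballI ext)
  fix i p assume "i \<in> {1..n}"
  then have i: "1 \<le> i" "i \<le> n" by auto
  let ?F = "evf (weyl_denom \<Xi> n)"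
  show "FT i ?F p = \<iota> (chi \<Xi> n i) * ?F p"
  proof (cases "gen p")
    case False
    then show ?thesis by (simp add: FT_def evf_def)
  next
    case p: True
    have nz: "\<And>j. p j \<noteq> 0" using gen_nonzero[OF p] .
    have g: "gen (rp n i p)" using gen_sp[OF p, of i] by (simp only: sp_rp[OF i])
    have F: "?F p = (if sgn_s \<Xi> then PS n p else 1) * (if sgn_d \<Xi> then PD n p else 1)"
      "?F (rp n i p) = (if sgn_s \<Xi> then PS n (rp n i p) else 1) * (if sgn_d \<Xi> then PD n (rp n i p) else 1)"
      using p g gen_nonzero[OF g] nz by (simp_all add: evf_def ev_weyl_denom)
    have gnz: "f \<noteq> 0 \<Longrightarrow> ev p f \<noteq> 0" for f using p by (auto simp: gen_def)
    have e: "FT i ?F p = \<iota> (kap n i) * ?F p + cc i p * (?F (rp n i p) - ?F p)"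
      unfolding sp_rp[OF i, symmetric] by (rule FT_cc[OF p])
    show ?thesis
    proof (cases "chi \<Xi> n i = kap n i")
      case True
      then have "?F (rp n i p) = ?F p"
        using chi_ne_kap[OF i, of \<Xi>] F PS_swap[of i n p] PD_swap[of i n p] PS_neg[of n p] i by (cases "i < n") auto
      then show ?thesis using e True by simp
    next
      case False
      have "cc i p * ?F (rp n i p) = - cc i (rp n i p) * ?F p"
      proof (cases "i < n")
        case True
        let ?x = "p i" and ?y = "p (Suc i)"
        have r: "rp n i p i = ?y" "rp n i p (Suc i) = ?x" using True by (auto simp: rp_def)
        have "gs ?x ?y \<noteq> 0" using gnz[OF gsL_nonzero[of i "Suc i"]] nz by (simp add: ev_gL)
        moreover have "cc i p * gs ?y ?x = - cc i (rp n i p) * gs ?x ?y"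
          unfolding cc_less[OF p i(1) True] cc_less[OF g i(1) True] r
          using gen_ne(1)[OF p, of i "Suc i"] nz[of i] nz[of "Suc i"]
          by (simp add: gs_factor divide_simps hom_power) (simp add: algebra_simps power2_eq_square)
        ultimately have "cc i p * PS n (rp n i p) = - cc i (rp n i p) * PS n p"
          using PS_swap[OF i(1) True, of p] by algebra
        then show ?thesis using False chi_ne_kap[OF i, of \<Xi>] True PD_swap[OF i(1) True, of p] by (simp add: F flip: mult.assoc)
      next
        case n: False
        then have n': "i = n" using i by simp
        let ?x = "p n"
        have r: "rp n n p n = 1 / ?x" by (simp add: rp_def)
        have "gn ?x \<noteq> 0" using gnz[OF gnL_nonzero] nz by (simp add: ev_gL)
        moreover have "?x ^ 2 \<noteq> 1" using gen_ne(3)[OF p, of n] nz[of n] by (auto simp: field_simps power2_eq_square)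
        then have "cc n p * gn (1 / ?x) = - cc n (rp n n p) * gn ?x"
          unfolding cc_n[OF p] cc_n[OF g[unfolded n']] r
          using nz[of n] by (simp add: divide_simps) (simp add: algebra_simps power2_eq_square)
        ultimately have "cc n p * PD n (rp n n p) = - cc n (rp n n p) * PD n p"
          using PD_neg[OF n_pos, of p] by algebra
        then show ?thesis using False chi_ne_kap[OF i, of \<Xi>] PS_neg[of n p] by (simp add: F[unfolded n'] n' mult.left_commute)
      qed
      moreover have "\<iota> (chi \<Xi> n i) = - (1 / \<iota> (kap n i))"
        using chi_cases[OF i(1), of \<Xi> n] False by (simp add: hom_simps)
      moreover have "cc i (rp n i p) = \<iota> (kap n i) + 1 / \<iota> (kap n i) - cc i p"
        unfolding sp_rp[OF i, symmetric] by (rule cc_sp[OF p i(2)])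
      ultimately show ?thesis unfolding e by algebra
    qed
  qed
qed

end

section \<open>The denominators as eigenvectors of \<open>Z\<close>\<close>

context rank
begin

lemma isotypic_weyl_denom: assumes "weyl_denom \<Xi> n \<in> supp_in lat" shows "isotypic \<Xi> (weyl_denom \<Xi> n)"
proof -
  have "hecke n i (weyl_denom \<Xi> n) = scal (chi \<Xi> n i) * weyl_denom \<Xi> n" if "i \<in> {1..n}" for i
    by (rule base_evf_inj) (use base.iso_weyl_denom[of \<Xi>] that in \<open>simp add: base.iso_def base.evf_hecke base.evf_scal\<close>)
  then show ?thesis using assms by (simp add: isotypic_def)
qed

text \<open>For this choice of \<open>\<kappa>\<close> the majorization conditions reduce to a bound
  on the sum of absolute values. The resulting sets are \<open>good\<close>, and their radii add up
  under products.\<close>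

definition tot :: "int \<Rightarrow> expo set" where "tot N = dom (Poly_Mapping.single 1 N)"

lemma tot_iff: "0 \<le> N \<Longrightarrow> \<mu> \<in> tot N \<longleftrightarrow> \<mu> \<in> lat \<and> (\<Sum>j=1..n. \<bar>lk \<mu> j\<bar>) \<le> N"
proof -
  assume N: "0 \<le> N"
  have s: "(\<Sum>i=1..k. lk (Poly_Mapping.single 1 N) i) = (if k = 0 then 0 else N)" for k :: nat
    by (induction k) (auto simp: lookup_single when_def)
  show ?thesis
  proof
    assume "\<mu> \<in> tot N"
    then show "\<mu> \<in> lat \<and> (\<Sum>j=1..n. \<bar>lk \<mu> j\<bar>) \<le> N" using n_pos N
      unfolding tot_def dom_def s by (auto dest!: spec[of _ "{1..n}"])
  next
    assume m: "\<mu> \<in> lat \<and> (\<Sum>j=1..n. \<bar>lk \<mu> j\<bar>) \<le> N"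
    have "(\<Sum>j\<in>J. \<bar>lk \<mu> j\<bar>) \<le> (if card J = 0 then 0 else N)" if J: "J \<subseteq> {1..n}" for J
    proof (cases "J = {}")
      case False
      then have "card J \<noteq> 0" using finite_subset[OF J] by simp
      moreover have "(\<Sum>j\<in>J. \<bar>lk \<mu> j\<bar>) \<le> (\<Sum>j=1..n. \<bar>lk \<mu> j\<bar>)" using J by (intro sum_mono2) auto
      ultimately show ?thesis using m by simp
    qed simp
    then show "\<mu> \<in> tot N" using m unfolding tot_def dom_def s by blast
  qed
qed

lemma tot_mult: assumes "f \<in> supp_in (tot N)" "g \<in> supp_in (tot M)" "0 \<le> N" "0 \<le> M" shows "f * g \<in> supp_in (tot (N + M))"
proof -
  have "a + b \<in> tot (N + M)" if "a \<in> tot N" "b \<in> tot M" for a b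
  proof -
    have "(\<Sum>j=1..n. \<bar>lk (a + b) j\<bar>) \<le> (\<Sum>j=1..n. \<bar>lk a j\<bar> + \<bar>lk b j\<bar>)"
      by (intro sum_mono) (simp add: lookup_add)
    then show ?thesis using that assms by (auto simp: tot_iff sum.distrib in_lattice lookup_add)
  qed
  then show ?thesis using keys_mult[of f g] assms by (fastforce simp: supp_in_def)
qed

lemma tot_prod: "finite A \<Longrightarrow> (\<And>x. x \<in> A \<Longrightarrow> F x \<in> supp_in (tot 1)) \<Longrightarrow> prod F A \<in> supp_in (tot (int (card A)))"
proof (induction A rule: finite_induct)
  case empty
  then show ?case using supp_in_single[of 0 "tot 0" 1] by (simp add: tot_iff in_lattice)
next
  case (insert x A)
  then have "F x * prod F A \<in> supp_in (tot (1 + int (card A)))" by (intro tot_mult) auto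
  then show ?case using insert by simp
qed

lemma card_prs: "int (card (prs n)) = (\<Sum>a=1..n. int n - int a)"
  by (simp add: prs_def of_nat_diff)

lemma weyl_denom_tot: "weyl_denom \<Xi> n \<in> supp_in (tot (\<Sum>a=1..n. lk (denom_weight \<Xi> n) a))"
proof -
  have v: "ve a \<in> tot 1" "- ve a \<in> tot 1" if "a \<in> {1..n}" for a
    using that by (auto simp: tot_iff in_lattice lookup_single when_def if_distrib[of abs] cong: if_cong)
  have z: "0 \<in> tot 1" by (simp add: tot_iff in_lattice)
  have s: "gsL a b \<in> supp_in (tot 1)" if "a \<in> {1..n}" "b \<in> {1..n}" for a b
    unfolding gsL_def using v that by (intro supp_in_add supp_in_diff supp_in_scal supp_in_single)
  have d: "gnL a \<in> supp_in (tot 1)" if "a \<in> {1..n}" for a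
    unfolding gnL_def using v z that by (intro supp_in_add supp_in_diff supp_in_scal supp_in_single)
  have "(\<Prod>(a, b)\<in>prs n. gsL a b) \<in> supp_in (tot (int (card (prs n))))"
    by (intro tot_prod) (auto intro!: s simp: prs_def)
  moreover have "(\<Prod>a=1..n. gnL a) \<in> supp_in (tot (int n))"
    using tot_prod[of "{1..n}" gnL] d by simp
  moreover have "1 \<in> supp_in (tot 0)" using supp_in_single[of 0 "tot 0" 1] by (simp add: tot_iff in_lattice)
  moreover have "(\<Sum>a=1..n. lk (denom_weight \<Xi> n) a) = (if sgn_s \<Xi> then int (card (prs n)) else 0) + (if sgn_d \<Xi> then int n else 0)"
    unfolding card_prs lk_denom_weight by (simp add: sum.distrib)
  ultimately show ?thesis unfolding weyl_denom_def by (auto intro!: tot_mult)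
qed

lemma reg_denom_weight: "reg \<Xi> (denom_weight \<Xi> n)"
  unfolding reg_def dominant_def using chi_ne_kap[of _ n \<Xi>] by (auto simp: mm_def lk_denom_weight in_lattice)

lemma reg_add_denom_weight: assumes "dominant n \<kappa>" "\<kappa> \<in> lat" shows "reg \<Xi> (\<kappa> + denom_weight \<Xi> n)"
proof -
  have m: "mm n i (\<kappa> + denom_weight \<Xi> n) = mm n i \<kappa> + mm n i (denom_weight \<Xi> n)" for i by (simp add: mm_def lookup_add)
  have "0 \<le> mm n i \<kappa>" if "i \<in> {1..n}" for i using assms that by (simp add: dominant_def)
  then show ?thesis using reg_denom_weight[of \<Xi>] assms unfolding reg_def dominant_def m
    by (fastforce simp: in_lattice lookup_add)
qed

text \<open>Regularity forces a positive last entry if \<open>sgn_d\<close> holds, and strict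
  descents if \<open>sgn_s\<close> holds; going down from position \<open>n\<close> adds these
  up.\<close>

lemma reg_ge: assumes r: "reg \<Xi> \<nu>" shows "k \<le> n \<Longrightarrow> 1 \<le> k \<Longrightarrow> lk (denom_weight \<Xi> n) k \<le> lk \<nu> k"
proof (induction k rule: inc_induct)
  case base
  then show ?case using r n_pos chi_ne_kap[of n n \<Xi>] by (auto simp: reg_def dominant_def mm_def lk_denom_weight dest!: spec[of _ n] bspec[of _ _ n])
next
  case (step k)
  have "(sgn_s \<Xi> \<longrightarrow> mm n k \<nu> \<noteq> 0) \<and> 0 \<le> mm n k \<nu>" using r step chi_ne_kap[of k n \<Xi>] by (auto simp: reg_def dominant_def)
  then show ?case using step by (auto simp: mm_def lk_denom_weight split: if_splits)
qed

lemma reg_tot: assumes "reg \<Xi> \<nu>" "\<nu> \<in> tot (\<Sum>a=1..n. lk (denom_weight \<Xi> n) a)" shows "\<nu> = denom_weight \<Xi> n"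
proof -
  let ?N = "\<Sum>a=1..n. lk (denom_weight \<Xi> n) a"
  have N: "0 \<le> ?N" by (intro sum_nonneg) (simp add: lk_denom_weight)
  have "(\<Sum>a=1..n. lk \<nu> a) \<le> (\<Sum>a=1..n. \<bar>lk \<nu> a\<bar>)" by (intro sum_mono) auto
  then have "(\<Sum>a=1..n. lk \<nu> a - lk (denom_weight \<Xi> n) a) \<le> 0" using assms(2) unfolding tot_iff[OF N] sum_subtractf by linarith
  moreover have ge: "0 \<le> lk \<nu> a - lk (denom_weight \<Xi> n) a" if "a \<in> {1..n}" for a using reg_ge[OF assms(1), of a] that by simp
  then have "0 \<le> (\<Sum>a=1..n. lk \<nu> a - lk (denom_weight \<Xi> n) a)" by (rule sum_nonneg)
  ultimately have "(\<Sum>a=1..n. lk \<nu> a - lk (denom_weight \<Xi> n) a) = 0" by simp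
  then have "\<forall>a\<in>{1..n}. lk \<nu> a - lk (denom_weight \<Xi> n) a = 0"
    using sum_nonneg_eq_0_iff[of "{1..n}" "\<lambda>a. lk \<nu> a - lk (denom_weight \<Xi> n) a"] ge by blast
  then have "lk \<nu> a = lk (denom_weight \<Xi> n) a" if "a \<in> {1..n}" for a using that by force
  moreover have "lk \<nu> a = lk (denom_weight \<Xi> n) a" if "a \<notin> {1..n}" for a
    using that assms(1) by (auto simp: reg_def in_lattice lk_denom_weight)
  ultimately show ?thesis by (intro poly_mapping_eqI) blast
qed

lemma isotypic_lincomb: assumes "isotypic \<Xi> f" "isotypic \<Xi> g" shows "isotypic \<Xi> (f - scal c * g)"
proof -
  have "hecke n j (x - y) = hecke n j x - hecke n j y" if "j \<le> n" for j x y using app_diff[of "LT j" x y] that by (simp add: app_LT)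
  then show ?thesis using assms unfolding isotypic_def
    by (auto simp: hecke_scal[OF n_pos] right_diff_distrib mult.left_commute intro!: supp_in_diff supp_in_scal simp del: scal_simps scal_mult)
qed

lemma isotypic_Z: assumes "isotypic \<Xi> f" shows "isotypic \<Xi> (app LH.Z f)"
  unfolding isotypic_def
proof (intro conjI ballI)
  show "app LH.Z f \<in> supp_in lat" using assms stableD[OF stable_Z[OF good_lattice]] by (simp add: isotypic_def)
  show "hecke n j (app LH.Z f) = scal (chi \<Xi> n j) * app LH.Z f" if "j \<in> {1..n}" for j
    using app_LT_Z[of j f] that assms by (simp add: app_LT isotypic_def linD[OF lin_Z])
qed

text \<open>Within the bound of \<open>weyl_denom_tot\<close> the only regular exponent is
  \<open>denom_weight\<close>, so it leads. The element \<open>B\<close> is isotypic, satisfies the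
  same bound and has coefficient 0 there; having no possible leading exponent, it is zero.\<close>

lemma weyl_denom_eigen: "isotypic \<Xi> (weyl_denom \<Xi> n)" "app LH.Z (weyl_denom \<Xi> n) = scal (central_eigenvalue (denom_weight \<Xi> n)) * weyl_denom \<Xi> n" "lk (weyl_denom \<Xi> n) (denom_weight \<Xi> n) \<noteq> 0"
proof -
  let ?A = "weyl_denom \<Xi> n" and ?d = "denom_weight \<Xi> n" and ?N = "\<Sum>a=1..n. lk (denom_weight \<Xi> n) a"
  have gt: "good (tot ?N)" unfolding tot_def by (rule good_dom)
  have lat: "supp_in (tot ?N) \<subseteq> supp_in lat" using gt unfolding good_def by (auto simp: supp_in_def)
  show i: "isotypic \<Xi> ?A" using isotypic_weyl_denom weyl_denom_tot lat by blast
  obtain \<nu> where \<nu>: "\<nu> \<in> Poly_Mapping.keys ?A" "\<And>\<mu>. \<mu> \<in> Poly_Mapping.keys ?A \<Longrightarrow> nm n \<mu> \<le> nm n \<nu>" "reg \<Xi> \<nu>"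
    using isotypic_top[OF i weyl_denom_nonzero] by metis
  have top: "\<nu> = ?d" using reg_tot[OF \<nu>(3)] weyl_denom_tot[of \<Xi>] \<nu>(1) by (auto simp: supp_in_def)
  show k: "lk ?A ?d \<noteq> 0" using \<nu>(1) top by (simp add: in_keys_iff)
  have d: "dominant n ?d" "?d \<in> lat" using reg_denom_weight[of \<Xi>] by (auto simp: reg_def)
  define B where "B = app LH.Z ?A - scal (central_eigenvalue ?d) * ?A"
  have Bt: "B \<in> supp_in (tot ?N)" unfolding B_def
    using weyl_denom_tot[of \<Xi>] stableD[OF stable_Z[OF gt]] by (intro supp_in_diff supp_in_scal) auto
  have Bi: "isotypic \<Xi> B" unfolding B_def by (intro isotypic_lincomb isotypic_Z i)
  have "lk (app LH.Z ?A) ?d = central_eigenvalue ?d * lk ?A ?d"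
    using Z_top[of ?A ?d] \<nu>(2) top weyl_denom_tot[of \<Xi>] lat dr_dominant[OF d] by auto
  then have B0: "lk B ?d = 0" by (simp add: B_def lookup_minus lk_scal)
  have "B = 0"
  proof (rule ccontr)
    assume "B \<noteq> 0"
    then obtain \<nu> where \<nu>: "\<nu> \<in> Poly_Mapping.keys B" "reg \<Xi> \<nu>" using isotypic_top[OF Bi] by metis
    then have "\<nu> = ?d" using reg_tot Bt by (auto simp: supp_in_def)
    then show False using \<nu>(1) B0 by (simp add: in_keys_iff)
  qed
  then show "app LH.Z ?A = scal (central_eigenvalue ?d) * ?A" by (simp add: B_def)
qed

text \<open>Both are isotypic eigenvectors for one eigenvalue. The factor is left open, since
  leading coefficients are compared at the end.\<close>

lemma sym_poly_denom_weight: "\<exists>c. c \<noteq> 0 \<and> sym_poly \<Xi> n (denom_weight \<Xi> n) = scal c * weyl_denom \<Xi> n"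
proof -
  let ?A = "weyl_denom \<Xi> n" and ?d = "denom_weight \<Xi> n" and ?S = "sym_poly \<Xi> n (denom_weight \<Xi> n)"
  note S = sym_poly[OF reg_denom_weight[of \<Xi>]] and A = weyl_denom_eigen[of \<Xi>]
  define c where "c = lk ?S ?d / lk ?A ?d"
  have "?S - scal c * ?A = 0"
  proof (rule isotypic_unique)
    show "isotypic \<Xi> (?S - scal c * ?A)" by (rule isotypic_lincomb[OF S(1) A(1)])
    show "app LH.Z (?S - scal c * ?A) = scal (central_eigenvalue ?d) * (?S - scal c * ?A)"
      by (simp only: app_diff linD[OF lin_Z] S(2) A(2) right_diff_distrib mult.left_commute)
    show "lk (?S - scal c * ?A) ?d = 0" using A(3) by (simp add: c_def lookup_minus lk_scal)
  qed (use reg_denom_weight[of \<Xi>] in \<open>auto simp: reg_def\<close>)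
  moreover have "c \<noteq> 0" using S(4) A(3) by (simp add: c_def)
  ultimately show ?thesis by auto
qed

end

section \<open>Parameter shifts as field homomorphisms\<close>

definition shq :: "nat \<Rightarrow> nat \<Rightarrow> param \<Rightarrow> coeff" where
  "shq a b = par(T_half := q_h ^ a * t_h, Tn_half := q_h ^ b * tn_h)"

lemma shifts: "shift_pm = shq 0 2" "shift_mp = shq 1 0" "shift_minus = shq 1 2"
  by (auto simp: shift_pm_def shift_mp_def shift_minus_def shq_def fun_eq_iff)

text \<open>On a monomial the substitution only adds a power of \<open>q_h\<close> that depends on
  the degrees in \<open>t_h\<close> and \<open>tn_h\<close>. It is therefore injective on exponents,
  hence on polynomials, and extends to fractions.\<close>

definition shm :: "nat \<Rightarrow> nat \<Rightarrow> (param \<Rightarrow>\<^sub>0 nat) \<Rightarrow> param \<Rightarrow>\<^sub>0 nat" where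
  "shm a b m = m + Poly_Mapping.single Q_half (a * lk m T_half + b * lk m Tn_half)"

lemma shm_add: "shm a b (m + m') = shm a b m + shm a b m'"
  by (rule poly_mapping_eqI) (simp add: shm_def lookup_add lookup_single when_def algebra_simps)

lemma shm_inj: assumes "shm a b m = shm a b m'" shows "m = m'"
proof -
  have e: "lk (shm a b m) v = lk (shm a b m') v" for v using assms by simp
  have v: "lk m v = lk m' v" if "v \<noteq> Q_half" for v using e[of v] that by (simp add: shm_def lookup_add lookup_single)
  then have "lk m Q_half = lk m' Q_half" using e[of Q_half] v[of T_half] v[of Tn_half] by (simp add: shm_def lookup_add)
  then show ?thesis using v by (intro poly_mapping_eqI) metis
qed

definition psub :: "nat \<Rightarrow> nat \<Rightarrow> param_poly \<Rightarrow> param_poly" where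
  "psub a b = pm_lift (\<lambda>m c. Poly_Mapping.single (shm a b m) c)"

interpretation psub: pm_hom "\<lambda>m c. Poly_Mapping.single (shm a b m) (c::complex)" for a b
  by standard (simp_all add: single_add shm_add mult_single, simp add: shm_def)

lemma psub_add: "psub a b (p + p') = psub a b p + psub a b p'"
  by (simp add: psub_def psub.lift_add)

lemma psub_mult: "psub a b (p * p') = psub a b p * psub a b p'"
  by (simp add: psub_def psub.lift_mult)

lemma psub_single: "psub a b (Poly_Mapping.single m c) = Poly_Mapping.single (shm a b m) c"
  by (simp add: psub_def psub.lift_single)

lemma psub_nonzero: assumes "p \<noteq> 0" shows "psub a b p \<noteq> 0"
proof -
  obtain m where m: "m \<in> Poly_Mapping.keys p" using assms by fastforce
  have "lk (psub a b p) (shm a b m) = (\<Sum>m'\<in>Poly_Mapping.keys p. if m' = m then lk p m' else 0)"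
    unfolding psub_def pm_lift_def lookup_sum
    by (intro sum.cong refl) (auto simp: lookup_single when_def dest: shm_inj)
  then have "lk (psub a b p) (shm a b m) = lk p m" using m by simp
  then show ?thesis using m by (auto simp: in_keys_iff)
qed

lemma single_to_fract: "to_fract (Poly_Mapping.single m 1) = (\<Prod>v\<in>UNIV. par v ^ lk m v)"
proof -
  have "expv (\<lambda>v. int (lk m v)) = m" by (rule poly_mapping_eqI) (simp add: lk_expv)
  then show ?thesis using Mon_to_fract[of "\<lambda>v. int (lk m v)"] by (simp add: Mon_def)
qed

lemma shq_prod: "(\<Prod>v\<in>Poly_Mapping.keys m. shq a b v ^ lk m v) = to_fract (Poly_Mapping.single (shm a b m) 1)"
proof -
  have "(\<Prod>v\<in>Poly_Mapping.keys m. shq a b v ^ lk m v) = (\<Prod>v\<in>UNIV. shq a b v ^ lk m v)"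
    by (rule prod.mono_neutral_left) (auto simp: in_keys_iff)
  also have "\<dots> = (\<Prod>v\<in>UNIV. par v ^ lk (shm a b m) v)"
    by (simp add: UNIV_param shq_def shm_def lookup_add lookup_single power_add power_mult_distrib power_mult)
  finally show ?thesis by (simp add: single_to_fract)
qed

lemma eval_param_shq: "eval_param (shq a b) p = to_fract (psub a b p)"
proof -
  have "to_fract (Poly_Mapping.single 0 c) * to_fract (Poly_Mapping.single m (1::complex)) = to_fract (Poly_Mapping.single m c)"
    for c and m :: "param \<Rightarrow>\<^sub>0 nat" by (simp add: mult_single flip: to_fract_mult)
  moreover have "to_fract (sum F A) = (\<Sum>x\<in>A. to_fract (F x))" for F :: "(param \<Rightarrow>\<^sub>0 nat) \<Rightarrow> param_poly" and A
    by (induction A rule: infinite_finite_induct) simp_all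
  ultimately show ?thesis by (simp add: eval_param_def shq_prod psub_def pm_lift_def)
qed

text \<open>The fraction picked by \<open>SOME\<close> is unknown, but it is related to the given
  one by cross multiplication. Since \<open>psub\<close> is multiplicative and keeps denominators
  nonzero, the quotient of the images is the same.\<close>

lemma subst_Fract:
  assumes "b' \<noteq> 0"
  shows "subst_coeff (shq a b) (Fraction_Field.Fract a' b') = to_fract (psub a b a') / to_fract (psub a b b')"
proof -
  let ?P = "\<lambda>(c, d). d \<noteq> 0 \<and> Fraction_Field.Fract a' b' = Fraction_Field.Fract c d"
  obtain c d where cd: "(SOME x. ?P x) = (c, d)" by (cases "SOME x. ?P x") auto
  have "?P (SOME x. ?P x)" by (rule someI[of ?P "(a', b')"]) (use assms in auto)
  then have d: "d \<noteq> 0" "a' * d = c * b'" unfolding cd using assms by (auto simp: eq_fract)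
  have "psub a b a' * psub a b d = psub a b c * psub a b b'" using arg_cong[OF d(2), of "psub a b"] by (simp add: psub_mult)
  then have "to_fract (psub a b a') * to_fract (psub a b d) = to_fract (psub a b c) * to_fract (psub a b b')"
    by (simp flip: to_fract_mult)
  then show ?thesis using psub_nonzero[OF d(1), of a b] psub_nonzero[OF assms, of a b]
    unfolding subst_coeff_def cd by (simp add: eval_param_shq field_simps)
qed

interpretation subst: coeff_hom "subst_coeff (shq a b)" for a b
proof
  have psub1: "psub a b 1 = 1" for a b using psub_single[of a b 0 1] by (simp add: shm_def)
  fix x y :: coeff
  obtain p r where x: "x = Fraction_Field.Fract p r" "r \<noteq> 0" by (cases x) auto
  obtain p' r' where y: "y = Fraction_Field.Fract p' r'" "r' \<noteq> 0" by (cases y) auto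
  show "subst_coeff (shq a b) (x + y) = subst_coeff (shq a b) x + subst_coeff (shq a b) y"
    using x y psub_nonzero[of r a b] psub_nonzero[of r' a b]
    by (simp add: subst_Fract psub_add psub_mult add_divide_distrib)
  show "subst_coeff (shq a b) (x * y) = subst_coeff (shq a b) x * subst_coeff (shq a b) y"
    using x y by (simp add: subst_Fract psub_mult)
  show "subst_coeff (shq a b) 1 = 1" using subst_Fract[of 1 a b 1] psub1[of a b] by (simp add: One_fract_def[symmetric])
qed

lemma subst_par: "subst_coeff (shq a b) (par v) = shq a b v"
proof -
  have "subst_coeff (shq a b) (par v) = to_fract (Poly_Mapping.single (shm a b (Poly_Mapping.single v 1)) 1)"
    using subst_Fract[of 1 a b "Poly_Mapping.single (Poly_Mapping.single v 1) 1"] psub_single[of a b 0 1]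
    by (simp add: par_def to_fract_def psub_single shm_def)
  also have "\<dots> = shq a b v" using shq_prod[where m = "Poly_Mapping.single v 1", symmetric, of a b] by simp
  finally show ?thesis .
qed

lemma lk_subst: "lk (subst_laurent (shq a b) f) \<mu> = subst_coeff (shq a b) (lk f \<mu>)"
  by (simp add: subst_laurent_def Poly_Mapping.map.rep_eq when_def)

lemma keys_subst: "Poly_Mapping.keys (subst_laurent (shq a b) f) = Poly_Mapping.keys f"
  by (auto simp: in_keys_iff lk_subst)

section \<open>The centre at shifted parameters\<close>

context eval_rep
begin

text \<open>The travelling coordinate passes each other coordinate twice; the two coefficients
  combine to one factor of the denominator at \<open>1 / y 1\<close>. The passage at position
  \<open>n\<close> gives the factor \<open>gn\<close>.\<close>

lemma Mc_eq:
  assumes y: "gen y"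
  shows "Mc y = (\<Prod>m=1..<n. gs (1 / y 1) (y (Suc m)) / (y 1 * \<iota> t_par * ((1 - 1 / (y 1 * y (Suc m))) * (1 - y (Suc m) / y 1)))) *
    (gn (1 / y 1) / (y 1 * \<iota> tn_h * (1 - 1 / y 1 ^ 2)))"
proof -
  let ?a = "y 1"
  have nz: "\<And>i. y i \<noteq> 0" using gen_nonzero[OF y] .
  have t: "\<iota> t_par = \<iota> t_h * \<iota> t_h" by (simp add: hom_simps power2_eq_square)
  have "cc m (ins y m (1 / ?a)) * cc m (ins y (Suc m) ?a) =
    gs (1 / ?a) (y (Suc m)) / (?a * \<iota> t_par * ((1 - 1 / (?a * y (Suc m))) * (1 - y (Suc m) / ?a)))" if m: "m \<in> {1..<n}" for m
  proof -
    let ?b = "y (Suc m)"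
    have g: "gen (ins y m (1 / ?a))" "gen (ins y (Suc m) ?a)"
      using ins_orb[OF n_pos, of m y] ins_orb[OF n_pos, of "Suc m" y] m gen_orb[OF _ y] by auto
    have v: "ins y m (1 / ?a) m = 1 / ?a" "ins y m (1 / ?a) (Suc m) = ?b" "ins y (Suc m) ?a m = ?b" "ins y (Suc m) ?a (Suc m) = ?a"
      using m by (auto simp: ins_def)
    define d where "d = (1 - 1 / (?a * ?b)) * (1 - ?b / ?a)"
    have c: "cc m (ins y m (1 / ?a)) = (1 / \<iota> t_h - \<iota> t_h * (1 / (?a * ?b))) / (1 - 1 / (?a * ?b))"
      "cc m (ins y (Suc m) ?a) = (1 / \<iota> t_h - \<iota> t_h * (?b / ?a)) / (1 - ?b / ?a)"
      using cc_less[OF g(1), of m] cc_less[OF g(2), of m] m unfolding v by simp_all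
    have "cc m (ins y m (1 / ?a)) * cc m (ins y (Suc m) ?a) =
      (1 / \<iota> t_h - \<iota> t_h * (1 / (?a * ?b))) * (1 / \<iota> t_h - \<iota> t_h * (?b / ?a)) / d"
      unfolding c d_def by simp
    also have "(1 / \<iota> t_h - \<iota> t_h * (1 / (?a * ?b))) * (1 / \<iota> t_h - \<iota> t_h * (?b / ?a)) = gs (1 / ?a) ?b / (?a * \<iota> t_par)"
      using nz[of 1] nz[of "Suc m"] unfolding gs_def t by (simp add: field_simps power2_eq_square)
    finally show ?thesis by (simp add: d_def)
  qed
  then have "(\<Prod>m=1..<n. cc m (ins y m (1 / ?a))) * (\<Prod>m=1..<n. cc m (ins y (Suc m) ?a)) =
    (\<Prod>m=1..<n. gs (1 / ?a) (y (Suc m)) / (?a * \<iota> t_par * ((1 - 1 / (?a * y (Suc m))) * (1 - y (Suc m) / ?a))))"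
    unfolding prod.distrib[symmetric] by (rule prod.cong[OF refl])
  moreover have "cc n (ins y n (1 / ?a)) = gn (1 / ?a) / (?a * \<iota> tn_h * (1 - 1 / ?a ^ 2))"
  proof -
    have "gen (ins y n (1 / ?a))" using ins_orb(2)[OF n_pos, of n y] n_pos gen_orb[OF _ y] by simp
    then show ?thesis using cc_n[of "ins y n (1 / ?a)"] by (simp add: ins_def power_one_over mult.assoc)
  qed
  ultimately show ?thesis unfolding Mc_def by (simp add: mult_ac)
qed

lemma PS_first: "PS n (y(1 := u)) = (\<Prod>m=1..<n. gs u (y (Suc m))) * (\<Prod>(a, b)\<in>{x \<in> prs n. fst x \<noteq> 1}. gs (y a) (y b))"
proof -
  have s: "prs n = (\<lambda>m. (1, Suc m)) ` {1..<n} \<union> {x \<in> prs n. fst x \<noteq> 1}"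
  proof (intro set_eqI iffI)
    fix x assume x: "x \<in> prs n"
    show "x \<in> (\<lambda>m. (1, Suc m)) ` {1..<n} \<union> {x \<in> prs n. fst x \<noteq> 1}"
    proof (cases "fst x = 1")
      case True
      then have "x = (1, Suc (snd x - 1))" "snd x - 1 \<in> {1..<n}" using x by (cases x; auto simp: prs_def)+
      then show ?thesis by blast
    qed (use x in simp)
  qed (auto simp: prs_def)
  have f: "finite ((\<lambda>m. (1::nat, Suc m)) ` {1..<n})" "finite {x \<in> prs n. fst x \<noteq> 1}"
    "(\<lambda>m. (1::nat, Suc m)) ` {1..<n} \<inter> {x \<in> prs n. fst x \<noteq> 1} = {}" by auto
  have "PS n (y(1 := u)) = (\<Prod>(a, b)\<in>(\<lambda>m. (1, Suc m)) ` {1..<n}. gs ((y(1 := u)) a) ((y(1 := u)) b)) *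
    (\<Prod>(a, b)\<in>{x \<in> prs n. fst x \<noteq> 1}. gs ((y(1 := u)) a) ((y(1 := u)) b))"
    unfolding PS_def by (subst s) (rule prod.union_disjoint[OF f])
  also have "(\<Prod>(a, b)\<in>(\<lambda>m. (1, Suc m)) ` {1..<n}. gs ((y(1 := u)) a) ((y(1 := u)) b)) = (\<Prod>m=1..<n. gs u (y (Suc m)))"
    by (subst prod.reindex) (auto simp: inj_on_def intro!: prod.cong)
  also have "(\<Prod>(a, b)\<in>{x \<in> prs n. fst x \<noteq> 1}. gs ((y(1 := u)) a) ((y(1 := u)) b)) = (\<Prod>(a, b)\<in>{x \<in> prs n. fst x \<noteq> 1}. gs (y a) (y b))"
    by (intro prod.cong refl) (auto simp: prs_def)
  finally show ?thesis .
qed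

lemma PD_first: "PD n (y(1 := u)) = gn u * (\<Prod>a\<in>{1..n} - {1}. gn (y a))"
proof -
  have "1 \<in> {1..n}" using n_pos by simp
  then show ?thesis unfolding PD_def by (subst prod.remove[of _ 1]) (auto intro!: prod.cong arg_cong2[of _ _ _ _ "(*)"])
qed

end

text \<open>A parameter is shifted exactly where the character takes its sign value. In powers of
  \<open>q_h\<close> the factor is 1 for \<open>t_h\<close> and 2 for \<open>tn_h\<close>.\<close>

definition sh :: "char_sign \<Rightarrow> param \<Rightarrow> coeff" where
  "sh \<Xi> = shq (if sgn_s \<Xi> then 1 else 0) (if sgn_d \<Xi> then 2 else 0)"

lemma subst_sh:
  "subst_coeff (sh \<Xi>) q_h = q_h" "subst_coeff (sh \<Xi>) t0_h = t0_h" "subst_coeff (sh \<Xi>) u0_h = u0_h" "subst_coeff (sh \<Xi>) un_h = un_h"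
  "subst_coeff (sh \<Xi>) t_h = (if sgn_s \<Xi> then q_h * t_h else t_h)" "subst_coeff (sh \<Xi>) tn_h = (if sgn_d \<Xi> then q_par * tn_h else tn_h)"
  unfolding sh_def subst_par by (simp_all add: shq_def)

lemma lk_sh: "lk (subst_laurent (sh \<Xi>) f) \<mu> = subst_coeff (sh \<Xi>) (lk f \<mu>)"
  unfolding sh_def by (rule lk_subst)

lemma keys_sh: "Poly_Mapping.keys (subst_laurent (sh \<Xi>) f) = Poly_Mapping.keys f"
  unfolding sh_def by (rule keys_subst)

interpretation sh: coeff_hom "subst_coeff (sh \<Xi>)" for \<Xi>
  unfolding sh_def by (rule subst.coeff_hom_axioms)

lemma coeff_hom_shift: "coeff_hom (\<lambda>c. base_hom (subst_coeff (sh \<Xi>) c))"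
  by standard (simp_all add: sh.hom_simps base.hom_simps)

context rank
begin

text \<open>In the form \<open>yo\<close> the substitution multiplies the term at \<open>k\<close>
  by \<open>q^(n-k)\<close> if \<open>t\<close> is shifted and by \<open>q\<close> if
  \<open>tn_h\<close> is shifted. These exponents are the entries of \<open>pi_vec\<close> and of
  \<open>omega\<close>.\<close>

lemma central_eigenvalue_shift:
  assumes d: "dominant n \<kappa>" and lat: "\<kappa> \<in> lat"
  shows "subst_coeff (sh \<Xi>) (central_eigenvalue \<kappa>) = central_eigenvalue (\<kappa> + denom_weight \<Xi> n)"
proof -
  have r: "dominant n (\<kappa> + denom_weight \<Xi> n)" "\<kappa> + denom_weight \<Xi> n \<in> lat" using reg_add_denom_weight[OF assms, of \<Xi>] by (auto simp: reg_def)
  have "subst_coeff (sh \<Xi>) (yo \<kappa> k) = yo (\<kappa> + denom_weight \<Xi> n) k" if k: "k \<in> {1..n}" for k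
  proof -
    have s: "subst_coeff (sh \<Xi>) (yo \<kappa> k) = q_par powi lk \<kappa> k * (if sgn_s \<Xi> then q_par * t_par else t_par) ^ (n - k) * t0_h * (if sgn_d \<Xi> then q_par * tn_h else tn_h)"
      by (simp add: yo_def sh.hom_simps subst_sh power_mult_distrib)
    have "q_par powi (int n - int k) = q_par ^ (n - k)" using k by (simp flip: of_nat_diff)
    then show ?thesis unfolding s using k
      by (simp add: yo_def lookup_add lk_denom_weight power_int_add power_mult_distrib mult_ac)
  qed
  then show ?thesis by (simp add: central_eigenvalue_eq[OF assms] central_eigenvalue_eq[OF r] sh.hom_simps)
qed

context fixes \<Xi> :: char_sign begin

text \<open>The same points with the coefficient map preceded by the shift: a value of
  \<open>f\<close> here is the value of the substituted polynomial in \<open>base\<close>.\<close>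

interpretation R: eval_rep "\<lambda>c. base_hom (subst_coeff (sh \<Xi>) c)" n
  by (intro eval_rep.intro coeff_hom_shift eval_rep_axioms.intro n_pos)

lemma R_ev: "R.ev p f = base.ev p (subst_laurent (sh \<Xi>) f)"
  by (simp add: R.ev_def base.ev_def pm_lift_def keys_sh lk_sh R.mon_def base.mon_def)

lemma R_gen: "base.gen p \<Longrightarrow> R.gen p"
proof -
  assume g: "base.gen p"
  have "f = 0" if "R.ev p f = 0" for f
  proof -
    have "subst_laurent (sh \<Xi>) f = 0" using that g unfolding R_ev base.gen_def by blast
    then have "Poly_Mapping.keys (subst_laurent (sh \<Xi>) f) = {}" by simp
    then show ?thesis by (simp add: keys_sh)
  qed
  then show ?thesis using g by (simp add: base.gen_def R.gen_def)
qed

lemma q0_eq: "R.q0 y = base.q0 y"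
  by (simp add: R.q0_def base.q0_def sh.hom_simps subst_sh)

text \<open>With primes for the shifted parameters, \<open>gs (q/a) b = gs' (1/a) b / q\<close> and
  \<open>gn (q/a) = gn' (1/a) / q\<close>. The factors \<open>1/q\<close> match the change of
  \<open>t\<close> and \<open>tn_h\<close> in the denominators of \<open>Mc_eq\<close>, and the
  factors without the first coordinate agree on both sides.\<close>

lemma Mc_shift:
  assumes y: "base.gen y"
  shows "base.Mc y * base.evf (weyl_denom \<Xi> n) (base.q0 y) = R.Mc y * base.evf (weyl_denom \<Xi> n) (y(1 := 1 / y 1))"
proof -
  let ?a = "y 1" and ?q = "base_hom q_par" and ?T = "base_hom t_par"
  have nz: "\<And>i. y i \<noteq> 0" using base.gen_nonzero[OF y] .
  have p': "base.gen (y(1 := 1 / ?a))"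
    using base.gen_orb[OF ins_orb(2)[OF n_pos, of 1 y] y] n_pos ins_1[of y "1 / ?a"] by simp
  have q': "base.gen (y(1 := ?q / ?a))" using base.gen_q0[OF y] by (simp add: base.q0_def)
  have e: "base.evf (weyl_denom \<Xi> n) (base.q0 y) = (if sgn_s \<Xi> then base.PS n (y(1 := ?q / ?a)) else 1) * (if sgn_d \<Xi> then base.PD n (y(1 := ?q / ?a)) else 1)"
    "base.evf (weyl_denom \<Xi> n) (y(1 := 1 / ?a)) = (if sgn_s \<Xi> then base.PS n (y(1 := 1 / ?a)) else 1) * (if sgn_d \<Xi> then base.PD n (y(1 := 1 / ?a)) else 1)"
    unfolding base.evf_def base.q0_def
    by (simp_all only: base.ev_weyl_denom[OF base.gen_nonzero[OF q']] base.ev_weyl_denom[OF base.gen_nonzero[OF p']] p' q' if_True)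
  have qn: "?q \<noteq> 0" by simp
  define D where "D m = (1 - 1 / (?a * y (Suc m))) * (1 - y (Suc m) / ?a)" for m
  define XL XR where "XL m = base.gs (1 / ?a) (y (Suc m)) / (?a * ?T * D m)"
    and "XR m = R.gs (1 / ?a) (y (Suc m)) / (?a * base_hom (subst_coeff (sh \<Xi>) t_par) * D m)" for m
  define YL YR where "YL = base.gn (1 / ?a) / (?a * base_hom tn_h * (1 - 1 / ?a ^ 2))"
    and "YR = R.gn (1 / ?a) / (?a * base_hom (subst_coeff (sh \<Xi>) tn_h) * (1 - 1 / ?a ^ 2))"
  have M: "base.Mc y = (\<Prod>m=1..<n. XL m) * YL" "R.Mc y = (\<Prod>m=1..<n. XR m) * YR"
    unfolding base.Mc_eq[OF y] R.Mc_eq[OF R_gen[OF y]] XL_def XR_def YL_def YR_def D_def by simp_all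
  have t: "subst_coeff (sh \<Xi>) t_par = (if sgn_s \<Xi> then q_par * t_par else t_par)"
    by (simp add: sh.hom_simps subst_sh power_mult_distrib)
  have X: "(\<Prod>m=1..<n. XL m) * (if sgn_s \<Xi> then base.PS n (y(1 := ?q / ?a)) else 1) =
    (\<Prod>m=1..<n. XR m) * (if sgn_s \<Xi> then base.PS n (y(1 := 1 / ?a)) else 1)"
  proof (cases "sgn_s \<Xi>")
    case True
    have g: "base.gs (?q / ?a) b = R.gs (1 / ?a) b / ?q" for b
      using nz[of 1] qn True unfolding base.gs_def R.gs_def t
      by (simp add: base.hom_mult field_simps power2_eq_square)
    have "XL m * base.gs (?q / ?a) (y (Suc m)) = XR m * base.gs (1 / ?a) (y (Suc m))" for m
      unfolding g XL_def XR_def t using True qn by (simp add: base.hom_mult mult_ac)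
    then have "(\<Prod>m=1..<n. XL m) * (\<Prod>m=1..<n. base.gs (?q / ?a) (y (Suc m))) = (\<Prod>m=1..<n. XR m) * (\<Prod>m=1..<n. base.gs (1 / ?a) (y (Suc m)))"
      by (simp only: prod.distrib[symmetric])
    then show ?thesis using True by (simp only: base.PS_first if_True mult.assoc[symmetric])
  next
    case False
    then have "XL = XR" by (simp add: XL_def XR_def fun_eq_iff t base.gs_def R.gs_def)
    then show ?thesis using False by simp
  qed
  have Y: "YL * (if sgn_d \<Xi> then base.PD n (y(1 := ?q / ?a)) else 1) = YR * (if sgn_d \<Xi> then base.PD n (y(1 := 1 / ?a)) else 1)"
  proof (cases "sgn_d \<Xi>")
    case True
    have gm: "subst_coeff (sh \<Xi>) (gam 0 1) = q_par * gam 0 1" "subst_coeff (sh \<Xi>) tn_par = q_par ^ 2 * tn_par"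
      using True by (simp_all add: gam_def sh.hom_simps subst_sh algebra_simps power_mult_distrib)
    have g: "base.gn (?q / ?a) = R.gn (1 / ?a) / ?q"
      using nz[of 1] qn unfolding base.gn_def R.gn_def gm
      by (simp add: base.hom_mult base.hom_power field_simps power2_eq_square)
    have "YL * base.gn (?q / ?a) = YR * base.gn (1 / ?a)"
      unfolding g YL_def YR_def using True qn by (simp add: subst_sh base.hom_mult mult_ac)
    then show ?thesis using True by (simp only: base.PD_first if_True mult.assoc[symmetric])
  next
    case False
    then have "YL = YR" by (simp add: YL_def YR_def base.gn_def R.gn_def gam_def sh.hom_simps subst_sh)
    then show ?thesis using False by simp
  qed
  show ?thesis unfolding M e using X Y by algebra
qed

text \<open>The affine reflection involves only \<open>q\<close>, \<open>t_0\<close> and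
  \<open>u_0\<close>, which the shift leaves alone.\<close>

lemma cc0_shift: "base.gen y \<Longrightarrow> R.cc 0 y = base.cc 0 y"
  using R.cc_eq[OF R_gen, of y 0] base.cc_eq[of y 0]
  by (simp add: kap_def gam_def zd_def R.zv_def base.zv_def sh.hom_simps subst_sh)

text \<open>\<open>Z_invariant\<close> is applied twice with the same invariant function: to the
  denominator with the original parameters, and to the constant 1 with the shifted ones. By
  \<open>Mc_shift\<close> the weights of the neighbouring orbits coincide.\<close>

theorem Z_product:
  assumes P: "isotypic Plus P" "app LH.Z P = scal (central_eigenvalue \<kappa>) * P" and \<kappa>: "dominant n \<kappa>" "\<kappa> \<in> lat"
  shows "app LH.Z (weyl_denom \<Xi> n * subst_laurent (sh \<Xi>) P) = scal (central_eigenvalue (\<kappa> + denom_weight \<Xi> n)) * (weyl_denom \<Xi> n * subst_laurent (sh \<Xi>) P)"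
    and "i \<in> {1..n} \<Longrightarrow> hecke n i (weyl_denom \<Xi> n * subst_laurent (sh \<Xi>) P) = scal (chi \<Xi> n i) * (weyl_denom \<Xi> n * subst_laurent (sh \<Xi>) P)"
proof -
  let ?A = "weyl_denom \<Xi> n" and ?P = "subst_laurent (sh \<Xi>) P" and ?p = base_pt and ?i = "\<lambda>c. base_hom (subst_coeff (sh \<Xi>) c)"
  define \<psi> where "\<psi> = R.evf P"
  have Pi: "R.iso Plus \<psi>"
    using P(1) unfolding R.iso_def \<psi>_def by (auto simp: isotypic_def R.evf_hecke[symmetric] R.evf_scal)
  \<comment> \<open>For the trivial character the denominator is the empty product, so this is a
    case of \<open>iso_weyl_denom\<close>.\<close>
  have R1: "R.iso Plus (R.evf 1)"
    using R.iso_weyl_denom[of Plus] by (simp add: weyl_denom_def sgn_s_def sgn_d_def)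
  have w: "winv n \<psi>"
    unfolding winv_def
  proof (intro allI impI)
    fix p i assume i: "1 \<le> i \<and> i \<le> n"
    show "\<psi> (rp n i p) = \<psi> p"
    proof (cases "R.gen p")
      case True
      then show ?thesis using R.iso_step(1)[OF Pi True] i chi_Plus by simp
    next
      case False
      then have "\<not> R.gen (rp n i p)" using R.gen_sp[of "rp n i p" i] R.sp_rp[of i] i by auto
      then show ?thesis using False by (simp add: \<psi>_def R.evf_def)
    qed
  qed
  have AP: "base.evf (?A * ?P) = (\<lambda>z. base.evf ?A z * \<psi> z)"
    using R_gen base.gen_nonzero by (auto simp: fun_eq_iff base.evf_def \<psi>_def R.evf_def R_ev base.ev_mult)
  show "hecke n i (?A * ?P) = scal (chi \<Xi> n i) * (?A * ?P)" if "i \<in> {1..n}"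
  proof (rule base_evf_inj)
    show "base.evf (hecke n i (?A * ?P)) = base.evf (scal (chi \<Xi> n i) * (?A * ?P))"
      using base.iso_times[OF base.iso_weyl_denom[of \<Xi>] w] that by (simp add: base.evf_hecke base.evf_scal AP base.iso_def)
  qed
  have AZ: "app base.FH.Z (base.evf ?A) z = base_hom (central_eigenvalue (denom_weight \<Xi> n)) * base.evf ?A z" for z
    using weyl_denom_eigen(2)[of \<Xi>] by (simp add: base.evf_Z[symmetric] base.evf_scal)
  have Anz: "base.evf ?A z \<noteq> 0" if "base.gen z" for z
    using that weyl_denom_nonzero[of \<Xi> n] by (auto simp: base.evf_def base.gen_def)
  have d0: "dominant n 0" "0 \<in> lat" by (auto simp: dominant_def mm_def in_lattice)
  \<comment> \<open>No exponent has norm below that of 0, so the leading term of \<open>Z 1\<close>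
    is all of it.\<close>
  have "app LH.Z (mono 0) - scal (central_eigenvalue 0) * mono 0 \<in> supp_in (below (nm n 0))" by (rule Z_lead[OF d0])
  moreover have "below (nm n 0) = {}" using nm_nonneg[of n] by (auto simp: below_def nm_def sum_nonneg not_less)
  ultimately have Z1: "app LH.Z 1 = scal (central_eigenvalue 0) * 1" by (simp add: supp_in_def)
  have RZ: "app (R.FH.Z) (R.evf 1) z = ?i (central_eigenvalue 0) * R.evf 1 z" for z
    using Z1 by (simp only: R.evf_Z[symmetric] R.evf_scal)
  have one: "R.evf 1 z = 1" if "R.gen z" for z using that by (simp add: R.evf_def)
  let ?O = "(\<lambda>y. orb n (base.q0 y)) ` orb n ?p"
  define KL where "KL y = base.Mc y * base.cc 0 y * base.evf ?A (base.q0 y) / base.evf ?A (y(1 := 1 / y 1))" for y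
  define KR where "KR y = R.Mc y * R.cc 0 y * R.evf 1 (base.q0 y) / R.evf 1 (y(1 := 1 / y 1))" for y
  have K: "KL y = KR y" if "y \<in> orb n ?p" for y
  proof -
    have g: "base.gen y" using base.gen_orb[OF that base_gen] .
    have p': "base.gen (y(1 := 1 / y 1))"
      using base.gen_orb[OF ins_orb(2)[OF n_pos, of 1 y] g] n_pos ins_1[of y "1 / y 1"] by simp
    have "KR y = R.Mc y * base.cc 0 y"
      unfolding KR_def using one[OF R_gen[OF base.gen_q0[OF g]]] one[OF R_gen[OF p']] cc0_shift[OF g] by simp
    moreover have "KL y = (base.Mc y * base.evf ?A (base.q0 y)) * base.cc 0 y / base.evf ?A (y(1 := 1 / y 1))"
      by (simp add: KL_def mult_ac)
    ultimately show ?thesis using Mc_shift[OF g] Anz[OF p'] by simp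
  qed
  define r where "r o' = (SOME y. y \<in> orb n ?p \<and> o' = orb n (base.q0 y))" for o'
  have r: "r o' \<in> orb n ?p" if "o' \<in> ?O" for o'
    using someI_ex[of "\<lambda>y. y \<in> orb n ?p \<and> o' = orb n (base.q0 y)"] that unfolding r_def by blast
  \<comment> \<open>The part of \<open>Z\<close> that leads to neighbouring orbits, the same for
    both parameter sets by \<open>K\<close>.\<close>
  define X where "X = (\<Sum>o'\<in>?O. (\<psi> (base.q0 (r o')) - \<psi> ?p) * KR (r o'))"
  have "app base.FH.Z (base.evf (?A * ?P)) ?p = base.evf ?A ?p * (base_hom (central_eigenvalue (denom_weight \<Xi> n)) * \<psi> ?p +
      (\<Sum>o'\<in>?O. (\<psi> (base.q0 (r o')) - \<psi> ?p) * KL (r o')))"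
    using base.Z_invariant[OF base.iso_weyl_denom Anz AZ w base_gen] unfolding AP KL_def r_def Let_def by simp
  also have "(\<Sum>o'\<in>?O. (\<psi> (base.q0 (r o')) - \<psi> ?p) * KL (r o')) = X"
    unfolding X_def using K r by (intro sum.cong) auto
  finally have L: "app base.FH.Z (base.evf (?A * ?P)) ?p = base.evf ?A ?p * (base_hom (central_eigenvalue (denom_weight \<Xi> n)) * \<psi> ?p + X)" .
  have m1: "(\<lambda>z. R.evf 1 z * \<psi> z) = \<psi>" by (auto simp: fun_eq_iff \<psi>_def R.evf_def)
  have "app (R.FH.Z) \<psi> ?p = ?i (central_eigenvalue 0) * \<psi> ?p + X"
    using R.Z_invariant[OF R1 _ RZ w R_gen[OF base_gen]] one one[OF R_gen[OF base_gen]]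
    unfolding m1 X_def KR_def r_def q0_eq Let_def by simp
  moreover have "app (R.FH.Z) \<psi> ?p = ?i (central_eigenvalue \<kappa>) * \<psi> ?p"
    using P(2) unfolding \<psi>_def R.evf_Z[symmetric] by (simp add: R.evf_scal)
  \<comment> \<open>\<open>X\<close> is eliminated between the two formulas. The constants match
    because the shift takes the eigenvalue at weight 0 to the one at
    \<open>denom_weight\<close>.\<close>
  ultimately have "base_hom (central_eigenvalue (denom_weight \<Xi> n)) * \<psi> ?p + X = base_hom (central_eigenvalue (\<kappa> + denom_weight \<Xi> n)) * \<psi> ?p"
    using central_eigenvalue_shift[OF \<kappa>] central_eigenvalue_shift[OF d0] by simp
  then have "app base.FH.Z (base.evf (?A * ?P)) ?p = base_hom (central_eigenvalue (\<kappa> + denom_weight \<Xi> n)) * base.evf (?A * ?P) ?p"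
    unfolding L by (simp add: AP mult_ac)
  then have "base.evf (app LH.Z (?A * ?P)) ?p = base.evf (scal (central_eigenvalue (\<kappa> + denom_weight \<Xi> n)) * (?A * ?P)) ?p"
    by (simp add: base.evf_Z base.evf_scal)
  then show "app LH.Z (?A * ?P) = scal (central_eigenvalue (\<kappa> + denom_weight \<Xi> n)) * (?A * ?P)"
    using base.gen_eq_iff[OF base_gen] base_gen unfolding base.evf_def by simp
qed

end

end

section \<open>The product formula\<close>

context rank
begin

lemma reg_Plus: "dominant n \<kappa> \<Longrightarrow> \<kappa> \<in> lat \<Longrightarrow> reg Plus \<kappa>"
  by (simp add: reg_def chi_Plus)

text \<open>Both sides are isotypic with the same eigenvalue of \<open>Z\<close>, so one coefficient
  decides. The symmetric polynomial of type \<open>Plus\<close> has leading coefficient 1, which the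
  substitution preserves, and for type \<open>\<Xi>\<close> this coefficient is a ratio of character
  values at the longest element that does not depend on the weight.\<close>

lemma sym_poly_product:
  assumes \<kappa>: "dominant n \<kappa>" "\<kappa> \<in> lat"
  shows "sym_poly \<Xi> n (denom_weight \<Xi> n) * subst_laurent (sh \<Xi>) (sym_poly Plus n \<kappa>) = sym_poly \<Xi> n (\<kappa> + denom_weight \<Xi> n)"
    and "sym_poly \<Xi> n (denom_weight \<Xi> n) \<noteq> 0"
proof -
  let ?d = "denom_weight \<Xi> n" and ?P = "sym_poly Plus n \<kappa>" and ?S = "sym_poly \<Xi> n (\<kappa> + denom_weight \<Xi> n)"
  let ?Q = "subst_laurent (sh \<Xi>) ?P"
  obtain c where c: "c \<noteq> 0" "sym_poly \<Xi> n ?d = scal c * weyl_denom \<Xi> n" using sym_poly_denom_weight by blast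
  show "sym_poly \<Xi> n ?d \<noteq> 0" using c weyl_denom_nonzero[of \<Xi> n] by simp
  note P = sym_poly[OF reg_Plus[OF \<kappa>]] and S = sym_poly[OF reg_add_denom_weight[OF \<kappa>, of \<Xi>]] and D = sym_poly[OF reg_denom_weight[of \<Xi>]]
  have d: "dominant n ?d" "?d \<in> lat" using reg_denom_weight[of \<Xi>] by (auto simp: reg_def)
  have k: "dominant n (\<kappa> + ?d)" "\<kappa> + ?d \<in> lat" using reg_add_denom_weight[OF \<kappa>, of \<Xi>] by (auto simp: reg_def)
  define G where "G = sym_poly \<Xi> n ?d * ?Q"
  have G: "G = scal c * (weyl_denom \<Xi> n * ?Q)" by (simp add: G_def c(2) mult.assoc)
  have Ql: "?Q \<in> supp_in (dom \<kappa>)" using P(3)[OF good_dom self_dom[OF \<kappa>]] by (simp add: supp_in_def keys_sh)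
  have Dl: "sym_poly \<Xi> n ?d \<in> supp_in (dom ?d)" using D(3)[OF good_dom self_dom[OF d]] .
  have iso: "isotypic \<Xi> G"
    unfolding isotypic_def
  proof (intro conjI ballI)
    have "a + b \<in> lat" if "a \<in> dom ?d" "b \<in> dom \<kappa>" for a b using that by (auto simp: dom_def in_lattice lookup_add)
    then show "G \<in> supp_in lat" using Ql Dl keys_mult[of "sym_poly \<Xi> n ?d" ?Q] unfolding G_def supp_in_def by blast
    show "hecke n i G = scal (chi \<Xi> n i) * G" if "i \<in> {1..n}" for i
      using Z_product(2)[OF P(1,2) \<kappa> that, of \<Xi>] that
      unfolding G by (simp add: hecke_scal[OF n_pos] mult.left_commute del: scal_simps scal_mult)
  qed
  have Z: "app LH.Z G = scal (central_eigenvalue (\<kappa> + ?d)) * G"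
    unfolding G linD[OF lin_Z] Z_product(1)[OF P(1,2) \<kappa>] by (rule mult.left_commute)
  have "lk G (?d + \<kappa>) = lk (sym_poly \<Xi> n ?d) ?d * lk ?Q \<kappa>"
    unfolding G_def by (rule lk_times_top[OF Dl Ql d(2)])
  also have "lk ?Q \<kappa> = 1" unfolding lk_sh P(4) by (simp add: sh.hom_1)
  finally have l: "lk G (\<kappa> + ?d) = lk ?S (\<kappa> + ?d)" by (simp add: D(4) S(4) add.commute)
  have "?S - scal 1 * G = 0"
  proof (rule isotypic_unique[OF isotypic_lincomb[OF S(1) iso] _ k])
    show "app LH.Z (?S - scal 1 * G) = scal (central_eigenvalue (\<kappa> + ?d)) * (?S - scal 1 * G)"
      by (simp only: app_diff linD[OF lin_Z] S(2) Z right_diff_distrib mult.left_commute)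
    show "lk (?S - scal 1 * G) (\<kappa> + ?d) = 0" using l by (simp add: lookup_minus)
  qed
  then show "sym_poly \<Xi> n ?d * ?Q = ?S" by (simp add: G_def)
qed

lemma sym_poly_0: "sym_poly Plus n 0 = 1"
proof -
  have d: "denom_weight Plus n = 0" and A: "weyl_denom Plus n = 1" by (simp_all add: denom_weight_def weyl_denom_def sgn_s_def sgn_d_def)
  obtain c where c: "sym_poly Plus n 0 = scal c * 1" using sym_poly_denom_weight[of Plus] unfolding d A by blast
  have "lk (sym_poly Plus n 0) 0 = 1" using sym_poly(4)[OF reg_denom_weight[of Plus]] by (simp add: d)
  then have "c = 1" unfolding c lk_scal by simp
  then show ?thesis using c by simp
qed

end

theorem theorem5p7:
  fixes n :: nat and lam :: expo
  assumes "1 \<le> n"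
    and "lam \<in> lattice n"
    and "\<And>i. 1 \<le> i \<Longrightarrow> i < n \<Longrightarrow> Poly_Mapping.lookup lam (Suc i) \<le> Poly_Mapping.lookup lam i"
    and "0 < Poly_Mapping.lookup lam n"
  shows "(P_poly n 0 \<noteq> 0 \<and>
          to_fract (P_poly n lam) = to_fract (P_poly n (lam + 0)) / to_fract (P_poly n 0)) \<and>
         (A_pm n (omega n) \<noteq> 0 \<and>
          to_fract (subst_laurent shift_pm (P_poly n lam)) =
            to_fract (A_pm n (lam + omega n)) / to_fract (A_pm n (omega n))) \<and>
         (A_minus n (rho n) \<noteq> 0 \<and>
          to_fract (subst_laurent shift_minus (P_poly n lam)) =
            to_fract (A_minus n (lam + rho n)) / to_fract (A_minus n (rho n))) \<and>
         (A_mp n (pi_vec n) \<noteq> 0 \<and>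
          to_fract (subst_laurent shift_mp (P_poly n lam)) =
            to_fract (A_mp n (lam + pi_vec n)) / to_fract (A_mp n (pi_vec n)))"
proof -
  interpret rank n by (rule rank.intro[OF assms(1)])
  have d: "dominant n lam"
    unfolding dominant_def mm_def using assms(3,4) by auto
  note key = sym_poly_product[OF d assms(2)]
  have quot: "to_fract (subst_laurent (sh \<Xi>) (sym_poly Plus n lam)) =
    to_fract (sym_poly \<Xi> n (lam + denom_weight \<Xi> n)) / to_fract (sym_poly \<Xi> n (denom_weight \<Xi> n))" for \<Xi>
    using key(2)[of \<Xi>] by (simp flip: key(1))
  have sh: "sh PlusMinus = shift_pm" "sh Minus = shift_minus" "sh MinusPlus = shift_mp"
    by (simp_all add: sh_def shifts sgn_s_def sgn_d_def)
  \<comment> \<open>The second equation is \<open>rho = pi + omega\<close>, entry by entry.\<close>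
  have denom_weight: "denom_weight PlusMinus n = omega n" "denom_weight Minus n = rho n" "denom_weight MinusPlus n = pi_vec n"
    by (auto simp: denom_weight_def sgn_s_def sgn_d_def lookup_add lk_pi lk_omega lk_rho intro!: poly_mapping_eqI)
  show ?thesis
    using quot[of PlusMinus] quot[of Minus] quot[of MinusPlus] key(2)[of PlusMinus] key(2)[of Minus] key(2)[of MinusPlus]
    by (simp add: P_poly_def A_pm_def A_minus_def A_mp_def sym_poly_0 sh denom_weight)
qed

end
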